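(* For $n\ge 3$, let $G(n)$ be the simply connected nilpotent Lie group corresponding to the real Lie algebra $\mathfrak{g}(n)$ with basis $(e_i)_{1\le i\le n}$ and nonzero brackets $[e_i,e_j]=(i-j)e_{i+j}$ for $i+j\le n$ (and $[e_i,e_j]=0$ if $i+j>n$). Then the systolic growth of $G(n)$ is $\simeq r^{D+h}$ with $h=\lceil (n-4)/2\rceil$, where $D=\frac{n(n-1)}{2}+1$ is the homogeneous dimension of $\mathfrak{g}(n)$.
   Context: Lie algebra notions. For a finite-dimensional nilpotent Lie algebra $\mathfrak{g}$, the lower central series is $\mathfrak{g}^1=\mathfrak{g}$, $\mathfrak{g}^{i+1}=[\mathfrak{g},\mathfrak{g}^i]$, and the homogeneous dimension is $D=\sum_{i\ge 1}\dim(\mathfrak{g}^i)$. $\lceil\cdot\rceil$ is the ceiling function. Systolic growth. Let $H$ be a compactly generated locally compact group, $|\cdot|$ the word length relative to some compact generating subset. For $X\subset H$, the systole is $\mathrm{sys}(X)=\inf\{|x|:x\in X\smallsetminus\{1\}\}\in\mathbf{R}_+\cup\{+\infty\}$. Fix a left-invariant Haar measure on $H$. The systolic growth of $H$ is the function mapping $r\ge 0$ to the infimum $\sigma(r)\in\mathbf{R}_+\cup\{+\infty\}$ of covolumes of cocompact lattices of $H$ with systole $\ge r$. All lattices in nilpotent locally compact groups are cocompact, and the asymptotic type of $\sigma$ does not depend on the choices. Asymptotics. For functions $f,g$ of a positive real variable $r$, $f\preceq g$ means that there are constants $C,C',C''>0$ with $f(r)\le Cg(C'r)+C''$ for all $r$;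 $f\simeq g$ means $f\preceq g\preceq f$. *)

theory Defs
  imports "HOL-Analysis.Analysis" "HOL-Algebra.Generated_Groups"
begin

section \<open>Real Lie algebras\<close>

text \<open>A finite-dimensional real Lie algebra is a type of class \<open>euclidean_space\<close> with a bracket.
  Only the vector space structure and the resulting canonical topology are used; the inner product
  of the class plays no role.\<close>

definition lie_bracket :: "('g::real_vector \<Rightarrow> 'g \<Rightarrow> 'g) \<Rightarrow> bool" where
  "lie_bracket br \<longleftrightarrow> bilinear br \<and> (\<forall>x. br x x = 0) \<and>
     (\<forall>x y z. br x (br y z) + br y (br z x) + br z (br x y) = 0)"

text \<open>The index is shifted by one: \<open>lower_central br i\<close> is the term with superscript \<open>i + 1\<close>,
  so \<open>lower_central br 0\<close> is the whole Lie algebra.\<close>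

primrec lower_central :: "('g::real_vector \<Rightarrow> 'g \<Rightarrow> 'g) \<Rightarrow> nat \<Rightarrow> 'g set" where
  "lower_central br 0 = UNIV"
| "lower_central br (Suc i) = span {br x y | x y. y \<in> lower_central br i}"

text \<open>For a nilpotent Lie algebra only finitely many terms of the series are nonzero.\<close>

definition homogeneous_dim :: "('g::euclidean_space \<Rightarrow> 'g \<Rightarrow> 'g) \<Rightarrow> nat" where
  "homogeneous_dim br = (\<Sum>i. dim (lower_central br i))"

definition is_lie_basis_g ::
    "nat \<Rightarrow> ('g::real_vector \<Rightarrow> 'g \<Rightarrow> 'g) \<Rightarrow> (nat \<Rightarrow> 'g) \<Rightarrow> bool" where
  "is_lie_basis_g n br e \<longleftrightarrow>
     inj_on e {1..n} \<and> independent (e ` {1..n}) \<and> span (e ` {1..n}) = UNIV \<and>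
     (\<forall>i\<in>{1..n}. \<forall>j\<in>{1..n}.
        br (e i) (e j) = (if i + j \<le> n then (real i - real j) *\<^sub>R e (i + j) else 0))"


section \<open>The simply connected nilpotent Lie group of a nilpotent Lie algebra\<close>

text \<open>The simply connected Lie group with nilpotent Lie algebra \<open>g\<close> is unique up to isomorphism, and
  its exponential map is a diffeomorphism from \<open>g\<close>. Transported along the exponential map, it is \<open>g\<close>
  itself with the Baker--Campbell--Hausdorff product \<open>x * y = log (exp x exp y)\<close>. This product is
  defined here by Dynkin's formula: the sum over all nonempty lists
  \<open>(r\<^sub>1, s\<^sub>1), \<dots>, (r\<^sub>k, s\<^sub>k)\<close> of pairs of naturals with all \<open>r\<^sub>i + s\<^sub>i > 0\<close> of
    \<open>(-1)^(k-1) / k * [x^r\<^sub>1 y^s\<^sub>1 \<dots> x^r\<^sub>k y^s\<^sub>k] / ((\<Sum>i. r\<^sub>i + s\<^sub>i) * (\<Prod>i. r\<^sub>i! s\<^sub>i!))\<close>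
  where the bracket of a word is nested to the right. As \<open>g\<close> is nilpotent, all but finitely many
  terms vanish.\<close>

fun nested_bracket :: "('g::real_vector \<Rightarrow> 'g \<Rightarrow> 'g) \<Rightarrow> 'g list \<Rightarrow> 'g" where
  "nested_bracket br [] = 0"
| "nested_bracket br [x] = x"
| "nested_bracket br (x # y # zs) = br x (nested_bracket br (y # zs))"

definition dynkin_index :: "(nat \<times> nat) list set" where
  "dynkin_index = {ps. ps \<noteq> [] \<and> (\<forall>(r, s)\<in>set ps. r + s > 0)}"

definition dynkin_word :: "'g \<Rightarrow> 'g \<Rightarrow> (nat \<times> nat) list \<Rightarrow> 'g list" where
  "dynkin_word x y ps = concat (map (\<lambda>(r, s). replicate r x @ replicate s y) ps)"

definition dynkin_coeff :: "(nat \<times> nat) list \<Rightarrow> real" where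
  "dynkin_coeff ps = (-1) ^ (length ps - 1) /
     (real (length ps) * real (\<Sum>(r, s)\<leftarrow>ps. r + s) * (\<Prod>(r, s)\<leftarrow>ps. fact r * fact s))"

definition bch :: "('g::euclidean_space \<Rightarrow> 'g \<Rightarrow> 'g) \<Rightarrow> 'g \<Rightarrow> 'g \<Rightarrow> 'g" where
  "bch br x y = (\<Sum>\<^sub>\<infinity>ps\<in>dynkin_index. dynkin_coeff ps *\<^sub>R nested_bracket br (dynkin_word x y ps))"

definition nilpotent_lie_group :: "('g::euclidean_space \<Rightarrow> 'g \<Rightarrow> 'g) \<Rightarrow> 'g monoid" where
  "nilpotent_lie_group br = \<lparr>carrier = UNIV, mult = bch br, one = 0\<rparr>"


section \<open>Lattices and systolic growth\<close>

text \<open>Topological groups are represented by a group whose carrier is a whole topological type.\<close>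

definition compact_generating_set :: "'a::topological_space monoid \<Rightarrow> 'a set \<Rightarrow> bool" where
  "compact_generating_set G S \<longleftrightarrow> compact S \<and> S \<subseteq> carrier G \<and> generate G S = carrier G"

definition word_length :: "'a monoid \<Rightarrow> 'a set \<Rightarrow> 'a \<Rightarrow> nat" where
  "word_length G S x = (LEAST k. \<exists>xs. length xs = k \<and> set xs \<subseteq> S \<union> (\<lambda>s. inv\<^bsub>G\<^esub> s) ` S \<and>
     foldr (mult G) xs \<one>\<^bsub>G\<^esub> = x)"

text \<open>The infimum of the empty set is \<open>\<infinity>\<close>.\<close>

definition systole :: "'a monoid \<Rightarrow> 'a set \<Rightarrow> 'a set \<Rightarrow> ennreal" where
  "systole G S X = (INF x\<in>X - {\<one>\<^bsub>G\<^esub>}. of_nat (word_length G S x))"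

text \<open>The groups have second countable underlying space. Given local compactness, regularity of the
  measure is then automatic and need not be part of the definition.\<close>

definition left_haar_measure ::
    "'a::{second_countable_topology, t2_space} monoid \<Rightarrow> 'a measure \<Rightarrow> bool" where
  "left_haar_measure G \<mu> \<longleftrightarrow> sets \<mu> = sets borel \<and>
     (\<forall>g\<in>carrier G. \<forall>A\<in>sets borel. emeasure \<mu> ((\<lambda>x. g \<otimes>\<^bsub>G\<^esub> x) ` A) = emeasure \<mu> A) \<and>
     (\<forall>K. compact K \<longrightarrow> emeasure \<mu> K < \<infinity>) \<and> emeasure \<mu> UNIV \<noteq> 0"

text \<open>The quotient by left multiplication by \<open>\<Gamma>\<close>, whose points are the right cosets
  \<open>\<Gamma> #> g\<close>: a set of cosets is open iff its preimage (its union) is open.\<close>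

definition coset_topology :: "'a::topological_space monoid \<Rightarrow> 'a set \<Rightarrow> 'a set topology" where
  "coset_topology G \<Gamma> = topology (\<lambda>U. U \<subseteq> rcosets\<^bsub>G\<^esub> \<Gamma> \<and> open (\<Union>U))"

definition fundamental_domain :: "'a::topological_space monoid \<Rightarrow> 'a set \<Rightarrow> 'a set \<Rightarrow> bool" where
  "fundamental_domain G \<Gamma> F \<longleftrightarrow> F \<in> sets borel \<and> F \<subseteq> carrier G \<and>
     (\<forall>g\<in>carrier G. \<exists>!\<gamma>. \<gamma> \<in> \<Gamma> \<and> \<gamma> \<otimes>\<^bsub>G\<^esub> g \<in> F)"

text \<open>The covolume is the total mass of the quotient by \<open>\<Gamma>\<close>, that is, the measure of a Borel
  fundamental domain. For a discrete subgroup of a second countable locally compact group such a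
  domain exists, and by left invariance all of them have the same measure, so that the infimum below
  is over a single value.\<close>

definition covolume :: "'a::topological_space monoid \<Rightarrow> 'a measure \<Rightarrow> 'a set \<Rightarrow> ennreal" where
  "covolume G \<mu> \<Gamma> = (INF F\<in>{F. fundamental_domain G \<Gamma> F}. emeasure \<mu> F)"

definition lattice_subgroup :: "'a::topological_space monoid \<Rightarrow> 'a measure \<Rightarrow> 'a set \<Rightarrow> bool" where
  "lattice_subgroup G \<mu> \<Gamma> \<longleftrightarrow> subgroup \<Gamma> G \<and> discrete \<Gamma> \<and> covolume G \<mu> \<Gamma> < \<infinity>"

definition cocompact_lattice :: "'a::topological_space monoid \<Rightarrow> 'a measure \<Rightarrow> 'a set \<Rightarrow> bool" where
  "cocompact_lattice G \<mu> \<Gamma> \<longleftrightarrow> lattice_subgroup G \<mu> \<Gamma> \<and> compact_space (coset_topology G \<Gamma>)"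

definition systolic_growth ::
    "'a::topological_space monoid \<Rightarrow> 'a set \<Rightarrow> 'a measure \<Rightarrow> real \<Rightarrow> ennreal" where
  "systolic_growth G S \<mu> r =
     (INF \<Gamma>\<in>{\<Gamma>. cocompact_lattice G \<mu> \<Gamma> \<and> systole G S \<Gamma> \<ge> ennreal r}. covolume G \<mu> \<Gamma>)"


section \<open>Asymptotic comparison\<close>

definition growth_le :: "(real \<Rightarrow> ennreal) \<Rightarrow> (real \<Rightarrow> ennreal) \<Rightarrow> bool" where
  "growth_le f g \<longleftrightarrow> (\<exists>C>0. \<exists>C'>0. \<exists>C''>0. \<forall>r>0.
     f r \<le> ennreal C * g (C' * r) + ennreal C'')"

definition growth_equiv :: "(real \<Rightarrow> ennreal) \<Rightarrow> (real \<Rightarrow> ennreal) \<Rightarrow> bool" where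
  "growth_equiv f g \<longleftrightarrow> growth_le f g \<and> growth_le g f"

end

theory Submission
  imports Defs
begin

text \<open>The Lie algebra acts by the vector fields \<open>e i = - X^(i + 1) d/dX\<close>, and the image of \<open>1 / X\<close>
  under a group element, \<open>1 / X * (1 + d 1 x * X + d 2 x * X^2 + \<dots>)\<close>, provides global coordinates \<open>d
  1, \<dots>, d n\<close>. That the Baker-Campbell-Hausdorff product acts by composition follows from the
  differential equation of \<open>t \<mapsto> log (exp (t x) exp (t y))\<close>. An element of length \<open>r\<close> has \<open>d m\<close> of
  order at most \<open>r^(wt m)\<close>, and conversely; here \<open>wt 1 = 1\<close> and \<open>wt m = m - 1\<close> otherwise.

  A lattice has a triangular basis; let \<open>a m > 0\<close> be the leading coordinate of its \<open>m\<close>-th member, so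
  that the covolume is comparable to \<open>a 1 * \<dots> * a n\<close>. Commutators give \<open>a (i + j) \<le> \<bar>i - j\<bar> * a i *
  a j\<close> for \<open>i \<noteq> j\<close>. If the systole is at least \<open>r\<close>, then \<open>a n\<close> is at least of order \<open>r^(n - 1)\<close>, and
  for even \<open>n\<close> Minkowski's theorem in the abelian subgroup of elements whose first \<open>n / 2 - 1\<close>
  coordinates vanish bounds \<open>a (n / 2) * \<dots> * a n\<close> from below. Taking logarithms, this is a linear
  program, and its optimal solution \<open>a m = r^(expo m)\<close> is realized by explicit lattices.\<close>

section \<open>The Baker-Campbell-Hausdorff formula in nilpotent representations\<close>

text \<open>Three points shape the proof. In the coordinate \<open>1 / X\<close> the product is
  affine in its right factor: \<open>d m\<close> of \<open>x * y\<close> is \<open>d m x\<close>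
  plus a combination of the \<open>d i y\<close> with coefficients taken from the power
  \<open>-(i - 1)\<close> of the series of \<open>x\<close>. For \<open>i = 1\<close> this power is
  trivial, so the first coordinate of the right factor never enters a higher one; hence the weight
  \<open>m - 1\<close> instead of \<open>m\<close>. Since \<open>[e i, e i] = 0\<close>, commutators
  relate no level to itself, and for \<open>n = 2 h\<close> level \<open>h\<close> has no partner.
  This gap causes all that is special to even \<open>n\<close>: in the lower bound Minkowski's
  theorem fills it, and in the construction it lets level \<open>h\<close> have exponent
  \<open>h - 1\<close>, at the price of a quadratic correction of the top coordinate. A triangular
  basis requires every \<open>lev m\<close> to meet the lattice in a lattice. For
  \<open>n \<ge> 4\<close> commutators force this. For \<open>n = 3\<close>, the Heisenberg group,
  it can fail, but there the exponent is the homogeneous dimension 4, which a packing of balls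
  yields for every lattice.\<close>

definition fun_calc :: "nat \<Rightarrow> real fps \<Rightarrow> ('v::real_vector \<Rightarrow> 'v) \<Rightarrow> 'v \<Rightarrow> 'v" where
  "fun_calc K f T v = (\<Sum>k<K. fps_nth f k *\<^sub>R (T ^^ k) v)"

lemma linear_funpow:
  fixes T :: "'v::real_vector \<Rightarrow> 'v"
  assumes "linear T" shows "linear (T ^^ k)"
proof (induction k)
  case 0
  then show ?case using linear_id by (simp add: id_def)
next
  case (Suc k)
  show ?case unfolding funpow.simps by (rule linear_compose[OF Suc assms])
qed

lemma linear_fun_calc:
  assumes "linear T" shows "linear (fun_calc K f T)"
  unfolding fun_calc_def
  by (intro linear_compose_sum ballI linear_compose_scale_right linear_funpow assms)

lemma funpow_eq_0_mono:
  fixes T :: "'v::real_vector \<Rightarrow> 'v"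
  assumes "linear T" "\<And>v. (T ^^ N) v = 0" "N \<le> k"
  shows "(T ^^ k) v = 0"
proof -
  obtain j where "k = j + N" using assms(3) by (metis add.commute le_Suc_ex)
  then show ?thesis using assms(2) linear_0[OF linear_funpow[OF assms(1)]] by (simp add: funpow_add)
qed

text \<open>Turns a sum by total degree, as in a Cauchy product, into a product of two sums. When
  two operators of nilpotency order \<open>N\<close> are involved, \<open>q + p \<ge> 2 * N\<close>
  forces one factor to vanish; this is why exponentials are cut off at \<open>2 * N\<close>.\<close>

lemma sum_triangle_square:
  fixes G :: "nat \<Rightarrow> nat \<Rightarrow> 'v::comm_monoid_add"
  assumes "\<And>q p. K \<le> q + p \<Longrightarrow> G q p = 0"
  shows "(\<Sum>k<K. \<Sum>p\<le>k. G (k - p) p) = (\<Sum>q<K. \<Sum>p<K. G q p)"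
proof -
  have "(\<Sum>k<K. \<Sum>p\<le>k. G (k - p) p) = (\<Sum>(p,q)\<in>{(p,q). p + q < K}. G q p)"
    using sum.triangle_reindex[of "\<lambda>p q. G q p" K] by simp
  also have "\<dots> = (\<Sum>(p,q)\<in>{..<K}\<times>{..<K}. G q p)"
    by (rule sum.mono_neutral_left) (auto intro!: assms simp: add.commute)
  also have "\<dots> = (\<Sum>p<K. \<Sum>q<K. G q p)" by (simp add: sum.cartesian_product)
  also have "\<dots> = (\<Sum>q<K. \<Sum>p<K. G q p)" by (rule sum.swap)
  finally show ?thesis .
qed

lemma fun_calc_mult:
  assumes T: "linear T" and nil: "\<And>v. (T ^^ K) v = 0"
  shows "fun_calc K (f * g) T v = fun_calc K f T (fun_calc K g T v)"
proof -
  have "fun_calc K (f * g) T v =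
      (\<Sum>k<K. \<Sum>p\<le>k. (fps_nth f (k - p) * fps_nth g p) *\<^sub>R (T ^^ ((k - p) + p)) v)"
    unfolding fun_calc_def fps_mult_nth scaleR_sum_left
  proof (rule sum.cong[OF refl])
    fix k
    show "(\<Sum>i = 0..k. (fps_nth f i * fps_nth g (k - i)) *\<^sub>R (T ^^ k) v) =
      (\<Sum>p\<le>k. (fps_nth f (k - p) * fps_nth g p) *\<^sub>R (T ^^ (k - p + p)) v)"
      by (rule sum.reindex_bij_witness[of _ "\<lambda>i. k - i" "\<lambda>i. k - i"]) auto
  qed
  also have "\<dots> = (\<Sum>q<K. \<Sum>p<K. (fps_nth f q * fps_nth g p) *\<^sub>R (T ^^ (q + p)) v)"
    by (rule sum_triangle_square) (simp add: funpow_eq_0_mono[OF T nil])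
  also have "\<dots> = fun_calc K f T (fun_calc K g T v)"
    unfolding fun_calc_def
    by (simp add: linear_sum[OF linear_funpow[OF T]] linear_cmul[OF linear_funpow[OF T]]
        scaleR_sum_right funpow_add)
  finally show ?thesis .
qed

lemma fun_calc_1: "K > 0 \<Longrightarrow> fun_calc K 1 T v = v"
  unfolding fun_calc_def by (simp add: if_distrib[of "\<lambda>c. c *\<^sub>R _"] cong: if_cong)

lemma fun_calc_diff: "fun_calc K (f - g) T v = fun_calc K f T v - fun_calc K g T v"
  unfolding fun_calc_def by (simp add: scaleR_diff_left sum_subtractf)

lemma fun_calc_power:
  assumes "linear T" "\<And>v. (T ^^ K) v = 0" "K > 0"
  shows "(fun_calc K g T ^^ k) v = fun_calc K (g ^ k) T v"
  using assms by (induction k) (simp_all add: fun_calc_1 fun_calc_mult)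

text \<open>As \<open>g\<close> has no constant term, \<open>g ^ k\<close> starts in degree
  \<open>k\<close>, so cutting the outer series at \<open>K\<close> changes nothing below degree
  \<open>K\<close>.\<close>

lemma fun_calc_compose:
  assumes "linear T" "\<And>v. (T ^^ K) v = 0" "K > 0" and g: "fps_nth g 0 = 0"
  shows "fun_calc K f (fun_calc K g T) v = fun_calc K (f oo g) T v"
proof -
  have coeff: "(\<Sum>k<K. fps_nth f k * fps_nth (g ^ k) j) = fps_nth (f oo g) j" if "j < K" for j
    unfolding fps_compose_nth
    by (rule sum.mono_neutral_right) (use that g in \<open>auto simp: startsby_zero_power_prefix\<close>)
  have "fun_calc K f (fun_calc K g T) v = (\<Sum>k<K. fps_nth f k *\<^sub>R fun_calc K (g ^ k) T v)"
    by (simp add: fun_calc_def[of K f] fun_calc_power assms)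
  also have "\<dots> = (\<Sum>j<K. \<Sum>k<K. (fps_nth f k * fps_nth (g ^ k) j) *\<^sub>R (T ^^ j) v)"
    unfolding fun_calc_def by (subst sum.swap) (simp add: scaleR_sum_right)
  also have "\<dots> = fun_calc K (f oo g) T v"
    unfolding fun_calc_def by (rule sum.cong) (simp_all add: coeff flip: scaleR_sum_left)
  finally show ?thesis .
qed

text \<open>The series \<open>(1 - exp (-X)) / X\<close> and \<open>ln (1 + X) / X\<close>.\<close>

definition dexp_series :: "real fps" where
  "dexp_series = Abs_fps (\<lambda>p. (-1) ^ p / fact (Suc p))"

definition dlog_series :: "real fps" where
  "dlog_series = Abs_fps (\<lambda>k. (-1) ^ k / real (Suc k))"

text \<open>The second factor is \<open>X / (exp X - 1)\<close>, so the product is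
  \<open>(1 - exp (-X)) / (exp X - 1)\<close>. With \<open>X\<close> replaced by
  \<open>br (Z t)\<close> the identity cancels the derivative of the exponential against the
  differential equation for \<open>Z\<close>.\<close>

lemma dexp_series_dlog_series:
  "dexp_series * (dlog_series oo (fps_exp 1 - 1)) = fps_exp (-1)"
proof -
  let ?e = "fps_exp 1 - 1 :: real fps"
  have e0: "fps_nth ?e 0 = 0" by simp
  have ex: "fps_exp (-1) * fps_exp 1 = (1 :: real fps)"
    by (simp add: fps_exp_add_mult[symmetric])
  have "dexp_series * fps_X = 1 - fps_exp (-1)"
  proof (rule fps_ext)
    fix k show "fps_nth (dexp_series * fps_X) k = fps_nth (1 - fps_exp (-1)) k"
      by (cases k) (simp_all add: dexp_series_def algebra_simps)
  qed
  also have "\<dots> = fps_exp (-1) * ?e" using ex by (simp add: algebra_simps)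
  finally have 1: "dexp_series * fps_X = fps_exp (-1) * ?e" .
  have ln: "dlog_series * fps_X = fps_ln 1"
  proof (rule fps_ext)
    fix k show "fps_nth (dlog_series * fps_X) k = fps_nth (fps_ln 1) k"
      by (cases k) (simp_all add: dlog_series_def fps_ln_nth)
  qed
  have "(dlog_series oo ?e) * ?e = (dlog_series * fps_X) oo ?e"
    by (simp add: fps_compose_mult_distrib[OF e0] fps_X_fps_compose_startby0[OF e0])
  also have "\<dots> = fps_X"
    unfolding ln by (simp add: fps_ln_fps_exp_inv fps_inv_fps_exp_compose)
  finally have "dexp_series * (dlog_series oo ?e) * ?e = fps_exp (-1) * ?e"
    using 1 by (simp add: mult.assoc)
  moreover have "?e \<noteq> 0"
  proof
    assume "?e = 0"
    then have "fps_nth ?e 1 = 0" by simp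
    then show False by simp
  qed
  ultimately show ?thesis by simp
qed

text \<open>Used with \<open>\<rho> = br\<close>, where the differential equation is solved, and
  with a faithful representation on truncated power series, where the group law is read off.\<close>

locale nilpotent_rep =
  fixes br :: "'g::euclidean_space \<Rightarrow> 'g \<Rightarrow> 'g" and \<rho> :: "'g \<Rightarrow> 'v::euclidean_space \<Rightarrow> 'v"
    and N :: nat
  assumes bilin_br: "bilinear br" and bilin: "bilinear \<rho>" and br_self: "br x x = 0"
    and rep: "\<rho> (br x y) v = \<rho> x (\<rho> y v) - \<rho> y (\<rho> x v)"
    and nilp_br: "(br x ^^ N) y = 0" and nilp: "(\<rho> x ^^ N) v = 0" and N: "N > 0"
begin

definition E :: "'g \<Rightarrow> 'v \<Rightarrow> 'v" where "E z = fun_calc (2 * N) (fps_exp 1) (\<rho> z)"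

lemma linear_br: "linear (br x)" using bilin_br by (simp add: bilinear_def)
lemma linear_rho: "linear (\<rho> x)" using bilin by (simp add: bilinear_def)
lemma linear_rho_left: "linear (\<lambda>x. \<rho> x v)" using bilin by (simp add: bilinear_def)
lemma nilp_br2: "(br x ^^ (2 * N)) y = 0"
  by (rule funpow_eq_0_mono[OF linear_br nilp_br]) simp
lemma nilp2: "(\<rho> x ^^ (2 * N)) v = 0"
  by (rule funpow_eq_0_mono[OF linear_rho nilp]) simp
lemma linear_E: "linear (E z)" unfolding E_def by (rule linear_fun_calc[OF linear_rho])

lemma rho_minus: "\<rho> (- x) v = - \<rho> x v" using linear_neg[OF linear_rho_left] .
lemma rho_scale: "\<rho> (c *\<^sub>R x) v = c *\<^sub>R \<rho> x v" using linear_cmul[OF linear_rho_left] .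

lemma funpow_minus: "((\<lambda>w. - br z w) ^^ p) u = (-1) ^ p *\<^sub>R (br z ^^ p) u"
  by (induction p) (simp_all add: linear_cmul[OF linear_br])

text \<open>Moving \<open>\<rho> u\<close> to the right past one factor \<open>\<rho> z\<close>
  costs the term \<open>\<rho> (- br z u)\<close>; iterating this, Pascal's rule produces the
  binomial coefficients.\<close>

lemma rho_funpow:
  "\<rho> u ((\<rho> z ^^ k) v) =
     (\<Sum>p\<le>k. real (k choose p) *\<^sub>R (\<rho> z ^^ (k - p)) (\<rho> (((\<lambda>w. - br z w) ^^ p) u) v))"
proof (induction k arbitrary: v)
  case (Suc k)
  define a where "a p = \<rho> (((\<lambda>w. - br z w) ^^ p) u)" for p
  define T where "T = \<rho> z"
  have lT: "linear (T ^^ j)" for j unfolding T_def by (rule linear_funpow[OF linear_rho])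
  have a: "a p (T v) = T (a p v) + a (Suc p) v" for p v
    unfolding a_def T_def by (simp add: rho_minus rep)
  have TT: "(T ^^ j) (T w) = (T ^^ Suc j) w" for j w by (simp add: funpow_swap1)
  have "\<rho> u ((T ^^ Suc k) v) = \<rho> u ((T ^^ k) (T v))" by (simp add: funpow_swap1)
  also have "\<dots> = (\<Sum>p\<le>k. real (k choose p) *\<^sub>R (T ^^ (k - p)) (a p (T v)))"
    using Suc unfolding a_def T_def by simp
  also have "\<dots> = (\<Sum>p\<le>k. real (k choose p) *\<^sub>R (T ^^ (Suc k - p)) (a p v))
     + (\<Sum>p\<le>k. real (k choose p) *\<^sub>R (T ^^ (k - p)) (a (Suc p) v))"
    by (simp add: a linear_add[OF lT] TT scaleR_add_right sum.distrib Suc_diff_le del: funpow.simps)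
  also have "(\<Sum>p\<le>k. real (k choose p) *\<^sub>R (T ^^ (Suc k - p)) (a p v)) =
     (\<Sum>p\<le>Suc k. real (k choose p) *\<^sub>R (T ^^ (Suc k - p)) (a p v))" by simp
  also have "\<dots> = (T ^^ Suc k) (a 0 v)
      + (\<Sum>p\<le>k. real (k choose Suc p) *\<^sub>R (T ^^ (k - p)) (a (Suc p) v))"
    by (subst sum.atMost_Suc_shift) simp
  also have "\<dots> + (\<Sum>p\<le>k. real (k choose p) *\<^sub>R (T ^^ (k - p)) (a (Suc p) v)) =
      (\<Sum>p\<le>Suc k. real (Suc k choose p) *\<^sub>R (T ^^ (Suc k - p)) (a p v))"
    by (subst sum.atMost_Suc_shift)
      (simp add: sum.distrib[symmetric] scaleR_add_left[symmetric] add.commute)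
  finally show ?case unfolding a_def T_def .
qed simp

text \<open>Conjugation by an exponential acts on the Lie algebra by \<open>exp (- ad z)\<close>:
  dividing \<open>rho_funpow\<close> by \<open>k!\<close> splits the double sum into a product of
  two exponentials.\<close>

lemma rho_E:
  "\<rho> u (E z v) = E z (\<rho> (fun_calc (2 * N) (fps_exp (-1)) (br z) u) v)"
proof -
  define a where "a p = \<rho> (((\<lambda>w. - br z w) ^^ p) u) v" for p
  define T where "T = \<rho> z"
  have lT: "linear (T ^^ j)" for j unfolding T_def by (rule linear_funpow[OF linear_rho])
  have T0: "(T ^^ j) w = 0" if "N \<le> j" for j w
    using funpow_eq_0_mono[OF linear_rho nilp that] unfolding T_def .
  have a0: "a j = 0" if "N \<le> j" for j
    using funpow_eq_0_mono[OF linear_br nilp_br that] unfolding a_def funpow_minus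
    by (simp add: linear_0[OF linear_rho_left])
  have "\<rho> u (E z v) = (\<Sum>k<2*N. (1 / fact k) *\<^sub>R (\<Sum>p\<le>k. real (k choose p) *\<^sub>R (T ^^ (k - p)) (a p)))"
    unfolding E_def fun_calc_def
    by (simp add: linear_sum[OF linear_rho] linear_cmul[OF linear_rho] rho_funpow a_def T_def)
  also have "\<dots> = (\<Sum>k<2*N. \<Sum>p\<le>k. (1 / (fact (k - p) * fact p)) *\<^sub>R (T ^^ (k - p)) (a p))"
    by (intro sum.cong refl) (simp add: scaleR_sum_right binomial_fact mult.commute)
  also have "\<dots> = (\<Sum>q<2*N. \<Sum>p<2*N. (1 / (fact q * fact p)) *\<^sub>R (T ^^ q) (a p))"
  proof (rule sum_triangle_square)
    fix q p assume "2 * N \<le> q + p"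
    then have "N \<le> q \<or> N \<le> p" by linarith
    then show "(1 / (fact q * fact p)) *\<^sub>R (T ^^ q) (a p) = 0"
      using T0 a0 by (auto simp: linear_0[OF lT])
  qed
  also have "\<dots> = E z (\<Sum>p<2*N. (1 / fact p) *\<^sub>R a p)"
    unfolding E_def fun_calc_def T_def[symmetric]
    by (simp add: linear_sum[OF lT] linear_cmul[OF lT] scaleR_sum_right)
  also have "(\<Sum>p<2*N. (1 / fact p) *\<^sub>R a p) = \<rho> (fun_calc (2 * N) (fps_exp (-1)) (br z) u) v"
    unfolding a_def fun_calc_def funpow_minus
    by (simp add: linear_sum[OF linear_rho_left] rho_scale)
  finally show ?thesis .
qed

lemma has_vector_derivative_rho:
  assumes "(Z has_vector_derivative Z') F" "(w has_vector_derivative w') (at t within U)"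
    "F = at t within U"
  shows "((\<lambda>s. \<rho> (Z s) (w s)) has_vector_derivative \<rho> (Z t) w' + \<rho> Z' (w t)) (at t within U)"
  using bounded_bilinear.has_vector_derivative[OF bilinear_conv_bounded_bilinear[THEN iffD1, OF bilin]]
    assms by blast

text \<open>The product rule puts \<open>\<rho> Z'\<close> between powers of
  \<open>\<rho> (Z t)\<close>; \<open>rho_funpow\<close> moves it to the right, and summing over its
  position turns \<open>k choose p\<close> into \<open>k choose Suc p\<close>.\<close>

lemma has_vector_derivative_funpow:
  assumes Z: "(Z has_vector_derivative Z') (at t within U)"
    and w: "(w has_vector_derivative w') (at t within U)"
  shows "((\<lambda>s. (\<rho> (Z s) ^^ k) (w s)) has_vector_derivative
     (\<Sum>p<k. real (k choose Suc p) *\<^sub>R (\<rho> (Z t) ^^ (k - Suc p)) (\<rho> (((\<lambda>u. - br (Z t) u) ^^ p) Z') (w t)))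
      + (\<rho> (Z t) ^^ k) w') (at t within U)"
proof (induction k)
  case 0
  then show ?case using w by simp
next
  case (Suc k)
  define T where "T = \<rho> (Z t)"
  define a where "a p = \<rho> (((\<lambda>u. - br (Z t) u) ^^ p) Z') (w t)" for p
  have lT: "linear T" unfolding T_def by (rule linear_rho)
  have "((\<lambda>s. (\<rho> (Z s) ^^ Suc k) (w s)) has_vector_derivative
     T ((\<Sum>p<k. real (k choose Suc p) *\<^sub>R (T ^^ (k - Suc p)) (a p)) + (T ^^ k) w')
     + \<rho> Z' ((T ^^ k) (w t))) (at t within U)"
    using has_vector_derivative_rho[OF Z Suc refl] unfolding T_def a_def by simp
  moreover have "T ((\<Sum>p<k. real (k choose Suc p) *\<^sub>R (T ^^ (k - Suc p)) (a p)) + (T ^^ k) w')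
     + \<rho> Z' ((T ^^ k) (w t)) =
     (\<Sum>p<Suc k. real (Suc k choose Suc p) *\<^sub>R (T ^^ (Suc k - Suc p)) (a p)) + (T ^^ Suc k) w'"
  proof -
    have TT: "T ((T ^^ (k - Suc p)) x) = (T ^^ (k - p)) x" if "p < k" for p x
      using that by (metis Suc_diff_Suc comp_apply funpow.simps(2))
    have "T (\<Sum>p<k. real (k choose Suc p) *\<^sub>R (T ^^ (k - Suc p)) (a p))
        = (\<Sum>p<Suc k. real (k choose Suc p) *\<^sub>R (T ^^ (k - p)) (a p))"
      by (simp add: linear_sum[OF lT] linear_cmul[OF lT] TT)
    moreover have "\<rho> Z' ((T ^^ k) (w t)) = (\<Sum>p<Suc k. real (k choose p) *\<^sub>R (T ^^ (k - p)) (a p))"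
      unfolding T_def a_def rho_funpow by (simp add: lessThan_Suc_atMost)
    ultimately show ?thesis
      by (simp add: linear_add[OF lT] sum.distrib scaleR_add_left del: sum.lessThan_Suc)
  qed
  ultimately show ?case unfolding T_def a_def by simp
qed

text \<open>The classical formula \<open>d exp Z = exp Z * ((1 - exp (- ad Z)) / ad Z) Z'\<close>:
  dividing \<open>k choose Suc p\<close> by \<open>k!\<close> leaves the coefficients of the
  exponential and of \<open>dexp_series\<close>.\<close>

lemma has_vector_derivative_E:
  assumes Z: "(Z has_vector_derivative Z') (at t within U)"
    and w: "(w has_vector_derivative w') (at t within U)"
  shows "((\<lambda>s. E (Z s) (w s)) has_vector_derivative
     E (Z t) (\<rho> (fun_calc (2 * N) dexp_series (br (Z t)) Z') (w t) + w')) (at t within U)"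
proof -
  define T where "T = \<rho> (Z t)"
  define a where "a p = \<rho> (((\<lambda>u. - br (Z t) u) ^^ p) Z') (w t)" for p
  have lT: "linear (T ^^ j)" for j unfolding T_def by (rule linear_funpow[OF linear_rho])
  have T0: "(T ^^ j) w = 0" if "N \<le> j" for j w
    using funpow_eq_0_mono[OF linear_rho nilp that] unfolding T_def .
  have a0: "a j = 0" if "N \<le> j" for j
    using funpow_eq_0_mono[OF linear_br nilp_br that] unfolding a_def funpow_minus
    by (simp add: linear_0[OF linear_rho_left])
  define G where "G q p = (1 / (fact q * fact (Suc p))) *\<^sub>R (T ^^ q) (a p)" for q p
  have G0: "G q p = 0" if "2 * N - 1 \<le> q + p" for q p
  proof -
    have "N \<le> q \<or> N \<le> p" using that N by linarith
    then show ?thesis using T0 a0 unfolding G_def by (auto simp: linear_0[OF lT])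
  qed
  \<comment> \<open>The summand \<open>k = 0\<close> has zero derivative, so the triangle is indexed
    by \<open>k - 1\<close> and has side \<open>M\<close>.\<close>
  obtain M where M: "2 * N = Suc M" using N by (cases N) auto
  have "(\<Sum>k<2*N. (1 / fact k) *\<^sub>R (\<Sum>p<k. real (k choose Suc p) *\<^sub>R (T ^^ (k - Suc p)) (a p)))
     = (\<Sum>k<M. (1 / fact (Suc k)) *\<^sub>R (\<Sum>p<Suc k. real (Suc k choose Suc p) *\<^sub>R (T ^^ (k - p)) (a p)))"
    unfolding M by (subst sum.lessThan_Suc_shift) simp
  also have "\<dots> = (\<Sum>k<M. \<Sum>p\<le>k. G (k - p) p)"
    unfolding scaleR_sum_right lessThan_Suc_atMost G_def
    by (intro sum.cong refl) (simp add: binomial_fact del: fact_Suc binomial_Suc_Suc)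
  also have "\<dots> = (\<Sum>q<M. \<Sum>p<M. G q p)"
    by (rule sum_triangle_square) (use G0 M in simp)
  also have "\<dots> = (\<Sum>q<2*N. \<Sum>p<2*N. G q p)"
    unfolding M using G0 M by (simp add: sum.distrib)
  also have "\<dots> = E (Z t) (\<Sum>p<2*N. (1 / fact (Suc p)) *\<^sub>R a p)"
    unfolding E_def fun_calc_def T_def[symmetric] G_def
    by (simp add: linear_sum[OF lT] linear_cmul[OF lT] scaleR_sum_right del: fact_Suc)
  also have "(\<Sum>p<2*N. (1 / fact (Suc p)) *\<^sub>R a p)
    = \<rho> (fun_calc (2 * N) dexp_series (br (Z t)) Z') (w t)"
    unfolding a_def fun_calc_def funpow_minus
    by (simp add: linear_sum[OF linear_rho_left] rho_scale dexp_series_def del: fact_Suc)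
  finally have eq: "(\<Sum>k<2*N. (1 / fact k) *\<^sub>R (\<Sum>p<k. real (k choose Suc p) *\<^sub>R (T ^^ (k - Suc p)) (a
    p)))
    = E (Z t) (\<rho> (fun_calc (2 * N) dexp_series (br (Z t)) Z') (w t))" .
  have "((\<lambda>s. \<Sum>k<2*N. (1 / fact k) *\<^sub>R (\<rho> (Z s) ^^ k) (w s)) has_vector_derivative
     (\<Sum>k<2*N. (1 / fact k) *\<^sub>R ((\<Sum>p<k. real (k choose Suc p) *\<^sub>R (T ^^ (k - Suc p)) (a p)) + (T ^^ k)
       w')))
     (at t within U)"
    unfolding T_def a_def
    by (intro has_vector_derivative_sum bounded_linear.has_vector_derivative[OF
      bounded_linear_scaleR_right]
        has_vector_derivative_funpow Z w)
  then show ?thesis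
    using eq by (simp add: linear_add[OF linear_E] scaleR_add_right sum.distrib)
       (simp add: E_def fun_calc_def T_def)
qed

end

text \<open>Pairing with a vector orthogonal to \<open>W\<close> gives a real function with zero
  derivative. Only the open interval is used for \<open>f'\<close>, because the formula for
  \<open>Z'\<close> is obtained by dividing by \<open>t\<close> and excludes
  \<open>t = 0\<close>.\<close>

lemma vector_derivative_in_subspace:
  fixes f :: "real \<Rightarrow> 'v::euclidean_space"
  assumes W: "subspace W" and s: "0 \<le> s"
    and f: "\<And>t. t \<in> {0..s} \<Longrightarrow> (f has_vector_derivative f' t) (at t)"
    and f': "\<And>t. t \<in> {0<..<s} \<Longrightarrow> f' t \<in> W"
  shows "f s - f 0 \<in> W"
proof (cases "s = 0")
  case True
  then show ?thesis using subspace_0[OF W] by simp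
next
  case False
  have "orthogonal y (f s - f 0)" if y: "y \<in> W\<^sup>\<bottom>" for y
  proof -
    have d: "((\<lambda>t. y \<bullet> f t) has_real_derivative (y \<bullet> f' t)) (at t)" if "t \<in> {0..s}" for t
      using bounded_linear.has_vector_derivative[OF bounded_linear_inner_right f[OF that]]
      by (simp add: has_real_derivative_iff_has_vector_derivative)
    have "y \<bullet> f s = y \<bullet> f 0"
    proof (rule DERIV_isconst_end[where f = "\<lambda>t. y \<bullet> f t" and a = 0 and b = s])
      show "0 < s" using s False by simp
      show "continuous_on {0..s} (\<lambda>t. y \<bullet> f t)"
        by (intro continuous_at_imp_continuous_on ballI DERIV_isCont[OF d])
      show "DERIV (\<lambda>t. y \<bullet> f t) t :> 0" if "0 < t" "t < s" for t
        using d[of t] f'[of t] y that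
        by (auto simp: orthogonal_comp_def orthogonal_def inner_commute)
    qed
    then show "orthogonal y (f s - f 0)" by (simp add: orthogonal_def inner_diff_right)
  qed
  then have "f s - f 0 \<in> W\<^sup>\<bottom>\<^sup>\<bottom>"
    unfolding orthogonal_comp_def[of "W\<^sup>\<bottom>"] by blast
  then show ?thesis by (simp add: orthogonal_comp_self W)
qed

lemma fun_calc_kernel:
  assumes "linear T" "T u = 0" "K > 0"
  shows "fun_calc K f T u = fps_nth f 0 *\<^sub>R u"
proof -
  have "(T ^^ Suc k) u = 0" for k
    using assms linear_0[OF linear_funpow[OF assms(1)]] by (simp add: funpow_swap1)
  moreover obtain M where "K = Suc M" using assms(3) gr0_implies_Suc by blast
  ultimately show ?thesis
    unfolding fun_calc_def by (simp add: sum.lessThan_Suc_shift del: funpow.simps sum.lessThan_Suc)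
qed

lemma fun_calc_in_subspace:
  assumes "subspace W" "\<And>u. u \<in> W \<Longrightarrow> T u \<in> W" "v \<in> W"
  shows "fun_calc K f T v \<in> W"
proof -
  have "(T ^^ k) v \<in> W" for k by (induction k) (use assms in auto)
  then show ?thesis unfolding fun_calc_def by (intro subspace_sum subspace_scale assms(1))
qed

context nilpotent_rep
begin

lemma K: "2 * N > 0" using N by simp

lemma E_uminus: "E (- z) = fun_calc (2 * N) (fps_exp (-1)) (\<rho> z)"
proof -
  have "(\<rho> (- z) ^^ k) v = (-1) ^ k *\<^sub>R (\<rho> z ^^ k) v" for k v
    by (induction k) (simp_all add: rho_minus linear_cmul[OF linear_rho])
  then show ?thesis unfolding E_def fun_calc_def by (intro ext sum.cong) simp_all
qed

lemma E_inverse: "E (- z) (E z v) = v" "E z (E (- z) v) = v"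
proof -
  have "fps_exp (-1) * fps_exp 1 = (1 :: real fps)" "fps_exp 1 * fps_exp (-1) = (1 :: real fps)"
    by (simp_all add: fps_exp_add_mult[symmetric])
  then show "E (- z) (E z v) = v" "E z (E (- z) v) = v"
    unfolding E_uminus unfolding E_def
    by (simp_all add: fun_calc_mult[OF linear_rho nilp2, symmetric] fun_calc_1[OF K])
qed

lemma E_0: "E 0 v = v"
proof -
  have "\<rho> 0 v = 0" by (rule linear_0[OF linear_rho_left])
  then show ?thesis unfolding E_def using fun_calc_kernel[OF linear_rho _ K] by simp
qed

lemma br_scale_self: "br (c *\<^sub>R x) x = 0"
  using bilin_br br_self by (simp add: bilinear_lmul)

lemma rho_E_self: "\<rho> y (E (c *\<^sub>R y) v) = E (c *\<^sub>R y) (\<rho> y v)"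
  unfolding rho_E using fun_calc_kernel[OF linear_br br_scale_self K] by simp

lemma has_vector_derivative_E_line:
  assumes "(w has_vector_derivative w') (at t within U)"
  shows "((\<lambda>s. E (- (s *\<^sub>R x)) (w s)) has_vector_derivative
     E (- (t *\<^sub>R x)) (w' - \<rho> x (w t))) (at t within U)"
proof -
  have "((\<lambda>s. - (s *\<^sub>R x)) has_vector_derivative - x) (at t within U)"
    by (auto intro!: derivative_eq_intros)
  from has_vector_derivative_E[OF this assms]
  have "((\<lambda>s. E (- (s *\<^sub>R x)) (w s)) has_vector_derivative
     E (- (t *\<^sub>R x)) (\<rho> (fun_calc (2 * N) dexp_series (br (- (t *\<^sub>R x))) (- x)) (w t) + w')) (at t
       within U)" .
  moreover have "fun_calc (2 * N) dexp_series (br (- (t *\<^sub>R x))) (- x) = - x"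
    by (subst fun_calc_kernel[OF linear_br _ K])
      (use br_scale_self[of "-t" "x"] in \<open>simp_all add: linear_neg[OF linear_br] dexp_series_def\<close>)
  ultimately show ?thesis by (simp add: rho_minus)
qed

text \<open>By \<open>rho_E\<close> the contributions of all three factors gather in one Lie algebra
  element between \<open>E (Z t)\<close> and the last factor. If it vanishes,
  \<open>exp (- t x) exp (Z t) exp (- t y)\<close> is constant, that is,
  \<open>exp (Z t) = exp (t x) exp (t y)\<close>.\<close>

lemma has_vector_derivative_conjugate:
  assumes Z: "(Z has_vector_derivative Z') (at t)"
  shows "((\<lambda>s. E (- (s *\<^sub>R x)) (E (Z s) (E (- (s *\<^sub>R y)) v))) has_vector_derivative
     E (- (t *\<^sub>R x)) (E (Z t) (\<rho> (fun_calc (2 * N) dexp_series (br (Z t)) Z'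
        - fun_calc (2 * N) (fps_exp (-1)) (br (Z t)) x - y) (E (- (t *\<^sub>R y)) v)))) (at t)"
proof -
  let ?w = "E (- (t *\<^sub>R y)) v"
  have "((\<lambda>s. E (- (s *\<^sub>R y)) v) has_vector_derivative E (- (t *\<^sub>R y)) (0 - \<rho> y v)) (at t)"
    by (rule has_vector_derivative_E_line) simp
  moreover have "E (- (t *\<^sub>R y)) (0 - \<rho> y v) = - \<rho> y ?w"
    using rho_E_self[of y "- t" v] by (simp add: linear_neg[OF linear_E])
  ultimately have w: "((\<lambda>s. E (- (s *\<^sub>R y)) v) has_vector_derivative - \<rho> y ?w) (at t)" by simp
  show ?thesis
    using has_vector_derivative_E_line[OF has_vector_derivative_E[OF Z w], of x]
    unfolding rho_E[of x "Z t" ?w] linear_diff[OF linear_E, symmetric]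
    by (simp add: linear_diff[OF linear_rho_left] linear_add[OF linear_rho_left] algebra_simps)
qed

end

text \<open>The index is shifted by one against a central filtration that starts with superscript 1;
  this explains the \<open>Suc\<close> in the bracket condition.\<close>

locale nilpotent_filtration =
  fixes br :: "'g::euclidean_space \<Rightarrow> 'g \<Rightarrow> 'g" and F :: "nat \<Rightarrow> 'g set" and N :: nat
  assumes lie: "lie_bracket br" and sub: "subspace (F i)" and F0: "F 0 = UNIV"
    and decr: "F (Suc i) \<subseteq> F i"
    and brF: "u \<in> F i \<Longrightarrow> v \<in> F j \<Longrightarrow> br u v \<in> F (Suc (i + j))"
    and FN: "F N = {0}" and N: "N > 0"
begin

lemma bilinear_br: "bilinear br" and br_self: "br x x = 0" using lie by (auto simp: lie_bracket_def)

lemma br_swap: "br x y = - br y x"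
proof -
  have "br x y + br y x = 0"
    using br_self[of "x + y"] unfolding bilinear_ladd[OF bilinear_br] bilinear_radd[OF bilinear_br]
    unfolding br_self by (simp add: add.commute)
  then show ?thesis by (simp add: eq_neg_iff_add_eq_0)
qed

lemma F_mono: "i \<le> j \<Longrightarrow> F j \<subseteq> F i"
  by (rule lift_Suc_antimono_le[of F]) (use decr in auto)

lemma br_funpow_F: "y \<in> F i \<Longrightarrow> (br x ^^ k) y \<in> F (i + k)"
proof (induction k)
  case (Suc k)
  then have "br x ((br x ^^ k) y) \<in> F (Suc (0 + (i + k)))" by (intro brF) (auto simp: F0)
  then show ?case by simp
qed simp

lemma br_preserves_F: "y \<in> F i \<Longrightarrow> br x y \<in> F i"
  using br_funpow_F[where k=1, of y i x] F_mono[of i "Suc i"] by auto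

lemma nilpotent: "(br x ^^ N) y = 0"
  using br_funpow_F[where k=N, of y 0 x] by (simp add: F0 FN)

sublocale ad: nilpotent_rep br br N
proof
  show "br (br x y) v = br x (br y v) - br y (br x v)" for x y v
  proof -
    have "br v (br x y) + br x (br y v) + br y (br v x) = 0"
      using lie by (auto simp: lie_bracket_def)
    moreover have "br v (br x y) = - br (br x y) v" by (rule br_swap)
    moreover have "br y (br v x) = - br y (br x v)"
      using br_swap[of v x] by (simp add: bilinear_rneg[OF bilinear_br])
    ultimately show ?thesis by (simp add: algebra_simps)
  qed
qed (simp_all add: bilinear_br br_self nilpotent N)

lemma ad_E_F: "v \<in> F i \<Longrightarrow> ad.E z v \<in> F i"
  unfolding ad.E_def by (rule fun_calc_in_subspace[OF sub br_preserves_F])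

lemma funpow_diff_F:
  assumes B: "linear B" and BF: "\<And>i v. v \<in> F i \<Longrightarrow> B v \<in> F i"
    and CF: "\<And>i v. v \<in> F i \<Longrightarrow> C v \<in> F i"
    and D: "\<And>i v. v \<in> F i \<Longrightarrow> B v - C v \<in> F (i + k)" and v: "v \<in> F i"
  shows "(B ^^ j) v - (C ^^ j) v \<in> F (i + k)"
proof (induction j)
  case 0
  then show ?case using subspace_0[OF sub] by simp
next
  case (Suc j)
  have "(C ^^ j) v \<in> F i" by (induction j) (use CF v in auto)
  then have "B ((B ^^ j) v - (C ^^ j) v) + (B ((C ^^ j) v) - C ((C ^^ j) v)) \<in> F (i + k)"
    by (intro subspace_add sub BF D Suc)
  then show ?case by (simp add: linear_diff[OF B])
qed

lemma fun_calc_diff_F: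
  assumes "linear B" and "\<And>i v. v \<in> F i \<Longrightarrow> B v \<in> F i"
    and "\<And>i v. v \<in> F i \<Longrightarrow> C v \<in> F i"
    and "\<And>i v. v \<in> F i \<Longrightarrow> B v - C v \<in> F (i + k)" and "v \<in> F i"
  shows "fun_calc K f B v - fun_calc K f C v \<in> F (i + k)"
  unfolding fun_calc_def sum_subtractf[symmetric] scaleR_diff_right[symmetric]
  by (intro subspace_sum subspace_scale sub funpow_diff_F assms)

end

text \<open>The differential equation satisfied by \<open>Z t = log (exp (t x) exp (t y))\<close>.\<close>

locale bch_curve = nilpotent_filtration br F N
  for br :: "'g::euclidean_space \<Rightarrow> 'g \<Rightarrow> 'g" and F N +
  fixes x y :: 'g and Z Z' :: "real \<Rightarrow> 'g"
  assumes Z0: "Z 0 = 0" and Z: "(Z has_vector_derivative Z' t) (at t)"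
    and Z': "t \<in> {0<..<1} \<Longrightarrow> Z' t = fun_calc (2 * N) dlog_series
       (\<lambda>v. ad.E (t *\<^sub>R x) (ad.E (t *\<^sub>R y) v) - v) (x + ad.E (t *\<^sub>R x) (ad.E (t *\<^sub>R y) y))"
begin

definition A :: "real \<Rightarrow> 'g \<Rightarrow> 'g" where "A t v = ad.E (t *\<^sub>R x) (ad.E (t *\<^sub>R y) v)"

lemma linear_A: "linear (A t)"
  unfolding A_def using linear_compose[OF ad.linear_E ad.linear_E] by (simp add: comp_def)

lemma A_F: "v \<in> F i \<Longrightarrow> A t v \<in> F i" unfolding A_def by (intro ad_E_F)

text \<open>The element found in \<open>has_vector_derivative_conjugate\<close>: the defect of
  \<open>Z\<close> as a logarithm of \<open>exp (t x) exp (t y)\<close>.\<close>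

definition R :: "real \<Rightarrow> 'g" where
  "R t = fun_calc (2 * N) dexp_series (br (Z t)) (Z' t)
        - fun_calc (2 * N) (fps_exp (-1)) (br (Z t)) x - y"

text \<open>By \<open>dexp_series_dlog_series\<close>, \<open>R\<close> would vanish if
  \<open>Z'\<close> were built from \<open>ad.E (Z t)\<close> instead of \<open>A t\<close>. So
  \<open>R\<close> only measures the difference between these two operators.\<close>

lemma R_eq:
  assumes t: "t \<in> {0<..<1}"
  shows "R t = fun_calc (2 * N) dexp_series (br (Z t))
     (fun_calc (2 * N) dlog_series (\<lambda>v. A t v - v) (x + A t y)
      - fun_calc (2 * N) dlog_series (\<lambda>v. ad.E (Z t) v - v) (x + ad.E (Z t) y))"
proof -
  note lin = linear_fun_calc[OF ad.linear_br]
  let ?T = "br (Z t)"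
  have C: "(\<lambda>v. ad.E (Z t) v - v) = fun_calc (2 * N) (fps_exp 1 - 1) ?T"
    by (intro ext) (simp add: ad.E_def fun_calc_diff fun_calc_1[OF ad.K])
  have "fun_calc (2 * N) dexp_series ?T (fun_calc (2 * N) dlog_series (\<lambda>v. ad.E (Z t) v - v) u)
     = fun_calc (2 * N) (fps_exp (-1)) ?T u" for u
    unfolding C
    by (simp add: fun_calc_compose[OF ad.linear_br ad.nilp_br2 ad.K]
        fun_calc_mult[OF ad.linear_br ad.nilp_br2, symmetric] dexp_series_dlog_series)
  moreover have "fun_calc (2 * N) (fps_exp (-1)) ?T (ad.E (Z t) y) = y"
    using ad.E_inverse(1)[of "Z t" y] unfolding ad.E_uminus .
  ultimately show ?thesis
    unfolding R_def linear_diff[OF lin] Z'[OF t] A_def[symmetric]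
    by (simp add: linear_add[OF lin])
qed

text \<open>A bootstrap along the filtration replaces any use of operator logarithms. If
  \<open>ad.E (Z t)\<close> and \<open>A t\<close> agree up to \<open>k\<close> filtration steps,
  then \<open>R t\<close> lies in \<open>F k\<close>; bracketing with it gains \<open>k + 1\<close>
  steps, and integration carries the gain back to the operators.\<close>

lemma E_approx:
  assumes "t \<in> {0..1}" "v \<in> F i"
  shows "ad.E (Z t) v - A t v \<in> F (i + k)"
  using assms
proof (induction k arbitrary: t v i)
  case 0
  then show ?case by (auto intro!: subspace_diff sub ad_E_F A_F)
next
  case (Suc k)
  have R: "R s \<in> F k" if s: "s \<in> {0<..<1}" for s
  proof -
    have 1: "fun_calc (2 * N) dlog_series (\<lambda>v. A s v - v) (x + A s y)
       - fun_calc (2 * N) dlog_series (\<lambda>v. ad.E (Z s) v - v) (x + A s y) \<in> F (0 + k)"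
    proof (rule fun_calc_diff_F)
      show "linear (\<lambda>v. A s v - v)" by (intro linear_compose_sub linear_A linear_ident)
      show "A s v - v - (ad.E (Z s) v - v) \<in> F (i + k)" if "v \<in> F i" for v i
        using Suc.IH[of s v i] s that subspace_neg[OF sub, of "ad.E (Z s) v - A s v" "i + k"] by auto
    qed (auto intro!: subspace_diff sub A_F ad_E_F simp: F0)
    have 2: "fun_calc (2 * N) dlog_series (\<lambda>v. ad.E (Z s) v - v)
        ((x + A s y) - (x + ad.E (Z s) y)) \<in> F k"
    proof (rule fun_calc_in_subspace[OF sub])
      show "x + A s y - (x + ad.E (Z s) y) \<in> F k"
        using Suc.IH[of s y 0] s subspace_neg[OF sub, of "ad.E (Z s) y - A s y" k] by (auto simp: F0)
    qed (auto intro!: subspace_diff sub ad_E_F)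
    have 3: "linear (\<lambda>v. ad.E (Z s) v - v)"
      by (intro linear_compose_sub ad.linear_E linear_ident)
    have "fun_calc (2 * N) dlog_series (\<lambda>v. A s v - v) (x + A s y)
       - fun_calc (2 * N) dlog_series (\<lambda>v. ad.E (Z s) v - v) (x + ad.E (Z s) y) \<in> F k"
      using subspace_add[OF sub 1[unfolded add_0] 2] unfolding linear_diff[OF linear_fun_calc[OF 3]]
        by simp
    then show ?thesis
      unfolding R_eq[OF s] by (intro fun_calc_in_subspace[OF sub br_preserves_F])
  qed
  \<comment> \<open>The factor \<open>ad.E (t *\<^sub>R y)\<close> with fixed \<open>t\<close>
    cancels the one in \<open>y\<close> at \<open>s = t\<close>; at \<open>s = 0\<close> it is all
    that remains.\<close>
  let ?f = "\<lambda>s. ad.E (- (s *\<^sub>R x)) (ad.E (Z s) (ad.E (- (s *\<^sub>R y)) (ad.E (t *\<^sub>R y) v)))"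
  have "?f t - ?f 0 \<in> F (i + Suc k)"
  proof (rule vector_derivative_in_subspace[OF sub])
    show "(?f has_vector_derivative ad.E (- (s *\<^sub>R x)) (ad.E (Z s)
        (br (R s) (ad.E (- (s *\<^sub>R y)) (ad.E (t *\<^sub>R y) v))))) (at s)" for s
      unfolding R_def by (rule ad.has_vector_derivative_conjugate[OF Z])
    show "ad.E (- (s *\<^sub>R x)) (ad.E (Z s)
        (br (R s) (ad.E (- (s *\<^sub>R y)) (ad.E (t *\<^sub>R y) v)))) \<in> F (i + Suc k)" if "s \<in> {0<..<t}" for s
    proof -
      have "br (R s) (ad.E (- (s *\<^sub>R y)) (ad.E (t *\<^sub>R y) v)) \<in> F (Suc (k + i))"
        using that Suc.prems by (intro brF R ad_E_F) auto
      then show ?thesis by (intro ad_E_F) (simp add: add.commute)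
    qed
  qed (use Suc.prems in auto)
  then have "ad.E (t *\<^sub>R x) (ad.E (- (t *\<^sub>R x)) (ad.E (Z t) v) - ad.E (t *\<^sub>R y) v) \<in> F (i + Suc k)"
    by (intro ad_E_F) (simp add: ad.E_inverse ad.E_0 Z0)
  then show ?case by (simp add: linear_diff[OF ad.linear_E] ad.E_inverse A_def)
qed

lemma R_eq_0: assumes t: "t \<in> {0<..<1}" shows "R t = 0"
proof -
  have "ad.E (Z t) v = A t v" for v
    using E_approx[of t v 0 N] t by (simp add: F0 FN)
  then have "ad.E (Z t) = A t" by auto
  then show ?thesis unfolding R_eq[OF t] by (simp add: linear_0[OF linear_fun_calc[OF ad.linear_br]])
qed

text \<open>\<open>R = 0\<close> is a statement in the Lie algebra, so the threefold product of
  \<open>has_vector_derivative_conjugate\<close> is constant in every nilpotent representation, not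
  only in the adjoint one.\<close>

lemma E_rep:
  assumes "nilpotent_rep br \<rho> M" and NM: "N \<le> M"
  shows "nilpotent_rep.E \<rho> M (Z 1) v = nilpotent_rep.E \<rho> M x (nilpotent_rep.E \<rho> M y v)"
proof -
  interpret r: nilpotent_rep br \<rho> M by fact
  \<comment> \<open>The representation cuts series in \<open>br z\<close> at \<open>2 * M\<close>,
    the definition of \<open>R\<close> at \<open>2 * N\<close>; powers of \<open>br z\<close> from
    \<open>N\<close> on vanish.\<close>
  have K: "fun_calc (2 * M) f (br z) u = fun_calc (2 * N) f (br z) u" for f z u
    unfolding fun_calc_def
    by (rule sum.mono_neutral_right)
      (use NM in \<open>auto intro: funpow_eq_0_mono[OF ad.linear_br ad.nilp_br2]\<close>)
  let ?f = "\<lambda>s. r.E (- (s *\<^sub>R x)) (r.E (Z s) (r.E (- (s *\<^sub>R y)) (r.E y v)))"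
  have "?f 1 - ?f 0 \<in> {0}"
  proof (rule vector_derivative_in_subspace)
    show "(?f has_vector_derivative r.E (- (s *\<^sub>R x)) (r.E (Z s)
        (\<rho> (R s) (r.E (- (s *\<^sub>R y)) (r.E y v))))) (at s)" for s
      using r.has_vector_derivative_conjugate[OF Z] unfolding R_def K .
    show "r.E (- (s *\<^sub>R x)) (r.E (Z s)
        (\<rho> (R s) (r.E (- (s *\<^sub>R y)) (r.E y v)))) \<in> {0}" if "s \<in> {0<..<1}" for s
      using R_eq_0[OF that] by (simp add: linear_0[OF r.linear_rho_left] linear_0[OF r.linear_E])
  qed auto
  then have "r.E x (r.E (- x) (r.E (Z 1) v)) = r.E x (r.E y v)"
    by (simp add: r.E_inverse r.E_0 Z0)
  then show ?thesis by (simp add: r.E_inverse)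
qed

end

section \<open>Summation of Dynkin's series\<close>

lemma nested_bracket_Cons: "w \<noteq> [] \<Longrightarrow> nested_bracket br (x # w) = br x (nested_bracket br w)"
  by (cases w) simp_all

lemma nested_bracket_replicate:
  "w \<noteq> [] \<Longrightarrow> nested_bracket br (replicate r x @ w) = (br x ^^ r) (nested_bracket br w)"
  by (induction r) (simp_all add: nested_bracket_Cons)

lemma nested_bracket_scale:
  assumes "bilinear br"
  shows "nested_bracket br (map (scaleR t) w) = t ^ length w *\<^sub>R nested_bracket br w"
proof (induction w)
  case (Cons x w)
  then show ?case
    by (cases "w = []")
      (simp_all add: nested_bracket_Cons bilinear_lmul[OF assms] bilinear_rmul[OF assms])
qed simp

definition pair_weight :: "nat \<times> nat \<Rightarrow> real" where
  "pair_weight = (\<lambda>(r, s). 1 / (fact r * fact s))"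

definition word_weight :: "(nat \<times> nat) list \<Rightarrow> real" where
  "word_weight ps = prod_list (map pair_weight ps)"

definition nonzero_pairs :: "nat \<Rightarrow> (nat \<times> nat) set" where
  "nonzero_pairs K = {..<K} \<times> {..<K} - {(0, 0)}"

text \<open>Here \<open>k\<close> is the number of pairs minus one, in accordance with the
  coefficient \<open>(-1) ^ k / (k + 1)\<close> of \<open>dlog_series\<close>; the bound on the
  entries makes the set finite.\<close>

definition dynkin_lists :: "nat \<Rightarrow> nat \<Rightarrow> (nat \<times> nat) list set" where
  "dynkin_lists K k = {ps. length ps = Suc k \<and> set ps \<subseteq> nonzero_pairs K}"

lemma finite_nonzero_pairs: "finite (nonzero_pairs K)" by (simp add: nonzero_pairs_def)

lemma finite_dynkin_lists: "finite (dynkin_lists K k)"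
  unfolding dynkin_lists_def using finite_lists_length_eq[OF finite_nonzero_pairs, of K "Suc k"]
  by (simp add: conj_commute)

lemma dynkin_lists_0: "dynkin_lists K 0 = (\<lambda>p. [p]) ` nonzero_pairs K"
  unfolding dynkin_lists_def by (auto simp: length_Suc_conv)

lemma dynkin_lists_Suc:
  "dynkin_lists K (Suc k) = (\<lambda>(p, ps). p # ps) ` (nonzero_pairs K \<times> dynkin_lists K k)"
  unfolding dynkin_lists_def by (auto simp: length_Suc_conv image_iff)

lemma sum_nonzero_pairs:
  fixes g :: "nat \<Rightarrow> nat \<Rightarrow> 'v::ab_group_add"
  assumes "K > 0"
  shows "(\<Sum>p\<in>nonzero_pairs K. g (fst p) (snd p)) = (\<Sum>r<K. \<Sum>s<K. g r s) - g 0 0"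
proof -
  have "(\<Sum>r<K. \<Sum>s<K. g r s) = (\<Sum>p\<in>{..<K} \<times> {..<K}. g (fst p) (snd p))"
    by (simp add: sum.cartesian_product case_prod_beta)
  also have "\<dots> = g 0 0 + (\<Sum>p\<in>nonzero_pairs K. g (fst p) (snd p))"
    unfolding nonzero_pairs_def by (subst sum.remove[of _ "(0, 0)"]) (use assms in auto)
  finally show ?thesis by simp
qed

lemma dynkin_word_Cons:
  "dynkin_word x y ((r, s) # ps) = replicate r x @ replicate s y @ dynkin_word x y ps"
  by (simp add: dynkin_word_def)

lemma dynkin_word_Nil: "dynkin_word x y [] = []"
  by (simp add: dynkin_word_def)

lemma dynkin_word_scale:
  "dynkin_word (t *\<^sub>R x) (t *\<^sub>R y) ps = map (scaleR t) (dynkin_word x y ps)"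
  by (induction ps) (auto simp: dynkin_word_Cons dynkin_word_Nil)

lemma length_dynkin_word: "length (dynkin_word x y ps) = (\<Sum>(r, s)\<leftarrow>ps. r + s)"
  by (induction ps) (auto simp: dynkin_word_Cons dynkin_word_Nil)

lemma dynkin_coeff_eq:
  "dynkin_coeff ps = (-1) ^ (length ps - 1) / real (length ps) * word_weight ps
     / real (length (dynkin_word x y ps))"
proof -
  have "word_weight ps = 1 / (\<Prod>(r, s)\<leftarrow>ps. fact r * fact s)"
    unfolding word_weight_def pair_weight_def by (induction ps) auto
  then show ?thesis by (simp add: dynkin_coeff_def length_dynkin_word)
qed

context nilpotent_filtration
begin

lemma nested_bracket_F: "w \<noteq> [] \<Longrightarrow> nested_bracket br w \<in> F (length w - 1)"
proof (induction w)
  case (Cons x w)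
  show ?case
  proof (cases "w = []")
    case False
    then have "br x (nested_bracket br w) \<in> F (Suc (0 + (length w - 1)))"
      by (intro brF Cons) (auto simp: F0)
    with False show ?thesis by (simp add: nested_bracket_Cons)
  qed (simp add: F0)
qed simp

lemma nested_bracket_long: "N < length w \<Longrightarrow> nested_bracket br w = 0"
  using nested_bracket_F[of w] F_mono[of N "length w - 1"] by (cases w) (auto simp: FN)

text \<open>A pair \<open>(r, s)\<close> in front of a word applies \<open>br x ^^ r\<close> after
  \<open>br y ^^ s\<close>, so the sum over all pairs is a product of exponentials; leaving out
  \<open>(0, 0)\<close> subtracts the identity.\<close>

lemma sum_pair_weight:
  assumes "K = 2 * N"
  shows "(\<Sum>p\<in>nonzero_pairs K. pair_weight p *\<^sub>R (br x ^^ fst p) ((br y ^^ snd p) u))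
     = ad.E x (ad.E y u) - u"
proof -
  note l = linear_funpow[OF ad.linear_br]
  have "(\<Sum>p\<in>nonzero_pairs K. (1 / (fact (fst p) * fact (snd p))) *\<^sub>R (br x ^^ fst p) ((br y ^^ snd p)
    u))
      = (\<Sum>r<K. \<Sum>s<K. (1 / (fact r * fact s)) *\<^sub>R (br x ^^ r) ((br y ^^ s) u)) - u"
    by (subst sum_nonzero_pairs) (use N assms in auto)
  also have "(\<Sum>r<K. \<Sum>s<K. (1 / (fact r * fact s)) *\<^sub>R (br x ^^ r) ((br y ^^ s) u)) = ad.E x (ad.E y u)"
    unfolding ad.E_def fun_calc_def assms[symmetric]
    by (simp add: linear_sum[OF l] linear_cmul[OF l] scaleR_sum_right)
  finally show ?thesis by (simp add: pair_weight_def case_prod_beta)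
qed

text \<open>As \<open>br z z = 0\<close>, the last pair of a word contributes only if it is
  \<open>(1, 0)\<close>, giving \<open>x\<close>, or has \<open>s = 1\<close>, giving
  \<open>(br x ^^ r) y\<close>. The sum \<open>x + ad.E x y\<close> takes the stated form because
  \<open>ad.E y y = y\<close>.\<close>

lemma sum_pair_weight_last:
  assumes "K = 2 * N"
  shows "(\<Sum>p\<in>nonzero_pairs K. pair_weight p *\<^sub>R nested_bracket br (dynkin_word x y [p]))
     = x + ad.E x (ad.E y y)"
proof -
  define h where "h r s = (if s = 0 then (if r = 1 then x else 0)
    else if s = 1 then (br x ^^ r) y else 0)" for r s :: nat
  have ker: "(br z ^^ Suc k) z = 0" for z k
    unfolding funpow_Suc_right by (simp add: br_self linear_0[OF linear_funpow[OF ad.linear_br]])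
  have h: "nested_bracket br (dynkin_word x y [(r, s)]) = h r s" if "r \<noteq> 0 \<or> s \<noteq> 0" for r s
  proof (cases s)
    case 0
    with that obtain r' where r: "r = Suc r'" using not0_implies_Suc by auto
    have "replicate r x = replicate r' x @ [x]" by (simp add: r replicate_append_same)
    then have "nested_bracket br (dynkin_word x y [(r, s)]) = (br x ^^ r') x"
      using nested_bracket_replicate[of "[x]" br r' x]
      by (simp add: 0 dynkin_word_Cons dynkin_word_Nil)
    then show ?thesis using ker[of _ x] by (cases r') (simp_all add: h_def 0 r del: funpow.simps(2))
  next
    case (Suc s')
    have "replicate s y = replicate s' y @ [y]" by (simp add: Suc replicate_append_same)
    then have "nested_bracket br (dynkin_word x y [(r, s)]) = (br x ^^ r) ((br y ^^ s') y)"
      using nested_bracket_replicate[of "[y]" br s' y]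
        nested_bracket_replicate[of "replicate s' y @ [y]" br r x]
      by (simp add: dynkin_word_Cons dynkin_word_Nil)
    then show ?thesis using ker[of _ y] linear_0[OF linear_funpow[OF ad.linear_br]]
      by (cases s') (simp_all add: h_def Suc del: funpow.simps(2))
  qed
  obtain M where M: "K = Suc (Suc M)" using assms N by (cases N) auto
  have "(\<Sum>p\<in>nonzero_pairs K. pair_weight p *\<^sub>R nested_bracket br (dynkin_word x y [p]))
    = (\<Sum>p\<in>nonzero_pairs K. (1 / (fact (fst p) * fact (snd p))) *\<^sub>R h (fst p) (snd p))"
  proof (intro sum.cong refl)
    fix p assume "p \<in> nonzero_pairs K"
    then obtain r s where "p = (r, s)" "r \<noteq> 0 \<or> s \<noteq> 0" by (cases p) (auto simp: nonzero_pairs_def)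
    then show "pair_weight p *\<^sub>R nested_bracket br (dynkin_word x y [p])
      = (1 / (fact (fst p) * fact (snd p))) *\<^sub>R h (fst p) (snd p)"
      by (simp add: pair_weight_def h)
  qed
  also have "\<dots> = (\<Sum>r<K. \<Sum>s<K. (1 / (fact r * fact s)) *\<^sub>R h r s) - h 0 0"
    by (subst sum_nonzero_pairs) (use M in auto)
  also have "\<dots> = (\<Sum>r<K. \<Sum>s<K. (1 / (fact r * fact s)) *\<^sub>R h r s)" by (simp add: h_def)
  also have "\<dots> = (\<Sum>r<K. (if r = 1 then x else 0) + (1 / fact r) *\<^sub>R (br x ^^ r) y)"
  proof (rule sum.cong[OF refl])
    fix r
    have "(\<Sum>s<K. (1 / (fact r * fact s)) *\<^sub>R h r s) = (1 / fact r) *\<^sub>R h r 0 + (1 / fact r) *\<^sub>R h r 1"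
      unfolding M by (simp add: sum.lessThan_Suc_shift h_def del: sum.lessThan_Suc)
    then show "(\<Sum>s<K. (1 / (fact r * fact s)) *\<^sub>R h r s)
      = (if r = 1 then x else 0) + (1 / fact r) *\<^sub>R (br x ^^ r) y"
      by (auto simp: h_def)
  qed
  also have "\<dots> = x + ad.E x y"
    unfolding sum.distrib ad.E_def fun_calc_def assms[symmetric] by (simp add: M)
  also have "ad.E y y = y"
    unfolding ad.E_def using fun_calc_kernel[OF ad.linear_br br_self ad.K] by simp
  ultimately show ?thesis by simp
qed

text \<open>The last pair yields the starting vector, and each of the \<open>k\<close> pairs before
  it applies \<open>exp (ad x) exp (ad y) - 1\<close> once more.\<close>

lemma sum_dynkin_lists:
  assumes "K = 2 * N"
  shows "(\<Sum>ps\<in>dynkin_lists K k. word_weight ps *\<^sub>R nested_bracket br (dynkin_word x y ps))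
     = ((\<lambda>v. ad.E x (ad.E y v) - v) ^^ k) (x + ad.E x (ad.E y y))"
proof (induction k)
  case 0
  have "(\<Sum>ps\<in>dynkin_lists K 0. word_weight ps *\<^sub>R nested_bracket br (dynkin_word x y ps))
    = (\<Sum>p\<in>nonzero_pairs K. pair_weight p *\<^sub>R nested_bracket br (dynkin_word x y [p]))"
    unfolding dynkin_lists_0 by (subst sum.reindex) (auto simp: inj_on_def word_weight_def)
  then show ?case by (simp add: sum_pair_weight_last[OF assms])
next
  case (Suc k)
  let ?nb = "\<lambda>ps. nested_bracket br (dynkin_word x y ps)"
  note l = linear_funpow[OF ad.linear_br]
  have nb: "?nb (p # ps) = (br x ^^ fst p) ((br y ^^ snd p) (?nb ps))" if "ps \<in> dynkin_lists K k"
    for p ps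
  proof -
    have "dynkin_word x y ps \<noteq> []"
      using that by (cases ps) (auto simp: dynkin_lists_def dynkin_word_Cons nonzero_pairs_def)
    then show ?thesis by (cases p) (simp add: dynkin_word_Cons nested_bracket_replicate)
  qed
  have "(\<Sum>ps\<in>dynkin_lists K (Suc k). word_weight ps *\<^sub>R ?nb ps)
    = (\<Sum>(p, ps)\<in>nonzero_pairs K \<times> dynkin_lists K k. word_weight (p # ps) *\<^sub>R ?nb (p # ps))"
    unfolding dynkin_lists_Suc by (subst sum.reindex) (auto simp: inj_on_def case_prod_beta)
  also have "\<dots> = (\<Sum>p\<in>nonzero_pairs K. \<Sum>ps\<in>dynkin_lists K k. word_weight (p # ps) *\<^sub>R ?nb (p # ps))"
    by (simp add: sum.cartesian_product)
  also have "\<dots> = (\<Sum>p\<in>nonzero_pairs K. pair_weight p *\<^sub>R (br x ^^ fst p) ((br y ^^ snd p)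
       (\<Sum>ps\<in>dynkin_lists K k. word_weight ps *\<^sub>R ?nb ps)))"
    by (intro sum.cong refl)
      (simp add: nb word_weight_def linear_sum[OF l] linear_cmul[OF l] scaleR_sum_right)
  finally show ?case by (simp add: sum_pair_weight[OF assms] Suc)
qed

text \<open>A Dynkin index outside these lists has more than \<open>K\<close> pairs or an entry at
  least \<open>K\<close>. In both cases its word has length at least \<open>2 * N\<close>, so its
  bracket is zero.\<close>

lemma bch_eq_finite_sum:
  assumes K: "K = 2 * N"
  shows "bch br x y = (\<Sum>k<K. \<Sum>ps\<in>dynkin_lists K k. dynkin_coeff ps *\<^sub>R nested_bracket br (dynkin_word x
    y ps))"
proof -
  have eq: "infsum (\<lambda>ps. dynkin_coeff ps *\<^sub>R nested_bracket br (dynkin_word x y ps)) dynkin_index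
    = infsum (\<lambda>ps. dynkin_coeff ps *\<^sub>R nested_bracket br (dynkin_word x y ps)) (\<Union>k<K. dynkin_lists K k)"
  proof (rule infsum_cong_neutral)
    fix ps assume "ps \<in> (\<Union>k<K. dynkin_lists K k) - dynkin_index"
    then show "dynkin_coeff ps *\<^sub>R nested_bracket br (dynkin_word x y ps) = 0"
      by (fastforce simp: dynkin_lists_def nonzero_pairs_def dynkin_index_def)
  next
    fix ps assume ps: "ps \<in> dynkin_index - (\<Union>k<K. dynkin_lists K k)"
    have len: "length ps \<le> (\<Sum>(r, s)\<leftarrow>qs. r + s) + (length ps - length qs)"
      if "\<forall>(r, s)\<in>set qs. r + s > 0" "length qs \<le> length ps" for qs :: "(nat \<times> nat) list"
      using that by (induction qs) (auto simp: less_eq_Suc_le)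
    have ge: "r + s \<le> (\<Sum>(r, s)\<leftarrow>ps. r + s)" if "(r, s) \<in> set ps" for r s
      using member_le_sum_list[of "r + s" "map (\<lambda>(r, s). r + s) ps"] that by force
    have "K \<le> (\<Sum>(r, s)\<leftarrow>ps. r + s)"
    proof (cases "length ps \<le> K")
      case True
      then have "length ps - 1 < K" "length ps = Suc (length ps - 1)"
        using ps N K by (auto simp: dynkin_index_def)
      then have "\<not> set ps \<subseteq> nonzero_pairs K" using ps by (auto simp: dynkin_lists_def)
      then obtain r s where "(r, s) \<in> set ps" "(r, s) \<notin> nonzero_pairs K" by auto
      then have "K \<le> r + s" using ps by (fastforce simp: nonzero_pairs_def dynkin_index_def)
      with ge \<open>(r, s) \<in> set ps\<close> show ?thesis by (meson order_trans)
    next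
      case False
      then show ?thesis using len[of ps] ps by (simp add: dynkin_index_def)
    qed
    then have "N < length (dynkin_word x y ps)" using K N by (simp add: length_dynkin_word)
    then show "dynkin_coeff ps *\<^sub>R nested_bracket br (dynkin_word x y ps) = 0"
      by (simp add: nested_bracket_long)
  qed auto
  show ?thesis
    unfolding bch_def eq
    by (subst infsum_finite, force intro: finite_dynkin_lists, subst sum.UNION_disjoint)
      (auto simp: finite_dynkin_lists, auto simp: dynkin_lists_def)
qed

text \<open>Let \<open>Z t\<close> be the series of \<open>t x\<close> and \<open>t y\<close>. A
  word of length \<open>l\<close> carries \<open>t ^ l\<close>; differentiating produces a factor
  \<open>l\<close>, which cancels the \<open>1 / l\<close> of Dynkin's coefficient, and the rest
  sums to \<open>dlog_series\<close> as the differential equation demands.\<close>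

lemma bch_hom:
  assumes "nilpotent_rep br \<rho> M" and "N \<le> M"
  shows "nilpotent_rep.E \<rho> M (bch br x y) v = nilpotent_rep.E \<rho> M x (nilpotent_rep.E \<rho> M y v)"
proof -
  define K where "K = 2 * N"
  let ?nb = "\<lambda>x y ps. nested_bracket br (dynkin_word x y ps)"
  let ?len = "\<lambda>ps. length (dynkin_word x y ps)"
  define Z where "Z t = (\<Sum>k<K. \<Sum>ps\<in>dynkin_lists K k. dynkin_coeff ps *\<^sub>R t ^ ?len ps *\<^sub>R ?nb x y ps)"
    for t
  define Z' where "Z' t = (\<Sum>k<K. \<Sum>ps\<in>dynkin_lists K k.
     dynkin_coeff ps *\<^sub>R (real (?len ps) * t ^ (?len ps - 1)) *\<^sub>R ?nb x y ps)" for t :: real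
  have scale: "?nb (t *\<^sub>R x) (t *\<^sub>R y) ps = t ^ ?len ps *\<^sub>R ?nb x y ps" for t ps
    by (simp add: dynkin_word_scale nested_bracket_scale[OF bilinear_br])
  have len0: "?len ps \<noteq> 0" if "ps \<in> dynkin_lists K k" for ps k
    using that by (cases ps) (auto simp: dynkin_lists_def dynkin_word_Cons nonzero_pairs_def)
  have "bch_curve br F N x y Z Z'"
  proof unfold_locales
    show "Z 0 = 0" unfolding Z_def by (intro sum.neutral ballI) (use len0 in auto)
    show "(Z has_vector_derivative Z' t) (at t)" for t
      unfolding Z_def[abs_def] Z'_def
      by (intro has_vector_derivative_sum bounded_linear.has_vector_derivative[OF
        bounded_linear_scaleR_right]
          bounded_linear.has_vector_derivative[OF bounded_linear_scaleR_left])
        (auto intro!: derivative_eq_intros simp flip: has_real_derivative_iff_has_vector_derivative)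
    show "Z' t = fun_calc (2 * N) dlog_series
         (\<lambda>v. ad.E (t *\<^sub>R x) (ad.E (t *\<^sub>R y) v) - v) (x + ad.E (t *\<^sub>R x) (ad.E (t *\<^sub>R y) y))"
      (is "_ = fun_calc _ _ ?B ?u") if "t \<in> {0<..<1}" for t
    proof -
      have t: "t \<noteq> 0" using that by auto
      have lB: "linear ?B"
        using linear_compose[OF ad.linear_E ad.linear_E]
          by (intro linear_compose_sub linear_ident) (simp add: comp_def)
      \<comment> \<open>Multiplication by \<open>t\<close> restores the power \<open>t ^ l\<close>,
        so that the words in \<open>t x\<close> and \<open>t y\<close> reappear.\<close>
      have "t *\<^sub>R Z' t = (\<Sum>k<K. ((-1) ^ k / real (Suc k)) *\<^sub>R
          (\<Sum>ps\<in>dynkin_lists K k. word_weight ps *\<^sub>R ?nb (t *\<^sub>R x) (t *\<^sub>R y) ps))"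
        unfolding Z'_def scaleR_sum_right
      proof (intro sum.cong refl)
        fix k ps assume ps: "ps \<in> dynkin_lists K k"
        then have l: "length ps = Suc k" by (simp add: dynkin_lists_def)
        have p: "t * t ^ (?len ps - 1) = t ^ ?len ps"
          using len0[OF ps] by (metis not_gr_zero power_minus_mult mult.commute)
        have "t * (dynkin_coeff ps * (real (?len ps) * t ^ (?len ps - 1)))
           = (-1) ^ k / real (Suc k) * (word_weight ps * t ^ ?len ps)"
          unfolding dynkin_coeff_eq[of ps x y] l p[symmetric] using len0[OF ps] by simp
        then show "t *\<^sub>R dynkin_coeff ps *\<^sub>R (real (?len ps) * t ^ (?len ps - 1)) *\<^sub>R ?nb x y ps
           = ((-1) ^ k / real (Suc k)) *\<^sub>R word_weight ps *\<^sub>R ?nb (t *\<^sub>R x) (t *\<^sub>R y) ps"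
          unfolding scale scaleR_scaleR by simp
      qed
      also have "\<dots> = fun_calc K dlog_series ?B (t *\<^sub>R x + ad.E (t *\<^sub>R x) (ad.E (t *\<^sub>R y) (t *\<^sub>R y)))"
        unfolding sum_dynkin_lists[OF K_def] fun_calc_def by (simp add: dlog_series_def)
      also have "\<dots> = t *\<^sub>R fun_calc K dlog_series ?B ?u"
        by (simp add: linear_cmul[OF ad.linear_E] flip: scaleR_add_right linear_cmul[OF
          linear_fun_calc[OF lB]])
      finally show ?thesis using t by (simp add: K_def)
    qed
  qed
  then interpret bch_curve br F N x y Z Z' .
  have "Z 1 = bch br x y" unfolding Z_def bch_eq_finite_sum[OF K_def] by simp
  then show ?thesis using E_rep[OF assms, of v] by simp
qed

end

section \<open>Vector fields acting on power series\<close>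

text \<open>The vector field \<open>- c X d/dX\<close> acting on \<open>X^(-\<alpha>) * f\<close>,
  with the factor \<open>X^(-\<alpha>)\<close> split off: \<open>\<alpha> = 1\<close> belongs to
  \<open>1 / X\<close>, \<open>\<alpha> = 0\<close> to ordinary power series.\<close>

definition fps_op :: "real fps \<Rightarrow> real \<Rightarrow> real fps \<Rightarrow> real fps" where
  "fps_op c \<alpha> f = c * (fps_const \<alpha> * f - fps_X * fps_deriv f)"

text \<open>If \<open>c\<close> has no constant term, the \<open>k\<close>-th iterate starts in
  degree \<open>k\<close>, so stopping at \<open>k = m\<close> gives the full exponential series in
  degree \<open>m\<close>.\<close>

definition fps_op_exp :: "real fps \<Rightarrow> real \<Rightarrow> real fps \<Rightarrow> real fps" where
  "fps_op_exp c \<alpha> f = Abs_fps (\<lambda>m. \<Sum>k\<le>m. fps_nth ((fps_op c \<alpha> ^^ k) f) m / fact k)"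

lemma fps_op_nth:
  "fps_nth (fps_op c \<alpha> f) m = (\<Sum>i=0..m. fps_nth c i * ((\<alpha> - real (m - i)) * fps_nth f (m - i)))"
proof -
  have *: "fps_nth (fps_const \<alpha> * f - fps_X * fps_deriv f) j = (\<alpha> - real j) * fps_nth f j" for j
    by (cases j) (simp_all add: algebra_simps)
  show ?thesis unfolding fps_op_def fps_mult_nth[of c] * ..
qed

lemma fps_op_mult: "fps_op c (\<alpha> + \<beta>) (f * g) = fps_op c \<alpha> f * g + f * fps_op c \<beta> g"
  by (simp add: fps_op_def algebra_simps flip: fps_const_add)

lemma fps_op_add: "fps_op c \<alpha> (f + g) = fps_op c \<alpha> f + fps_op c \<alpha> g"
  by (simp add: fps_op_def algebra_simps)

lemma fps_op_const_mult: "fps_op c \<alpha> (fps_const a * f) = fps_const a * fps_op c \<alpha> f"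
  by (simp add: fps_op_def algebra_simps)

lemma fps_op_sum: "fps_op c \<alpha> (\<Sum>i\<in>I. f i) = (\<Sum>i\<in>I. fps_op c \<alpha> (f i))"
proof (induction I rule: infinite_finite_induct)
  case (insert x F) then show ?case by (simp add: fps_op_add)
qed (simp_all add: fps_op_def)

lemma fps_op_funpow_add: "(fps_op c \<alpha> ^^ k) (f + g) = (fps_op c \<alpha> ^^ k) f + (fps_op c \<alpha> ^^ k) g"
  by (induction k) (simp_all add: fps_op_add)

lemma fps_op_funpow_const_mult: "(fps_op c \<alpha> ^^ k) (fps_const a * f)
  = fps_const a * (fps_op c \<alpha> ^^ k) f"
  by (induction k) (simp_all add: fps_op_const_mult)

lemma fps_op_exp_add: "fps_op_exp c \<alpha> (f + g) = fps_op_exp c \<alpha> f + fps_op_exp c \<alpha> g"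
  by (rule fps_ext) (simp add: fps_op_exp_def fps_op_funpow_add add_divide_distrib sum.distrib)

lemma fps_op_exp_const_mult: "fps_op_exp c \<alpha> (fps_const a * f) = fps_const a * fps_op_exp c \<alpha> f"
  by (rule fps_ext) (simp add: fps_op_exp_def fps_op_funpow_const_mult sum_distrib_left)

lemma fps_op_exp_sum:
  "finite I \<Longrightarrow> fps_op_exp c \<alpha> (\<Sum>i\<in>I. f i) = (\<Sum>i\<in>I. fps_op_exp c \<alpha> (f i))"
proof (induction I rule: finite_induct)
  case empty
  show ?case using fps_op_exp_const_mult[of c \<alpha> 0 0] by simp
qed (simp add: fps_op_exp_add)

lemma fps_op_funpow_nth_less:
  assumes "fps_nth c 0 = 0" "m < k"
  shows "fps_nth ((fps_op c \<alpha> ^^ k) f) m = 0"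
  using assms(2)
proof (induction k arbitrary: m)
  case (Suc k)
  show ?case unfolding funpow.simps comp_apply fps_op_nth
  proof (intro sum.neutral ballI)
    fix i assume "i \<in> {0..m}"
    then have "i = 0 \<or> m - i < k" using Suc.prems by auto
    then show "fps_nth c i * ((\<alpha> - real (m - i)) * fps_nth ((fps_op c \<alpha> ^^ k) f) (m - i)) = 0"
      using Suc.IH[of "m - i"] assms(1) by auto
  qed
qed simp

lemma fps_op_funpow_mult:
  "(fps_op c (\<alpha> + \<beta>) ^^ k) (f * g) =
     (\<Sum>i\<le>k. fps_const (real (k choose i)) * ((fps_op c \<alpha> ^^ (k - i)) f * (fps_op c \<beta> ^^ i) g))"
proof (induction k)
  case (Suc k)
  define a where "a i = (fps_op c \<alpha> ^^ i) f" for i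
  define b where "b i = (fps_op c \<beta> ^^ i) g" for i
  have "(fps_op c (\<alpha> + \<beta>) ^^ Suc k) (f * g)
    = (\<Sum>i\<le>k. fps_const (real (k choose i)) * fps_op c (\<alpha> + \<beta>) (a (k - i) * b i))"
    using Suc by (simp add: fps_op_sum fps_op_const_mult a_def b_def)
  also have "\<dots> = (\<Sum>i\<le>k. fps_const (real (k choose i)) * (a (Suc k - i) * b i))
     + (\<Sum>i\<le>k. fps_const (real (k choose i)) * (a (k - i) * b (Suc i)))"
    unfolding fps_op_mult by (simp add: a_def b_def distrib_left sum.distrib Suc_diff_le)
  also have "(\<Sum>i\<le>k. fps_const (real (k choose i)) * (a (Suc k - i) * b i))
     = (\<Sum>i\<le>Suc k. fps_const (real (k choose i)) * (a (Suc k - i) * b i))" by simp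
  also have "\<dots> = a (Suc k) * b 0 + (\<Sum>i\<le>k. fps_const (real (k choose Suc i)) * (a (k - i) * b (Suc i)))"
    by (subst sum.atMost_Suc_shift) simp
  also have "\<dots> + (\<Sum>i\<le>k. fps_const (real (k choose i)) * (a (k - i) * b (Suc i)))
    = (\<Sum>i\<le>Suc k. fps_const (real (Suc k choose i)) * (a (Suc k - i) * b i))"
  proof -
    have *: "fps_const (real (Suc k choose Suc i)) =
       fps_const (real (k choose i)) + fps_const (real (k choose Suc i))" for i by simp
    show ?thesis
      unfolding sum.atMost_Suc_shift[of _ k] * distrib_right sum.distrib by (simp add: ac_simps)
  qed
  finally show ?case unfolding a_def b_def .
qed simp

lemma fps_mult_nth_eq_0:
  fixes f g :: "real fps"
  assumes "\<And>i. i < p \<Longrightarrow> fps_nth f i = 0" "\<And>i. i < q \<Longrightarrow> fps_nth g i = 0" "m < p + q"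
  shows "fps_nth (f * g) m = 0"
  unfolding fps_mult_nth
proof (rule sum.neutral, safe)
  fix i assume "i \<in> {0..m}"
  then have "i < p \<or> m - i < q" using assms(3) by auto
  then show "fps_nth f i * fps_nth g (m - i) = 0" using assms by auto
qed

text \<open>The exponential of a derivation is multiplicative, and the exponents of the split-off
  powers of \<open>X\<close> add. This determines the action on all powers of \<open>X\<close> from
  the image of \<open>1 / X\<close> alone.\<close>

lemma fps_op_exp_mult:
  assumes c: "fps_nth c 0 = 0"
  shows "fps_op_exp c (\<alpha> + \<beta>) (f * g) = fps_op_exp c \<alpha> f * fps_op_exp c \<beta> g"
proof (rule fps_ext)
  fix m
  define a where "a i = (fps_op c \<alpha> ^^ i) f" for i
  define b where "b i = (fps_op c \<beta> ^^ i) g" for i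
  define G where "G q p = fps_nth (a q * b p) m / (fact q * fact p)" for q p
  have a0: "fps_nth (a k) j = 0" and b0: "fps_nth (b k) j = 0" if "j < k" for k j
    using fps_op_funpow_nth_less[OF c that] by (simp_all add: a_def b_def)
  have G0: "G q p = 0" if "Suc m \<le> q + p" for q p
    unfolding G_def using fps_mult_nth_eq_0[of q "a q" p "b p" m] a0 b0 that by simp
  have "fps_nth (fps_op_exp c (\<alpha> + \<beta>) (f * g)) m = (\<Sum>k<Suc m. \<Sum>p\<le>k. G (k - p) p)"
    unfolding fps_op_exp_def fps_op_funpow_mult G_def a_def b_def
    unfolding fps_nth_Abs_fps lessThan_Suc_atMost fps_sum_nth sum_divide_distrib
    by (intro sum.cong refl) (simp add: binomial_fact mult.commute)
  also have "\<dots> = (\<Sum>q<Suc m. \<Sum>p<Suc m. G q p)" by (rule sum_triangle_square[OF G0])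
  also have "\<dots> = (\<Sum>j=0..m. (\<Sum>q<Suc m. fps_nth (a q) j / fact q) * (\<Sum>p<Suc m. fps_nth (b p) (m - j) /
    fact p))"
    unfolding G_def fps_mult_nth sum_product sum_divide_distrib
    by (simp add: sum.swap[of _ "{0..m}"] del: sum.lessThan_Suc)
  also have "\<dots> = (\<Sum>j=0..m. fps_nth (fps_op_exp c \<alpha> f) j * fps_nth (fps_op_exp c \<beta> g) (m - j))"
  proof (rule sum.cong[OF refl])
    fix j assume j: "j \<in> {0..m}"
    have "(\<Sum>q<Suc m. fps_nth (a q) j / fact q) = fps_nth (fps_op_exp c \<alpha> f) j"
      unfolding fps_op_exp_def a_def[symmetric] fps_nth_Abs_fps
      by (rule sum.mono_neutral_right) (use j a0 in auto)
    moreover have "(\<Sum>p<Suc m. fps_nth (b p) (m - j) / fact p) = fps_nth (fps_op_exp c \<beta> g) (m - j)"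
      unfolding fps_op_exp_def b_def[symmetric] fps_nth_Abs_fps
      by (rule sum.mono_neutral_right) (use j b0 in auto)
    ultimately show "(\<Sum>q<Suc m. fps_nth (a q) j / fact q) * (\<Sum>p<Suc m. fps_nth (b p) (m - j) / fact p)
       = fps_nth (fps_op_exp c \<alpha> f) j * fps_nth (fps_op_exp c \<beta> g) (m - j)" by simp
  qed
  finally show "fps_nth (fps_op_exp c (\<alpha> + \<beta>) (f * g)) m
    = fps_nth (fps_op_exp c \<alpha> f * fps_op_exp c \<beta> g) m"
    by (simp add: fps_mult_nth)
qed

lemma fps_op_exp_nth_0: "fps_nth (fps_op_exp c \<alpha> f) 0 = fps_nth f 0"
  by (simp add: fps_op_exp_def)

text \<open>In weight 1 the series \<open>X\<close> stands for \<open>1 / X * X = 1\<close> and is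
  fixed. If \<open>1 / X\<close> goes to \<open>T / X\<close>, then \<open>X\<close> must go to
  \<open>X / T\<close>, and \<open>1 / X * X^k\<close> to
  \<open>1 / X * X^k * T^(1 - k)\<close>.\<close>

lemma fps_op_exp_X_power:
  assumes c: "fps_nth c 0 = 0" and k: "k > 0"
  shows "fps_op_exp c 1 (fps_X ^ k) = fps_X ^ k * inverse (fps_op_exp c 1 1) ^ (k - 1)"
proof -
  let ?T = "fps_op_exp c 1 1" and ?P = "fps_op_exp c 0 fps_X"
  have mult: "fps_op_exp c 1 (f * g) = fps_op_exp c 1 f * fps_op_exp c 0 g" for f g
    using fps_op_exp_mult[OF c, of 1 0] by simp
  have T0: "fps_nth ?T 0 = 1" by (simp add: fps_op_exp_nth_0)
  have "fps_op c 1 fps_X = 0" by (simp add: fps_op_def)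
  moreover have "fps_op c 1 0 = 0" by (simp add: fps_op_def)
  ultimately have "(fps_op c 1 ^^ j) fps_X = (if j = 0 then fps_X else 0)" for j
    by (induction j) auto
  then have "fps_nth ((fps_op c 1 ^^ j) fps_X) m / fact j = (if j = 0 then fps_nth fps_X m else 0)"
    for j m
    by simp
  then have X: "fps_op_exp c 1 fps_X = fps_X"
    by (intro fps_ext) (simp add: fps_op_exp_def)
  have TP: "?T * ?P = fps_X" using mult[of 1 fps_X] X by simp
  have P: "?P = fps_X * inverse ?T"
  proof -
    have "?P = (inverse ?T * ?T) * ?P" using T0 by (simp add: inverse_mult_eq_1)
    also have "\<dots> = inverse ?T * fps_X" unfolding mult.assoc TP ..
    finally show ?thesis by (simp add: mult.commute)
  qed
  have "fps_op_exp c 1 (fps_X ^ j) = ?T * ?P ^ j" for j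
  proof (induction j)
    case (Suc j)
    have "fps_op_exp c 1 (fps_X ^ Suc j) = fps_op_exp c 1 (fps_X ^ j) * ?P"
      unfolding power_Suc2 by (rule mult)
    then show ?case unfolding Suc by (simp add: ac_simps)
  qed simp
  then have "fps_op_exp c 1 (fps_X ^ k) = ?T * (fps_X ^ k * inverse ?T ^ k)"
    by (simp add: P power_mult_distrib)
  also have "inverse ?T ^ k = inverse ?T * inverse ?T ^ (k - 1)"
    using k by (cases k) auto
  also have "?T * (fps_X ^ k * (inverse ?T * inverse ?T ^ (k - 1)))
     = (?T * inverse ?T) * (fps_X ^ k * inverse ?T ^ (k - 1))" by (simp add: ac_simps)
  finally show ?thesis using T0 by (simp add: inverse_mult_eq_1')
qed

text \<open>Coefficients of the vector field \<open>- c X d/dX\<close> enter triangularly.\<close>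

lemma fps_op_funpow_triangular:
  assumes "fps_nth c 0 = 0" "fps_nth c' 0 = 0" and eq: "\<And>j. j < m \<Longrightarrow> fps_nth c j = fps_nth c' j"
  shows "j < m \<Longrightarrow> fps_nth ((fps_op c 1 ^^ k) 1) j = fps_nth ((fps_op c' 1 ^^ k) 1) j"
    and "fps_nth ((fps_op c 1 ^^ Suc (Suc k)) 1) m = fps_nth ((fps_op c' 1 ^^ Suc (Suc k)) 1) m"
proof -
  have *: "\<forall>j<m. fps_nth ((fps_op c 1 ^^ k) 1) j = fps_nth ((fps_op c' 1 ^^ k) 1) j" for k
  proof (induction k)
    case (Suc k)
    show ?case unfolding funpow.simps comp_apply fps_op_nth
    proof (intro allI impI sum.cong refl)
      fix j i assume "j < m" "i \<in> {0..j}"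
      then have 1: "i < m" and 2: "j - i < m" by auto
      show "fps_nth c i * ((1 - real (j - i)) * fps_nth ((fps_op c 1 ^^ k) 1) (j - i)) =
        fps_nth c' i * ((1 - real (j - i)) * fps_nth ((fps_op c' 1 ^^ k) 1) (j - i))"
        unfolding eq[OF 1] Suc.IH[rule_format, OF 2] ..
    qed
  qed simp
  show "j < m \<Longrightarrow> fps_nth ((fps_op c 1 ^^ k) 1) j = fps_nth ((fps_op c' 1 ^^ k) 1) j"
    using * by blast
  show "fps_nth ((fps_op c 1 ^^ Suc (Suc k)) 1) m = fps_nth ((fps_op c' 1 ^^ Suc (Suc k)) 1) m"
    unfolding funpow.simps(2)[of "Suc k"] comp_apply fps_op_nth
  proof (rule sum.cong[OF refl])
    fix i assume "i \<in> {0..m}"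
    then consider "i = 0" | "i = m" | "0 < i" "i < m"
      by (metis atLeastAtMost_iff le_neq_implies_less neq0_conv)
    then show "fps_nth c i * ((1 - real (m - i)) * fps_nth ((fps_op c 1 ^^ Suc k) 1) (m - i)) =
      fps_nth c' i * ((1 - real (m - i)) * fps_nth ((fps_op c' 1 ^^ Suc k) 1) (m - i))"
    proof cases
      case 1
      then show ?thesis using assms(1,2) by simp
    next
      case 2
      have z: "fps_nth ((fps_op d 1 ^^ Suc k) 1) (m - i) = 0" if "fps_nth d 0 = 0" for d
        by (rule fps_op_funpow_nth_less[OF that]) (simp add: 2)
      show ?thesis unfolding z[OF assms(1)] z[OF assms(2)] by (simp only: mult_zero_right)
    next
      case 3
      then have 4: "m - i < m" by simp
      show ?thesis unfolding eq[OF 3(2)] *[rule_format, OF 4] ..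
    qed
  qed
qed

text \<open>In degree \<open>m > 0\<close> the exponential series has no term for
  \<open>k = 0\<close>, the coefficient of \<open>c\<close> for \<open>k = 1\<close>, and for
  \<open>k \<ge> 2\<close> only terms in lower coefficients of \<open>c\<close>.\<close>

lemma fps_op_exp_triangular:
  assumes c: "fps_nth c 0 = 0" "fps_nth c' 0 = 0" and eq: "\<And>j. j < m \<Longrightarrow> fps_nth c j = fps_nth c' j"
    and m: "m > 0"
  shows "fps_nth (fps_op_exp c 1 1) m - fps_nth (fps_op_exp c' 1 1) m = fps_nth c m - fps_nth c' m"
proof -
  define g where "g c k = fps_nth ((fps_op c 1 ^^ k) 1) m / fact k" for c k
  have g0: "g c 0 = 0" and g1: "g c 1 = fps_nth c m" for c
    using m by (simp_all add: g_def fps_op_def)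
  have g2: "g c (Suc (Suc k)) = g c' (Suc (Suc k))" for k
    unfolding g_def by (subst fps_op_funpow_triangular(2)[OF c]) (simp_all only: eq)
  obtain M where M: "m = Suc M" using m gr0_implies_Suc by blast
  have "(\<Sum>k\<le>M. g c (Suc k)) - (\<Sum>k\<le>M. g c' (Suc k))
     = (\<Sum>k\<le>M. if k = 0 then fps_nth c m - fps_nth c' m else 0)"
    unfolding sum_subtractf[symmetric]
  proof (intro sum.cong refl)
    fix k
    show "g c (Suc k) - g c' (Suc k) = (if k = 0 then fps_nth c m - fps_nth c' m else 0)"
      by (cases k) (use g1 g2 in auto)
  qed
  moreover have "fps_nth (fps_op_exp c 1 1) m = (\<Sum>k\<le>M. g c (Suc k))" for c
  proof -
    have "fps_nth (fps_op_exp c 1 1) m = (\<Sum>k\<le>Suc M. g c k)"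
      by (simp only: fps_op_exp_def fps_nth_Abs_fps g_def M)
    then show ?thesis by (simp only: sum.atMost_Suc_shift g0 add_0)
  qed
  ultimately show ?thesis by simp
qed

lemma continuous_on_fps_op_funpow:
  assumes "\<And>i. continuous_on U (\<lambda>x. fps_nth (c x) i)"
  shows "continuous_on U (\<lambda>x. fps_nth ((fps_op (c x) \<alpha> ^^ k) f) m)"
proof (induction k arbitrary: m)
  case (Suc k)
  then show ?case by (auto simp: fps_op_nth intro!: continuous_intros assms)
qed simp

lemma continuous_on_fps_op_exp:
  assumes "\<And>i. continuous_on U (\<lambda>x. fps_nth (c x) i)"
  shows "continuous_on U (\<lambda>x. fps_nth (fps_op_exp (c x) \<alpha> f) m)"
  unfolding fps_op_exp_def fps_nth_Abs_fps
  by (intro continuous_intros continuous_on_fps_op_funpow assms) simp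

section \<open>Coordinates on the group\<close>

text \<open>The series \<open>T\<close> in \<open>1 / X \<mapsto> T / X\<close>; the value
  \<open>c 0\<close> is overridden by 1, so coordinates can be indexed from 1.\<close>

definition tser :: "(nat \<Rightarrow> real) \<Rightarrow> real fps" where
  "tser c = Abs_fps (\<lambda>i. if i = 0 then 1 else c i)"

locale witt_algebra =
  fixes n :: nat and br :: "'g::euclidean_space \<Rightarrow> 'g \<Rightarrow> 'g" and e :: "nat \<Rightarrow> 'g"
  assumes n3: "n \<ge> 3" and lie: "lie_bracket br" and basis: "is_lie_basis_g n br e"
begin

definition bas :: "'g set" where "bas = e ` {1..n}"

text \<open>Extending by zero outside \<open>{1..n}\<close> lets convolution sums run over all
  degrees, including 0.\<close>

definition cf :: "nat \<Rightarrow> 'g \<Rightarrow> real" where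
  "cf i x = (if i \<in> {1..n} then representation bas x (e i) else 0)"

lemma inj_e: "inj_on e {1..n}" and indep: "independent bas" and span_e: "span bas = UNIV"
  and br_e: "i \<in> {1..n} \<Longrightarrow> j \<in> {1..n} \<Longrightarrow>
     br (e i) (e j) = (if i + j \<le> n then (real i - real j) *\<^sub>R e (i + j) else 0)"
  using basis unfolding is_lie_basis_g_def bas_def by blast+

lemma cf_add: "cf i (x + y) = cf i x + cf i y"
  by (simp add: cf_def representation_add[OF indep] span_e)

lemma cf_scale: "cf i (c *\<^sub>R x) = c * cf i x"
  by (simp add: cf_def representation_scale[OF indep] span_e)

lemma linear_cf: "linear (cf i)"
  by (rule linearI) (simp_all add: cf_add cf_scale)

lemma cf_0: "cf i 0 = 0" by (rule linear_0[OF linear_cf])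
lemma cf_sum: "cf i (\<Sum>j\<in>J. f j) = (\<Sum>j\<in>J. cf i (f j))" by (rule linear_sum[OF linear_cf])

lemma cf_outside: "i \<notin> {1..n} \<Longrightarrow> cf i x = 0" by (auto simp: cf_def)

lemma cf_e: "j \<in> {1..n} \<Longrightarrow> cf i (e j) = (if i = j then 1 else 0)"
proof -
  assume j: "j \<in> {1..n}"
  then have "e j \<in> bas" by (auto simp: bas_def)
  then have "representation bas (e j) = (\<lambda>v. if v = e j then 1 else 0)"
    by (rule representation_basis[OF indep])
  then show ?thesis using j inj_on_eq_iff[OF inj_e _ j, of i] unfolding cf_def by auto
qed

lemma expand: "(\<Sum>i\<in>{1..n}. cf i x *\<^sub>R e i) = x"
proof -
  have "(\<Sum>i\<in>{1..n}. cf i x *\<^sub>R e i) = (\<Sum>i\<in>{1..n}. representation bas x (e i) *\<^sub>R e i)"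
    by (rule sum.cong) (simp_all add: cf_def)
  also have "\<dots> = (\<Sum>b\<in>bas. representation bas x b *\<^sub>R b)"
    by (simp only: bas_def sum.reindex[OF inj_e] comp_def)
  also have "\<dots> = x"
    by (rule sum_representation_eq[OF indep]) (simp_all add: span_e, simp add: bas_def)
  finally show ?thesis .
qed

lemma cf_expand: "i \<in> {1..n} \<Longrightarrow> cf i (\<Sum>j\<in>{1..n}. c j *\<^sub>R e j) = c i"
proof -
  assume i: "i \<in> {1..n}"
  have "cf i (\<Sum>j\<in>{1..n}. c j *\<^sub>R e j) = (\<Sum>j\<in>{1..n}. if j = i then c j else 0)"
    unfolding cf_sum cf_scale by (rule sum.cong) (auto simp: cf_e)
  with i show ?thesis by simp
qed

lemma eqI_cf: "(\<And>i. i \<in> {1..n} \<Longrightarrow> cf i x = cf i y) \<Longrightarrow> x = y"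
proof -
  assume "\<And>i. i \<in> {1..n} \<Longrightarrow> cf i x = cf i y"
  then have "(\<Sum>i\<in>{1..n}. cf i x *\<^sub>R e i) = (\<Sum>i\<in>{1..n}. cf i y *\<^sub>R e i)" by (intro sum.cong) simp_all
  then show ?thesis unfolding expand .
qed

lemma continuous_on_cf: "continuous_on U (cf i)"
  using linear_continuous_on linear_cf linear_conv_bounded_linear by blast

lemma linear_eq_basis:
  assumes "linear f" "linear g" "\<And>i. i \<in> {1..n} \<Longrightarrow> f (e i) = g (e i)"
  shows "f x = (g x :: 'b::real_vector)"
  by (rule linear_eq_on[OF assms(1,2), where B = bas]) (use assms(3) span_e in \<open>auto simp: bas_def\<close>)

text \<open>The coefficient comes from applying \<open>- X^(i + 1) d/dX\<close> to \<open>X^(k - 1)\<close>.\<close>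

definition mul :: "'g \<Rightarrow> 'g \<Rightarrow> 'g" where
  "mul x v = (\<Sum>i\<in>{1..n}. \<Sum>k\<in>{1..n}. (cf i x * cf k v) *\<^sub>R
     (if i + k \<le> n then (1 - real k) *\<^sub>R e (i + k) else 0))"

lemma mul_add_left: "mul (x + y) v = mul x v + mul y v"
  by (simp add: mul_def cf_add distrib_right scaleR_add_left sum.distrib)
lemma mul_add_right: "mul x (v + w) = mul x v + mul x w"
  by (simp add: mul_def cf_add distrib_left scaleR_add_left sum.distrib)
lemma mul_scale_left: "mul (c *\<^sub>R x) v = c *\<^sub>R mul x v"
  by (simp add: mul_def cf_scale scaleR_sum_right mult.assoc)
lemma mul_scale_right: "mul x (c *\<^sub>R v) = c *\<^sub>R mul x v"
  by (simp add: mul_def cf_scale scaleR_sum_right ac_simps)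

lemma bilinear_mul: "bilinear mul"
  unfolding bilinear_def by (auto intro!: linearI simp: mul_add_left mul_add_right mul_scale_left
    mul_scale_right)

lemma bilinear_br: "bilinear br" using lie by (simp add: lie_bracket_def)

lemmas br_simps = bilinear_ladd[OF bilinear_br] bilinear_radd[OF bilinear_br]
  bilinear_lmul[OF bilinear_br] bilinear_rmul[OF bilinear_br]
lemmas mul_simps = mul_add_left mul_add_right mul_scale_left mul_scale_right

lemma mul_e: "i \<in> {1..n} \<Longrightarrow> k \<in> {1..n} \<Longrightarrow>
    mul (e i) (e k) = (if i + k \<le> n then (1 - real k) *\<^sub>R e (i + k) else 0)"
proof -
  assume i: "i \<in> {1..n}" and k: "k \<in> {1..n}"
  define t where "t i k = (if i + k \<le> n then (1 - real k) *\<^sub>R e (i + k) else 0)" for i k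
  have "mul (e i) (e k) = (\<Sum>i'\<in>{1..n}. if i' = i then (\<Sum>k'\<in>{1..n}. if k'
    = k then t i k' else 0) else 0)"
    unfolding mul_def t_def[symmetric]
  proof (rule sum.cong[OF refl])
    fix i'
    show "(\<Sum>k'\<in>{1..n}. (cf i' (e i) * cf k' (e k)) *\<^sub>R t i' k')
      = (if i' = i then (\<Sum>k'\<in>{1..n}. if k' = k then t i k' else 0) else 0)"
    proof (cases "i' = i")
      case True
      have "(\<Sum>k'\<in>{1..n}. (cf i' (e i) * cf k' (e k)) *\<^sub>R t i' k') = (\<Sum>k'\<in>{1..n}. if k'
        = k then t i k' else 0)"
        by (rule sum.cong) (simp_all only: cf_e[OF i] cf_e[OF k] True, simp)
      with True show ?thesis by simp
    next
      case False
      have "(\<Sum>k'\<in>{1..n}. (cf i' (e i) * cf k' (e k)) *\<^sub>R t i' k') = 0"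
        by (rule sum.neutral) (simp only: cf_e[OF i] False, simp)
      with False show ?thesis by simp
    qed
  qed
  also have "\<dots> = t i k" using i k by (simp del: One_nat_def)
  finally show ?thesis by (simp only: t_def)
qed

text \<open>On basis vectors this is \<open>(1 - j) - (1 - i) = i - j\<close>.\<close>

lemma br_eq_mul: "br x y = mul x y - mul y x"
proof -
  have 1: "br (e i) y = mul (e i) y - mul y (e i)" if "i \<in> {1..n}" for i y
    by (rule linear_eq_basis[where f = "br (e i)" and g = "\<lambda>y. mul (e i) y - mul y (e i)"])
      (use that in \<open>auto intro!: linearI simp: br_simps mul_simps br_e mul_e algebra_simps\<close>)
  show ?thesis
    by (rule linear_eq_basis[where f = "\<lambda>x. br x y" and g = "\<lambda>x. mul x y - mul y x"])
      (auto intro!: linearI simp: br_simps mul_simps 1 algebra_simps)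
qed

text \<open>On basis vectors both sides have the coefficient \<open>(1 - k) * (i - j)\<close>, on
  the right in the form \<open>(1 - k) * ((1 - j - k) - (1 - i - k))\<close>.\<close>

lemma mul_br: "mul (br x y) v = mul x (mul y v) - mul y (mul x v)"
proof -
  have 0: "mul (br (e i) (e j)) (e k) = mul (e i) (mul (e j) (e k)) - mul (e j) (mul (e i) (e k))"
    if "i \<in> {1..n}" "j \<in> {1..n}" "k \<in> {1..n}" for i j k
  proof -
    have z: "mul 0 v = 0" "mul v 0 = 0" for v
      using bilinear_mul by (simp_all add: bilinear_lzero bilinear_rzero)
    show ?thesis using that
      by (auto simp: br_e mul_e mul_simps z add.left_commute[of j i] add.assoc algebra_simps
          simp flip: scaleR_diff_left)
        (simp only: scaleR_add_left[symmetric], rule arg_cong[where f = "\<lambda>c. c *\<^sub>R _"], simp)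
  qed
  have 1: "mul (br (e i) (e j)) v = mul (e i) (mul (e j) v) - mul (e j) (mul (e i) v)"
    if "i \<in> {1..n}" "j \<in> {1..n}" for i j v
    by (rule linear_eq_basis[where f = "mul (br (e i) (e j))"
          and g = "\<lambda>v. mul (e i) (mul (e j) v) - mul (e j) (mul (e i) v)"])
      (use that in \<open>auto intro!: linearI simp: mul_simps 0 algebra_simps\<close>)
  have 2: "mul (br (e i) y) v = mul (e i) (mul y v) - mul y (mul (e i) v)"
    if "i \<in> {1..n}" for i y v
    by (rule linear_eq_basis[where f = "\<lambda>y. mul (br (e i) y) v"
          and g = "\<lambda>y. mul (e i) (mul y v) - mul y (mul (e i) v)"])
      (use that in \<open>auto intro!: linearI simp: br_simps mul_simps 1 algebra_simps\<close>)
  show ?thesis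
    by (rule linear_eq_basis[where f = "\<lambda>x. mul (br x y) v"
          and g = "\<lambda>x. mul x (mul y v) - mul y (mul x v)"])
      (auto intro!: linearI simp: br_simps mul_simps 2 algebra_simps)
qed

lemma cf_mul:
  assumes m: "m \<le> n"
  shows "cf m (mul x v) = (\<Sum>i=0..m. cf i x * ((1 - real (m - i)) * cf (m - i) v))"
proof -
  have inner: "cf m (\<Sum>k\<in>{1..n}. (cf i x * cf k v) *\<^sub>R (if i + k \<le> n then (1 - real k) *\<^sub>R e (i
    + k) else 0))
      = (if i \<le> m then cf i x * ((1 - real (m - i)) * cf (m - i) v) else 0)" if i: "i \<in> {1..n}" for i
  proof -
    have "cf m (\<Sum>k\<in>{1..n}. (cf i x * cf k v) *\<^sub>R (if i + k \<le> n then (1 - real k) *\<^sub>R e (i + k) else 0))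
      = (\<Sum>k\<in>{1..n}. if k = m - i \<and> i \<le> m then cf i x * ((1 - real (m - i)) * cf (m - i) v) else 0)"
      unfolding cf_sum by (intro sum.cong refl) (use i m in \<open>auto simp: cf_scale cf_e cf_0\<close>)
    also have "\<dots> = (if i \<le> m then cf i x * ((1 - real (m - i)) * cf (m - i) v) else 0)"
      using i m by (cases "m - i = 0") (auto simp: cf_outside)
    finally show ?thesis .
  qed
  have "cf m (mul x v) = (\<Sum>i\<in>{1..n}. if i \<le> m then cf i x * ((1 - real (m - i)) * cf (m - i) v) else 0)"
    unfolding mul_def by (rule trans[OF cf_sum]) (rule sum.cong[OF refl], rule inner)
  also have "\<dots> = (\<Sum>i=0..m. cf i x * ((1 - real (m - i)) * cf (m - i) v))"
    by (rule sum.mono_neutral_cong) (use m in \<open>auto simp: cf_outside\<close>)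
  finally show ?thesis .
qed

definition filt :: "nat \<Rightarrow> 'g set" where "filt j = {x. \<forall>i\<le>j. cf i x = 0}"

lemma subspace_filt: "subspace (filt j)"
  by (auto simp: subspace_def filt_def cf_0 cf_add cf_scale)

lemma mul_filt: "u \<in> filt i \<Longrightarrow> v \<in> filt j \<Longrightarrow> mul u v \<in> filt (Suc (i + j))"
  unfolding filt_def
proof (safe)
  fix m assume u: "\<forall>k\<le>i. cf k u = 0" and v: "\<forall>k\<le>j. cf k v = 0" and m: "m \<le> Suc (i + j)"
  have *: "cf k u = 0 \<or> cf (m - k) v = 0" if "k \<le> m" for k
    using u v m that by (cases "k \<le> i") auto
  show "cf m (mul u v) = 0"
  proof (cases "m \<le> n")
    case True
    show ?thesis unfolding cf_mul[OF True]
    proof (intro sum.neutral ballI)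
      fix k assume "k \<in> {0..m}"
      then show "cf k u * ((1 - real (m - k)) * cf (m - k) v) = 0" using *[of k] by auto
    qed
  qed (simp add: cf_outside)
qed

lemma filt_0: "filt 0 = UNIV" by (simp add: filt_def cf_outside)

lemma filt_n: "n \<le> N \<Longrightarrow> filt N = {0}"
  by (auto simp: filt_def cf_0 intro!: eqI_cf)

lemma filt_decr: "filt (Suc i) \<subseteq> filt i" by (auto simp: filt_def)

lemma mul_funpow_filt: "v \<in> filt j \<Longrightarrow> (mul x ^^ k) v \<in> filt (j + k)"
proof (induction k)
  case (Suc k)
  then show ?case using mul_filt[of x 0 "(mul x ^^ k) v" "j + k"] by (simp add: filt_0)
qed simp

sublocale nilpotent_filtration br filt n
proof
  show "br u v \<in> filt (Suc (i + j))" if "u \<in> filt i" "v \<in> filt j" for u v i j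
    unfolding br_eq_mul using mul_filt[OF that] mul_filt[OF that(2,1)]
    by (intro subspace_diff subspace_filt) (simp_all add: add.commute)
qed (use n3 lie subspace_filt filt_0 filt_decr filt_n in auto)

text \<open>The pair \<open>(v, c)\<close> represents the truncated power series \<open>c + cf 1 v * X + \<dots> + cf n v * X^n\<close>.\<close>

definition \<rho> :: "'g \<Rightarrow> 'g \<times> real \<Rightarrow> 'g \<times> real" where
  "\<rho> x w = (mul x (fst w) + snd w *\<^sub>R x, 0)"

lemma rho_funpow_Suc: "(\<rho> x ^^ Suc k) w = ((mul x ^^ k) (mul x (fst w) + snd w *\<^sub>R x), 0)"
  by (induction k) (simp_all add: \<rho>_def)

text \<open>The constant term is used up by the first application and \<open>n\<close> applications
  of \<open>mul x\<close> kill the rest, whence the order \<open>Suc n\<close>.\<close>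

sublocale R: nilpotent_rep br \<rho> "Suc n"
proof
  show "bilinear \<rho>" unfolding bilinear_def
    by (auto intro!: linearI simp: \<rho>_def mul_simps algebra_simps)
  show "\<rho> (br x y) w = \<rho> x (\<rho> y w) - \<rho> y (\<rho> x w)" for x y w
    by (simp add: \<rho>_def mul_br mul_simps) (simp add: br_eq_mul algebra_simps)
  show "(\<rho> x ^^ Suc n) w = 0" for x w
    unfolding rho_funpow_Suc using mul_funpow_filt[where j = 0 and k = n and x = x] filt_n[of n]
    by (simp add: filt_0 zero_prod_def)
  show "(br x ^^ Suc n) y = 0" for x y
    by (rule funpow_eq_0_mono[OF ad.linear_br nilpotent]) simp
qed (simp_all add: bilinear_br br_self)

definition ser :: "'g \<times> real \<Rightarrow> real fps" where
  "ser w = Abs_fps (\<lambda>m. if m = 0 then snd w else cf m (fst w))"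

definition cser :: "'g \<Rightarrow> real fps" where "cser x = Abs_fps (\<lambda>m. cf m x)"

lemma cser_0: "fps_nth (cser x) 0 = 0" by (simp add: cser_def cf_outside)

lemma ser_rho: "m \<le> n \<Longrightarrow> fps_nth (ser (\<rho> x w)) m = fps_nth (fps_op (cser x) 1 (ser w)) m"
proof -
  assume m: "m \<le> n"
  show ?thesis
  proof (cases "m = 0")
    case True
    then show ?thesis by (simp add: ser_def \<rho>_def fps_op_nth cser_0)
  next
    case False
    then obtain M where M: "m = Suc M" using not0_implies_Suc by blast
    have "fps_nth (fps_op (cser x) 1 (ser w)) m =
      (\<Sum>i=0..m. cf i x * ((1 - real (m - i)) * (if m - i = 0 then snd w else cf (m - i) (fst w))))"
      by (simp add: fps_op_nth cser_def ser_def)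
    also have "\<dots> = (\<Sum>i=0..m. cf i x * ((1 - real (m - i)) * cf (m - i) (fst w)) + (if i
      = m then cf m x * snd w else 0))"
      by (intro sum.cong refl) (auto simp: cf_outside)
    also have "\<dots> = cf m (mul x (fst w)) + cf m x * snd w"
      by (simp add: sum.distrib cf_mul[OF m])
    finally show ?thesis using False by (simp add: ser_def \<rho>_def cf_add cf_scale)
  qed
qed

lemma ser_rho_funpow: "m \<le> n \<Longrightarrow> fps_nth (ser ((\<rho> x ^^ k) w)) m
  = fps_nth ((fps_op (cser x) 1 ^^ k) (ser w)) m"
proof (induction k arbitrary: m)
  case (Suc k)
  have "fps_nth (ser ((\<rho> x ^^ Suc k) w)) m = fps_nth (fps_op (cser x) 1 (ser ((\<rho> x ^^ k) w))) m"
    using Suc.prems by (simp add: ser_rho)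
  also have "\<dots> = fps_nth (fps_op (cser x) 1 ((fps_op (cser x) 1 ^^ k) (ser w))) m"
    unfolding fps_op_nth using Suc by (intro sum.cong refl) simp
  finally show ?case by simp
qed simp

lemma ser_sum: "ser (\<Sum>i\<in>I. c i *\<^sub>R f i) = (\<Sum>i\<in>I. fps_const (c i) * ser (f i))"
  by (rule fps_ext) (simp add: ser_def fps_sum_nth fst_sum snd_sum cf_sum cf_scale)

lemma ser_E: "m \<le> n \<Longrightarrow> fps_nth (ser (R.E x w)) m = fps_nth (fps_op_exp (cser x) 1 (ser w)) m"
proof -
  assume m: "m \<le> n"
  have "fps_nth (ser (R.E x w)) m
    = (\<Sum>k<2 * Suc n. fps_nth ((fps_op (cser x) 1 ^^ k) (ser w)) m / fact k)"
    unfolding R.E_def fun_calc_def ser_sum fps_sum_nth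
    by (intro sum.cong refl) (simp add: ser_rho_funpow[OF m])
  also have "\<dots> = (\<Sum>k\<le>m. fps_nth ((fps_op (cser x) 1 ^^ k) (ser w)) m / fact k)"
    by (rule sum.mono_neutral_right) (use m fps_op_funpow_nth_less[OF cser_0] in auto)
  finally show ?thesis by (simp add: fps_op_exp_def)
qed

lemma snd_E: "snd (R.E x w) = snd w"
  using ser_E[of 0 x w] by (simp add: ser_def fps_op_exp_nth_0)

text \<open>In the coordinate \<open>1 / X\<close> the group acts by \<open>1 / X \<mapsto> 1 / X * (1 + d 1 x * X + d 2 x * X^2 +
  \<dots>)\<close>.\<close>

definition d :: "nat \<Rightarrow> 'g \<Rightarrow> real" where "d m x = fps_nth (fps_op_exp (cser x) 1 1) m"

lemma ser_one: "ser (0, 1) = 1"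
  by (rule fps_ext) (simp add: ser_def cf_0)

lemma d_eq_cf: "m \<in> {1..n} \<Longrightarrow> cf m (fst (R.E x (0, 1))) = d m x"
  using ser_E[of m x "(0, 1)"] by (simp add: ser_one d_def) (simp add: ser_def)

lemma E_one: "R.E x (0, 1) = ((\<Sum>m\<in>{1..n}. d m x *\<^sub>R e m), 1)"
proof (rule prod_eqI)
  show "fst (R.E x (0, 1)) = fst ((\<Sum>m\<in>{1..n}. d m x *\<^sub>R e m), 1 :: real)"
    by (simp only: fst_conv, rule eqI_cf) (simp only: d_eq_cf cf_expand)
qed (simp add: snd_E)

text \<open>Thus \<open>d m\<close> is \<open>cf m\<close> plus a function of the lower linear
  coordinates, which makes the change of coordinates invertible step by step.\<close>

lemma d_triangular:
  assumes "\<And>j. j < m \<Longrightarrow> cf j x = cf j y" and "m > 0"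
  shows "d m x - d m y = cf m x - cf m y"
  using fps_op_exp_triangular[of "cser x" "cser y" m] assms
    by (simp add: d_def cser_0) (simp add: cser_def)

lemma d_inj:
  assumes "\<And>m. m \<in> {1..n} \<Longrightarrow> d m x = d m y"
  shows "x = y"
proof (rule eqI_cf)
  fix i
  have "cf i x = cf i y" for i
  proof (induction i rule: less_induct)
    case (less i)
    show ?case
    proof (cases "i \<in> {1..n}")
      case True
      then show ?thesis using d_triangular[of i x y] less assms[of i] by auto
    qed (simp add: cf_outside)
  qed
  then show "cf i x = cf i y" .
qed

lemma continuous_on_d: "continuous_on U (d m)"
  unfolding d_def[abs_def]
  by (rule continuous_on_fps_op_exp) (simp add: cser_def continuous_on_cf)

lemma tser_d: "tser (\<lambda>i. d i x) = fps_op_exp (cser x) 1 1"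
  by (rule fps_ext) (simp add: tser_def d_def fps_op_exp_nth_0)

lemma E_bch: "R.E (bch br x y) w = R.E x (R.E y w)"
  by (rule bch_hom[OF R.nilpotent_rep_axioms]) simp

text \<open>The series of \<open>y\<close> is transformed by \<open>x\<close> term by term: with
  \<open>T\<close> the series of \<open>x\<close>, a term \<open>d i y * X^i\<close> becomes
  \<open>d i y * X^i * T^(1 - i)\<close>, and the constant term 1 becomes \<open>T\<close>.\<close>

lemma d_bch:
  assumes m: "m \<in> {1..n}"
  shows "d m (bch br x y) = d m x +
    (\<Sum>i=1..m. d i y * fps_nth (inverse (tser (\<lambda>i. d i x)) ^ (i - 1)) (m - i))"
proof -
  let ?E = "fps_op_exp (cser x) 1" and ?I = "inverse (tser (\<lambda>i. d i x))"
  have s: "ser (R.E y (0, 1)) = 1 + (\<Sum>i\<in>{1..n}. fps_const (d i y) * fps_X ^ i)"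
  proof (rule fps_ext)
    fix k
    have "(\<Sum>i\<in>{1..n}. d i y * fps_nth (fps_X ^ i) k) = (if k \<in> {1..n} then d k y else 0)"
    proof -
      have "(\<Sum>i\<in>{1..n}. d i y * fps_nth (fps_X ^ i) k) = (\<Sum>i\<in>{1..n}. if i = k then d i y else 0)"
        by (rule sum.cong) auto
      then show ?thesis by simp
    qed
    moreover have "cf k (\<Sum>i\<in>{1..n}. d i y *\<^sub>R e i) = (if k \<in> {1..n} then d k y else 0)"
      by (simp add: cf_expand cf_outside del: One_nat_def atLeastAtMost_iff)
    ultimately show "fps_nth (ser (R.E y (0, 1))) k
        = fps_nth (1 + (\<Sum>i\<in>{1..n}. fps_const (d i y) * fps_X ^ i)) k"
      by (simp add: E_one ser_def fps_sum_nth del: fps_X_power_nth)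
  qed
  have "d m (bch br x y) = fps_nth (ser (R.E x (R.E y (0, 1)))) m"
    using m d_eq_cf[of m "bch br x y"] by (simp add: ser_def E_bch)
  also have "\<dots> = fps_nth (?E (1 + (\<Sum>i\<in>{1..n}. fps_const (d i y) * fps_X ^ i))) m"
    using m by (simp add: ser_E s)
  also have "\<dots> = d m x + (\<Sum>i\<in>{1..n}. d i y * fps_nth (fps_X ^ i * ?I ^ (i - 1)) m)"
    unfolding fps_op_exp_add tser_d
    by (simp add: fps_op_exp_sum fps_op_exp_const_mult fps_sum_nth fps_op_exp_X_power[OF cser_0]
        d_def)
  also have "(\<Sum>i\<in>{1..n}. d i y * fps_nth (fps_X ^ i * ?I ^ (i - 1)) m)
      = (\<Sum>i=1..m. d i y * fps_nth (?I ^ (i - 1)) (m - i))"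
    by (rule sum.mono_neutral_cong_right) (use m in \<open>auto simp: fps_X_power_mult_nth\<close>)
  finally show ?thesis .
qed

text \<open>The orbit of the constant series separates group elements. The group axioms for
  \<open>bch\<close> thus come from composition of operators, without any manipulation of Dynkin's
  series.\<close>

lemma E_inj: "R.E x (0, 1) = R.E y (0, 1) \<Longrightarrow> x = y"
  by (rule d_inj) (metis d_eq_cf)

lemma bch_assoc: "bch br (bch br x y) z = bch br x (bch br y z)"
  by (rule E_inj) (simp add: E_bch)
lemma bch_0_left: "bch br 0 x = x" by (rule E_inj) (simp add: E_bch R.E_0)
lemma bch_minus_left: "bch br (- x) x = 0" by (rule E_inj) (simp add: E_bch R.E_0 R.E_inverse)
lemma group_G: "group (nilpotent_lie_group br)"
proof (rule groupI)
  fix x :: 'g assume "x \<in> carrier (nilpotent_lie_group br)"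
  show "\<exists>y\<in>carrier (nilpotent_lie_group br). y \<otimes>\<^bsub>nilpotent_lie_group br\<^esub> x = \<one>\<^bsub>nilpotent_lie_group br\<^esub>"
    by (rule bexI[of _ "- x"]) (simp_all add: nilpotent_lie_group_def bch_minus_left)
qed (simp_all add: nilpotent_lie_group_def bch_assoc bch_0_left)

lemma inv_G: "inv\<^bsub>nilpotent_lie_group br\<^esub> x = - x"
  by (rule group.inv_equality[OF group_G]) (simp_all add: nilpotent_lie_group_def bch_minus_left)

text \<open>A correction step for solving \<open>d m x = c m\<close>: by triangularity one more
  coordinate becomes final with each step, so \<open>n\<close> steps from 0 suffice. The iteration
  also shows continuity of the inverse.\<close>

definition mk_step :: "(nat \<Rightarrow> real) \<Rightarrow> 'g \<Rightarrow> 'g" where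
  "mk_step c x = (\<Sum>m\<in>{1..n}. (c m - d m x + cf m x) *\<^sub>R e m)"

definition mk :: "(nat \<Rightarrow> real) \<Rightarrow> 'g" where "mk c = (mk_step c ^^ n) 0"

lemma cf_mk_step: "m \<in> {1..n} \<Longrightarrow> cf m (mk_step c x) = c m - d m x + cf m x"
  unfolding mk_step_def by (rule cf_expand)

lemma mk_step_stable: "j \<le> k \<Longrightarrow> cf j ((mk_step c ^^ Suc k) 0) = cf j ((mk_step c ^^ k) 0)"
proof (induction k arbitrary: j)
  case (Suc k)
  show ?case
  proof (cases "j \<in> {1..n}")
    case True
    let ?x = "(mk_step c ^^ Suc k) 0" and ?y = "(mk_step c ^^ k) 0"
    have "d j ?x - d j ?y = cf j ?x - cf j ?y"
      by (rule d_triangular) (use Suc True in auto)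
    moreover have "cf j (mk_step c ?x) = c j - d j ?x + cf j ?x"
      "cf j (mk_step c ?y) = c j - d j ?y + cf j ?y"
      using cf_mk_step[OF True] by blast+
    ultimately show ?thesis by simp
  qed (simp add: cf_outside)
qed (simp add: cf_outside)

lemma d_mk: "m \<in> {1..n} \<Longrightarrow> d m (mk c) = c m"
  using mk_step_stable[of m n c] cf_mk_step[of m c "mk c"] by (auto simp: mk_def)

lemma continuous_on_mk: "continuous_on UNIV mk"
proof -
  have step: "continuous_on UNIV (\<lambda>c. mk_step c (g c))" if g: "continuous_on UNIV g" for g
    unfolding mk_step_def
    by (intro continuous_intros continuous_on_product_coordinates
        continuous_on_compose2[OF continuous_on_d[of UNIV] g subset_UNIV]
        continuous_on_compose2[OF continuous_on_cf[of UNIV] g subset_UNIV])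
  have "continuous_on UNIV (\<lambda>c. (mk_step c ^^ k) 0)" for k
    by (induction k) (simp_all add: step)
  then show ?thesis unfolding mk_def[abs_def] .
qed

lemma continuous_on_bch: "continuous_on UNIV (\<lambda>p. bch br (fst p) (snd p))"
proof -
  have mk: "bch br x y = mk (\<lambda>m. d m (bch br x y))" for x y
    by (rule d_inj) (simp add: d_mk)
  have rho: "continuous_on U (\<lambda>p. \<rho> (f p) (g p))" if "continuous_on U f" "continuous_on U g"
    for U :: "('g \<times> 'g) set" and f g
    using bounded_bilinear.continuous_on[OF bilinear_conv_bounded_bilinear[THEN iffD1, OF R.bilin] that]
      .
  have E: "continuous_on U (\<lambda>p. R.E (f p) (g p))" if f: "continuous_on U f" and g: "continuous_on U g"
    for U :: "('g \<times> 'g) set" and f g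
  proof -
    have "continuous_on U (\<lambda>p. (\<rho> (f p) ^^ k) (g p))" for k
      by (induction k) (simp_all add: g rho[OF f])
    then show ?thesis unfolding R.E_def fun_calc_def by (intro continuous_intros)
  qed
  have "continuous_on UNIV (\<lambda>p. cf m (fst (R.E (fst p) (R.E (snd p) (0, 1)))))" for m
    by (rule continuous_on_compose2[OF continuous_on_cf[of UNIV]])
      (auto intro!: continuous_intros E)
  then have "continuous_on UNIV (\<lambda>p. d m (bch br (fst p) (snd p)))" if "m \<in> {1..n}" for m
    using d_eq_cf[OF that, symmetric] by (simp add: E_bch)
  \<comment> \<open>The argument of \<open>mk\<close> is a function on all naturals, so continuity
    into the product space is arranged by putting zero outside \<open>{1..n}\<close>.\<close>
  then have c: "continuous_on UNIV (\<lambda>p. if m \<in> {1..n} then d m (bch br (fst p) (snd p)) else 0)" for m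
    by (cases "m \<in> {1..n}") auto
  have "bch br x y = mk (\<lambda>m. if m \<in> {1..n} then d m (bch br x y) else 0)" for x y
    by (rule d_inj) (simp add: d_mk)
  moreover have "continuous_on UNIV (\<lambda>p. mk (\<lambda>m. if m
    \<in> {1..n} then d m (bch br (fst p) (snd p)) else 0))"
    by (rule continuous_on_compose2[OF continuous_on_mk])
      (intro continuous_on_coordinatewise_then_product c, simp)
  ultimately show ?thesis by simp
qed

end

section \<open>The lower central series\<close>

context witt_algebra
begin

lemma filt_eq_span: "filt j = span (e ` {Suc j..n})"
proof
  show "filt j \<subseteq> span (e ` {Suc j..n})"
  proof
    fix x assume x: "x \<in> filt j"
    have "(\<Sum>i\<in>{1..n}. cf i x *\<^sub>R e i) \<in> span (e ` {Suc j..n})"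
    proof (rule span_sum)
      fix i assume i: "i \<in> {1..n}"
      show "cf i x *\<^sub>R e i \<in> span (e ` {Suc j..n})"
      proof (cases "i \<le> j")
        case True
        then show ?thesis using x by (simp add: filt_def span_zero)
      next
        case False
        then show ?thesis using i by (intro span_scale span_base) auto
      qed
    qed
    then show "x \<in> span (e ` {Suc j..n})" unfolding expand .
  qed
  have "e i \<in> filt j" if "i \<in> {Suc j..n}" for i
    using that cf_e[of i] by (auto simp: filt_def)
  then show "span (e ` {Suc j..n}) \<subseteq> filt j"
    by (intro span_minimal subspace_filt) auto
qed

lemma dim_filt: "dim (filt j) = n - j"
proof -
  have sub: "{Suc j..n} \<subseteq> {1..n}" by auto
  have "independent (e ` {Suc j..n})"
    using independent_mono[OF indep] sub unfolding bas_def by blast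
  then have "dim (filt j) = card (e ` {Suc j..n})"
    unfolding filt_eq_span by (simp add: dim_eq_card_independent)
  also have "\<dots> = n - j"
    using card_image[OF inj_on_subset[OF inj_e sub]] by simp
  finally show ?thesis .
qed

text \<open>Degree 2 could only come from \<open>mul (e 1) (e 1)\<close>, whose coefficient is
  \<open>1 - 1 = 0\<close>. The derived algebra therefore starts with \<open>e 3\<close>, one step
  later than the grading suggests.\<close>

lemma mul_filt_2: "mul x y \<in> filt 2"
proof -
  have "cf m (mul x y) = 0" if "m \<le> 2" for m
  proof -
    have m: "m \<le> n" using n3 that by simp
    have "cf i x * ((1 - real (m - i)) * cf (m - i) y) = 0" if "i \<in> {0..m}" for i
      using \<open>m \<le> 2\<close> that by (cases "m - i = 1"; cases "m - i = 0"; cases "i = 0")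
        (auto simp: cf_outside)
    then show ?thesis unfolding cf_mul[OF m] by (intro sum.neutral ballI)
  qed
  then show ?thesis by (simp add: filt_def)
qed

lemma br_e_1: "m \<in> {2..n} \<Longrightarrow> br (e 1) (e (m - 1)) = (2 - real m) *\<^sub>R e m"
proof -
  assume m: "m \<in> {2..n}"
  then have i: "1 \<in> {1..n}" "m - 1 \<in> {1..n}" and s: "1 + (m - 1) = m" "m \<le> n" by auto
  have "real 1 - real (m - 1) = 2 - real m" using m by auto
  then show ?thesis using br_e[OF i] s by simp
qed

text \<open>Bracketing with \<open>e 1\<close> reaches every \<open>e m\<close> with
  \<open>m \<ge> 3\<close> from \<open>e (m - 1)\<close>, as the factor \<open>2 - m\<close> is
  nonzero.\<close>

lemma lower_central_Suc: "lower_central br (Suc i) = filt (i + 2)"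
proof (induction i)
  case 0
  have "{br x y | x y. y \<in> UNIV} \<subseteq> filt 2"
    using mul_filt_2 by (auto simp: br_eq_mul intro: subspace_diff[OF subspace_filt])
  then have 1: "span {br x y | x y. y \<in> UNIV} \<subseteq> filt 2" by (rule span_minimal[OF _ subspace_filt])
  have "e m \<in> span {br x y | x y. y \<in> UNIV}" if m: "m \<in> {3..n}" for m
  proof -
    have br: "br (e 1) (e (m - 1)) = (2 - real m) *\<^sub>R e m" using m by (intro br_e_1) auto
    have "(1 / (2 - real m)) *\<^sub>R br (e 1) (e (m - 1)) = e m" using m br by simp
    then show ?thesis using span_scale[OF span_base, of "br (e 1) (e (m - 1))"]
      by (metis (mono_tags, lifting) UNIV_I mem_Collect_eq)
  qed
  then have "filt 2 \<subseteq> span {br x y | x y. y \<in> UNIV}"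
    unfolding filt_eq_span by (intro span_minimal subspace_span) auto
  with 1 have "span {br x y | x y. y \<in> UNIV} = filt (0 + 2)" unfolding add_0 by (rule subset_antisym)
  then show ?case unfolding lower_central.simps .
next
  case (Suc i)
  have "{br x y | x y. y \<in> filt (i + 2)} \<subseteq> filt (Suc i + 2)"
    using brF[of _ 0 _ "i + 2"] by (auto simp: filt_0)
  then have 1: "span {br x y | x y. y \<in> filt (i + 2)} \<subseteq> filt (Suc i + 2)"
    by (rule span_minimal[OF _ subspace_filt])
  have "e m \<in> span {br x y | x y. y \<in> filt (i + 2)}" if m: "m \<in> {i + 4..n}" for m
  proof -
    have br: "br (e 1) (e (m - 1)) = (2 - real m) *\<^sub>R e m" using m by (intro br_e_1) auto
    have *: "(1 / (2 - real m)) *\<^sub>R br (e 1) (e (m - 1)) = e m" using m br by simp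
    have "e (m - 1) \<in> filt (i + 2)" unfolding filt_eq_span using m by (intro span_base imageI) auto
    then have "br (e 1) (e (m - 1)) \<in> {br x y | x y. y \<in> filt (i + 2)}" by blast
    from span_scale[OF span_base[OF this], of "1 / (2 - real m)"] show ?thesis unfolding * .
  qed
  then have "filt (Suc i + 2) \<subseteq> span {br x y | x y. y \<in> filt (i + 2)}"
    unfolding filt_eq_span[of "Suc i + 2"] by (intro span_minimal subspace_span) auto
  with 1 show ?case unfolding lower_central.simps(2)[of br "Suc i"] Suc by blast
qed

text \<open>The dimensions are \<open>n, n - 2, n - 3, ..., 1\<close>; the value
  \<open>n - 1\<close> is skipped.\<close>

lemma homogeneous_dim_eq: "real (homogeneous_dim br) = real n * (real n - 1) / 2 + 1"
proof -
  define p where "p = n - 2"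
  have p: "n = Suc (Suc p)" using n3 unfolding p_def by linarith
  have dim_Suc: "dim (lower_central br (Suc i)) = p - i" for i
    unfolding lower_central_Suc dim_filt by (simp add: p)
  have dim_0: "dim (lower_central br 0) = n" using dim_filt[of 0] by (simp add: filt_0)
  have "homogeneous_dim br = (\<Sum>i\<le>Suc p. dim (lower_central br i))"
    unfolding homogeneous_dim_def
  proof (rule suminf_finite)
    fix k assume "k \<notin> {..Suc p}"
    then have "k = Suc (k - 1)" "p \<le> k - 1" by auto
    then show "dim (lower_central br k) = 0" by (metis dim_Suc diff_is_0_eq)
  qed simp
  also have "\<dots> = n + (\<Sum>i\<le>p. p - i)"
    unfolding sum.atMost_Suc_shift dim_0 dim_Suc ..
  also have "(\<Sum>i\<le>p. p - i) = (\<Sum>i\<le>p. i)"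
    by (rule sum.reindex_bij_witness[of _ "\<lambda>i. p - i" "\<lambda>i. p - i"]) auto
  finally have "real (homogeneous_dim br) = real n + (\<Sum>i\<le>p. real i)"
    by (simp only: of_nat_add of_nat_sum)
  also have "(\<Sum>i\<le>p. real i) = real p * (real p + 1) / 2"
    by (induction p) (simp_all add: field_simps)
  finally show ?thesis by (simp add: p field_simps)
qed

end

section \<open>The multiplication in coordinates\<close>

text \<open>From here on the Lie algebra is forgotten: a topological group with global coordinates
  and an explicit product formula is all that is used.\<close>

locale witt_group = group G for G :: "'g::euclidean_space monoid" (structure) +
  fixes n :: nat and d :: "nat \<Rightarrow> 'g \<Rightarrow> real" and mk :: "(nat \<Rightarrow> real) \<Rightarrow> 'g"
  assumes n3: "n \<ge> 3" and carrier_UNIV [simp]: "carrier G = UNIV"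
    and continuous_mult: "continuous_on UNIV (\<lambda>p. fst p \<otimes> snd p)"
    and continuous_inv: "continuous_on UNIV (\<lambda>x. inv x)"
    and continuous_d: "continuous_on UNIV (d m)" and continuous_mk: "continuous_on UNIV mk"
    and d_mk: "m \<in> {1..n} \<Longrightarrow> d m (mk c) = c m"
    and d_inj: "(\<And>m. m \<in> {1..n} \<Longrightarrow> d m x = d m y) \<Longrightarrow> x = y"
    and d_mult_raw: "m \<in> {1..n} \<Longrightarrow> d m (x \<otimes> y) = d m x +
      (\<Sum>i=1..m. d i y * fps_nth (inverse (tser (\<lambda>i. d i x)) ^ (i - 1)) (m - i))"

lemma (in witt_algebra) witt_group: "witt_group (nilpotent_lie_group br) n d mk"
proof -
  interpret G: group "nilpotent_lie_group br" by (rule group_G)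
  show ?thesis
  proof
    show "n \<ge> 3" by (rule n3)
    show "continuous_on UNIV (\<lambda>p. fst p \<otimes>\<^bsub>nilpotent_lie_group br\<^esub> snd p)"
      using continuous_on_bch by (simp add: nilpotent_lie_group_def)
    show "continuous_on UNIV (\<lambda>x. inv\<^bsub>nilpotent_lie_group br\<^esub> x)"
      unfolding inv_G by (intro continuous_intros)
    show "m \<in> {1..n} \<Longrightarrow> d m (x \<otimes>\<^bsub>nilpotent_lie_group br\<^esub> y) = d m x +
      (\<Sum>i=1..m. d i y * fps_nth (inverse (tser (\<lambda>i. d i x)) ^ (i - 1)) (m - i))" for m x y
      using d_bch[of m x y] by (simp add: nilpotent_lie_group_def)
    show "(\<And>m. m \<in> {1..n} \<Longrightarrow> d m x = d m y) \<Longrightarrow> x = y" for x y by (rule d_inj)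
    show "m \<in> {1..n} \<Longrightarrow> d m (mk c) = c m" for m c by (rule d_mk)
    show "carrier (nilpotent_lie_group br) = UNIV" by (simp add: nilpotent_lie_group_def)
  qed (rule continuous_on_d continuous_on_mk)+
qed

text \<open>With this and the next two lemmas, a series \<open>1 + c X^l + ...\<close> is
  multiplied, inverted and raised to powers to first order.\<close>

lemma fps_mult_flat:
  fixes f g :: "real fps"
  assumes "fps_nth f 0 = 1" "fps_nth g 0 = 1" "l > 0"
    and "\<And>i. 0 < i \<Longrightarrow> i < l \<Longrightarrow> fps_nth f i = 0"
  shows "fps_nth (f * g) l = fps_nth f l + fps_nth g l"
proof -
  have "fps_nth (f * g) l = (\<Sum>i=0..l. (if i = 0 then fps_nth g l else 0) + (if i
    = l then fps_nth f l else 0))"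
    unfolding fps_mult_nth using assms by (intro sum.cong refl) auto
  then show ?thesis by (simp add: sum.distrib)
qed

lemma fps_inverse_flat:
  fixes f :: "real fps"
  assumes "fps_nth f 0 = 1" "l > 0" "\<And>i. 0 < i \<Longrightarrow> i < l \<Longrightarrow> fps_nth f i = 0"
  shows "fps_nth (inverse f) l = - fps_nth f l"
proof -
  have "f * inverse f = 1" using assms(1) by (intro inverse_mult_eq_1') simp
  then have "fps_nth (f * inverse f) l = 0" using assms(2) by simp
  then show ?thesis using fps_mult_flat[of f "inverse f" l] assms by simp
qed

lemma fps_power_flat:
  fixes f :: "real fps"
  assumes "fps_nth f 0 = 1" "l > 0" "\<And>i. 0 < i \<Longrightarrow> i < l \<Longrightarrow> fps_nth f i = 0"
  shows "fps_nth (f ^ k) l = real k * fps_nth f l"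
proof (induction k)
  case (Suc k)
  have "fps_nth (f ^ k) 0 = 1" using assms(1) by (simp add: fps_power_zeroth)
  then show ?case using fps_mult_flat[of f "f ^ k" l] assms Suc by (simp add: algebra_simps)
qed (use assms in simp)

context witt_group
begin

definition K :: "nat \<Rightarrow> 'g \<Rightarrow> nat \<Rightarrow> real" where
  "K i x l = fps_nth (inverse (tser (\<lambda>i. d i x)) ^ (i - 1)) l"

lemma tser_0: "fps_nth (tser c) 0 = 1" by (simp add: tser_def)

lemma K_0: "K i x 0 = 1"
  by (simp add: K_def fps_power_zeroth tser_0)

lemma d_mult: "m \<in> {1..n} \<Longrightarrow> d m (x \<otimes> y) = d m x + d m y + (\<Sum>i\<in>{1..<m}. d i y * K i x (m - i))"
  unfolding d_mult_raw K_def[symmetric]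
  by (subst sum.last_plus) (simp_all add: K_0 atLeastLessThanSuc_atLeastAtMost)

definition lev :: "nat \<Rightarrow> 'g set" where "lev p = {x. \<forall>j\<in>{1..<p}. d j x = 0}"

lemma lev_1: "lev (Suc 0) = UNIV" by (simp add: lev_def)

lemma lev_Suc: "p > 0 \<Longrightarrow> x \<in> lev (Suc p) \<longleftrightarrow> x \<in> lev p \<and> d p x = 0"
  by (auto simp: lev_def less_Suc_eq)

lemma lev_mono: "p \<le> q \<Longrightarrow> x \<in> lev q \<Longrightarrow> x \<in> lev p" by (auto simp: lev_def)

lemma K_lev:
  assumes "x \<in> lev l" "l > 0"
  shows "K i x l = - real (i - 1) * d l x"
proof -
  let ?T = "tser (\<lambda>i. d i x)"
  have T: "fps_nth ?T j = (if j = 0 then 1 else d j x)" for j by (simp add: tser_def)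
  have T0: "fps_nth ?T j = 0" if "0 < j" "j < l" for j using assms that by (simp add: T lev_def)
  have I: "fps_nth (inverse ?T) j = - fps_nth ?T j" if "0 < j" "j \<le> l" for j
    by (rule fps_inverse_flat) (use T0 that in \<open>auto simp: T\<close>)
  have "K i x l = real (i - 1) * fps_nth (inverse ?T) l"
    unfolding K_def by (rule fps_power_flat) (use assms I T0 in \<open>auto simp: T\<close>)
  then show ?thesis using I[of l] assms by (simp add: T)
qed

lemma K_lev_less: "x \<in> lev p \<Longrightarrow> 0 < l \<Longrightarrow> l < p \<Longrightarrow> K i x l = 0"
  using K_lev[of x l i] lev_mono[of l p x] by (auto simp: lev_def)

text \<open>In the sum of \<open>d_mult\<close> the terms with \<open>i < q\<close> vanish because
  of \<open>y\<close>, and those with \<open>m - i < p\<close> because of \<open>x\<close>. Only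
  \<open>i = q\<close> in degree \<open>p + q\<close> survives, and there \<open>K\<close> is linear
  in \<open>d p x\<close>.\<close>

lemma d_mult_leading:
  assumes x: "x \<in> lev p" and y: "y \<in> lev q" and pq: "p > 0" "q > 0" and m: "m \<in> {1..n}" "m \<le> p + q"
  shows "d m (x \<otimes> y) = d m x + d m y - (if m = p + q then real (q - 1) * d p x * d q y else 0)"
proof -
  have z: "d i y * K i x (m - i) = 0" if "i \<in> {1..<m}" "i \<noteq> q \<or> m < p + q" for i
  proof (cases "i < q")
    case True
    then show ?thesis using y that by (simp add: lev_def)
  next
    case False
    then have "m - i < p" using that m by auto
    then show ?thesis using K_lev_less[OF x, of "m - i" i] that by simp
  qed
  have "(\<Sum>i\<in>{1..<m}. d i y * K i x (m - i)) = - (if m = p + q then real (q - 1) * d p x * d q y else 0)"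
  proof (cases "m = p + q")
    case True
    have "(\<Sum>i\<in>{1..<m}. d i y * K i x (m - i)) = d q y * K q x (m - q)"
    proof -
      have "(\<Sum>i\<in>{1..<m} - {q}. d i y * K i x (m - i)) = 0"
        using z by (intro sum.neutral) blast
      then show ?thesis using pq True by (subst sum.remove[of _ q]) auto
    qed
    then show ?thesis using True K_lev[OF x pq(1), of q] by simp
  next
    case False
    then show ?thesis using z m by (auto intro!: sum.neutral)
  qed
  then show ?thesis using d_mult[OF m(1), of x y] by simp
qed

lemma d_mult_left:
  assumes "x \<in> lev p" "p > 0" "m \<in> {1..n}" "m \<le> p"
  shows "d m (x \<otimes> y) = d m x + d m y"
  using d_mult_leading[of x p y 1 m] assms by (simp add: lev_1)

lemma d_one: "m \<in> {1..n} \<Longrightarrow> d m \<one> = 0"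
proof (induction m rule: less_induct)
  case (less m)
  then have "\<one> \<in> lev m" by (auto simp: lev_def)
  then show ?case using d_mult_left[of \<one> m m \<one>] less.prems by simp
qed

lemma one_lev: "p \<le> Suc n \<Longrightarrow> \<one> \<in> lev p" using d_one by (auto simp: lev_def)

lemma lev_top: "x \<in> lev (Suc n) \<Longrightarrow> x = \<one>"
  by (rule d_inj) (auto simp: lev_def d_one)

lemma mult_lev: "x \<in> lev p \<Longrightarrow> y \<in> lev p \<Longrightarrow> p \<le> Suc n \<Longrightarrow> x \<otimes> y \<in> lev p"
  using d_mult_left[of x p] by (cases "p = 0") (auto simp: lev_def)

lemma d_inv:
  assumes x: "x \<in> lev p" and p: "p > 0" and m: "m \<in> {1..n}" "m \<le> p"
  shows "d m (inv x) = - d m x"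
  using d_mult_left[OF assms, of "inv x"] d_one[OF m(1)] by simp

lemma inv_lev: "x \<in> lev p \<Longrightarrow> p \<le> Suc n \<Longrightarrow> inv x \<in> lev p"
  using d_inv[of x p] by (cases "p = 0") (auto simp: lev_def)

lemma pow_lev:
  assumes x: "x \<in> lev p" and p: "p \<in> {1..n}"
  shows "x [^] (k::int) \<in> lev p \<and> d p (x [^] k) = real_of_int k * d p x"
proof -
  have nat: "x [^] (j::nat) \<in> lev p \<and> d p (x [^] j) = real j * d p x" for j
  proof (induction j)
    case 0
    then show ?case using p d_one one_lev by simp
  next
    case (Suc j)
    have "x [^] Suc j = x [^] j \<otimes> x" by simp
    moreover have "x [^] j \<otimes> x \<in> lev p" by (rule mult_lev) (use Suc x p in auto)
    moreover have "d p (x [^] j \<otimes> x) = real j * d p x + d p x"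
      using d_mult_left[of "x [^] j" p p x] p Suc by simp
    ultimately show ?case by (simp add: distrib_right)
  qed
  show ?thesis
  proof (cases "k \<ge> 0")
    case True
    then have *: "x [^] k = x [^] nat k"
      unfolding int_pow_def2[of G x k] Let_def by (intro if_not_P) simp
    have r: "real (nat k) = real_of_int k" using True by simp
    show ?thesis using nat[of "nat k"] unfolding * r .
  next
    case False
    then have *: "x [^] k = inv (x [^] nat (- k))"
      unfolding int_pow_def2[of G x k] Let_def by (intro if_P) simp
    have pn: "p > 0" "p \<le> Suc n" using p by auto
    have r: "real (nat (- k)) = - real_of_int k" using False by simp
    have X: "x [^] nat (- k) \<in> lev p" and D: "d p (x [^] nat (- k)) = - real_of_int k * d p x"
      using nat[of "nat (- k)"] unfolding r by blast+
    have "d p (inv (x [^] nat (- k))) = real_of_int k * d p x"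
      unfolding d_inv[OF X pn(1) p order_refl] D by simp
    then show ?thesis unfolding * using inv_lev[OF X pn(2)] by blast
  qed
qed

lemma lev_quotient:
  assumes "\<And>j. j \<in> {1..<s} \<Longrightarrow> d j (c \<otimes> z) = d j z" "s \<le> Suc n"
  shows "c \<in> lev s"
proof -
  have "j \<in> {1..<s} \<Longrightarrow> d j c = 0" for j
  proof (induction j rule: less_induct)
    case (less j)
    then have "c \<in> lev j" by (auto simp: lev_def)
    then show ?case using d_mult_left[of c j j z] less.prems assms by auto
  qed
  then show ?thesis by (simp add: lev_def)
qed

definition comm :: "'g \<Rightarrow> 'g \<Rightarrow> 'g" where "comm x y = x \<otimes> y \<otimes> inv (y \<otimes> x)"

text \<open>In this form the leading coordinate of a commutator is the difference of the coordinates
  of \<open>x \<otimes> y\<close> and \<open>y \<otimes> x\<close>. The cross terms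
  \<open>- (q - 1)\<close> and \<open>- (p - 1)\<close> then leave the factor
  \<open>p - q\<close>.\<close>

lemma comm_mult: "comm x y \<otimes> (y \<otimes> x) = x \<otimes> y"
  by (simp add: comm_def m_assoc)

lemma comm_lev:
  assumes x: "x \<in> lev p" and y: "y \<in> lev q" and pq: "p > 0" "q > 0" "p + q \<le> n"
  shows "comm x y \<in> lev (p + q)" and "d (p + q) (comm x y) = (real p - real q) * d p x * d q y"
proof -
  show l: "comm x y \<in> lev (p + q)"
  proof (rule lev_quotient[where z = "y \<otimes> x"])
    fix j assume j: "j \<in> {1..<p + q}"
    then have "j \<in> {1..n}" "j \<noteq> p + q" "j \<noteq> q + p" using pq by auto
    then show "d j (comm x y \<otimes> (y \<otimes> x)) = d j (y \<otimes> x)"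
      unfolding comm_mult using d_mult_leading[OF x y pq(1,2), of j]
        d_mult_leading[OF y x pq(2,1), of j] j
      by simp
  qed (use pq in simp)
  have m: "p + q \<in> {1..n}" using pq by auto
  have "d (p + q) (x \<otimes> y) = d (p + q) (comm x y) + d (p + q) (y \<otimes> x)"
    using d_mult_left[OF l, of "p + q" "y \<otimes> x"] m pq unfolding comm_mult by simp
  moreover have "d (p + q) (x \<otimes> y) = d (p + q) x + d (p + q) y - real (q - 1) * d p x * d q y"
    using d_mult_leading[OF x y pq(1,2) m] by simp
  moreover have "d (p + q) (y \<otimes> x) = d (p + q) x + d (p + q) y - real (p - 1) * d q y * d p x"
    using d_mult_leading[OF y x pq(2,1), of "p + q"] m by (simp add: add.commute)
  ultimately show "d (p + q) (comm x y) = (real p - real q) * d p x * d q y"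
    using pq by (simp add: of_nat_diff algebra_simps)
qed

text \<open>Lattices with a triangular basis; \<open>a m\<close> is the length of the circle \<open>lev m / lev (m + 1)\<close>
  modulo the lattice.\<close>

definition box_group :: "'g set \<Rightarrow> (nat \<Rightarrow> real) \<Rightarrow> bool" where
  "box_group \<Gamma> a \<longleftrightarrow> subgroup \<Gamma> G \<and> (\<forall>m\<in>{1..n}. a m > 0 \<and> (\<exists>\<gamma>\<in>\<Gamma> \<inter> lev m. d m \<gamma> = a m) \<and>
     (\<forall>\<gamma>\<in>\<Gamma> \<inter> lev m. \<exists>k::int. d m \<gamma> = real_of_int k * a m))"

definition Box :: "(nat \<Rightarrow> real) \<Rightarrow> 'g set" where
  "Box a = {x. \<forall>m\<in>{1..n}. 0 \<le> d m x \<and> d m x < a m}"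

lemma box_groupD:
  assumes "box_group \<Gamma> a" "m \<in> {1..n}"
  shows "a m > 0" and "\<exists>\<gamma>\<in>\<Gamma> \<inter> lev m. d m \<gamma> = a m"
    and "\<gamma> \<in> \<Gamma> \<Longrightarrow> \<gamma> \<in> lev m \<Longrightarrow> \<exists>k::int. d m \<gamma> = real_of_int k * a m"
  using assms unfolding box_group_def by auto

lemma subgroup_int_pow: "subgroup \<Gamma> G \<Longrightarrow> x \<in> \<Gamma> \<Longrightarrow> x [^] (k::int) \<in> \<Gamma>"
proof -
  assume s: "subgroup \<Gamma> G" and x: "x \<in> \<Gamma>"
  have "x [^] (j::nat) \<in> \<Gamma>" for j
    by (induction j) (use s x in \<open>auto intro: subgroup.one_closed subgroup.m_closed\<close>)
  then show ?thesis
    unfolding int_pow_def2[of G x k] Let_def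
      by (cases "k < 0") (simp_all only: if_True if_False subgroup.m_inv_closed[OF s])
qed

text \<open>Coordinates are adjusted from the lowest upwards: multiplying on the left by an element
  of \<open>lev s\<close> keeps the coordinates below \<open>s\<close> and shifts the one at
  \<open>s\<close>.\<close>

lemma box_group_reduce:
  assumes "box_group \<Gamma> a" shows "\<exists>\<gamma>\<in>\<Gamma>. \<gamma> \<otimes> g \<in> Box a"
proof -
  have sub: "subgroup \<Gamma> G" using assms by (simp add: box_group_def)
  have "s \<le> n \<Longrightarrow> \<exists>\<gamma>\<in>\<Gamma>. \<forall>m\<in>{1..s}. 0 \<le> d m (\<gamma> \<otimes> g) \<and> d m (\<gamma> \<otimes> g) < a m" for s
  proof (induction s)
    case 0
    then show ?case using subgroup.one_closed[OF sub] by auto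
  next
    case (Suc s)
    then obtain \<gamma> where \<gamma>: "\<gamma> \<in> \<Gamma>" "\<forall>m\<in>{1..s}. 0 \<le> d m (\<gamma> \<otimes> g) \<and> d m (\<gamma> \<otimes> g) < a m" by auto
    have s: "Suc s \<in> {1..n}" using Suc by auto
    obtain \<delta> where \<delta>: "\<delta> \<in> \<Gamma>" "\<delta> \<in> lev (Suc s)" "d (Suc s) \<delta> = a (Suc s)"
      using box_groupD(2)[OF assms s] by auto
    have a: "a (Suc s) > 0" using box_groupD(1)[OF assms s] .
    define t where "t = d (Suc s) (\<gamma> \<otimes> g)"
    define k where "k = - \<lfloor>t / a (Suc s)\<rfloor>"
    define \<epsilon> where "\<epsilon> = \<delta> [^] k"
    have \<epsilon>: "\<epsilon> \<in> \<Gamma>" "\<epsilon> \<in> lev (Suc s)" "d (Suc s) \<epsilon> = real_of_int k * a (Suc s)"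
      unfolding \<epsilon>_def using subgroup_int_pow[OF sub \<delta>(1)] pow_lev[OF \<delta>(2) s, of k] \<delta>(3) by auto
    have "0 \<le> d m ((\<epsilon> \<otimes> \<gamma>) \<otimes> g) \<and> d m ((\<epsilon> \<otimes> \<gamma>) \<otimes> g) < a m" if m: "m \<in> {1..Suc s}" for m
    proof -
      have e: "d m ((\<epsilon> \<otimes> \<gamma>) \<otimes> g) = d m \<epsilon> + d m (\<gamma> \<otimes> g)"
        using d_mult_left[OF \<epsilon>(2), of m "\<gamma> \<otimes> g"] m s by (simp add: m_assoc)
      show ?thesis
      proof (cases "m = Suc s")
        case True
        have "0 \<le> t - real_of_int \<lfloor>t / a (Suc s)\<rfloor> * a (Suc s)"
          "t - real_of_int \<lfloor>t / a (Suc s)\<rfloor> * a (Suc s) < a (Suc s)"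
          using floor_divide_lower[OF a, of t] floor_divide_upper[OF a, of t]
            by (simp_all add: algebra_simps)
        then show ?thesis unfolding e unfolding True \<epsilon>(3) t_def[symmetric] by (simp add: k_def)
      next
        case False
        then have "d m \<epsilon> = 0" using \<epsilon>(2) m by (auto simp: lev_def)
        then show ?thesis using e \<gamma>(2) m False by auto
      qed
    qed
    then show ?case using subgroup.m_closed[OF sub \<epsilon>(1) \<gamma>(1)] by blast
  qed
  from this[of n] show ?thesis by (auto simp: Box_def)
qed

text \<open>The first nonzero coordinate of a lattice element is a nonzero integer multiple of the
  corresponding \<open>a m\<close>. Uniqueness, discreteness and the systole bound all rest on
  this.\<close>

lemma box_group_trivial:
  assumes box: "box_group \<Gamma> a" and \<gamma>: "\<gamma> \<in> \<Gamma>"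
    and small: "\<And>m. m \<in> {1..n} \<Longrightarrow> \<gamma> \<in> lev m \<Longrightarrow> \<bar>d m \<gamma>\<bar> < a m"
  shows "\<gamma> = \<one>"
proof -
  have "s \<le> n \<Longrightarrow> \<gamma> \<in> lev (Suc s)" for s
  proof (induction s)
    case 0
    then show ?case by (simp add: lev_1)
  next
    case (Suc s)
    have s: "Suc s \<in> {1..n}" using Suc by auto
    have lev: "\<gamma> \<in> lev (Suc s)" using Suc by simp
    obtain k :: int where k: "d (Suc s) \<gamma> = real_of_int k * a (Suc s)"
      using box_groupD(3)[OF box s \<gamma> lev] by auto
    have a: "a (Suc s) > 0" using box_groupD(1)[OF box s] .
    have "\<bar>real_of_int k\<bar> * a (Suc s) < 1 * a (Suc s)" using small[OF s lev] a by (simp add: k abs_mult)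
    then have "k = 0" using a by simp
    then show ?case using lev k by (simp add: lev_Suc)
  qed
  then show ?thesis using lev_top by blast
qed

lemma box_group_unique:
  assumes box: "box_group \<Gamma> a" and \<gamma>: "\<gamma> \<in> \<Gamma>" and g: "g \<in> Box a" "\<gamma> \<otimes> g \<in> Box a"
  shows "\<gamma> = \<one>"
proof (rule box_group_trivial[OF box \<gamma>])
  fix m assume m: "m \<in> {1..n}" "\<gamma> \<in> lev m"
  then have "d m (\<gamma> \<otimes> g) = d m \<gamma> + d m g"
    using d_mult_left[of \<gamma> m m g] by auto
  then show "\<bar>d m \<gamma>\<bar> < a m" using g m by (force simp: Box_def)
qed

end

section \<open>Integrality and size of coefficients of products and inverses\<close>

lemma fps_mult_coeff_in:
  fixes f g :: "real fps"
  assumes J0: "\<And>l. 0 \<in> J l" and Jadd: "\<And>l x y. x \<in> J l \<Longrightarrow> y \<in> J l \<Longrightarrow> x + y \<in> J l"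
    and Jmult: "\<And>p q x y. 0 < p \<Longrightarrow> 0 < q \<Longrightarrow> p + q \<le> L \<Longrightarrow> x \<in> J p \<Longrightarrow> y \<in> J q \<Longrightarrow> x * y \<in> J (p + q)"
    and f0: "fps_nth f 0 = 1" and g0: "fps_nth g 0 = 1"
    and f: "\<And>l. l \<in> {1..L} \<Longrightarrow> fps_nth f l \<in> J l" and g: "\<And>l. l \<in> {1..L} \<Longrightarrow> fps_nth g l \<in> J l"
    and l: "l \<in> {1..L}"
  shows "fps_nth (f * g) l \<in> J l"
proof -
  have sum: "(\<Sum>i\<in>I. h i) \<in> J l" if "\<And>i. i \<in> I \<Longrightarrow> h i \<in> J l" for I :: "nat set" and h
    using that by (induction I rule: infinite_finite_induct) (auto intro: J0 Jadd)
  have "fps_nth f i * fps_nth g (l - i) \<in> J l" if i: "i \<in> {0..l}" for i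
  proof -
    consider "i = 0" | "i = l" | "0 < i" "i < l"
      using i by (metis atLeastAtMost_iff le_neq_implies_less neq0_conv)
    then show ?thesis
    proof cases
      case 3
      then have il: "i \<in> {1..L}" "l - i \<in> {1..L}" and li: "i + (l - i) = l" using l by auto
      have "0 < l - i" "i + (l - i) \<le> L" using 3 l by auto
      from Jmult[OF 3(1) this f[OF il(1)] g[OF il(2)]] show ?thesis unfolding li .
    next
      case 1
      then show ?thesis using f0 g[OF l] by simp
    next
      case 2
      then show ?thesis using g0 f[OF l] by simp
    qed
  qed
  then show ?thesis unfolding fps_mult_nth by (rule sum)
qed

lemma fps_inverse_coeff:
  fixes f :: "real fps"
  assumes "fps_nth f 0 = 1" "l > 0"
  shows "fps_nth (inverse f) l = - (\<Sum>i=1..l. fps_nth f i * fps_nth (inverse f) (l - i))"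
proof -
  have "f * inverse f = 1" using assms(1) by (intro inverse_mult_eq_1') simp
  then have "fps_nth (f * inverse f) l = 0" using assms(2) by simp
  moreover have "fps_nth (f * inverse f) l = fps_nth f 0 * fps_nth (inverse f) (l - 0)
      + (\<Sum>i=1..l. fps_nth f i * fps_nth (inverse f) (l - i))"
    unfolding fps_mult_nth One_nat_def by (rule sum.atLeast_Suc_atMost) simp
  ultimately show ?thesis unfolding assms(1) by simp
qed

lemma fps_inverse_coeff_in:
  fixes f :: "real fps"
  assumes J0: "\<And>l. 0 \<in> J l" and Jadd: "\<And>l x y. x \<in> J l \<Longrightarrow> y \<in> J l \<Longrightarrow> x + y \<in> J l"
    and Jneg: "\<And>l x. x \<in> J l \<Longrightarrow> - x \<in> J l"
    and Jmult: "\<And>p q x y. 0 < p \<Longrightarrow> 0 < q \<Longrightarrow> p + q \<le> L \<Longrightarrow> x \<in> J p \<Longrightarrow> y \<in> J q \<Longrightarrow> x * y \<in> J (p + q)"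
    and f0: "fps_nth f 0 = 1" and f: "\<And>l. l \<in> {1..L} \<Longrightarrow> fps_nth f l \<in> J l"
  shows "l \<in> {1..L} \<Longrightarrow> fps_nth (inverse f) l \<in> J l"
proof (induction l rule: less_induct)
  case (less l)
  have sum: "(\<Sum>i\<in>I. h i) \<in> J l" if "\<And>i. i \<in> I \<Longrightarrow> h i \<in> J l" for I :: "nat set" and h
    using that by (induction I rule: infinite_finite_induct) (auto intro: J0 Jadd)
  have "fps_nth f i * fps_nth (inverse f) (l - i) \<in> J l" if i: "i \<in> {1..l}" for i
  proof (cases "i = l")
    case True
    then show ?thesis using f[OF less.prems] f0 by simp
  next
    case False
    then have "0 < i" "0 < l - i" and le: "i + (l - i) \<le> L" and li: "i + (l - i) = l" and "i \<in> {1..L}"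
      using i less.prems by auto
    moreover have "fps_nth (inverse f) (l - i) \<in> J (l - i)"
      by (rule less.IH) (use \<open>0 < l - i\<close> \<open>0 < i\<close> le in auto)
    ultimately have "fps_nth f i * fps_nth (inverse f) (l - i) \<in> J (i + (l - i))"
      using Jmult f by blast
    then show ?thesis unfolding li .
  qed
  then have "- (\<Sum>i=1..l. fps_nth f i * fps_nth (inverse f) (l - i)) \<in> J l" by (intro Jneg sum)
  then show ?case using fps_inverse_coeff[OF f0, of l] less.prems by simp
qed

lemma fps_mult_agree:
  fixes f g f' g' :: "real fps"
  assumes "fps_nth f 0 = 1" "fps_nth g 0 = 1" "fps_nth f' 0 = 1" "fps_nth g' 0 = 1" "l > 0"
    and "\<And>i. i < l \<Longrightarrow> fps_nth f i = fps_nth f' i" and "\<And>i. i < l \<Longrightarrow> fps_nth g i = fps_nth g' i"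
  shows "fps_nth (f * g) l - fps_nth (f' * g') l
     = (fps_nth f l - fps_nth f' l) + (fps_nth g l - fps_nth g' l)"
proof -
  have "fps_nth (f * g) l - fps_nth (f' * g') l =
    (\<Sum>i=0..l. (if i = 0 then fps_nth g l - fps_nth g' l else 0) + (if i = l then fps_nth f l - fps_nth
      f' l else 0))"
    unfolding fps_mult_nth sum_subtractf[symmetric] using assms by (intro sum.cong refl) auto
  then show ?thesis by (simp add: sum.distrib)
qed

text \<open>The first-order difference of \<open>f^(-k)\<close> when \<open>f\<close> changes only
  from degree \<open>l\<close> on. It isolates the linear dependence of \<open>K i x l\<close> on
  \<open>d l x\<close>.\<close>

lemma fps_power_inverse_agree:
  fixes f f' :: "real fps"
  assumes f: "fps_nth f 0 = 1" "fps_nth f' 0 = 1"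
    and agree: "\<And>i. i < l \<Longrightarrow> fps_nth f i = fps_nth f' i"
  shows "0 < j \<Longrightarrow> j \<le> l \<Longrightarrow> fps_nth (inverse f ^ k) j - fps_nth (inverse f' ^ k) j
     = - real k * (fps_nth f j - fps_nth f' j)"
proof -
  have inv: "fps_nth (inverse f) j - fps_nth (inverse f') j = - (fps_nth f j - fps_nth f' j)"
    if "0 < j" "j \<le> l" for j
    using that
  proof (induction j rule: less_induct)
    case (less j)
    have "fps_nth (inverse f) i = fps_nth (inverse f') i" if "i < j" for i
      using less.IH[of i] agree[of i] f that less.prems by (cases "i = 0") auto
    moreover have "fps_nth (f * inverse f) j - fps_nth (f' * inverse f') j = 0"
      using f by (simp add: inverse_mult_eq_1')
    ultimately show ?case
      using fps_mult_agree[of f "inverse f" f' "inverse f'" j] f agree less.prems by simp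
  qed
  show "fps_nth (inverse f ^ k) j - fps_nth (inverse f' ^ k) j
    = - real k * (fps_nth f j - fps_nth f' j)"
    if "0 < j" "j \<le> l" for j
  proof (induction k)
    case (Suc k)
    then have k: "fps_nth (inverse f ^ k) j - fps_nth (inverse f' ^ k) j
      = - real k * (fps_nth f j - fps_nth f' j)" .
    have "fps_nth (inverse f) i = fps_nth (inverse f') i" if "i < j" for i
      using inv[of i] agree[of i] f that \<open>j \<le> l\<close> by (cases "i = 0") auto
    moreover from this have "fps_nth (inverse f ^ m) i = fps_nth (inverse f' ^ m) i" if "i < j" for i m
      using that
    proof (induction m arbitrary: i)
      case (Suc m)
      then show ?case unfolding power_Suc fps_mult_nth by (intro sum.cong refl) auto
    qed simp
    ultimately have "fps_nth (inverse f * inverse f ^ k) j - fps_nth (inverse f' * inverse f' ^ k) j =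
      (fps_nth (inverse f) j - fps_nth (inverse f') j) +
        (fps_nth (inverse f ^ k) j - fps_nth (inverse f' ^ k) j)"
      using f that by (intro fps_mult_agree) (simp_all add: fps_power_zeroth)
    then show ?case using k inv[OF that] by (simp add: algebra_simps)
  qed simp
qed

text \<open>The recursion for the inverse is dominated by
  \<open>\<Sum>i. M * (1 + M) ^ (l - i) = (1 + M) ^ l - 1\<close>, which is where the constant comes
  from.\<close>

lemma fps_inverse_bound:
  fixes f :: "real fps"
  assumes f0: "fps_nth f 0 = 1" and f: "\<And>l. l \<in> {1..L} \<Longrightarrow> \<bar>fps_nth f l\<bar> \<le> M * R ^ l"
    and MR: "M \<ge> 0" "R \<ge> 0"
  shows "l \<le> L \<Longrightarrow> \<bar>fps_nth (inverse f) l\<bar> \<le> (1 + M) ^ l * R ^ l"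
proof (induction l rule: less_induct)
  case (less l)
  show ?case
  proof (cases "l = 0")
    case True
    then show ?thesis using f0 by simp
  next
    case False
    have geo: "(\<Sum>i=1..l. M * (1 + M) ^ (l - i)) = (1 + M) ^ l - 1" for l
    proof (induction l)
      case (Suc l)
      have "(\<Sum>i=1..l. M * (1 + M) ^ (Suc l - i)) = (\<Sum>i=1..l. (1 + M) * (M * (1 + M) ^ (l - i)))"
      proof (rule sum.cong[OF refl])
        fix i assume "i \<in> {1..l}"
        then have "Suc l - i = Suc (l - i)" by auto
        then show "M * (1 + M) ^ (Suc l - i) = (1 + M) * (M * (1 + M) ^ (l - i))"
          by (simp only: power_Suc mult.left_commute)
      qed
      also have "\<dots> = (1 + M) * ((1 + M) ^ l - 1)" unfolding Suc[symmetric] sum_distrib_left ..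
      finally show ?case by (simp add: sum.cl_ivl_Suc algebra_simps)
    qed simp
    have "\<bar>fps_nth (inverse f) l\<bar> \<le> (\<Sum>i=1..l. \<bar>fps_nth f i * fps_nth (inverse f) (l - i)\<bar>)"
      using fps_inverse_coeff[OF f0, of l] False
        sum_abs[of "\<lambda>i. fps_nth f i * fps_nth (inverse f) (l - i)" "{1..l}"]
      by (simp only: abs_minus_cancel neq0_conv)
    also have "\<dots> \<le> (\<Sum>i=1..l. (M * (1 + M) ^ (l - i)) * R ^ l)"
    proof (rule sum_mono)
      fix i assume i: "i \<in> {1..l}"
      have "\<bar>fps_nth f i\<bar> * \<bar>fps_nth (inverse f) (l - i)\<bar> \<le> (M * R ^ i) * ((1
        + M) ^ (l - i) * R ^ (l - i))"
      proof (rule mult_mono)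
        show "\<bar>fps_nth f i\<bar> \<le> M * R ^ i" using f[of i] i less.prems by simp
        show "\<bar>fps_nth (inverse f) (l - i)\<bar> \<le> (1 + M) ^ (l - i) * R ^ (l - i)"
          using less.IH[of "l - i"] i less.prems by simp
      qed (use MR in simp_all)
      also have "\<dots> = (M * (1 + M) ^ (l - i)) * (R ^ i * R ^ (l - i))" by (simp add: ac_simps)
      also have "R ^ i * R ^ (l - i) = R ^ l" using i by (simp flip: power_add)
      finally show "\<bar>fps_nth f i * fps_nth (inverse f) (l - i)\<bar> \<le> (M * (1 + M) ^ (l - i)) * R ^ l"
        by (simp add: abs_mult)
    qed
    also have "\<dots> = ((1 + M) ^ l - 1) * R ^ l" unfolding sum_distrib_right[symmetric] geo ..
    also have "\<dots> \<le> (1 + M) ^ l * R ^ l" using MR by (intro mult_right_mono) auto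
    finally show ?thesis .
  qed
qed

lemma fps_power_bound:
  fixes f :: "real fps"
  assumes f0: "fps_nth f 0 = 1" and f: "\<And>l. l \<le> L \<Longrightarrow> \<bar>fps_nth f l\<bar> \<le> A * R ^ l"
    and AR: "A \<ge> 1" "R \<ge> 0"
  shows "l \<le> L \<Longrightarrow> \<bar>fps_nth (f ^ k) l\<bar> \<le> (real (Suc L) * A) ^ k * R ^ l"
proof (induction k arbitrary: l)
  case 0
  then show ?case using AR by (cases "l = 0") auto
next
  case (Suc k)
  have "\<bar>fps_nth (f * f ^ k) l\<bar> \<le> (\<Sum>i=0..l. \<bar>fps_nth f i * fps_nth (f ^ k) (l - i)\<bar>)"
    unfolding fps_mult_nth by (rule sum_abs)
  also have "\<dots> \<le> (\<Sum>i=0..l. A * (real (Suc L) * A) ^ k * R ^ l)"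
  proof (rule sum_mono)
    fix i assume i: "i \<in> {0..l}"
    have "\<bar>fps_nth f i\<bar> * \<bar>fps_nth (f ^ k) (l - i)\<bar>
      \<le> (A * R ^ i) * ((real (Suc L) * A) ^ k * R ^ (l - i))"
    proof (rule mult_mono)
      show "\<bar>fps_nth f i\<bar> \<le> A * R ^ i" using f[of i] i Suc.prems by simp
      show "\<bar>fps_nth (f ^ k) (l - i)\<bar> \<le> (real (Suc L) * A) ^ k * R ^ (l - i)"
        using Suc.IH[of "l - i"] i Suc.prems by simp
    qed (use AR in simp_all)
    also have "\<dots> = A * (real (Suc L) * A) ^ k * (R ^ i * R ^ (l - i))" by (simp add: ac_simps)
    also have "R ^ i * R ^ (l - i) = R ^ l" using i by (simp flip: power_add)
    finally show "\<bar>fps_nth f i * fps_nth (f ^ k) (l - i)\<bar> \<le> A * (real (Suc L) * A) ^ k * R ^ l"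
      by (simp add: abs_mult)
  qed
  also have "\<dots> = real (Suc l) * (A * (real (Suc L) * A) ^ k * R ^ l)" by simp
  also have "\<dots> \<le> real (Suc L) * (A * (real (Suc L) * A) ^ k * R ^ l)"
    using Suc.prems AR by (intro mult_right_mono) auto
  finally show ?case by (simp add: ac_simps)
qed

lemma discrete_imp_countable:
  fixes S :: "'a::second_countable_topology set"
  assumes "discrete S" shows "countable S"
proof -
  obtain B :: "'a set set" where B: "countable B" "topological_basis B"
    using ex_countable_basis by blast
  have "\<exists>b\<in>B. b \<inter> S = {x}" if "x \<in> S" for x
  proof -
    have "x isolated_in S" using assms that by (simp add: discrete_def)
    then obtain T where T: "open T" "T \<inter> S = {x}" unfolding isolated_in_def by blast
    then obtain b where "b \<in> B" "x \<in> b" "b \<subseteq> T" using topological_basisE[OF B(2)] by blast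
    then show ?thesis using T that by blast
  qed
  then have "\<exists>f. \<forall>x\<in>S. f x \<in> B \<and> f x \<inter> S = {x}" by (intro bchoice) blast
  then obtain f where f: "\<forall>x\<in>S. f x \<in> B \<and> f x \<inter> S = {x}" ..
  have "inj_on f S"
  proof (rule inj_onI)
    fix x y assume "x \<in> S" "y \<in> S" "f x = f y"
    then have "{x} = {y}" using f by blast
    then show "x = y" by simp
  qed
  moreover have "countable (f ` S)" using f by (intro countable_subset[OF _ B(1)]) blast
  ultimately show ?thesis using countable_image_inj_on by blast
qed

context witt_group
begin

lemma tser_nth: "fps_nth (tser c) l = (if l = 0 then 1 else c l)" by (simp add: tser_def)

lemma K_agree:
  assumes "\<And>p. p \<in> {1..<l} \<Longrightarrow> d p x = d p y" "l > 0"
  shows "K i x l - K i y l = - real (i - 1) * (d l x - d l y)"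
  unfolding K_def using fps_power_inverse_agree[of "tser (\<lambda>i. d i x)" "tser (\<lambda>i. d i y)" l l "i - 1"]
    assms
  by (simp add: tser_nth)

text \<open>\<open>J l\<close> collects the admissible values in degree \<open>l\<close>; the
  instance needed is the group of multiples of \<open>b l\<close>, closed under products when
  \<open>b p * b q\<close> is a multiple of \<open>b (p + q)\<close>.\<close>

lemma K_in:
  assumes J0: "\<And>l. 0 \<in> J l" and Jadd: "\<And>l x y. x \<in> J l \<Longrightarrow> y \<in> J l \<Longrightarrow> x + y \<in> J l"
    and Jneg: "\<And>l x. x \<in> J l \<Longrightarrow> - x \<in> J l"
    and Jmult: "\<And>p q x y. 0 < p \<Longrightarrow> 0 < q \<Longrightarrow> p + q \<le> L \<Longrightarrow> x \<in> J p \<Longrightarrow> y \<in> J q \<Longrightarrow> x * y \<in> J (p + q)"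
    and d: "\<And>p. p \<in> {1..L} \<Longrightarrow> d p x \<in> J p" and l: "l \<in> {1..L}"
  shows "K i x l \<in> J l"
proof -
  let ?I = "inverse (tser (\<lambda>i. d i x))"
  have I: "fps_nth ?I l \<in> J l" if "l \<in> {1..L}" for l
    using fps_inverse_coeff_in[of J L "tser (\<lambda>i. d i x)" l] J0 Jadd Jneg Jmult d that
    by (auto simp: tser_nth)
  have I0: "fps_nth ?I 0 = 1" by (simp add: tser_nth)
  have "fps_nth (?I ^ k) l \<in> J l" if "l \<in> {1..L}" for k l
    using that
  proof (induction k arbitrary: l)
    case 0
    then show ?case using J0 by simp
  next
    case (Suc k)
    show ?case unfolding power_Suc
      by (rule fps_mult_coeff_in[of J L ?I])
        (use I I0 Suc J0 Jadd Jmult in \<open>auto simp: fps_power_zeroth\<close>)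
  qed
  then show ?thesis using l by (simp add: K_def)
qed

lemma K_bound:
  assumes "M \<ge> 0"
  obtains C where "C \<ge> 1" "\<And>R x i l. R \<ge> 0 \<Longrightarrow> (\<And>p. p \<in> {1..n} \<Longrightarrow> \<bar>d p x\<bar> \<le> M * R ^ p) \<Longrightarrow>
     i \<le> n \<Longrightarrow> l \<le> n \<Longrightarrow> \<bar>K i x l\<bar> \<le> C * R ^ l"
proof
  define A where "A = (1 + M) ^ n"
  have A: "A \<ge> 1" using assms by (simp add: A_def)
  define C where "C = (real (Suc n) * A) ^ n"
  have nA: "real (Suc n) * A \<ge> 1" using mult_mono[of 1 "real (Suc n)" 1 A] A by simp
  then show "C \<ge> 1" by (simp add: C_def)
  fix R x i l assume R: "(R::real) \<ge> 0" and d: "\<And>p. p \<in> {1..n} \<Longrightarrow> \<bar>d p x\<bar> \<le> M * R ^ p"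
    and il: "i \<le> n" "l \<le> n"
  let ?I = "inverse (tser (\<lambda>i. d i x))"
  have "\<bar>fps_nth ?I l\<bar> \<le> A * R ^ l" if "l \<le> n" for l
  proof -
    have "\<bar>fps_nth ?I l\<bar> \<le> (1 + M) ^ l * R ^ l"
      by (rule fps_inverse_bound[where L = n]) (use d assms R that in \<open>auto simp: tser_nth\<close>)
    also have "\<dots> \<le> A * R ^ l" unfolding A_def using assms R that
      by (intro mult_right_mono power_increasing) auto
    finally show ?thesis .
  qed
  then have "\<bar>K i x l\<bar> \<le> (real (Suc n) * A) ^ (i - 1) * R ^ l"
    unfolding K_def by (intro fps_power_bound[where L = n]) (use A R il in \<open>auto simp: tser_nth\<close>)
  also have "\<dots> \<le> C * R ^ l"
    unfolding C_def using nA R il by (intro mult_right_mono power_increasing) auto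
  finally show "\<bar>K i x l\<bar> \<le> C * R ^ l" .
qed

section \<open>Topology of the group and of its quotients\<close>

lemma continuous_translate: "continuous_on UNIV (\<lambda>x. g \<otimes> x)"
proof -
  have "continuous_on UNIV (\<lambda>x. fst (g, x) \<otimes> snd (g, x))"
    by (rule continuous_on_compose2[OF continuous_mult]) (auto intro!: continuous_intros)
  then show ?thesis by simp
qed

lemma translate_image: "(\<lambda>x. g \<otimes> x) ` A = (\<lambda>x. inv g \<otimes> x) -` A"
proof (intro equalityI subsetI)
  fix x assume "x \<in> (\<lambda>x. inv g \<otimes> x) -` A"
  moreover have "x = g \<otimes> (inv g \<otimes> x)" by (simp add: m_assoc[symmetric])
  ultimately show "x \<in> (\<lambda>x. g \<otimes> x) ` A" by (metis image_eqI vimageD)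
qed (auto simp: m_assoc[symmetric])

lemma open_translate: "open U \<Longrightarrow> open ((\<lambda>x. g \<otimes> x) ` U)"
  unfolding translate_image by (rule open_vimage[OF _ continuous_translate])

lemma borel_translate: "A \<in> sets borel \<Longrightarrow> (\<lambda>x. g \<otimes> x) ` A \<in> sets borel"
  unfolding translate_image
  using measurable_sets[OF borel_measurable_continuous_onI[OF continuous_translate], of A "inv g"]
    by simp

lemma borel_vimage_translate: "A \<in> sets borel \<Longrightarrow> (\<lambda>x. g \<otimes> x) -` A \<in> sets borel"
  using measurable_sets[OF borel_measurable_continuous_onI[OF continuous_translate], of A g] by simp

definition cBox :: "(nat \<Rightarrow> real) \<Rightarrow> 'g set" where
  "cBox a = {x. \<forall>m\<in>{1..n}. \<bar>d m x\<bar> \<le> a m}"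

lemma compact_cBox: "compact (cBox a)"
proof -
  \<comment> \<open>The singleton \<open>{0}\<close> outside \<open>{1..n}\<close> makes Tychonoff's
    theorem applicable to the infinite product on which \<open>mk\<close> is defined.\<close>
  define S where "S m = (if m \<in> {1..n} then {- a m..a m} else {0})" for m
  have "compactin (product_topology (\<lambda>m. euclidean) UNIV) (PiE UNIV S)"
    unfolding compactin_PiE by (auto simp: S_def)
  then have c: "compact (PiE UNIV S)" by (simp add: euclidean_product_topology)
  have "cBox a = mk ` PiE UNIV S"
  proof (intro equalityI subsetI)
    fix x assume x: "x \<in> cBox a"
    have "x = mk (\<lambda>m. if m \<in> {1..n} then d m x else 0)" by (rule d_inj) (simp only: d_mk if_True)
    moreover have "(\<lambda>m. if m \<in> {1..n} then d m x else 0) \<in> PiE UNIV S"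
    proof -
      have "- a m \<le> d m x \<and> d m x \<le> a m" if "m \<in> {1..n}" for m
      proof -
        have "\<bar>d m x\<bar> \<le> a m" using x that by (simp add: cBox_def)
        then show ?thesis by linarith
      qed
      then show ?thesis by (auto simp: S_def)
    qed
    ultimately show "x \<in> mk ` PiE UNIV S" by blast
  next
    fix x assume "x \<in> mk ` PiE UNIV S"
    then obtain c where c: "x = mk c" "\<And>m. c m \<in> S m" by auto
    have "\<bar>d m x\<bar> \<le> a m" if "m \<in> {1..n}" for m
      using c(2)[of m] that unfolding c(1) d_mk[OF that] by (auto simp: S_def)
    then show "x \<in> cBox a" by (simp add: cBox_def)
  qed
  then show ?thesis using compact_continuous_image[OF continuous_on_subset[OF continuous_mk] c] by simp
qed

lemma Box_subset_cBox: "Box a \<subseteq> cBox a" by (auto simp: Box_def cBox_def)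

lemma borel_Box: "Box a \<in> sets borel"
proof -
  have eq: "Box a = (\<Inter>m\<in>{1..n}. d m -` {0..<a m})" by (auto simp: Box_def)
  show ?thesis unfolding eq
  proof (rule sets.finite_INT)
    fix m show "d m -` {0..<a m} \<in> sets borel"
      using measurable_sets[OF borel_measurable_continuous_onI[OF continuous_d], of "{0..<a m}" m]
        by simp
  qed (use n3 in auto)
qed

definition oBox :: "(nat \<Rightarrow> real) \<Rightarrow> 'g set" where
  "oBox a = {x. \<forall>m\<in>{1..n}. \<bar>d m x\<bar> < a m}"

lemma open_oBox: "open (oBox a)"
proof -
  have "oBox a = (\<Inter>m\<in>{1..n}. d m -` {- a m<..<a m})" by (auto simp: oBox_def abs_less_iff)
  then show ?thesis using open_vimage[OF _ continuous_d] by (auto intro!: open_INT)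
qed

lemma box_group_discrete:
  assumes box: "box_group \<Gamma> a" shows "discrete \<Gamma>"
proof -
  have sub: "subgroup \<Gamma> G" using box by (simp add: box_group_def)
  have "\<gamma> isolated_in \<Gamma>" if \<gamma>: "\<gamma> \<in> \<Gamma>" for \<gamma>
  proof -
    have "(\<lambda>x. \<gamma> \<otimes> x) ` oBox a \<inter> \<Gamma> = {\<gamma>}"
    proof (intro equalityI subsetI)
      fix y assume "y \<in> (\<lambda>x. \<gamma> \<otimes> x) ` oBox a \<inter> \<Gamma>"
      then obtain u where u: "u \<in> oBox a" "y = \<gamma> \<otimes> u" "y \<in> \<Gamma>" by blast
      have "u = inv \<gamma> \<otimes> y" unfolding u(2) by (simp add: m_assoc[symmetric])
      then have "u \<in> \<Gamma>" using subgroup.m_closed[OF sub subgroup.m_inv_closed[OF sub \<gamma>] u(3)] by simp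
      then have "u = \<one>" by (rule box_group_trivial[OF box]) (use u in \<open>auto simp: oBox_def\<close>)
      then show "y \<in> {\<gamma>}" using u(2) by simp
    next
      fix y assume "y \<in> {\<gamma>}"
      moreover have "\<one> \<in> oBox a" using d_one box_groupD(1)[OF box] by (simp add: oBox_def)
      then have "\<gamma> \<in> (\<lambda>x. \<gamma> \<otimes> x) ` oBox a" by (intro image_eqI[of _ _ \<one>]) auto
      ultimately show "y \<in> (\<lambda>x. \<gamma> \<otimes> x) ` oBox a \<inter> \<Gamma>" using \<gamma> by blast
    qed
    then show ?thesis unfolding isolated_in_def using \<gamma> open_translate[OF open_oBox] by blast
  qed
  then show ?thesis by (simp add: discrete_def)
qed

lemma box_group_fundamental_domain:
  assumes box: "box_group \<Gamma> a" shows "fundamental_domain G \<Gamma> (Box a)"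
proof -
  have sub: "subgroup \<Gamma> G" using box by (simp add: box_group_def)
  have "\<exists>!\<gamma>. \<gamma> \<in> \<Gamma> \<and> \<gamma> \<otimes> g \<in> Box a" for g
  proof (rule ex_ex1I)
    show "\<exists>\<gamma>. \<gamma> \<in> \<Gamma> \<and> \<gamma> \<otimes> g \<in> Box a" using box_group_reduce[OF box] by blast
    fix \<gamma> \<gamma>' assume 1: "\<gamma> \<in> \<Gamma> \<and> \<gamma> \<otimes> g \<in> Box a" and 2: "\<gamma>' \<in> \<Gamma> \<and> \<gamma>' \<otimes> g \<in> Box a"
    have "(\<gamma>' \<otimes> inv \<gamma>) \<otimes> (\<gamma> \<otimes> g) = \<gamma>' \<otimes> g"
    proof -
      have "inv \<gamma> \<otimes> (\<gamma> \<otimes> g) = g" by (simp add: m_assoc[symmetric])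
      then show ?thesis by (simp add: m_assoc)
    qed
    moreover have "\<gamma>' \<otimes> inv \<gamma> \<in> \<Gamma>" using sub 1 2 by (simp add: subgroup.m_closed subgroup.m_inv_closed)
    ultimately have "\<gamma>' \<otimes> inv \<gamma> = \<one>" using box_group_unique[OF box] 1 2 by metis
    then show "\<gamma> = \<gamma>'" by (metis carrier_UNIV UNIV_I inv_closed inv_equality inv_inv)
  qed
  then show ?thesis by (simp add: fundamental_domain_def borel_Box)
qed

lemma rcosets_eq:
  assumes "subgroup \<Gamma> G" "A \<in> rcosets \<Gamma>" "B \<in> rcosets \<Gamma>" "x \<in> A" "x \<in> B"
  shows "A = B"
proof (rule ccontr)
  assume "A \<noteq> B"
  then have "disjnt A B" using pairwiseD[OF rcos_disjoint[OF assms(1)] assms(2,3)] by blast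
  then show False using assms(4,5) unfolding disjnt_def by blast
qed

lemma istopology_coset:
  assumes sub: "subgroup \<Gamma> G"
  shows "istopology (\<lambda>U. U \<subseteq> rcosets \<Gamma> \<and> open (\<Union>U))"
  unfolding istopology_def
proof (intro conjI allI impI)
  fix S T assume S: "S \<subseteq> rcosets \<Gamma> \<and> open (\<Union>S)" and T: "T \<subseteq> rcosets \<Gamma> \<and> open (\<Union>T)"
  have "\<Union>(S \<inter> T) = \<Union>S \<inter> \<Union>T"
  proof (intro equalityI subsetI)
    fix x assume "x \<in> \<Union>S \<inter> \<Union>T"
    then obtain A B where "A \<in> S" "B \<in> T" "x \<in> A" "x \<in> B" by blast
    moreover from this have "A = B" using rcosets_eq[OF sub, of A B x] S T by blast
    ultimately show "x \<in> \<Union>(S \<inter> T)" by blast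
  qed blast
  then show "S \<inter> T \<subseteq> rcosets \<Gamma>" "open (\<Union>(S \<inter> T))" using S T by auto
next
  fix \<K> assume K: "\<forall>U\<in>\<K>. U \<subseteq> rcosets \<Gamma> \<and> open (\<Union>U)"
  then have "open (\<Union>U\<in>\<K>. \<Union>U)" by (intro open_UN) blast
  moreover have "(\<Union>U\<in>\<K>. \<Union>U) = \<Union>(\<Union>\<K>)" by blast
  ultimately show "\<Union>\<K> \<subseteq> rcosets \<Gamma>" "open (\<Union>(\<Union>\<K>))" using K by auto
qed

lemma openin_coset_topology:
  "subgroup \<Gamma> G \<Longrightarrow> openin (coset_topology G \<Gamma>) U \<longleftrightarrow> U \<subseteq> rcosets \<Gamma> \<and> open (\<Union>U)"
  unfolding coset_topology_def topology_inverse'[OF istopology_coset] ..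

lemma topspace_coset_topology:
  assumes sub: "subgroup \<Gamma> G" shows "topspace (coset_topology G \<Gamma>) = rcosets \<Gamma>"
proof -
  have "\<Union>(rcosets \<Gamma>) = UNIV" using rcosets_part_G[OF sub] by simp
  then have "openin (coset_topology G \<Gamma>) (rcosets \<Gamma>)" using openin_coset_topology[OF sub] by simp
  then show ?thesis using openin_coset_topology[OF sub] openin_subset
    by (metis openin_topspace subset_antisym)
qed

lemma box_group_compact_quotient:
  assumes box: "box_group \<Gamma> a" shows "compact_space (coset_topology G \<Gamma>)"
proof -
  have sub: "subgroup \<Gamma> G" using box by (simp add: box_group_def)
  show ?thesis
    unfolding compact_space_alt topspace_coset_topology[OF sub]
  proof (intro allI impI)
    fix \<U> assume U: "(\<forall>U\<in>\<U>. openin (coset_topology G \<Gamma>) U) \<and> rcosets \<Gamma> \<subseteq> \<Union>\<U>"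
    have "cBox a \<subseteq> (\<Union>U\<in>\<U>. \<Union>U)"
    proof
      fix x
      have "\<Gamma> #> x \<in> rcosets \<Gamma>" unfolding RCOSETS_def by auto
      moreover have "x \<in> \<Gamma> #> x" using sub by (simp add: rcos_self)
      ultimately show "x \<in> (\<Union>U\<in>\<U>. \<Union>U)" using U by blast
    qed
    then obtain C where C: "C \<subseteq> \<U>" "finite C" "cBox a \<subseteq> (\<Union>U\<in>C. \<Union>U)"
      using compactE_image[OF compact_cBox, of \<U> Union a] U openin_coset_topology[OF sub] by metis
    have "rcosets \<Gamma> \<subseteq> \<Union>C"
    proof
      fix Y assume Y: "Y \<in> rcosets \<Gamma>"
      then obtain g where g: "Y = \<Gamma> #> g" by (auto simp: RCOSETS_def)
      obtain \<gamma> where \<gamma>: "\<gamma> \<in> \<Gamma>" "\<gamma> \<otimes> g \<in> Box a" using box_group_reduce[OF box] by blast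
      then obtain U Z where Z: "U \<in> C" "Z \<in> U" "\<gamma> \<otimes> g \<in> Z" using C(3) Box_subset_cBox by blast
      then have "Z \<in> rcosets \<Gamma>" using U C(1) openin_coset_topology[OF sub] by blast
      moreover have "\<gamma> \<otimes> g \<in> Y" unfolding g r_coset_def using \<gamma>(1) by blast
      ultimately have "Z = Y" using rcosets_eq[OF sub _ Y Z(3)] by blast
      then show "Y \<in> \<Union>C" using Z by blast
    qed
    then show "\<exists>\<F>. finite \<F> \<and> \<F> \<subseteq> \<U> \<and> rcosets \<Gamma> \<subseteq> \<Union>\<F>" using C by blast
  qed
qed

text \<open>The images of the increasing open boxes cover the quotient, so by compactness a single
  box meets every coset.\<close>

lemma compact_quotient_imp_bounded:
  assumes sub: "subgroup \<Gamma> G" and comp: "compact_space (coset_topology G \<Gamma>)"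
  obtains R :: real where "\<And>g. \<exists>\<gamma>\<in>\<Gamma>. \<gamma> \<otimes> g \<in> oBox (\<lambda>_. R)"
proof -
  define U where "U k = (\<lambda>g. \<Gamma> #> g) ` oBox (\<lambda>_. real k)" for k :: nat
  have mono: "oBox (\<lambda>_. real j) \<subseteq> oBox (\<lambda>_. real k)" if "j \<le> k" for j k
    using that by (force simp: oBox_def)
  have U_open: "openin (coset_topology G \<Gamma>) (U k)" for k
  proof -
    have "\<Union>(U k) = (\<Union>\<gamma>\<in>\<Gamma>. (\<lambda>x. \<gamma> \<otimes> x) ` oBox (\<lambda>_. real k))"
      unfolding U_def r_coset_def by blast
    then have "open (\<Union>(U k))" using open_translate[OF open_oBox] by auto
    moreover have "U k \<subseteq> rcosets \<Gamma>" by (auto simp: U_def RCOSETS_def)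
    ultimately show ?thesis by (simp add: openin_coset_topology[OF sub])
  qed
  have "rcosets \<Gamma> \<subseteq> \<Union>(range U)"
  proof
    fix Y assume "Y \<in> rcosets \<Gamma>"
    then obtain g where g: "Y = \<Gamma> #> g" by (auto simp: RCOSETS_def)
    obtain k :: nat where "(\<Sum>m\<in>{1..n}. \<bar>d m g\<bar>) < real k" using reals_Archimedean2 by blast
    then have "g \<in> oBox (\<lambda>_. real k)"
      unfolding oBox_def using member_le_sum[of _ "{1..n}" "\<lambda>m. \<bar>d m g\<bar>"] by fastforce
    then show "Y \<in> \<Union>(range U)" unfolding g U_def by blast
  qed
  then obtain F where F: "finite F" "F \<subseteq> range U" "rcosets \<Gamma> \<subseteq> \<Union>F"
    using comp U_open unfolding compact_space_alt topspace_coset_topology[OF sub]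
    by (metis (mono_tags, lifting) rangeE)
  obtain I where I: "finite I" "F = U ` I" using finite_subset_image[OF F(1,2)] by blast
  obtain k where k: "\<forall>i\<in>I. i \<le> k" using I(1) finite_nat_set_iff_bounded_le by blast
  have "\<exists>\<gamma>\<in>\<Gamma>. \<gamma> \<otimes> g \<in> oBox (\<lambda>_. real k)" for g
  proof -
    have "\<Gamma> #> g \<in> rcosets \<Gamma>" unfolding RCOSETS_def by auto
    then obtain i h where "i \<in> I" "h \<in> oBox (\<lambda>_. real i)" "\<Gamma> #> g = \<Gamma> #> h"
      using F(3) I(2) unfolding U_def by blast
    moreover from this have "h \<in> \<Gamma> #> g" using rcos_self[of h \<Gamma>] sub by simp
    ultimately show ?thesis using k mono unfolding r_coset_def by blast
  qed
  then show ?thesis using that by blast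
qed

end

locale witt_haar = witt_group G n d mk for G :: "'g::euclidean_space monoid" (structure) and n d mk +
  fixes \<mu> :: "'g measure"
  assumes haar: "left_haar_measure G \<mu>"
begin

lemma sets_haar: "sets \<mu> = sets borel" using haar by (simp add: left_haar_measure_def)

lemma emeasure_translate: "A \<in> sets borel \<Longrightarrow> emeasure \<mu> ((\<lambda>x. g \<otimes> x) ` A) = emeasure \<mu> A"
  using haar by (auto simp: left_haar_measure_def)

lemma emeasure_compact: "compact C \<Longrightarrow> emeasure \<mu> C < \<infinity>"
  using haar by (auto simp: left_haar_measure_def)

text \<open>Cut \<open>P\<close> into pieces that elements of \<open>\<Gamma>\<close> carry into
  \<open>E\<close>. The moved pieces are disjoint by the packing condition and keep their measure.
  This compares a box with any fundamental domain and also bounds lattice indices.\<close>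

lemma packing_le_covering:
  assumes sub: "subgroup \<Gamma> G" and count: "countable \<Gamma>"
    and P: "P \<in> sets borel" and packing: "\<And>\<gamma> p. \<gamma> \<in> \<Gamma> \<Longrightarrow> p \<in> P \<Longrightarrow> \<gamma> \<otimes> p \<in> P \<Longrightarrow> \<gamma> = \<one>"
    and E: "E \<in> sets borel" and covering: "\<And>g. \<exists>\<gamma>\<in>\<Gamma>. \<gamma> \<otimes> g \<in> E"
  shows "emeasure \<mu> P \<le> emeasure \<mu> E"
proof -
  \<comment> \<open>\<open>\<Gamma>\<close> is enumerated by the possibly finite index set
    \<open>I\<close>; pieces with index outside \<open>I\<close> are empty.\<close>
  define I where "I = to_nat_on \<Gamma> ` \<Gamma>"
  define h where "h = from_nat_into \<Gamma>"
  have h: "h k \<in> \<Gamma>" "to_nat_on \<Gamma> (h k) = k" if "k \<in> I" for k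
    using that count by (auto simp: I_def h_def)
  define A where "A k = (if k \<in> I then P \<inter> (\<lambda>x. h k \<otimes> x) -` E else {})" for k
  define B where "B k = (\<lambda>x. h k \<otimes> x) ` A k" for k
  have A: "A k \<in> sets borel" for k
    unfolding A_def using P borel_vimage_translate[OF E] by auto
  then have B: "B k \<in> sets borel" for k unfolding B_def by (rule borel_translate)
  have "P \<subseteq> (\<Union>k. A k)"
  proof
    fix p assume p: "p \<in> P"
    obtain \<gamma> where \<gamma>: "\<gamma> \<in> \<Gamma>" "\<gamma> \<otimes> p \<in> E" using covering by blast
    then have "to_nat_on \<Gamma> \<gamma> \<in> I" "h (to_nat_on \<Gamma> \<gamma>) = \<gamma>" using count by (auto simp: I_def h_def)
    then have "p \<in> A (to_nat_on \<Gamma> \<gamma>)" using p \<gamma> by (simp add: A_def)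
    then show "p \<in> (\<Union>k. A k)" by blast
  qed
  then have "emeasure \<mu> P \<le> emeasure \<mu> (\<Union>k. A k)"
    using A sets_haar by (intro emeasure_mono) auto
  also have "\<dots> \<le> (\<Sum>k. emeasure \<mu> (A k))"
    using A sets_haar by (intro emeasure_subadditive_countably) auto
  also have "\<dots> = (\<Sum>k. emeasure \<mu> (B k))"
    unfolding B_def using emeasure_translate[OF A] by simp
  also have "\<dots> = emeasure \<mu> (\<Union>k. B k)"
  proof (rule suminf_emeasure)
    show "range B \<subseteq> sets \<mu>" using B sets_haar by auto
    show "disjoint_family B"
      unfolding disjoint_family_on_def
    proof (intro ballI impI)
      fix j k :: nat assume jk: "j \<noteq> k"
      show "B j \<inter> B k = {}"
      proof (rule ccontr)
        assume "B j \<inter> B k \<noteq> {}"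
        then obtain x y where xy: "x \<in> A j" "y \<in> A k" "h j \<otimes> x = h k \<otimes> y" by (auto simp: B_def)
        then have jkI: "j \<in> I" "k \<in> I" and P: "x \<in> P" "y \<in> P" by (auto simp: A_def split: if_splits)
        have "(inv (h j) \<otimes> h k) \<otimes> y = inv (h j) \<otimes> (h j \<otimes> x)" using xy(3) by (simp add: m_assoc)
        also have "\<dots> = x" by (simp add: m_assoc[symmetric])
        finally have "inv (h j) \<otimes> h k = \<one>"
          using packing[of "inv (h j) \<otimes> h k" y] P h(1)[OF jkI(1)] h(1)[OF jkI(2)] sub
          by (simp add: subgroup.m_closed subgroup.m_inv_closed)
        then have "h j \<otimes> (inv (h j) \<otimes> h k) = h j" by simp
        then have "h k = h j" by (simp add: m_assoc[symmetric])
        then show False using h(2)[OF jkI(1)] h(2)[OF jkI(2)] jk by simp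
      qed
    qed
  qed
  also have "\<dots> \<le> emeasure \<mu> E"
  proof (rule emeasure_mono)
    show "(\<Union>k. B k) \<subseteq> E" by (auto simp: B_def A_def split: if_splits)
  qed (simp add: E sets_haar)
  finally show ?thesis .
qed

end

section \<open>Lattices with prescribed leading coordinates\<close>

definition mults :: "real \<Rightarrow> real set" where "mults b = range (\<lambda>k::int. real_of_int k * b)"

lemma multsI: "x = real_of_int k * b \<Longrightarrow> x \<in> mults b" by (auto simp: mults_def)
lemma multsE: "x \<in> mults b \<Longrightarrow> (\<And>k::int. x = real_of_int k * b \<Longrightarrow> P) \<Longrightarrow> P" by (auto simp: mults_def)

lemma mults_0: "0 \<in> mults b" by (rule multsI[of _ 0]) simp
lemma mults_self: "b \<in> mults b" by (rule multsI[of _ 1]) simp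
lemma mults_add: "x \<in> mults b \<Longrightarrow> y \<in> mults b \<Longrightarrow> x + y \<in> mults b"
  by (elim multsE) (rule multsI, simp only: distrib_right[symmetric] of_int_add[symmetric])
lemma mults_neg: "x \<in> mults b \<Longrightarrow> - x \<in> mults b"
  by (elim multsE) (rule multsI, simp only: mult_minus_left[symmetric] of_int_minus[symmetric])
lemma mults_diff: "x \<in> mults b \<Longrightarrow> y \<in> mults b \<Longrightarrow> x - y \<in> mults b"
  using mults_add[OF _ mults_neg] by fastforce
lemma mults_sum: "(\<And>i. i \<in> I \<Longrightarrow> h i \<in> mults b) \<Longrightarrow> (\<Sum>i\<in>I. h i) \<in> mults b"
  by (induction I rule: infinite_finite_induct) (auto simp: mults_0 mults_add)
lemma mults_mult:
  assumes "x \<in> mults b" "y \<in> mults c" "b * c \<in> mults e" shows "x * y \<in> mults e"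
proof -
  obtain j k l :: int where "x = j * b" "y = k * c" "b * c = l * e" using assms
    by (auto simp: mults_def)
  then have "x * y = real_of_int (j * k * l) * e" by (simp add: ac_simps)
  then show ?thesis by (rule multsI)
qed
lemma mults_trans: "x \<in> mults b \<Longrightarrow> b \<in> mults c \<Longrightarrow> x \<in> mults c"
  using mults_mult[of x b 1 1 c] mults_self[of 1] by simp

lemma power_mults: "j \<le> i \<Longrightarrow> real r ^ i \<in> mults (real r ^ j)"
proof -
  assume "j \<le> i"
  then have "real r ^ i = real_of_int (int (r ^ (i - j))) * real r ^ j" by (simp flip: power_add)
  then show ?thesis by (rule multsI)
qed

context witt_group
begin

text \<open>The case \<open>L = n - 1\<close> leaves the top coordinate free, to be governed by
  \<open>\<theta>\<close> when \<open>n\<close> is even.\<close>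

definition lat_low :: "nat \<Rightarrow> (nat \<Rightarrow> real) \<Rightarrow> 'g set" where
  "lat_low L b = {x. \<forall>m\<in>{1..L}. d m x \<in> mults (b m)}"

lemma lat_lowD: "x \<in> lat_low L b \<Longrightarrow> m \<in> {1..L} \<Longrightarrow> d m x \<in> mults (b m)"
  by (simp add: lat_low_def)

lemma K_mults:
  assumes b: "\<And>p q. 0 < p \<Longrightarrow> 0 < q \<Longrightarrow> p + q \<le> L \<Longrightarrow> b p * b q \<in> mults (b (p + q))"
    and x: "x \<in> lat_low L b" and l: "l \<in> {1..L}"
  shows "K i x l \<in> mults (b l)"
  by (rule K_in[where L = L]) (use x l in \<open>auto simp: mults_0 mults_add mults_neg intro: mults_mult b
    lat_lowD\<close>)

lemma mult_term_mults:
  assumes b: "\<And>p q. 0 < p \<Longrightarrow> 0 < q \<Longrightarrow> p + q \<le> L \<Longrightarrow> b p * b q \<in> mults (b (p + q))"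
    and x: "x \<in> lat_low L b" and y: "d i y \<in> mults (b i)" and i: "0 < i" "i < m" "m \<le> L"
  shows "d i y * K i x (m - i) \<in> mults (b m)"
proof -
  have "b i * b (m - i) \<in> mults (b (i + (m - i)))" by (rule b) (use i in auto)
  then have "b i * b (m - i) \<in> mults (b m)" using i by simp
  moreover have "K i x (m - i) \<in> mults (b (m - i))" by (rule K_mults[OF b x]) (use i in auto)
  ultimately show ?thesis using y mults_mult by blast
qed

lemma lat_low_mult:
  assumes b: "\<And>p q. 0 < p \<Longrightarrow> 0 < q \<Longrightarrow> p + q \<le> L \<Longrightarrow> b p * b q \<in> mults (b (p + q))" and L: "L \<le> n"
    and x: "x \<in> lat_low L b" and y: "y \<in> lat_low L b"
  shows "x \<otimes> y \<in> lat_low L b"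
  unfolding lat_low_def
proof safe
  fix m assume m: "m \<in> {1..L}"
  have "(\<Sum>i\<in>{1..<m}. d i y * K i x (m - i)) \<in> mults (b m)"
    by (rule mults_sum, rule mult_term_mults[OF b x lat_lowD[OF y]]) (use m in auto)
  then show "d m (x \<otimes> y) \<in> mults (b m)"
    using d_mult[of m x y] m L lat_lowD[OF x m] lat_lowD[OF y m] by (auto intro: mults_add)
qed

lemma lat_low_inv:
  assumes b: "\<And>p q. 0 < p \<Longrightarrow> 0 < q \<Longrightarrow> p + q \<le> L \<Longrightarrow> b p * b q \<in> mults (b (p + q))" and L: "L \<le> n"
    and x: "x \<in> lat_low L b"
  shows "inv x \<in> lat_low L b"
proof -
  have "m \<in> {1..L} \<Longrightarrow> d m (inv x) \<in> mults (b m)" for m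
  proof (induction m rule: less_induct)
    case (less m)
    have mn: "m \<in> {1..n}" using less.prems L by auto
    have "(\<Sum>i\<in>{1..<m}. d i (inv x) * K i x (m - i)) \<in> mults (b m)"
      by (rule mults_sum, rule mult_term_mults[OF b x less.IH]) (use less.prems in auto)
    moreover have "d m (inv x) = - (d m x + (\<Sum>i\<in>{1..<m}. d i (inv x) * K i x (m - i)))"
      using d_mult[OF mn, of x "inv x"] d_one[OF mn] by simp
    ultimately show ?case using lat_lowD[OF x less.prems] by (simp only:) (intro mults_neg mults_add)
  qed
  then show ?thesis by (simp add: lat_low_def)
qed

lemma box_group_ilat:
  assumes b: "\<And>p q. 0 < p \<Longrightarrow> 0 < q \<Longrightarrow> p + q \<le> n \<Longrightarrow> b p * b q \<in> mults (b (p + q))"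
    and pos: "\<And>m. m \<in> {1..n} \<Longrightarrow> b m > 0"
  shows "box_group (lat_low n b) b"
  unfolding box_group_def
proof (intro conjI ballI)
  show "subgroup (lat_low n b) G"
    by (rule subgroupI)
      (use lat_low_mult[OF b] lat_low_inv[OF b] d_one in \<open>auto simp: lat_low_def mults_0\<close>,
        metis One_nat_def atLeastAtMost_iff mults_0)
  fix m assume m: "m \<in> {1..n}"
  show "b m > 0" by (rule pos[OF m])
  define x where "x = mk (\<lambda>p. if p = m then b m else 0)"
  have dx: "d p x = (if p = m then b m else 0)" if "p \<in> {1..n}" for p unfolding x_def
    by (rule d_mk[OF that])
  have "x \<in> lat_low n b" unfolding lat_low_def using dx mults_0 mults_self by auto
  moreover have "x \<in> lev m" unfolding lev_def using dx m by auto
  moreover have "d m x = b m" using dx[OF m] by simp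
  ultimately show "\<exists>\<gamma>\<in>lat_low n b \<inter> lev m. d m \<gamma> = b m" by blast
  fix \<gamma> assume "\<gamma> \<in> lat_low n b \<inter> lev m"
  then show "\<exists>k::int. d m \<gamma> = real_of_int k * b m" using lat_lowD[of \<gamma> n b m] m
    by (auto simp: mults_def)
qed

definition \<theta> :: "real \<Rightarrow> nat \<Rightarrow> 'g \<Rightarrow> real" where "\<theta> c h x = d n x + c * (d h x)\<^sup>2"

text \<open>For \<open>n = 2 h\<close> the products of two elements of weight \<open>h\<close> violate integrality in the top
  coordinate by the symmetric cocycle \<open>- (h - 1) d h x d h y\<close>, which the quadratic term in \<open>\<theta>\<close>
  compensates.\<close>

definition even_lat :: "nat \<Rightarrow> nat \<Rightarrow> (nat \<Rightarrow> real) \<Rightarrow> 'g set" where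
  "even_lat h r b = lat_low (n - 1) b \<inter> {x. \<theta> (real (h - 1) / 2) h x \<in> mults (b n)}"

text \<open>The optimum of the linear program: the commutator bound at levels \<open>i\<close> and
  \<open>n - i\<close> is met with \<open>i + (n - i - 1) = n - 1\<close>, and the levels from
  \<open>n / 2\<close> on have the values allowed by Minkowski's bound.\<close>

definition expo :: "nat \<Rightarrow> nat" where "expo m = (if 2 * m < n then m else m - 1)"

text \<open>An index from \<open>n / 2\<close> on loses 1, and so does the sum \<open>p + q\<close>.
  Two losses on the left happen only for \<open>p = q = n / 2\<close>, the excluded case.\<close>

lemma expo_mults:
  assumes "0 < p" "0 < q" "p + q \<le> n" "p \<noteq> q \<or> 2 * p \<noteq> n"
  shows "real r ^ expo p * real r ^ expo q \<in> mults (real r ^ expo (p + q))"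
  unfolding power_add[symmetric] by (rule power_mults) (use assms in \<open>auto simp: expo_def\<close>)

text \<open>All coordinates below \<open>h\<close> are divisible by \<open>r ^ i\<close>, so the
  mixed part \<open>e\<close> of \<open>d h (x \<otimes> y)\<close> is divisible by
  \<open>r ^ h\<close>, a factor \<open>r\<close> better than \<open>d h\<close> itself. After
  \<open>\<theta>\<close> has removed \<open>- (h - 1) * d h x * d h y\<close>, each remaining term
  at level \<open>h\<close> contains such a better factor.\<close>

lemma theta_mult:
  assumes n: "2 * h = n" and h: "h \<ge> 2" and r: "r = 2 * s"
    and b_def: "b = (\<lambda>m. real r ^ expo m)"
    and x: "x \<in> lat_low (n - 1) b" and y: "y \<in> lat_low (n - 1) b"
  shows "\<theta> (real (h - 1) / 2) h (x \<otimes> y) - \<theta> (real (h - 1) / 2) h x - \<theta> (real (h - 1) / 2) h y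
    \<in> mults (b n)"
proof -
  define c where "c = real (h - 1) / 2"
  have b: "b p * b q \<in> mults (b (p + q))" if "0 < p" "0 < q" "p + q \<le> n - 1" for p q
    unfolding b_def by (rule expo_mults) (use that n h in auto)
  have expo: "expo n = 2 * h - 1" "expo h = h - 1" using n h by (simp_all add: expo_def)
  have expo_less: "expo i = i" if "i < h" for i using n that by (simp add: expo_def)
  have bn: "b n = real r ^ (2 * h - 1)" and bh: "b h = real r ^ (h - 1)" unfolding b_def expo
    by simp_all
  have hn: "h \<le> n - 1" "h < n" "h \<le> n" using n h by linarith+
  have K: "K i x l \<in> mults (b l)" if "l \<in> {1..n - 1}" for i l by (rule K_mults[OF b x that])
  have dh: "d h x \<in> mults (real r ^ (h - 1))" "d h y \<in> mults (real r ^ (h - 1))"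
    using lat_lowD[OF x, of h] lat_lowD[OF y, of h] hn h unfolding bh by auto
  define e where "e = (\<Sum>i\<in>{1..<h}. d i y * K i x (h - i))"
  have e: "e \<in> mults (real r ^ h)"
    unfolding e_def
  proof (rule mults_sum)
    fix i assume i: "i \<in> {1..<h}"
    have f1: "d i y \<in> mults (real r ^ i)" using lat_lowD[OF y, of i] i hn expo_less[of i]
      by (simp add: b_def)
    have "h - i \<in> {1..n - 1}" using i hn by auto
    then have f2: "K i x (h - i) \<in> mults (real r ^ (h - i))"
      using K[of "h - i" i] i expo_less[of "h - i"] by (simp add: b_def)
    have f3: "real r ^ i * real r ^ (h - i) = real r ^ h" using i by (simp flip: power_add)
    show "d i y * K i x (h - i) \<in> mults (real r ^ h)"
      by (rule mults_mult[OF f1 f2]) (simp only: f3 mults_self)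
  qed
  have dhxy: "d h (x \<otimes> y) = d h x + d h y + e" unfolding e_def using hn h by (intro d_mult) simp
  \<comment> \<open>Deleting the coordinates from \<open>h\<close> on leaves a point to which the
    finer divisibility by \<open>r ^ p\<close> applies; \<open>K h x h\<close> differs from
    \<open>K h x' h\<close> only by its linear term.\<close>
  define x' where "x' = mk (\<lambda>p. if p < h then d p x else 0)"
  have dx': "d p x' = (if p < h then d p x else 0)" if "p \<in> {1..n}" for p unfolding x'_def
    by (rule d_mk[OF that])
  have "K h x' h \<in> mults (real r ^ h)"
  proof (rule K_mults[where L = h and b = "\<lambda>p. real r ^ p"])
    show "x' \<in> lat_low h (\<lambda>p. real r ^ p)"
      unfolding lat_low_def
    proof safe
      fix p assume p: "p \<in> {1..h}"
      then have "p \<in> {1..n}" using hn by simp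
      then show "d p x' \<in> mults (real r ^ p)"
        using dx'[of p] lat_lowD[OF x, of p] p hn expo_less[of p]
        by (cases "p < h") (simp_all add: b_def mults_0)
    qed
  qed (use h in \<open>auto simp: power_add mults_self\<close>)
  moreover have "K h x h - K h x' h = - real (h - 1) * (d h x - d h x')"
    by (rule K_agree) (use dx' hn h in simp_all)
  moreover have "d h x' = 0" using dx'[of h] hn h by simp
  ultimately have Kh: "K h x h + real (h - 1) * d h x \<in> mults (real r ^ h)" by (simp add: algebra_simps)
  have split: "(\<Sum>i\<in>{1..<n}. d i y * K i x (n - i)) = (\<Sum>i\<in>{1..<n} - {h}. d i y * K i x (n - i))
    + d h y * K h x h"
  proof -
    have "n - h = h" using n by linarith
    then show ?thesis using hn h by (subst sum.remove[of _ h]) simp_all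
  qed
  have rest: "(\<Sum>i\<in>{1..<n} - {h}. d i y * K i x (n - i)) \<in> mults (b n)"
  proof (rule mults_sum)
    fix i assume i: "i \<in> {1..<n} - {h}"
    have "b i * b (n - i) \<in> mults (b (i + (n - i)))" unfolding b_def
      by (rule expo_mults) (use i in auto, use n in linarith)
    then have "b i * b (n - i) \<in> mults (b n)" using i by simp
    moreover have "d i y \<in> mults (b i)" using lat_lowD[OF y, of i] i by auto
    moreover have "n - i \<in> {1..n - 1}" using i by auto
    then have "K i x (n - i) \<in> mults (b (n - i))" by (rule K)
    ultimately show "d i y * K i x (n - i) \<in> mults (b n)" using mults_mult by blast
  qed
  have hh: "real r ^ (h - 1) * real r ^ h = b n" unfolding bn power_add[symmetric] using h
    by (auto intro: arg_cong[where f = "\<lambda>k. real r ^ k"])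
  have t2: "d h y * (K h x h + real (h - 1) * d h x) \<in> mults (b n)"
    using mults_mult[OF dh(2) Kh] hh mults_self by metis
  have t3: "real (h - 1) * (d h x + d h y) * e \<in> mults (b n)"
  proof -
    have 1: "real (h - 1) \<in> mults 1" by (rule multsI[of _ "int (h - 1)"]) simp
    have "real (h - 1) * (d h x + d h y) \<in> mults (real r ^ (h - 1))"
      by (rule mults_mult[OF 1 mults_add[OF dh]]) (simp add: mults_self)
    then show ?thesis using mults_mult[OF _ e] hh mults_self by metis
  qed
  \<comment> \<open>Here \<open>r = 2 * s\<close> is used: \<open>e\<close> squared has one more
    factor \<open>r\<close> than \<open>b n\<close>, and this absorbs the denominator 2 of
    \<open>c\<close>.\<close>
  have t4: "c * e\<^sup>2 \<in> mults (b n)"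
  proof -
    obtain k :: int where k: "e = real_of_int k * real r ^ h" using e by (rule multsE)
    have "real r ^ h * real r ^ h = real r * b n" unfolding bn power_add[symmetric] power_Suc[symmetric]
      using h by (auto intro: arg_cong[where f = "\<lambda>k. real r ^ k"])
    then have "c * e\<^sup>2 = c * (real_of_int k)\<^sup>2 * (real r * b n)"
      by (simp add: k power2_eq_square ac_simps)
    also have "\<dots> = real_of_int (int (h - 1) * k\<^sup>2 * int s) * b n" by (simp add: c_def r)
    finally show ?thesis by (rule multsI)
  qed
  have "d n (x \<otimes> y) = d n x + d n y + (\<Sum>i\<in>{1..<n}. d i y * K i x (n - i))" using n3
    by (intro d_mult) simp
  then have "\<theta> c h (x \<otimes> y) - \<theta> c h x - \<theta> c h y =
      (\<Sum>i\<in>{1..<n} - {h}. d i y * K i x (n - i)) + d h y * (K h x h + real (h - 1) * d h x)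
      + real (h - 1) * (d h x + d h y) * e + c * e\<^sup>2"
    unfolding \<theta>_def split dhxy by (simp add: c_def power2_eq_square field_simps)
  moreover have "\<dots> \<in> mults (b n)" by (intro mults_add rest t2 t3 t4)
  ultimately show ?thesis by (simp add: c_def)
qed

lemma box_group_even_lat:
  assumes n: "2 * h = n" and h: "h \<ge> 2" and r: "r = 2 * s" "s > 0"
    and b_def: "b = (\<lambda>m. real r ^ expo m)"
  shows "box_group (even_lat h r b) b"
proof -
  define c where "c = real (h - 1) / 2"
  have b: "b p * b q \<in> mults (b (p + q))" if "0 < p" "0 < q" "p + q \<le> n - 1" for p q
    unfolding b_def by (rule expo_mults) (use that n h in auto)
  have ev: "even_lat h r b = lat_low (n - 1) b \<inter> {x. \<theta> c h x \<in> mults (b n)}"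
    by (simp add: even_lat_def c_def)
  have hn: "h \<in> {1..n}" "n \<in> {1..n}" "n - 1 \<le> n"
  proof -
    have "1 \<le> h" "h \<le> n" "1 \<le> n" using n h by linarith+
    then show "h \<in> {1..n}" "n \<in> {1..n}" "n - 1 \<le> n" by simp_all
  qed
  note th = theta_mult[OF n h r(1) b_def, folded c_def]
  have th1: "\<theta> c h \<one> = 0" using d_one hn by (simp add: \<theta>_def)
  show ?thesis
    unfolding box_group_def
  proof (intro conjI ballI)
    show "subgroup (even_lat h r b) G"
    proof (rule subgroupI)
      have "\<one> \<in> even_lat h r b" unfolding ev lat_low_def using d_one th1 mults_0 by auto
      then show "even_lat h r b \<noteq> {}" by blast
      fix x assume x: "x \<in> even_lat h r b"
      have y: "inv x \<in> lat_low (n - 1) b" using x lat_low_inv[OF b] hn by (auto simp: ev)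
      have "\<theta> c h \<one> - \<theta> c h x - \<theta> c h (inv x) \<in> mults (b n)" using th[of x "inv x"] x y
        by (simp add: ev)
      then have "- (\<theta> c h \<one> - \<theta> c h x - \<theta> c h (inv x)) - \<theta> c h x \<in> mults (b n)"
        by (rule mults_diff[OF mults_neg]) (use x in \<open>simp add: ev\<close>)
      then show "inv x \<in> even_lat h r b" using y th1 by (simp add: ev)
      fix y assume y: "y \<in> even_lat h r b"
      have "x \<otimes> y \<in> lat_low (n - 1) b" using x y lat_low_mult[OF b] hn by (auto simp: ev)
      moreover have "(\<theta> c h (x \<otimes> y) - \<theta> c h x - \<theta> c h y) + \<theta> c h x + \<theta> c h y \<in> mults (b n)"
        using th[of x y] x y by (intro mults_add) (auto simp: ev)
      ultimately show "x \<otimes> y \<in> even_lat h r b" by (simp add: ev)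
    qed simp
    fix m assume m: "m \<in> {1..n}"
    show "b m > 0" using r by (simp add: b_def)
    \<comment> \<open>At level \<open>h\<close> the top coordinate is chosen so that
      \<open>\<theta>\<close> vanishes in spite of the quadratic term.\<close>
    define x where "x = mk (\<lambda>p. if p = m then b m else if p = n \<and> m = h then - c * (b h)\<^sup>2 else 0)"
    have dx: "d p x = (if p = m then b m else if p = n \<and> m = h then - c * (b h)\<^sup>2 else 0)"
      if "p \<in> {1..n}" for p
      unfolding x_def by (rule d_mk[OF that])
    have "h \<noteq> n" using n h by linarith
    then have "\<theta> c h x \<in> mults (b n)"
      unfolding \<theta>_def using dx[OF hn(1)] dx[OF hn(2)] mults_self mults_0 by auto
    moreover have "d p x \<in> mults (b p)" if "p \<in> {1..n - 1}" for p
    proof -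
      have "p \<in> {1..n}" "p \<noteq> n" using that n3 by auto
      then show ?thesis using dx[of p] mults_0 mults_self by simp
    qed
    ultimately have "x \<in> even_lat h r b" unfolding ev lat_low_def by blast
    moreover have "x \<in> lev m" unfolding lev_def using dx m by auto
    moreover have "d m x = b m" using dx[OF m] by simp
    ultimately show "\<exists>\<gamma>\<in>even_lat h r b \<inter> lev m. d m \<gamma> = b m" by blast
    fix \<gamma> assume g: "\<gamma> \<in> even_lat h r b \<inter> lev m"
    have "d m \<gamma> \<in> mults (b m)"
    proof (cases "m = n")
      case True
      then have "d h \<gamma> = 0" using g \<open>h \<noteq> n\<close> hn by (auto simp: lev_def)
      then show ?thesis using g True by (simp add: ev \<theta>_def)
    next
      case False
      then show ?thesis using g m lat_lowD[of \<gamma> "n - 1" b m] by (auto simp: ev)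
    qed
    then show "\<exists>k::int. d m \<gamma> = real_of_int k * b m" by (auto simp: mults_def)
  qed
qed

text \<open>Needed to compare volumes with the unit lattice. As \<open>h \<ge> 2\<close>, the
  coordinate \<open>d h x\<close> is divisible by the even number \<open>r\<close>, so the quadratic
  term in \<open>\<theta>\<close> is an integer.\<close>

lemma even_lat_subset:
  assumes n: "2 * h = n" and h: "h \<ge> 2" and r: "r = 2 * s"
    and b_def: "b = (\<lambda>m. real r ^ expo m)"
  shows "even_lat h r b \<subseteq> lat_low n (\<lambda>_. 1)"
proof
  fix x assume x: "x \<in> even_lat h r b"
  have one: "b m \<in> mults 1" for m unfolding b_def using power_mults[of 0 "expo m" r] by simp
  have low: "d m x \<in> mults 1" if "m \<in> {1..n - 1}" for m
    using x lat_lowD[of x "n - 1" b m] that mults_trans[OF _ one] by (auto simp: even_lat_def)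
  obtain k :: int where k: "d h x = real_of_int k * b h"
  proof -
    have "1 \<le> h" "h \<le> n - 1" using n h by linarith+
    then have "h \<in> {1..n - 1}" by simp
    then have "d h x \<in> mults (b h)" using x lat_lowD[of x "n - 1" b h] by (simp add: even_lat_def)
    then show thesis using that by (auto simp: mults_def)
  qed
  obtain j where j: "h = Suc (Suc j)" using h by (metis Suc_le_D numeral_2_eq_2 Suc_le_mono)
  have "expo h = h - 1" using n by (simp add: expo_def)
  then have "b h = real r ^ Suc j" using j by (simp add: b_def)
  then have "real (h - 1) / 2 * (d h x)\<^sup>2
    = real_of_int (int (h - 1) * k\<^sup>2 * int s * int (r ^ j) * int (r ^ Suc j)) * 1"
    by (simp add: k r power2_eq_square)
  then have "real (h - 1) / 2 * (d h x)\<^sup>2 \<in> mults 1" by (rule multsI)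
  moreover have "d n x + real (h - 1) / 2 * (d h x)\<^sup>2 \<in> mults 1"
    using x mults_trans[OF _ one] by (auto simp: even_lat_def \<theta>_def)
  ultimately have "(d n x + real (h - 1) / 2 * (d h x)\<^sup>2) - real (h - 1) / 2 * (d h x)\<^sup>2 \<in> mults 1"
    by (intro mults_diff)
  then have "d n x \<in> mults 1" by simp
  moreover have "m = n \<or> m \<in> {1..n - 1}" if "m \<in> {1..n}" for m using that by auto
  ultimately show "x \<in> lat_low n (\<lambda>_. 1)" unfolding lat_low_def using low by blast
qed

end

lemma card_int_interval:
  fixes u v :: real
  shows "v - u - 1 \<le> real (card {k::int. u \<le> real_of_int k \<and> real_of_int k < v})"
    and "finite {k::int. u \<le> real_of_int k \<and> real_of_int k < v}"
proof -
  have eq: "{k::int. u \<le> real_of_int k \<and> real_of_int k < v} = {\<lceil>u\<rceil>..<\<lceil>v\<rceil>}"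
    by (auto simp: ceiling_le_iff less_ceiling_iff)
  show "finite {k::int. u \<le> real_of_int k \<and> real_of_int k < v}" unfolding eq by simp
  have "v - u - 1 \<le> real_of_int (\<lceil>v\<rceil> - \<lceil>u\<rceil>)" by linarith
  also have "\<dots> \<le> real (nat (\<lceil>v\<rceil> - \<lceil>u\<rceil>))" by linarith
  finally show "v - u - 1 \<le> real (card {k::int. u \<le> real_of_int k \<and> real_of_int k < v})" unfolding eq
    by simp
qed

context witt_haar
begin

text \<open>The points of the larger lattice in \<open>Box a\<close> number at most the product of
  the \<open>k m\<close>, and the translates of \<open>Box b\<close> by them meet every coset of
  \<open>\<Gamma>\<close>.\<close>

lemma emeasure_Box_le_index:
  assumes \<Gamma>: "box_group \<Gamma> a" and \<Lambda>: "box_group (lat_low n b) b" and sub: "\<Gamma> \<subseteq> lat_low n b"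
    and k: "\<And>m. m \<in> {1..n} \<Longrightarrow> a m = real (k m) * b m"
  shows "emeasure \<mu> (Box a) \<le> of_nat (\<Prod>m\<in>{1..n}. k m) * emeasure \<mu> (Box b)"
proof -
  define T where "T = lat_low n b \<inter> Box a"
  define f where "f t = (\<lambda>m\<in>{1..n}. nat \<lfloor>d m t / b m\<rfloor>)" for t
  have fT: "f t \<in> PiE {1..n} (\<lambda>m. {..<k m})" and df: "\<forall>m\<in>{1..n}. d m t = real (f t m) * b m"
    if t: "t \<in> T" for t
  proof -
    have 1: "nat \<lfloor>d m t / b m\<rfloor> < k m \<and> d m t = real (nat \<lfloor>d m t / b m\<rfloor>) * b m" if m: "m \<in> {1..n}" for m
    proof -
      have bm: "b m > 0" using box_groupD(1)[OF \<Lambda> m] .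
      obtain j :: int where j: "d m t = real_of_int j * b m" using t m lat_lowD[of t n b m]
        by (auto simp: T_def mults_def)
      have "0 \<le> d m t" "d m t < a m" using t m by (auto simp: T_def Box_def)
      then have "0 \<le> d m t" "d m t < real (k m) * b m" unfolding k[OF m] by auto
      then have "0 \<le> real_of_int j" "real_of_int j < real (k m)" using bm unfolding j
        by (simp_all add: zero_le_mult_iff)
      moreover have "d m t / b m = real_of_int j" using bm j by simp
      ultimately show ?thesis using j by simp
    qed
    show "f t \<in> PiE {1..n} (\<lambda>m. {..<k m})" using 1 by (auto simp: f_def)
    show "\<forall>m\<in>{1..n}. d m t = real (f t m) * b m" using 1 by (simp add: f_def)
  qed
  have inj: "inj_on f T"
  proof (rule inj_onI)
    fix s t assume "s \<in> T" "t \<in> T" "f s = f t"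
    then show "s = t" using df[of s] df[of t] by (intro d_inj) simp
  qed
  have fin: "finite (PiE {1..n} (\<lambda>m. {..<k m}))" by (rule finite_PiE) auto
  have finT: "finite T" using inj_on_finite[OF inj _ fin] fT by blast
  have "card T \<le> card (PiE {1..n} (\<lambda>m. {..<k m}))" using card_inj_on_le[OF inj _ fin] fT by blast
  also have "\<dots> = (\<Prod>m\<in>{1..n}. k m)" by (simp add: card_PiE)
  finally have card: "card T \<le> (\<Prod>m\<in>{1..n}. k m)" .
  have "emeasure \<mu> (Box a) \<le> emeasure \<mu> (\<Union>t\<in>T. (\<lambda>x. t \<otimes> x) ` Box b)"
  proof (rule packing_le_covering)
    show "subgroup \<Gamma> G" using \<Gamma> by (simp add: box_group_def)
    show "countable \<Gamma>" by (rule discrete_imp_countable[OF box_group_discrete[OF \<Gamma>]])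
    show "\<gamma> = \<one>" if "\<gamma> \<in> \<Gamma>" "p \<in> Box a" "\<gamma> \<otimes> p \<in> Box a" for \<gamma> p
      by (rule box_group_unique[OF \<Gamma> that])
    show "(\<Union>t\<in>T. (\<lambda>x. t \<otimes> x) ` Box b) \<in> sets borel" using finT
      by (intro sets.finite_UN borel_translate borel_Box)
    fix g
    obtain l where l: "l \<in> lat_low n b" "l \<otimes> g \<in> Box b" using box_group_reduce[OF \<Lambda>] by blast
    obtain \<gamma> where \<gamma>: "\<gamma> \<in> \<Gamma>" "\<gamma> \<otimes> inv l \<in> Box a" using box_group_reduce[OF \<Gamma>] by blast
    have "subgroup (lat_low n b) G" using \<Lambda> by (simp add: box_group_def)
    then have "\<gamma> \<otimes> inv l \<in> lat_low n b" using l(1) \<gamma>(1) sub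
      by (auto intro: subgroup.m_closed subgroup.m_inv_closed)
    then have "\<gamma> \<otimes> inv l \<in> T" using \<gamma> by (simp add: T_def)
    moreover have "\<gamma> \<otimes> g = (\<gamma> \<otimes> inv l) \<otimes> (l \<otimes> g)"
    proof -
      have "inv l \<otimes> (l \<otimes> g) = g" by (simp add: m_assoc[symmetric])
      then show ?thesis by (simp add: m_assoc)
    qed
    ultimately show "\<exists>\<gamma>\<in>\<Gamma>. \<gamma> \<otimes> g \<in> (\<Union>t\<in>T. (\<lambda>x. t \<otimes> x) ` Box b)" using \<gamma>(1) l(2) by blast
  qed (rule borel_Box)
  also have "\<dots> \<le> (\<Sum>t\<in>T. emeasure \<mu> ((\<lambda>x. t \<otimes> x) ` Box b))"
    using borel_translate[OF borel_Box] sets_haar by (intro emeasure_subadditive_finite finT) auto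
  also have "\<dots> = of_nat (card T) * emeasure \<mu> (Box b)" by (simp add: emeasure_translate[OF borel_Box])
  also have "\<dots> \<le> of_nat (\<Prod>m\<in>{1..n}. k m) * emeasure \<mu> (Box b)"
    using card by (intro mult_right_mono) (simp_all only: of_nat_le_iff zero_le)
  finally show ?thesis .
qed

lemma box_group_unit: "box_group (lat_low n (\<lambda>_. 1)) (\<lambda>_. 1)"
  by (rule box_group_ilat) (simp_all add: mults_self)

lemma emeasure_Box_finite: "emeasure \<mu> (Box a) < \<infinity>"
proof -
  have "emeasure \<mu> (Box a) \<le> emeasure \<mu> (cBox a)"
    using borel_compact[OF compact_cBox] sets_haar by (intro emeasure_mono Box_subset_cBox) auto
  then show ?thesis using emeasure_compact[OF compact_cBox, of a] by (rule le_less_trans)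
qed

lemma emeasure_unit_Box_pos: "emeasure \<mu> (Box (\<lambda>_. 1)) > 0"
proof (rule ccontr)
  assume "\<not> emeasure \<mu> (Box (\<lambda>_. 1)) > 0"
  then have 0: "emeasure \<mu> (Box (\<lambda>_. 1)) = 0" by simp
  let ?L = "lat_low n (\<lambda>_. 1)"
  have count: "countable ?L" by (rule discrete_imp_countable[OF box_group_discrete[OF box_group_unit]])
  have "(\<Union>l\<in>?L. (\<lambda>x. inv l \<otimes> x) ` Box (\<lambda>_. 1)) \<in> null_sets \<mu>"
    using 0 count by (intro null_sets_UN')
      (auto simp: null_sets_def emeasure_translate[OF borel_Box] borel_translate[OF borel_Box]
      sets_haar)
  moreover have "(\<Union>l\<in>?L. (\<lambda>x. inv l \<otimes> x) ` Box (\<lambda>_. 1)) = UNIV"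
  proof -
    have "g \<in> (\<Union>l\<in>?L. (\<lambda>x. inv l \<otimes> x) ` Box (\<lambda>_. 1))" for g
    proof -
      obtain l where l: "l \<in> ?L" "l \<otimes> g \<in> Box (\<lambda>_. 1)" using box_group_reduce[OF box_group_unit]
        by blast
      have "g = inv l \<otimes> (l \<otimes> g)" by (simp add: m_assoc[symmetric])
      with l show ?thesis by blast
    qed
    then show ?thesis by blast
  qed
  ultimately have "emeasure \<mu> UNIV = 0" by (simp add: null_sets_def)
  then show False using haar by (simp add: left_haar_measure_def)
qed

lemma emeasure_translates_disjoint:
  assumes \<Lambda>: "box_group \<Lambda> b" and X: "finite X" "X \<subseteq> \<Lambda>"
  shows "emeasure \<mu> (\<Union>x\<in>X. (\<lambda>y. x \<otimes> y) ` Box b) = of_nat (card X) * emeasure \<mu> (Box b)"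
proof -
  have "disjoint_family_on (\<lambda>x. (\<lambda>y. x \<otimes> y) ` Box b) X"
    unfolding disjoint_family_on_def
  proof (intro ballI impI)
    fix x y assume xy: "x \<in> X" "y \<in> X" "x \<noteq> y"
    show "(\<lambda>z. x \<otimes> z) ` Box b \<inter> (\<lambda>z. y \<otimes> z) ` Box b = {}"
    proof (rule ccontr)
      assume "(\<lambda>z. x \<otimes> z) ` Box b \<inter> (\<lambda>z. y \<otimes> z) ` Box b \<noteq> {}"
      then obtain u v where uv: "u \<in> Box b" "v \<in> Box b" "x \<otimes> u = y \<otimes> v" by auto
      have "(inv x \<otimes> y) \<otimes> v = inv x \<otimes> (x \<otimes> u)" using uv(3) by (simp add: m_assoc)
      also have "\<dots> = u" by (simp add: m_assoc[symmetric])
      finally have "(inv x \<otimes> y) \<otimes> v \<in> Box b" using uv by simp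
      moreover have "subgroup \<Lambda> G" using \<Lambda> by (simp add: box_group_def)
      then have "inv x \<otimes> y \<in> \<Lambda>" using xy X by (auto intro: subgroup.m_closed subgroup.m_inv_closed)
      ultimately have "inv x \<otimes> y = \<one>" using box_group_unique[OF \<Lambda>] uv by blast
      then have "x \<otimes> (inv x \<otimes> y) = x" by simp
      then have "y = x" by (simp add: m_assoc[symmetric])
      then show False using xy by simp
    qed
  qed
  then have "emeasure \<mu> (\<Union>x\<in>X. (\<lambda>y. x \<otimes> y) ` Box b) = (\<Sum>x\<in>X. emeasure \<mu> ((\<lambda>y. x \<otimes> y) ` Box b))"
    using X borel_translate[OF borel_Box] sets_haar by (intro sum_emeasure[symmetric]) auto
  then show ?thesis by (simp add: emeasure_translate[OF borel_Box])
qed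

text \<open>The box is filled with translates of a fine box \<open>Box (N^(-m))\<close> by elements of a fine lattice.\<close>

lemma emeasure_Box_ge:
  assumes a: "\<And>m. m \<in> {1..n} \<Longrightarrow> a m > 0"
  shows "ennreal (\<Prod>m\<in>{1..n}. a m / 4) * emeasure \<mu> (Box (\<lambda>_. 1)) \<le> emeasure \<mu> (Box a)"
proof -
  define M where "M = (\<Sum>m\<in>{1..n}. a m)"
  have M0: "M \<ge> 0" unfolding M_def using a by (intro sum_nonneg) (auto intro: less_imp_le)
  have aM: "a m \<le> M" if "m \<in> {1..n}" for m
    unfolding M_def using that a by (intro member_le_sum) (auto intro: less_imp_le)
  obtain C where C: "C \<ge> 1" "\<And>R x i l. R \<ge> 0 \<Longrightarrow> (\<And>p. p \<in> {1..n} \<Longrightarrow> \<bar>d p x\<bar> \<le> M * R ^ p) \<Longrightarrow>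
     i \<le> n \<Longrightarrow> l \<le> n \<Longrightarrow> \<bar>K i x l\<bar> \<le> C * R ^ l" using K_bound[OF M0] by blast
  define \<alpha> where "\<alpha> = Min (a ` {1..n})"
  have \<alpha>: "\<alpha> > 0" "\<And>m. m \<in> {1..n} \<Longrightarrow> \<alpha> \<le> a m"
    unfolding \<alpha>_def using a n3 by (auto simp: Min_gr_iff)
  \<comment> \<open>\<open>N\<close> makes two things hold: multiplication by the fine box moves
    coordinates by at most \<open>\<alpha> / 4\<close>, and \<open>a m * N ^ m \<ge> 4\<close>, so
    an interval of length \<open>a m * N ^ m / 2\<close> keeps half of that number of
    integers.\<close>
  obtain N :: nat where N: "4 * (1 + real n * C) / \<alpha> + 4 / \<alpha> + 1 < real N" using reals_Archimedean2
    by blast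
  have pos: "4 * (1 + real n * C) / \<alpha> \<ge> 0" "4 / \<alpha> \<ge> 0" using \<alpha>(1) C(1) by auto
  have N1: "real N \<ge> 1" "N > 0" using N pos by linarith+
  have N2: "(1 + real n * C) / real N \<le> \<alpha> / 4"
  proof -
    have "4 * (1 + real n * C) / \<alpha> \<le> real N" using N pos by linarith
    then have "4 * (1 + real n * C) \<le> real N * \<alpha>" using \<alpha>(1) by (simp add: pos_divide_le_eq)
    then show ?thesis using N1 by (simp add: pos_divide_le_eq mult.commute)
  qed
  have N3: "4 \<le> real N * \<alpha>"
  proof -
    have "4 / \<alpha> \<le> real N" using N pos by linarith
    then show ?thesis using \<alpha>(1) by (simp add: pos_divide_le_eq)
  qed
  have Nm: "real N \<le> real N ^ m" if "m \<in> {1..n}" for m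
    using power_increasing[of 1 m "real N"] N1 that by simp
  \<comment> \<open>Sides \<open>N^(-m)\<close> are multiplicative, so they define a lattice; it
    contains the unit lattice.\<close>
  define b where "b m = 1 / real N ^ m" for m
  have b_le: "0 < b m" "b m \<le> 1 / real N" if "m \<in> {1..n}" for m
    using N1 Nm[OF that] by (auto simp: b_def intro!: divide_left_mono)
  have \<Lambda>: "box_group (lat_low n b) b"
    by (rule box_group_ilat) (use N1 in \<open>auto simp: b_def power_add mults_self\<close>)
  \<comment> \<open>Only the middle half of \<open>Box a\<close> is filled with lattice points,
    which leaves room for the perturbation by the fine box.\<close>
  define J where "J m = {k::int. a m / 4 * real N ^ m \<le> real_of_int k
    \<and> real_of_int k < 3 * a m / 4 * real N ^ m}" for m
  define X where "X = (\<lambda>j. mk (\<lambda>m. real_of_int (j m) * b m)) ` PiE {1..n} J"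
  have J: "finite (J m)" "a m / 4 * real N ^ m \<le> real (card (J m))" if m: "m \<in> {1..n}" for m
  proof -
    show "finite (J m)" unfolding J_def by (rule card_int_interval(2))
    have "4 \<le> real N ^ m * a m"
      using N3 mult_mono[OF Nm[OF m] \<alpha>(2)[OF m]] \<alpha>(1) N1 by simp
    then have "a m / 4 * real N ^ m \<le> 3 * a m / 4 * real N ^ m - a m / 4 * real N ^ m - 1"
      by (simp add: field_simps)
    also have "\<dots> \<le> real (card (J m))" unfolding J_def by (rule card_int_interval(1))
    finally show "a m / 4 * real N ^ m \<le> real (card (J m))" .
  qed
  have finX: "finite X" unfolding X_def using J by (intro finite_imageI finite_PiE) auto
  have dX: "d m (mk (\<lambda>m. real_of_int (j m) * b m)) = real_of_int (j m) * b m" if "m \<in> {1..n}" for m j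
    by (rule d_mk[OF that])
  have "inj_on (\<lambda>j. mk (\<lambda>m. real_of_int (j m) * b m)) (PiE {1..n} J)"
  proof (rule inj_onI)
    fix i j assume ij: "i \<in> PiE {1..n} J" "j \<in> PiE {1..n} J"
      and eq: "mk (\<lambda>m. real_of_int (i m) * b m) = mk (\<lambda>m. real_of_int (j m) * b m)"
    show "i = j"
    proof (rule PiE_ext[OF ij])
      fix m assume m: "m \<in> {1..n}"
      have "real_of_int (i m) * b m = real_of_int (j m) * b m" unfolding dX[OF m, symmetric] eq ..
      then show "i m = j m" using b_le[OF m] by simp
    qed
  qed
  then have cardX: "card X = (\<Prod>m\<in>{1..n}. card (J m))" unfolding X_def by (simp add: card_image card_PiE)
  have X_sub: "X \<subseteq> lat_low n b"
    unfolding X_def lat_low_def using dX by (auto intro: multsI)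
  have X_mid: "a m / 4 \<le> d m x \<and> d m x < 3 * a m / 4" if x: "x \<in> X" and m: "m \<in> {1..n}" for x m
  proof -
    obtain j where j: "j \<in> PiE {1..n} J" "x = mk (\<lambda>m. real_of_int (j m) * b m)" using x
      by (auto simp: X_def)
    have "j m \<in> J m" using j m by blast
    moreover have "d m x = real_of_int (j m) / real N ^ m" using dX[OF m] j by (simp add: b_def)
    ultimately show ?thesis using N1 by (simp add: J_def pos_le_divide_eq pos_divide_less_eq)
  qed
  have sub: "x \<otimes> y \<in> Box a" if x: "x \<in> X" and y: "y \<in> Box b" for x y
  proof -
    have Kx: "\<bar>K i x l\<bar> \<le> C" if "i \<le> n" "l \<le> n" for i l
    proof -
      have "\<bar>d p x\<bar> \<le> M * 1 ^ p" if "p \<in> {1..n}" for p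
        using X_mid[OF x that] aM[OF that] a[OF that] by simp
      then show ?thesis using C(2)[of 1 x i l] that by simp
    qed
    have dy: "\<bar>d i y\<bar> \<le> 1 / real N" if "i \<in> {1..n}" for i
    proof -
      have "0 \<le> d i y" "d i y < b i" using y that by (auto simp: Box_def)
      then show ?thesis using b_le[OF that] by linarith
    qed
    have "0 \<le> d m (x \<otimes> y) \<and> d m (x \<otimes> y) < a m" if m: "m \<in> {1..n}" for m
    proof -
      have "\<bar>\<Sum>i\<in>{1..<m}. d i y * K i x (m - i)\<bar> \<le> (\<Sum>i\<in>{1..<m}. 1 / real N * C)"
      proof (rule order_trans[OF sum_abs sum_mono])
        fix i assume "i \<in> {1..<m}"
        then show "\<bar>d i y * K i x (m - i)\<bar> \<le> 1 / real N * C"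
          unfolding abs_mult using m by (intro mult_mono dy Kx) auto
      qed
      also have "\<dots> = real (m - 1) * (1 / real N * C)" by simp
      also have "\<dots> \<le> real n * (1 / real N * C)" using m C(1) by (intro mult_right_mono) auto
      finally have s: "\<bar>\<Sum>i\<in>{1..<m}. d i y * K i x (m - i)\<bar> \<le> real n * (1 / real N * C)" .
      have "d m (x \<otimes> y) = d m x + d m y + (\<Sum>i\<in>{1..<m}. d i y * K i x (m - i))" by (rule d_mult[OF m])
      then have "\<bar>d m (x \<otimes> y) - d m x\<bar> \<le> 1 / real N + real n * (1 / real N * C)" using s dy[OF m]
        by linarith
      also have "\<dots> = (1 + real n * C) / real N" by (simp add: add_divide_distrib)
      also have "\<dots> \<le> a m / 4" using N2 \<alpha>(2)[OF m] by linarith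
      finally show ?thesis using X_mid[OF x m] a[OF m] by linarith
    qed
    then show ?thesis by (simp add: Box_def)
  qed
  have "emeasure \<mu> (Box (\<lambda>_. 1)) \<le> of_nat (\<Prod>m\<in>{1..n}. N ^ m) * emeasure \<mu> (Box b)"
  proof (rule emeasure_Box_le_index[OF box_group_unit \<Lambda>])
    have "1 \<in> mults (b m)" for m by (rule multsI[of _ "int (N ^ m)"]) (use N1 in \<open>simp add: b_def\<close>)
    then show "lat_low n (\<lambda>_. 1) \<subseteq> lat_low n b" unfolding lat_low_def using mults_trans by blast
  qed (use N1 in \<open>simp add: b_def\<close>)
  then have "ennreal (\<Prod>m\<in>{1..n}. a m / 4) * emeasure \<mu> (Box (\<lambda>_. 1))
      \<le> ennreal (\<Prod>m\<in>{1..n}. a m / 4) * (of_nat (\<Prod>m\<in>{1..n}. N ^ m) * emeasure \<mu> (Box b))"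
    by (rule mult_left_mono) simp
  also have "\<dots> = ennreal ((\<Prod>m\<in>{1..n}. a m / 4) * real (\<Prod>m\<in>{1..n}. N ^ m)) * emeasure \<mu> (Box b)"
    using a by (subst ennreal_mult)
      (auto intro!: prod_nonneg simp: less_imp_le mult.assoc ennreal_of_nat_eq_real_of_nat)
  also have "(\<Prod>m\<in>{1..n}. a m / 4) * real (\<Prod>m\<in>{1..n}. N ^ m) = (\<Prod>m\<in>{1..n}. a m / 4 * real N ^ m)"
    by (simp only: of_nat_prod of_nat_power prod.distrib)
  also have "ennreal (\<Prod>m\<in>{1..n}. a m / 4 * real N ^ m) * emeasure \<mu> (Box b)
    \<le> of_nat (card X) * emeasure \<mu> (Box b)"
  proof (rule mult_right_mono)
    have "(\<Prod>m\<in>{1..n}. a m / 4 * real N ^ m) \<le> (\<Prod>m\<in>{1..n}. real (card (J m)))"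
      using J a by (intro prod_mono) (auto intro!: mult_nonneg_nonneg divide_nonneg_nonneg
        less_imp_le[OF a])
    also have "\<dots> = real (card X)" unfolding cardX by simp
    finally show "ennreal (\<Prod>m\<in>{1..n}. a m / 4 * real N ^ m) \<le> of_nat (card X)"
      unfolding ennreal_of_nat_eq_real_of_nat by (rule ennreal_leI)
  qed simp
  also have "\<dots> = emeasure \<mu> (\<Union>x\<in>X. (\<lambda>y. x \<otimes> y) ` Box b)"
    by (rule emeasure_translates_disjoint[OF \<Lambda> finX X_sub, symmetric])
  also have "\<dots> \<le> emeasure \<mu> (Box a)"
    using sub borel_Box sets_haar by (intro emeasure_mono) auto
  finally show ?thesis .
qed

lemma covolume_ge_packing:
  assumes sub: "subgroup \<Gamma> G" and disc: "discrete \<Gamma>"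
    and P: "P \<in> sets borel" and packing: "\<And>\<gamma> p. \<gamma> \<in> \<Gamma> \<Longrightarrow> p \<in> P \<Longrightarrow> \<gamma> \<otimes> p \<in> P \<Longrightarrow> \<gamma> = \<one>"
  shows "emeasure \<mu> P \<le> covolume G \<mu> \<Gamma>"
  unfolding covolume_def
proof (rule INF_greatest)
  fix F assume "F \<in> {F. fundamental_domain G \<Gamma> F}"
  then have F: "F \<in> sets borel" "\<And>g. \<exists>\<gamma>\<in>\<Gamma>. \<gamma> \<otimes> g \<in> F" unfolding fundamental_domain_def by auto
  show "emeasure \<mu> P \<le> emeasure \<mu> F"
    by (rule packing_le_covering[OF sub discrete_imp_countable[OF disc] P packing F])
qed

lemma box_group_covolume_le: "box_group \<Gamma> a \<Longrightarrow> covolume G \<mu> \<Gamma> \<le> emeasure \<mu> (Box a)"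
  unfolding covolume_def by (rule INF_lower) (simp add: box_group_fundamental_domain)

lemma box_group_cocompact_lattice: "box_group \<Gamma> a \<Longrightarrow> cocompact_lattice G \<mu> \<Gamma>"
  unfolding cocompact_lattice_def lattice_subgroup_def
  using box_group_covolume_le[of \<Gamma> a] emeasure_Box_finite[of a] box_group_discrete
    box_group_compact_quotient
  by (auto simp: box_group_def[of \<Gamma>] intro: le_less_trans)

end

section \<open>Word length\<close>

context witt_group
begin

text \<open>As \<open>e 1\<close> and \<open>e 2\<close> generate the Lie algebra, \<open>e m\<close> lies in the term \<open>wt m\<close> of the lower
  central series and not in the next one.\<close>

definition wt :: "nat \<Rightarrow> nat" where "wt m = (if m = 1 then 1 else m - 1)"

lemma wt_pos: "m \<in> {1..n} \<Longrightarrow> wt m > 0" by (auto simp: wt_def)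
lemma wt_le: "m \<in> {1..n} \<Longrightarrow> wt m \<le> m" by (auto simp: wt_def)

text \<open>The flow of \<open>e 1\<close> translates \<open>1 / X\<close>, so the first coordinate
  of a right factor affects no other coordinate. This saves one power of the length in all weights
  \<open>wt m\<close> with \<open>m \<ge> 2\<close>.\<close>

lemma K_1: "l > 0 \<Longrightarrow> K 1 x l = 0" by (simp add: K_def)

text \<open>\<open>K i x l\<close> depends only on the coordinates up to \<open>l\<close>, so those
  above \<open>L\<close> may be set to zero before \<open>K_bound\<close> is applied. This permits
  induction on the coordinate.\<close>

lemma K_bound_low:
  assumes "M \<ge> 0"
  obtains C where "C \<ge> 1" "\<And>R x L i l. R \<ge> 0 \<Longrightarrow> L \<le> n \<Longrightarrow> (\<And>p. p \<in> {1..L} \<Longrightarrow> \<bar>d p x\<bar> \<le> M * R ^ p) \<Longrightarrow>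
     i \<le> n \<Longrightarrow> l \<le> L \<Longrightarrow> \<bar>K i x l\<bar> \<le> C * R ^ l"
proof -
  obtain C where C: "C \<ge> 1" "\<And>R x i l. R \<ge> 0 \<Longrightarrow> (\<And>p. p \<in> {1..n} \<Longrightarrow> \<bar>d p x\<bar> \<le> M * R ^ p) \<Longrightarrow>
     i \<le> n \<Longrightarrow> l \<le> n \<Longrightarrow> \<bar>K i x l\<bar> \<le> C * R ^ l" using K_bound[OF assms] by blast
  have "\<bar>K i x l\<bar> \<le> C * R ^ l"
    if R: "R \<ge> 0" and L: "L \<le> n" and x: "\<And>p. p \<in> {1..L} \<Longrightarrow> \<bar>d p x\<bar> \<le> M * R ^ p" and il: "i \<le> n" "l \<le> L"
    for R x L i l
  proof -
    define y where "y = mk (\<lambda>p. if p \<le> L then d p x else 0)"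
    have y: "d p y = (if p \<le> L then d p x else 0)" if "p \<in> {1..n}" for p unfolding y_def
      by (rule d_mk[OF that])
    have "K i x l = K i y l"
    proof (cases "l = 0")
      case False
      then have "K i x l - K i y l = - real (i - 1) * (d l x - d l y)"
        using y L il by (intro K_agree) auto
      moreover have "d l x = d l y" using y[of l] L il False by simp
      ultimately show ?thesis by simp
    qed (simp add: K_0)
    moreover have "\<bar>d p y\<bar> \<le> M * R ^ p" if "p \<in> {1..n}" for p
      using y[OF that] x[of p] that assms R by auto
    ultimately show ?thesis using C(2)[of R y i l] R L il by simp
  qed
  then show thesis using that C(1) by blast
qed

end

section \<open>Word length compared with coordinates\<close>

locale witt_gen = witt_group G n d mk for G :: "'g::euclidean_space monoid" (structure) and n d mk +
  fixes S :: "'g set"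
  assumes gen: "compact_generating_set G S"
begin

definition letters :: "'g set" where "letters = S \<union> (\<lambda>s. inv s) ` S"

text \<open>The length is exactly \<open>k\<close>, so the set of such elements is a continuous
  image of a product of compact sets.\<close>

definition word :: "nat \<Rightarrow> 'g \<Rightarrow> bool" where
  "word k x \<longleftrightarrow> (\<exists>xs. length xs = k \<and> set xs \<subseteq> letters \<and> foldr (mult G) xs \<one> = x)"

definition wl :: "'g \<Rightarrow> nat" where "wl x = word_length G S x"

lemma wl_eq: "wl x = (LEAST k. word k x)"
  by (simp add: wl_def word_length_def word_def letters_def)

lemma word_0: "word 0 x \<longleftrightarrow> x = \<one>" by (auto simp: word_def)

lemma word_1: "s \<in> letters \<Longrightarrow> word (Suc 0) s"
  unfolding word_def by (rule exI[of _ "[s]"]) simp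

lemma foldr_append_mult: "foldr (mult G) (xs @ ys) \<one> = foldr (mult G) xs \<one> \<otimes> foldr (mult G) ys \<one>"
  by (induction xs) (simp_all add: m_assoc)

lemma word_mult: "word j x \<Longrightarrow> word k y \<Longrightarrow> word (j + k) (x \<otimes> y)"
proof -
  assume "word j x" "word k y"
  then obtain xs ys where "length xs = j" "set xs \<subseteq> letters" "foldr (mult G) xs \<one> = x"
    "length ys = k" "set ys \<subseteq> letters" "foldr (mult G) ys \<one> = y" unfolding word_def by blast
  then show ?thesis unfolding word_def
    by (intro exI[of _ "xs @ ys"]) (simp add: foldr_append_mult del: foldr_append)
qed

lemma word_Suc: "word (Suc k) x \<longleftrightarrow> (\<exists>s\<in>letters. \<exists>y. word k y \<and> x = s \<otimes> y)"
proof
  assume "word (Suc k) x"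
  then obtain xs where "length xs = Suc k" "set xs \<subseteq> letters" "foldr (mult G) xs \<one> = x"
    unfolding word_def by blast
  then show "\<exists>s\<in>letters. \<exists>y. word k y \<and> x = s \<otimes> y" by (cases xs) (auto simp: word_def)
next
  assume "\<exists>s\<in>letters. \<exists>y. word k y \<and> x = s \<otimes> y"
  then show "word (Suc k) x" using word_mult[OF word_1] by auto
qed

lemma word_Suc_right: "word (Suc k) x \<Longrightarrow> \<exists>s\<in>letters. \<exists>y. word k y \<and> x = y \<otimes> s"
proof -
  assume "word (Suc k) x"
  then obtain xs where xs: "length xs = Suc k" "set xs \<subseteq> letters" "foldr (mult G) xs \<one> = x"
    unfolding word_def by blast
  then obtain ys s where ys: "xs = ys @ [s]" by (cases xs rule: rev_cases) auto
  then have "x = foldr (mult G) ys \<one> \<otimes> s" using xs(3) foldr_append_mult[of ys "[s]"] by simp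
  moreover have "word k (foldr (mult G) ys \<one>)" unfolding word_def using xs ys by auto
  ultimately show ?thesis using xs ys by auto
qed

lemma letters_inv: "s \<in> letters \<Longrightarrow> inv s \<in> letters" unfolding letters_def by auto

lemma word_inv: "word k x \<Longrightarrow> word k (inv x)"
proof (induction k arbitrary: x)
  case (Suc k)
  then obtain s y where s: "s \<in> letters" "word k y" "x = s \<otimes> y" unfolding word_Suc by blast
  have "word (k + Suc 0) (inv y \<otimes> inv s)" by (intro word_mult Suc.IH s word_1 letters_inv)
  then show ?case unfolding s(3) by (simp add: inv_mult_group)
qed (simp add: word_0)

lemma ex_word: "\<exists>k. word k x"
proof -
  have "x \<in> generate G S" using gen by (simp add: compact_generating_set_def)
  then show ?thesis
  proof (induction rule: generate.induct)
    case one
    show ?case using word_0 by blast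
  next
    case (incl h)
    then show ?case using word_1[of h] by (auto simp: letters_def)
  next
    case (inv h)
    then show ?case using word_1[of "inv h"] by (auto simp: letters_def)
  next
    case (eng h1 h2)
    then show ?case using word_mult by blast
  qed
qed

lemma word_wl: "word (wl x) x" unfolding wl_eq using ex_word by (rule LeastI_ex)
lemma wl_le: "word k x \<Longrightarrow> wl x \<le> k" unfolding wl_eq by (rule Least_le)
lemma wl_mult: "wl (x \<otimes> y) \<le> wl x + wl y" by (intro wl_le word_mult word_wl)
lemma wl_inv: "wl (inv x) \<le> wl x" by (intro wl_le word_inv word_wl)

lemma wl_nat_pow: "wl (x [^] (k::nat)) \<le> k * wl x"
proof (induction k)
  case 0
  then show ?case using wl_le[of 0 \<one>] word_0 by simp
next
  case (Suc k)
  then show ?case using wl_mult[of "x [^] k" x] by simp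
qed

lemma wl_comm: "wl (comm x y) \<le> 2 * (wl x + wl y)"
proof -
  have "wl (comm x y) \<le> wl (x \<otimes> y) + wl (inv (y \<otimes> x))" unfolding comm_def by (rule wl_mult)
  also have "\<dots> \<le> wl (x \<otimes> y) + wl (y \<otimes> x)" using wl_inv by simp
  finally show ?thesis using add_mono[OF wl_mult[of x y] wl_mult[of y x]] by simp
qed

lemma compact_letters: "compact letters"
  unfolding letters_def using gen
  by (auto simp: compact_generating_set_def intro!: compact_Un compact_continuous_image
      continuous_on_subset[OF continuous_inv])

lemma letters_bound:
  obtains M where "M \<ge> 0" "\<And>s m. s \<in> letters \<Longrightarrow> m \<in> {1..n} \<Longrightarrow> \<bar>d m s\<bar> \<le> M"
proof -
  have "\<exists>B. \<forall>s\<in>letters. \<bar>d m s\<bar> \<le> B" for m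
  proof -
    have "bounded (d m ` letters)"
      by (intro compact_imp_bounded compact_continuous_image continuous_on_subset[OF continuous_d]
        compact_letters) simp
    then show ?thesis unfolding bounded_iff by auto
  qed
  then obtain B where B: "\<And>m s. s \<in> letters \<Longrightarrow> \<bar>d m s\<bar> \<le> B m" by metis
  have "\<bar>d m s\<bar> \<le> (\<Sum>m\<in>{1..n}. \<bar>B m\<bar>)" if "s \<in> letters" "m \<in> {1..n}" for m s
  proof -
    have "\<bar>d m s\<bar> \<le> \<bar>B m\<bar>" using B[OF that(1), of m] by linarith
    also have "\<dots> \<le> (\<Sum>m\<in>{1..n}. \<bar>B m\<bar>)" using that by (intro member_le_sum) auto
    finally show ?thesis .
  qed
  then show thesis using that[of "\<Sum>m\<in>{1..n}. \<bar>B m\<bar>"] by (simp add: sum_nonneg)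
qed

text \<open>Multiplying a word of length \<open>k\<close> by one more letter changes
  \<open>d m\<close> by terms \<open>d i s * K i y (m - i)\<close>, bounded by a constant times
  \<open>(k + 1) ^ (m - 2)\<close> since \<open>i = 1\<close> drops out. Adding up these increments
  gives order \<open>k ^ (m - 1)\<close>.\<close>

lemma coordinate_growth_step:
  assumes m: "m \<in> {1..n}" and c: "c \<ge> 0"
    and low: "\<And>p k x. p \<in> {1..<m} \<Longrightarrow> word k x \<Longrightarrow> \<bar>d p x\<bar> \<le> c * real k ^ wt p"
  shows "\<exists>C\<ge>0. \<forall>k x. word k x \<longrightarrow> \<bar>d m x\<bar> \<le> C * real k ^ wt m"
proof -
  obtain M where M: "M \<ge> 0" "\<And>s m. s \<in> letters \<Longrightarrow> m \<in> {1..n} \<Longrightarrow> \<bar>d m s\<bar> \<le> M"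
    using letters_bound by blast
  show ?thesis
  proof (cases "m = 1")
    case True
    have "\<bar>d 1 x\<bar> \<le> M * real k" if "word k x" for k x
      using that
    proof (induction k arbitrary: x)
      case 0
      then show ?case using d_one[of 1] n3 by (simp add: word_0)
    next
      case (Suc k)
      then obtain s y where s: "s \<in> letters" "word k y" "x = y \<otimes> s" using word_Suc_right by blast
      have one: "1 \<in> {1..n}" using n3 by simp
      have "d 1 x = d 1 y + d 1 s" unfolding s(3) using d_mult[OF one, of y s] by simp
      then show ?case using Suc.IH[OF s(2)] M(2)[OF s(1) one] by (simp add: distrib_left)
    qed
    then show ?thesis using M(1) True by (auto simp: wt_def)
  next
    case False
    then have m2: "m \<ge> 2" using m by simp
    obtain C where C: "C \<ge> 1" "\<And>R x L i l. R \<ge> 0 \<Longrightarrow> L \<le> n \<Longrightarrow> (\<And>p. p \<in> {1..L} \<Longrightarrow> \<bar>d p x\<bar> \<le> c * R ^ p) \<Longrightarrow>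
       i \<le> n \<Longrightarrow> l \<le> L \<Longrightarrow> \<bar>K i x l\<bar> \<le> C * R ^ l" using K_bound_low[OF c] by blast
    define B where "B = M * (1 + real n * C)"
    have B: "B \<ge> 0" using M(1) C(1) by (simp add: B_def)
    have step: "\<bar>d m (y \<otimes> s) - d m y\<bar> \<le> B * real (Suc k) ^ (m - 2)" if y: "word k y"
      and s: "s \<in> letters" for y s k
    proof -
      have Kb: "\<bar>K i y l\<bar> \<le> C * real (Suc k) ^ l" if "i \<le> n" "l \<le> m - 1" for i l
      proof (rule C(2)[of _ "m - 1"])
        fix p assume p: "p \<in> {1..m - 1}"
        then have pn: "p \<in> {1..n}" and pm: "p \<in> {1..<m}" using m by auto
        have "real k ^ wt p \<le> real (Suc k) ^ wt p" by (intro power_mono) auto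
        also have "\<dots> \<le> real (Suc k) ^ p" using wt_le[OF pn] by (intro power_increasing) auto
        finally have "c * real k ^ wt p \<le> c * real (Suc k) ^ p" using c by (intro mult_left_mono)
        then show "\<bar>d p y\<bar> \<le> c * real (Suc k) ^ p" using low[OF pm y] by linarith
      qed (use that m in auto)
      have "\<bar>\<Sum>i\<in>{1..<m}. d i s * K i y (m - i)\<bar> \<le> (\<Sum>i\<in>{1..<m}. M * (C * real (Suc k) ^ (m - 2)))"
      proof (rule order_trans[OF sum_abs sum_mono])
        fix i assume i: "i \<in> {1..<m}"
        show "\<bar>d i s * K i y (m - i)\<bar> \<le> M * (C * real (Suc k) ^ (m - 2))"
        proof (cases "i = 1")
          case True
          then have "K i y (m - i) = 0" using K_1[of "m - 1" y] m2 by simp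
          then show ?thesis using M(1) C(1) by simp
        next
          case False
          have "\<bar>K i y (m - i)\<bar> \<le> C * real (Suc k) ^ (m - i)" using i m by (intro Kb) auto
          also have "\<dots> \<le> C * real (Suc k) ^ (m - 2)"
            using C(1) False i by (intro mult_left_mono power_increasing) auto
          finally have "\<bar>K i y (m - i)\<bar> \<le> C * real (Suc k) ^ (m - 2)" .
          moreover have "\<bar>d i s\<bar> \<le> M" using M(2)[OF s, of i] i m by auto
          ultimately show ?thesis unfolding abs_mult using M(1) by (intro mult_mono) auto
        qed
      qed
      also have "\<dots> = real (m - 1) * (M * (C * real (Suc k) ^ (m - 2)))" by simp
      also have "\<dots> \<le> real n * (M * (C * real (Suc k) ^ (m - 2)))"
        using m C(1) M(1) by (intro mult_right_mono) auto
      finally have "\<bar>\<Sum>i\<in>{1..<m}. d i s * K i y (m - i)\<bar> \<le> real n * (M * (C * real (Suc k) ^ (m - 2)))" .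
      moreover have "\<bar>d m s\<bar> \<le> M * real (Suc k) ^ (m - 2)"
      proof -
        have "M * 1 \<le> M * real (Suc k) ^ (m - 2)" using M(1) by (intro mult_left_mono one_le_power) auto
        then show ?thesis using M(2)[OF s m] by linarith
      qed
      moreover have "B * real (Suc k) ^ (m - 2) = M * real (Suc k) ^ (m - 2)
        + real n * (M * (C * real (Suc k) ^ (m - 2)))"
        by (simp add: B_def algebra_simps)
      ultimately show ?thesis using d_mult[OF m, of y s] by linarith
    qed
    have "\<bar>d m x\<bar> \<le> B * real k ^ (m - 1)" if "word k x" for k x
      using that
    proof (induction k arbitrary: x)
      case 0
      then show ?case using d_one[OF m] B by (simp add: word_0)
    next
      case (Suc k)
      then obtain s y where s: "s \<in> letters" "word k y" "x = y \<otimes> s" using word_Suc_right by blast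
      have e: "m - 1 = Suc (m - 2)" using m2 by simp
      have "\<bar>d m x\<bar> \<le> B * real k ^ (m - 1) + B * real (Suc k) ^ (m - 2)"
        using Suc.IH[OF s(2)] step[OF s(2,1)] unfolding s(3) by linarith
      also have "B * real k ^ (m - 1) \<le> B * (real k * real (Suc k) ^ (m - 2))"
        unfolding e power_Suc using B by (intro mult_left_mono power_mono) auto
      also have "B * (real k * real (Suc k) ^ (m - 2)) + B * real (Suc k) ^ (m - 2)
        = B * real (Suc k) ^ (m - 1)"
        unfolding e power_Suc by (simp add: algebra_simps)
      finally show ?case by simp
    qed
    then show ?thesis using B False by (auto simp: wt_def)
  qed
qed

lemma coordinate_growth:
  obtains C where "C \<ge> 1" "\<And>m x. m \<in> {1..n} \<Longrightarrow> \<bar>d m x\<bar> \<le> C * real (wl x) ^ wt m"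
proof -
  have "L \<le> n \<Longrightarrow> \<exists>C\<ge>0. \<forall>m\<in>{1..L}. \<forall>k x. word k x \<longrightarrow> \<bar>d m x\<bar> \<le> C * real k ^ wt m" for L
  proof (induction L)
    case (Suc L)
    then obtain c where c: "c \<ge> 0" "\<forall>m\<in>{1..L}. \<forall>k x. word k x \<longrightarrow> \<bar>d m x\<bar> \<le> c * real k ^ wt m" by auto
    obtain C where C: "C \<ge> 0" "\<forall>k x. word k x \<longrightarrow> \<bar>d (Suc L) x\<bar> \<le> C * real k ^ wt (Suc L)"
      using coordinate_growth_step[of "Suc L" c] c Suc.prems by auto
    have "\<bar>d m x\<bar> \<le> (c + C) * real k ^ wt m" if "m \<in> {1..Suc L}" "word k x" for m k x
    proof (cases "m = Suc L")
      case True
      then have "\<bar>d m x\<bar> \<le> C * real k ^ wt m" using C(2) that by simp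
      also have "\<dots> \<le> (c + C) * real k ^ wt m" using c(1) by (intro mult_right_mono) auto
      finally show ?thesis .
    next
      case False
      then have "\<bar>d m x\<bar> \<le> c * real k ^ wt m" using c(2) that by simp
      also have "\<dots> \<le> (c + C) * real k ^ wt m" using C(1) by (intro mult_right_mono) auto
      finally show ?thesis .
    qed
    then show ?case using c(1) C(1) by (intro exI[of _ "c + C"]) auto
  qed auto
  then obtain C where C: "C \<ge> 0" "\<forall>m\<in>{1..n}. \<forall>k x. word k x \<longrightarrow> \<bar>d m x\<bar> \<le> C * real k ^ wt m" by blast
  show thesis
  proof (rule that[of "C + 1"])
    fix m x assume m: "m \<in> {1..n}"
    have "\<bar>d m x\<bar> \<le> C * real (wl x) ^ wt m" using C(2) m word_wl by blast
    also have "\<dots> \<le> (C + 1) * real (wl x) ^ wt m" by (intro mult_right_mono) auto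
    finally show "\<bar>d m x\<bar> \<le> (C + 1) * real (wl x) ^ wt m" .
  qed (use C(1) in simp)
qed

lemma compact_words: "compact {x. word k x}"
proof (induction k)
  case 0
  then show ?case by (simp add: word_0)
next
  case (Suc k)
  have "{x. word (Suc k) x} = (\<lambda>p. fst p \<otimes> snd p) ` (letters \<times> {x. word k x})"
    unfolding word_Suc by force
  then show ?case
    using compact_continuous_image[OF continuous_on_subset[OF continuous_mult] compact_Times[OF
      compact_letters Suc]]
    by simp
qed

text \<open>By Baire's theorem some ball of the word metric has interior.\<close>

lemma wl_bounded_on_compact:
  assumes "compact Q" obtains B :: nat where "\<And>x. x \<in> Q \<Longrightarrow> wl x \<le> B"
proof -
  have "\<exists>k. interior {x. word k x} \<noteq> {}"
  proof (rule ccontr)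
    assume "\<not> ?thesis"
    then have e: "interior {x. word k x} = {}" for k by blast
    have "UNIV \<subseteq> closure (\<Inter>(range (\<lambda>k. - {x. word k x})))"
    proof (rule Baire)
      show "openin (top_of_set UNIV) T \<and> UNIV \<subseteq> closure T" if T: "T \<in> range (\<lambda>k. - {x. word k x})" for T
      proof -
        obtain k where k: "T = - {x. word k x}" using T by blast
        have "open T" unfolding k using compact_imp_closed[OF compact_words] by (simp only: open_Compl)
        moreover have "closure T = UNIV" unfolding k closure_complement e by simp
        ultimately show ?thesis by simp
      qed
    qed auto
    moreover have "(\<Inter>(range (\<lambda>k. - {x. word k x}))) = {}" using ex_word by blast
    ultimately show False by simp
  qed
  then obtain k z where z: "z \<in> interior {x. word k x}" by blast
  let ?O = "interior {x. word k x}"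
  have "Q \<subseteq> (\<Union>g\<in>UNIV. (\<lambda>x. g \<otimes> x) ` ?O)"
  proof
    fix x
    have "x = (x \<otimes> inv z) \<otimes> z" by (simp add: m_assoc)
    then show "x \<in> (\<Union>g\<in>UNIV. (\<lambda>x. g \<otimes> x) ` ?O)" using z by blast
  qed
  then obtain C' where C': "finite C'" "Q \<subseteq> (\<Union>g\<in>C'. (\<lambda>x. g \<otimes> x) ` ?O)"
    using compactE_image[OF assms, of UNIV "\<lambda>g. (\<lambda>x. g \<otimes> x) ` ?O"] open_translate[OF open_interior]
      by metis
  have "wl x \<le> (\<Sum>g\<in>C'. wl g) + k" if x: "x \<in> Q" for x
  proof -
    obtain g y where g: "g \<in> C'" "y \<in> ?O" "x = g \<otimes> y" using C' x by blast
    have "word k y" using g(2) interior_subset by blast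
    then have "wl y \<le> k" by (rule wl_le)
    moreover have "wl g \<le> (\<Sum>g\<in>C'. wl g)" using g(1) C'(1) by (intro member_le_sum) auto
    ultimately show ?thesis using wl_mult[of g y] g(3) by simp
  qed
  then show thesis using that by blast
qed

lemma nat_pow_lev:
  assumes "x \<in> lev p" "p \<in> {1..n}"
  shows "x [^] (k::nat) \<in> lev p \<and> d p (x [^] k) = real k * d p x"
  using pow_lev[OF assms, of "int k"] unfolding int_pow_int by simp

text \<open>Elements with prescribed leading coordinate \<open>t\<close> at level \<open>i\<close> are iterated commutators of
  powers.\<close>

lemma short_leading:
  assumes "i \<in> {1..n}"
  shows "\<exists>C\<ge>0. \<forall>R\<ge>1. \<forall>t. \<bar>t\<bar> \<le> R ^ wt i \<longrightarrow> (\<exists>g\<in>lev i. d i g = t \<and> real (wl g) \<le> C * R)"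
proof -
  obtain B :: nat where B: "\<And>x. x \<in> cBox (\<lambda>_. 1) \<Longrightarrow> wl x \<le> B"
    using wl_bounded_on_compact[OF compact_cBox] by metis
  have base: "\<exists>g\<in>lev i. d i g = t \<and> real (wl g) \<le> (2 * real B) * R"
    if i: "i \<in> {1..n}" "i \<le> 2" and R: "R \<ge> 1" and t: "\<bar>t\<bar> \<le> R ^ wt i" for i R t
  proof -
    define k where "k = nat \<lceil>R\<rceil>"
    \<comment> \<open>Levels 1 and 2 both have weight 1, so an element there is a power
      \<open>u [^] k\<close> of a point \<open>u\<close> of the unit box, with \<open>k\<close>
      between \<open>R\<close> and \<open>2 * R\<close>.\<close>
    have k: "R \<le> real k" "real k \<le> 2 * R" "k > 0" using R unfolding k_def by linarith+
    define u where "u = mk (\<lambda>p. if p = i then t / real k else 0)"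
    have u: "d p u = (if p = i then t / real k else 0)" if "p \<in> {1..n}" for p unfolding u_def
      by (rule d_mk[OF that])
    have "wt i = 1" using i by (auto simp: wt_def)
    then have "\<bar>t / real k\<bar> \<le> 1" using t k by simp
    then have "u \<in> cBox (\<lambda>_. 1)" unfolding cBox_def using u by simp
    then have "wl u \<le> B" by (rule B)
    have lev: "u \<in> lev i" unfolding lev_def using u i by simp
    have "d i (u [^] k) = t" using nat_pow_lev[OF lev i(1), of k] u[OF i(1)] k by simp
    moreover have "real (wl (u [^] k)) \<le> (2 * real B) * R"
    proof -
      have "real (wl (u [^] k)) \<le> real (k * wl u)" using wl_nat_pow[of u k]
        by (simp only: of_nat_le_iff)
      also have "\<dots> \<le> (2 * R) * real B" unfolding of_nat_mult using k \<open>wl u \<le> B\<close> R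
        by (intro mult_mono) auto
      finally show ?thesis by (simp add: ac_simps)
    qed
    ultimately show ?thesis using nat_pow_lev[OF lev i(1), of k] by blast
  qed
  show ?thesis
    using assms
  proof (induction i rule: less_induct)
    case (less i)
    show ?case
    proof (cases "i \<le> 2")
      case True
      then show ?thesis using base[OF less.prems] by (intro exI[of _ "2 * real B"]) auto
    next
      case False
      then have i1: "i - 1 \<in> {1..n}" "i - 1 < i" and one: "1 \<in> {1..n}" "1 \<le> (2::nat)" using less.prems
        by auto
      obtain C where C: "C \<ge> 0" "\<forall>R\<ge>1. \<forall>t. \<bar>t\<bar> \<le> R ^ wt (i - 1) \<longrightarrow>
          (\<exists>g\<in>lev (i - 1). d (i - 1) g = t \<and> real (wl g) \<le> C * R)"
        using less.IH[OF i1(2,1)] by blast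
      have "\<exists>g\<in>lev i. d i g = t \<and> real (wl g) \<le> (2 * (2 * real B + C)) * R"
        if R: "R \<ge> 1" and t: "\<bar>t\<bar> \<le> R ^ wt i" for R t
      proof -
        obtain x where x: "x \<in> lev 1" "d 1 x = R" "real (wl x) \<le> (2 * real B) * R"
          using base[OF one R, of R] R by (auto simp: wt_def)
        \<comment> \<open>The commutator of levels 1 and \<open>i - 1\<close> multiplies leading
          coordinates by \<open>2 - i\<close>, and \<open>x\<close> contributes \<open>R\<close>;
          both are divided out.\<close>
        define t' where "t' = t / ((2 - real i) * R)"
        have w: "wt i = Suc (wt (i - 1))" using False by (auto simp: wt_def)
        have "\<bar>t'\<bar> \<le> R ^ wt (i - 1)"
        proof -
          have "1 \<le> \<bar>2 - real i\<bar>" using False by linarith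
          then have "R \<le> \<bar>2 - real i\<bar> * R" using R by simp
          then have "R ^ wt (i - 1) * R \<le> R ^ wt (i - 1) * (\<bar>2 - real i\<bar> * R)" using R
            by (intro mult_left_mono) auto
          then have "\<bar>t\<bar> \<le> R ^ wt (i - 1) * (\<bar>2 - real i\<bar> * R)" using t unfolding w
            by (simp add: mult.commute)
          moreover have "\<bar>2 - real i\<bar> * R > 0" using False R by simp
          ultimately show ?thesis unfolding t'_def abs_divide abs_mult using R
            by (simp add: pos_divide_le_eq)
        qed
        then obtain y where y: "y \<in> lev (i - 1)" "d (i - 1) y = t'" "real (wl y) \<le> C * R" using C(2) R
          by blast
        have e: "1 + (i - 1) = i" "i \<le> n" using False less.prems by auto
        have "comm x y \<in> lev i" "d i (comm x y) = (real 1 - real (i - 1)) * d 1 x * d (i - 1) y"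
          using comm_lev[OF x(1) y(1)] i1 e by simp_all
        moreover have "(real 1 - real (i - 1)) * d 1 x * d (i - 1) y = t"
        proof -
          have "real 1 - real (i - 1) = 2 - real i" using False by (simp add: of_nat_diff)
          moreover have "(2 - real i) * R \<noteq> 0" using False R by simp
          ultimately show ?thesis unfolding x(2) y(2) t'_def by simp
        qed
        moreover have "real (wl (comm x y)) \<le> (2 * (2 * real B + C)) * R"
        proof -
          have "real (wl (comm x y)) \<le> real (2 * (wl x + wl y))" using wl_comm
            by (simp only: of_nat_le_iff)
          also have "\<dots> \<le> 2 * ((2 * real B) * R + C * R)" using x(3) y(3) by simp
          finally show ?thesis by (simp add: algebra_simps)
        qed
        ultimately show ?thesis by blast
      qed
      then show ?thesis using C(1) by (intro exI[of _ "2 * (2 * real B + C)"]) auto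
    qed
  qed
qed

text \<open>A short \<open>g\<close> with the same leading coordinate as \<open>x\<close> is split
  off. The coordinates of \<open>inv g \<otimes> x\<close> still obey the weighted bound with
  \<open>R\<close> replaced by \<open>C4 * R\<close>, and this element lies one level
  higher.\<close>

lemma wl_upper_step:
  assumes i: "i \<in> {1..n}" and C: "C \<ge> 0"
    and IH: "\<And>R x. R \<ge> 1 \<Longrightarrow> x \<in> lev (Suc i) \<Longrightarrow> (\<And>m. m \<in> {1..n} \<Longrightarrow> \<bar>d m x\<bar> \<le> R ^ wt m)
      \<Longrightarrow> real (wl x) \<le> C * R"
  shows "\<exists>C'\<ge>0. \<forall>R\<ge>1. \<forall>x\<in>lev i. (\<forall>m\<in>{1..n}. \<bar>d m x\<bar> \<le> R ^ wt m) \<longrightarrow> real (wl x) \<le> C' * R"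
proof -
  obtain C1 where C1: "C1 \<ge> 0" "\<forall>R\<ge>1. \<forall>t. \<bar>t\<bar> \<le> R ^ wt i \<longrightarrow> (\<exists>g\<in>lev i. d i g = t \<and> real (wl g) \<le> C1 * R)"
    using short_leading[OF i] by blast
  obtain CU where CU: "CU \<ge> 1" "\<And>m x. m \<in> {1..n} \<Longrightarrow> \<bar>d m x\<bar> \<le> CU * real (wl x) ^ wt m"
    using coordinate_growth by blast
  define C2 where "C2 = CU * (C1 + 1) ^ n"
  have C2: "C2 \<ge> 1" unfolding C2_def using CU(1) C1(1) mult_mono[of 1 CU 1 "(C1 + 1) ^ n"] by simp
  have C20: "C2 \<ge> 0" using C2 by simp
  obtain C3 where C3: "C3 \<ge> 1" "\<And>R x i l. R \<ge> 0 \<Longrightarrow> (\<And>p. p \<in> {1..n} \<Longrightarrow> \<bar>d p x\<bar> \<le> C2 * R ^ p) \<Longrightarrow>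
     i \<le> n \<Longrightarrow> l \<le> n \<Longrightarrow> \<bar>K i x l\<bar> \<le> C3 * R ^ l" using K_bound[OF C20] by blast
  define C4 where "C4 = C2 + 1 + real n * C3"
  have C4: "C4 \<ge> 1" using C2 C3(1) by (simp add: C4_def)
  have "real (wl x) \<le> (C1 + C * C4) * R"
    if R: "R \<ge> 1" and x: "x \<in> lev i" and dx: "\<forall>m\<in>{1..n}. \<bar>d m x\<bar> \<le> R ^ wt m" for R x
  proof -
    obtain g where g: "g \<in> lev i" "d i g = d i x" "real (wl g) \<le> C1 * R" using C1(2) R dx i by blast
    define h where "h = inv g"
    have h: "h \<in> lev i" "d i h = - d i x" "real (wl h) \<le> C1 * R"
    proof -
      show "h \<in> lev i" unfolding h_def using g(1) i by (intro inv_lev) auto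
      show "d i h = - d i x" unfolding h_def using d_inv[OF g(1), of i] g(2) i by simp
      have "real (wl h) \<le> real (wl g)" unfolding h_def using wl_inv by (simp only: of_nat_le_iff)
      then show "real (wl h) \<le> C1 * R" using g(3) by linarith
    qed
    have dh: "\<bar>d m h\<bar> \<le> C2 * R ^ wt m" if m: "m \<in> {1..n}" for m
    proof -
      have "real (wl h) ^ wt m \<le> ((C1 + 1) * R) ^ wt m"
        using h(3) R by (intro power_mono) (auto simp: distrib_right)
      also have "\<dots> = (C1 + 1) ^ wt m * R ^ wt m" by (rule power_mult_distrib)
      also have "\<dots> \<le> (C1 + 1) ^ n * R ^ wt m"
      proof (intro mult_right_mono power_increasing)
        show "wt m \<le> n" using wt_le[OF m] m by simp
      qed (use C1(1) R in auto)
      finally have "CU * real (wl h) ^ wt m \<le> CU * ((C1 + 1) ^ n * R ^ wt m)" using CU(1)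
        by (intro mult_left_mono) auto
      then show ?thesis using CU(2)[OF m, of h] unfolding C2_def by (simp add: mult.assoc)
    qed
    have Kh: "\<bar>K j h l\<bar> \<le> C3 * R ^ l" if "j \<le> n" "l \<le> n" for j l
    proof (rule C3(2))
      fix p assume p: "p \<in> {1..n}"
      have "C2 * R ^ wt p \<le> C2 * R ^ p" using C20 wt_le[OF p] R
        by (intro mult_left_mono power_increasing) auto
      then show "\<bar>d p h\<bar> \<le> C2 * R ^ p" using dh[OF p] by linarith
    qed (use that R in auto)
    define y where "y = h \<otimes> x"
    have y_lev: "y \<in> lev (Suc i)"
    proof -
      have "y \<in> lev i" unfolding y_def using h(1) x i by (intro mult_lev) auto
      moreover have "d i y = 0" unfolding y_def using d_mult_left[OF h(1), of i x] h(2) i by simp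
      ultimately show ?thesis using i by (simp add: lev_Suc)
    qed
    have dy: "\<bar>d m y\<bar> \<le> (C4 * R) ^ wt m" if m: "m \<in> {1..n}" for m
    proof -
      have "\<bar>\<Sum>j\<in>{1..<m}. d j x * K j h (m - j)\<bar> \<le> (\<Sum>j\<in>{1..<m}. C3 * R ^ wt m)"
      proof (rule order_trans[OF sum_abs sum_mono])
        fix j assume j: "j \<in> {1..<m}"
        show "\<bar>d j x * K j h (m - j)\<bar> \<le> C3 * R ^ wt m"
        \<comment> \<open>For \<open>j \<ge> 2\<close> the degrees add up exactly:
          \<open>(j - 1) + (m - j) = m - 1\<close>. For \<open>j = 1\<close> this count would be one
          too large, but the term is zero.\<close>
        proof (cases "j = 1")
          case True
          then have "K j h (m - j) = 0" using K_1[of "m - 1" h] j by simp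
          then show ?thesis using C3(1) R by simp
        next
          case False
          then have w: "wt j = j - 1" "wt m = m - 1" using j by (auto simp: wt_def)
          have "\<bar>d j x\<bar> * \<bar>K j h (m - j)\<bar> \<le> R ^ (j - 1) * (C3 * R ^ (m - j))"
          proof (rule mult_mono)
            have "j \<in> {1..n}" using j m by auto
            then show "\<bar>d j x\<bar> \<le> R ^ (j - 1)" using dx unfolding w(1)[symmetric] by blast
          qed (use j m Kh[of j "m - j"] R in auto)
          also have "\<dots> = C3 * R ^ ((j - 1) + (m - j))" by (simp add: power_add)
          also have "(j - 1) + (m - j) = wt m" using w j by auto
          finally show ?thesis by (simp add: abs_mult)
        qed
      qed
      also have "\<dots> = real (m - 1) * (C3 * R ^ wt m)" by simp
      also have "\<dots> \<le> real n * (C3 * R ^ wt m)" using m C3(1) R by (intro mult_right_mono) auto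
      finally have "\<bar>\<Sum>j\<in>{1..<m}. d j x * K j h (m - j)\<bar> \<le> real n * (C3 * R ^ wt m)" .
      moreover have "d m y = d m h + d m x + (\<Sum>j\<in>{1..<m}. d j x * K j h (m - j))" unfolding y_def
        by (rule d_mult[OF m])
      moreover have "\<bar>d m x\<bar> \<le> R ^ wt m" using dx m by blast
      ultimately have "\<bar>d m y\<bar> \<le> C2 * R ^ wt m + R ^ wt m + real n * (C3 * R ^ wt m)" using dh[OF m]
        by linarith
      also have "\<dots> = C4 * R ^ wt m" by (simp add: C4_def algebra_simps)
      also have "\<dots> \<le> C4 ^ wt m * R ^ wt m" using C4 wt_pos[OF m] R
        by (intro mult_right_mono self_le_power) auto
      finally show ?thesis by (simp add: power_mult_distrib)
    qed
    have CR: "C4 * R \<ge> 1" using mult_mono[OF C4 R] C4 by simp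
    have "real (wl y) \<le> C * (C4 * R)" by (rule IH[OF CR y_lev dy])
    moreover have "x = g \<otimes> y" unfolding y_def h_def by (simp add: m_assoc[symmetric])
    then have "real (wl x) \<le> real (wl g) + real (wl y)" using wl_mult[of g y] by (simp flip: of_nat_add)
    ultimately show ?thesis using g(3) by (simp add: algebra_simps)
  qed
  then show ?thesis using C1(1) C C4 by (intro exI[of _ "C1 + C * C4"]) auto
qed

lemma wl_upper:
  obtains C where "C \<ge> 1" "\<And>R x. R \<ge> 1 \<Longrightarrow> (\<And>m. m \<in> {1..n} \<Longrightarrow> \<bar>d m x\<bar> \<le> R ^ wt m) \<Longrightarrow> real (wl x) \<le> C * R"
proof -
  have "j \<le> n \<Longrightarrow> \<exists>C\<ge>0. \<forall>R\<ge>1. \<forall>x\<in>lev (Suc n - j). (\<forall>m\<in>{1..n}. \<bar>d m x\<bar> \<le> R ^ wt m) \<longrightarrow> real (wl x) \<le> C * R"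
    for j
  proof (induction j)
    case 0
    have "wl \<one> = 0" using wl_le[of 0 \<one>] word_0 by simp
    then show ?case using lev_top by (intro exI[of _ 0]) auto
  next
    case (Suc j)
    then obtain C where C: "C \<ge> 0" "\<forall>R\<ge>1. \<forall>x\<in>lev (Suc n - j). (\<forall>m\<in>{1..n}. \<bar>d m x\<bar> \<le> R ^ wt m)
      \<longrightarrow> real (wl x) \<le> C * R" by auto
    have e: "Suc (Suc n - Suc j) = Suc n - j" "Suc n - Suc j \<in> {1..n}" using Suc.prems by auto
    show ?case by (rule wl_upper_step[OF e(2) C(1)]) (use C(2) e(1) in auto)
  qed
  from this[of n] obtain C where C: "C \<ge> 0"
    "\<forall>R\<ge>1. \<forall>x. (\<forall>m\<in>{1..n}. \<bar>d m x\<bar> \<le> R ^ wt m) \<longrightarrow> real (wl x) \<le> C * R"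
    by (auto simp: lev_1)
  show thesis
  proof (rule that[of "C + 1"])
    fix R x assume R: "R \<ge> (1::real)" and x: "\<And>m. m \<in> {1..n} \<Longrightarrow> \<bar>d m x\<bar> \<le> R ^ wt m"
    have "real (wl x) \<le> C * R" using C(2) R x by blast
    then show "real (wl x) \<le> (C + 1) * R" using R by (simp add: distrib_right)
  qed (use C(1) in simp)
qed

end

section \<open>Lower bounds for lattices of given systole\<close>

text \<open>A generator is a positive element minimizing the integer part of
  \<open>x / \<epsilon>\<close>. A positive remainder \<open>r < a\<close> would have the same
  integer part, so \<open>a - r < \<epsilon>\<close> would be a nonzero element that is too
  small.\<close>

lemma real_subgroup_cyclic:
  fixes H :: "real set"
  assumes diff: "\<And>x y. x \<in> H \<Longrightarrow> y \<in> H \<Longrightarrow> x - y \<in> H" and \<epsilon>: "\<epsilon> > 0" "\<And>x. x \<in> H \<Longrightarrow> \<bar>x\<bar> < \<epsilon> \<Longrightarrow> x = 0"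
    and h: "h \<in> H" "h \<noteq> 0"
  obtains a where "a > 0" "a \<in> H" "\<And>x. x \<in> H \<Longrightarrow> \<exists>k::int. x = real_of_int k * a"
proof -
  have zero: "0 \<in> H" using diff[OF h(1) h(1)] by simp
  have neg: "- x \<in> H" if "x \<in> H" for x using diff[OF zero that] by simp
  have add: "x + y \<in> H" if "x \<in> H" "y \<in> H" for x y using diff[OF that(1) neg[OF that(2)]] by simp
  have nat_mult: "real k * x \<in> H" if "x \<in> H" for k x
    by (induction k) (use zero add that in \<open>auto simp: distrib_right\<close>)
  have int_mult: "real_of_int k * x \<in> H" if "x \<in> H" for k x
  proof (cases "k \<ge> 0")
    case True
    then show ?thesis using nat_mult[OF that, of "nat k"] by simp
  next
    case False
    then show ?thesis using neg[OF nat_mult[OF that, of "nat (- k)"]] by simp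
  qed
  have "\<exists>x. x \<in> H \<and> x > 0"
    using h neg[OF h(1)] by (cases "h > 0") (auto intro: exI[of _ "- h"])
  then obtain a where a: "a \<in> H" "a > 0"
    and least: "\<And>x. x \<in> H \<Longrightarrow> x > 0 \<Longrightarrow> nat \<lfloor>a / \<epsilon>\<rfloor> \<le> nat \<lfloor>x / \<epsilon>\<rfloor>"
    using ex_has_least_nat[of "\<lambda>x. x \<in> H \<and> x > 0" _ "\<lambda>x. nat \<lfloor>x / \<epsilon>\<rfloor>"] by blast
  have "\<exists>k::int. x = real_of_int k * a" if x: "x \<in> H" for x
  proof -
    define r where "r = x - real_of_int \<lfloor>x / a\<rfloor> * a"
    have r: "r \<in> H" "0 \<le> r" "r < a"
      unfolding r_def using diff[OF x int_mult[OF a(1)]] floor_divide_lower[OF a(2), of x]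
        floor_divide_upper[OF a(2), of x] by (auto simp: algebra_simps)
    have "r = 0"
    proof (rule ccontr)
      assume "r \<noteq> 0"
      then have "r > 0" using r by simp
      then have "nat \<lfloor>a / \<epsilon>\<rfloor> \<le> nat \<lfloor>r / \<epsilon>\<rfloor>" using least r by blast
      moreover have "0 \<le> \<lfloor>a / \<epsilon>\<rfloor>" "0 \<le> \<lfloor>r / \<epsilon>\<rfloor>" using a r \<epsilon>(1) by auto
      ultimately have "\<lfloor>a / \<epsilon>\<rfloor> \<le> \<lfloor>r / \<epsilon>\<rfloor>" by linarith
      then have "a / \<epsilon> - r / \<epsilon> < 1" by linarith
      then have "(a - r) / \<epsilon> < 1" by (simp add: diff_divide_distrib)
      then have "a - r < \<epsilon>" using \<epsilon>(1) by (simp add: divide_less_eq)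
      then have "a - r = 0" using \<epsilon>(2)[OF diff[OF a(1) r(1)]] r by simp
      then show False using r by simp
    qed
    then show ?thesis unfolding r_def by (intro exI[of _ "\<lfloor>x / a\<rfloor>"]) simp
  qed
  then show thesis using that a by blast
qed

text \<open>Minkowski's theorem for boxes, up to a factor \<open>2\<close> in each coordinate, by counting points.\<close>

lemma triangular_lattice_short_vector:
  fixes L :: "(nat \<Rightarrow> real) set"
  assumes diff: "\<And>x y. x \<in> L \<Longrightarrow> y \<in> L \<Longrightarrow> (\<lambda>i. x i - y i) \<in> L"
    and v: "\<And>i. i \<in> {h..n} \<Longrightarrow> v i \<in> L" "\<And>i j. i \<in> {h..n} \<Longrightarrow> j \<in> {h..<i} \<Longrightarrow> v i j = 0"
    and a: "\<And>i. i \<in> {h..n} \<Longrightarrow> v i i = a i" "\<And>i. i \<in> {h..n} \<Longrightarrow> a i > 0" and hn: "h \<le> n"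
    and R: "\<And>i. i \<in> {h..n} \<Longrightarrow> R i > 0" and vol: "(\<Prod>i\<in>{h..n}. 2 * a i) < (\<Prod>i\<in>{h..n}. R i)"
  obtains x i where "x \<in> L" "i \<in> {h..n}" "x i \<noteq> 0" "\<And>i. i \<in> {h..n} \<Longrightarrow> \<bar>x i\<bar> < R i"
proof -
  have zero: "(\<lambda>_. 0) \<in> L" using diff[OF v(1) v(1), of h h] hn by simp
  have neg: "(\<lambda>i. - x i) \<in> L" if "x \<in> L" for x using diff[OF zero that] by simp
  have add: "(\<lambda>i. x i + y i) \<in> L" if "x \<in> L" "y \<in> L" for x y using diff[OF that(1) neg[OF that(2)]]
    by simp
  have nat_mult: "(\<lambda>i. x i + real k * y i) \<in> L" if "x \<in> L" "y \<in> L" for k x y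
  proof (induction k)
    case (Suc k)
    then show ?case using add[OF Suc that(2)] by (simp add: algebra_simps)
  qed (simp add: that)
  have int_mult: "(\<lambda>i. x i + real_of_int k * y i) \<in> L" if "x \<in> L" "y \<in> L" for k x y
  proof (cases "k \<ge> 0")
    case True
    then show ?thesis using nat_mult[OF that, of "nat k"] by simp
  next
    case False
    then show ?thesis using nat_mult[OF that(1) neg[OF that(2)], of "nat (- k)"] by simp
  qed
  have "\<exists>N::nat. N > 0 \<and> (\<forall>i\<in>{h..n}. a i \<le> real N * R i)"
  proof -
    obtain N :: nat where N: "(\<Sum>i\<in>{h..n}. a i / R i) < real N" using reals_Archimedean2 by blast
    have nn: "0 \<le> a i / R i" if "i \<in> {h..n}" for i using a(2) R that by (simp add: less_imp_le)
    have "a i \<le> real N * R i" if i: "i \<in> {h..n}" for i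
    proof -
      have "a i / R i \<le> (\<Sum>i\<in>{h..n}. a i / R i)" using i nn by (intro member_le_sum) auto
      then have "a i / R i \<le> real N" using N by linarith
      then show ?thesis using R[OF i] by (simp add: pos_divide_le_eq)
    qed
    moreover have "0 \<le> (\<Sum>i\<in>{h..n}. a i / R i)" by (intro sum_nonneg nn)
    then have "N > 0" using N by (cases N) auto
    ultimately show ?thesis by blast
  qed
  then obtain N :: nat where N: "N > 0" "\<forall>i\<in>{h..n}. a i \<le> real N * R i" by blast
  \<comment> \<open>The number of steps \<open>a i\<close> that fit into the side
    \<open>N * R i\<close>. As the quotient is at least 1, rounding down loses at most a factor 2;
    this is the 2 in the volume hypothesis.\<close>
  define K where "K i = nat \<lfloor>real N * R i / a i\<rfloor>" for i
  have K: "real (K i) * a i \<le> real N * R i" "real N * R i \<le> real (K i) * (2 * a i)" if i: "i \<in> {h..n}"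
    for i
  proof -
    have ai: "a i > 0" using a i by simp
    have q: "1 \<le> real N * R i / a i" using N(2) i ai by (simp add: pos_le_divide_eq)
    define t where "t = real N * R i / a i"
    have "1 \<le> \<lfloor>t\<rfloor>" using q unfolding t_def by simp
    then have "real (nat \<lfloor>t\<rfloor>) = real_of_int \<lfloor>t\<rfloor>" by simp
    then have "real (nat \<lfloor>t\<rfloor>) \<le> t" "t \<le> real (nat \<lfloor>t\<rfloor>) * 2" using \<open>1 \<le> \<lfloor>t\<rfloor>\<close> by linarith+
    then have "real (K i) \<le> real N * R i / a i" "real N * R i / a i \<le> real (K i) * 2"
      unfolding K_def t_def .
    then show "real (K i) * a i \<le> real N * R i" "real N * R i \<le> real (K i) * (2 * a i)"
      using ai by (simp_all add: pos_le_divide_eq pos_divide_le_eq mult.assoc)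
  qed
  \<comment> \<open>One coordinate at a time, \<open>K i\<close> choices each, a set of points of
    \<open>L\<close> in the large box is built whose members are told apart by the coordinates
    treated so far.\<close>
  have "p \<le> Suc n \<Longrightarrow> h \<le> p \<Longrightarrow> \<exists>A. A \<subseteq> L \<and> finite A \<and> card A = (\<Prod>i\<in>{h..<p}. K i) \<and>
     (\<forall>x\<in>A. \<forall>i\<in>{h..<p}. 0 \<le> x i \<and> x i < real N * R i) \<and>
     (\<forall>x\<in>A. \<forall>y\<in>A. (\<forall>i\<in>{h..<p}. x i = y i) \<longrightarrow> x = y)" for p
  proof (induction p)
    case 0
    then show ?case using zero by (intro exI[of _ "{\<lambda>_. 0}"]) auto
  next
    case (Suc p)
    show ?case
    proof (cases "h = Suc p")
      case True
      then show ?thesis using zero by (intro exI[of _ "{\<lambda>_. 0}"]) auto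
    next
      case False
      then have hp: "h \<le> p" and pI: "p \<in> {h..n}" using Suc.prems by auto
      obtain A where A: "A \<subseteq> L" "finite A" "card A = (\<Prod>i\<in>{h..<p}. K i)"
        and box: "\<And>x i. x \<in> A \<Longrightarrow> i \<in> {h..<p} \<Longrightarrow> 0 \<le> x i \<and> x i < real N * R i"
        and inj: "\<And>x y. x \<in> A \<Longrightarrow> y \<in> A \<Longrightarrow> (\<And>i. i \<in> {h..<p} \<Longrightarrow> x i = y i) \<Longrightarrow> x = y"
        using Suc.IH Suc.prems hp by (metis Suc_leD)
      \<comment> \<open>An integer multiple of \<open>v p\<close> keeps the earlier coordinates and
        moves coordinate \<open>p\<close> to its remainder modulo \<open>a p\<close> plus
        \<open>k * a p\<close>.\<close>
      define F where "F = (\<lambda>(x, k) i. x i + real_of_int (int k - \<lfloor>x p / a p\<rfloor>) * v p i)"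
      have ap: "a p > 0" using a pI by simp
      have F_low: "F (x, k) i = x i" if "i \<in> {h..<p}" for x k i using v(2)[OF pI that]
        by (simp add: F_def)
      have F_p: "F (x, k) p = (x p - real_of_int \<lfloor>x p / a p\<rfloor> * a p) + real k * a p" for x k
        using a(1)[OF pI] by (simp add: F_def algebra_simps)
      have rest: "0 \<le> x p - real_of_int \<lfloor>x p / a p\<rfloor> * a p" "x p - real_of_int \<lfloor>x p / a p\<rfloor> * a p < a p"
        for x
        using floor_divide_lower[OF ap, of "x p"] floor_divide_upper[OF ap, of "x p"]
          by (auto simp: algebra_simps)
      have F_inj: "x = y \<and> k = l" if "x \<in> A" "y \<in> A" "\<And>i. i \<in> {h..<Suc p} \<Longrightarrow> F (x, k) i = F (y, l) i"
        for x y k l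
      proof -
        have "x i = y i" if "i \<in> {h..<p}" for i
          using that F_low[OF that] \<open>\<And>i. i \<in> {h..<Suc p} \<Longrightarrow> F (x, k) i = F (y, l) i\<close>[of i] by simp
        then have "x = y" using inj that by blast
        moreover have "F (x, k) p = F (y, l) p" using that(3)[of p] hp by simp
        ultimately show ?thesis using ap by (simp add: F_p)
      qed
      define A' where "A' = F ` (A \<times> {..<K p})"
      have injF: "inj_on F (A \<times> {..<K p})"
      proof (rule inj_onI)
        fix z w assume z: "z \<in> A \<times> {..<K p}" and w: "w \<in> A \<times> {..<K p}" and eq: "F z = F w"
        obtain x k y l where zw: "z = (x, k)" "w = (y, l)" by (cases z; cases w) auto
        have "x = y \<and> k = l" by (rule F_inj) (use z w eq zw in auto)
        then show "z = w" using zw by simp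
      qed
      have "card A' = card A * K p" unfolding A'_def
        by (simp add: card_image[OF injF] card_cartesian_product)
      also have "\<dots> = (\<Prod>i\<in>{h..<Suc p}. K i)" unfolding A(3) using hp
        by (simp add: prod.atLeastLessThan_Suc)
      finally have card: "card A' = (\<Prod>i\<in>{h..<Suc p}. K i)" .
      have "A' \<subseteq> L"
      proof
        fix z assume "z \<in> A'"
        then obtain x k where x: "x \<in> A" "z = F (x, k)" by (auto simp: A'_def)
        have "(\<lambda>i. x i + real_of_int (int k - \<lfloor>x p / a p\<rfloor>) * v p i) \<in> L"
          using x(1) A(1) by (intro int_mult v(1)[OF pI]) blast
        then show "z \<in> L" unfolding x(2) F_def by simp
      qed
      moreover have "finite A'" unfolding A'_def using A(2) by simp
      moreover have "0 \<le> z i \<and> z i < real N * R i" if z: "z \<in> A'" and i: "i \<in> {h..<Suc p}" for z i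
      proof -
        obtain x k where x: "x \<in> A" "k < K p" "z = F (x, k)" using z by (auto simp: A'_def)
        show ?thesis
        proof (cases "i = p")
          case True
          have "(real k + 1) * a p \<le> real (K p) * a p" using x(2) ap by (intro mult_right_mono) auto
          then have "(real k + 1) * a p \<le> real N * R p" using K(1)[OF pI] by linarith
          then show ?thesis unfolding True x(3) F_p using rest[of x] ap
            by (auto simp: distrib_right intro: add_nonneg_nonneg)
        next
          case False
          then show ?thesis using F_low[of i x k] box[OF x(1), of i] i x(3) by simp
        qed
      qed
      moreover have "z = w" if zw: "z \<in> A'" "w \<in> A'" "\<forall>i\<in>{h..<Suc p}. z i = w i" for z w
      proof -
        obtain x k y l where "x \<in> A" "z = F (x, k)" "y \<in> A" "w = F (y, l)" using zw(1,2)
          by (auto simp: A'_def)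
        then show ?thesis using F_inj[of x y k l] zw(3) by blast
      qed
      ultimately show ?thesis using card by (intro exI[of _ A']) blast
    qed
  qed
  from this[of "Suc n"] hn obtain A where A: "A \<subseteq> L" "finite A" "card A = (\<Prod>i\<in>{h..<Suc n}. K i)"
    and box: "\<And>x i. x \<in> A \<Longrightarrow> i \<in> {h..<Suc n} \<Longrightarrow> 0 \<le> x i \<and> x i < real N * R i"
    and inj: "\<And>x y. x \<in> A \<Longrightarrow> y \<in> A \<Longrightarrow> (\<And>i. i \<in> {h..<Suc n} \<Longrightarrow> x i = y i) \<Longrightarrow> x = y"
      by (metis le_SucI order_refl)
  have I: "{h..<Suc n} = {h..n}" by auto
  \<comment> \<open>The large box consists of \<open>N\<close> cells of side \<open>R i\<close> in
    each direction; with more points than cells, two share a cell, and their difference is the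
    vector sought.\<close>
  define c where "c x = (\<lambda>i\<in>{h..n}. nat \<lfloor>x i / R i\<rfloor>)" for x :: "nat \<Rightarrow> real"
  have c: "c x \<in> PiE {h..n} (\<lambda>_. {..<N})" if x: "x \<in> A" for x
  proof -
    have "nat \<lfloor>x i / R i\<rfloor> < N" if i: "i \<in> {h..n}" for i
    proof -
      have "0 \<le> x i" "x i < real N * R i" using box[OF x, of i] i I by auto
      then have "0 \<le> x i / R i" "x i / R i < real N" using R[OF i] by (simp_all add: pos_divide_less_eq)
      then show ?thesis by linarith
    qed
    then show ?thesis by (auto simp: c_def)
  qed
  have "card (PiE {h..n} (\<lambda>_. {..<N})) < card A"
  proof -
    have "real N ^ card {h..n} * (\<Prod>i\<in>{h..n}. 2 * a i) < real N ^ card {h..n} * (\<Prod>i\<in>{h..n}. R i)"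
      using vol N by simp
    also have "\<dots> = (\<Prod>i\<in>{h..n}. real N * R i)" by (simp add: prod.distrib)
    also have "\<dots> \<le> (\<Prod>i\<in>{h..n}. real (K i) * (2 * a i))"
      using K(2) R N by (intro prod_mono) (auto intro!: mult_nonneg_nonneg less_imp_le)
    also have "\<dots> = real (card A) * (\<Prod>i\<in>{h..n}. 2 * a i)" unfolding A(3) I prod.distrib of_nat_prod ..
    finally have lt: "real N ^ card {h..n} * (\<Prod>i\<in>{h..n}. 2 * a i)
      < real (card A) * (\<Prod>i\<in>{h..n}. 2 * a i)" .
    have "(\<Prod>i\<in>{h..n}. 2 * a i) > 0" using a(2) by (intro prod_pos) simp
    then have "real N ^ card {h..n} < real (card A)"
      by (rule mult_right_less_imp_less[OF lt less_imp_le])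
    then have "N ^ card {h..n} < card A" by (simp only: of_nat_power[symmetric] of_nat_less_iff)
    then show ?thesis by (simp add: card_PiE)
  qed
  moreover have "card (c ` A) \<le> card (PiE {h..n} (\<lambda>_. {..<N}))"
    using c by (intro card_mono finite_PiE) auto
  ultimately have "\<not> inj_on c A" using card_image[of c A] by auto
  then obtain x y where xy: "x \<in> A" "y \<in> A" "c x = c y" "x \<noteq> y" by (auto simp: inj_on_def)
  have close: "\<bar>x i - y i\<bar> < R i" if i: "i \<in> {h..n}" for i
  proof -
    have "0 \<le> x i" "0 \<le> y i" using box[OF xy(1), of i] box[OF xy(2), of i] i I by auto
    moreover have "nat \<lfloor>x i / R i\<rfloor> = nat \<lfloor>y i / R i\<rfloor>" using fun_cong[OF xy(3), of i] i
      by (simp add: c_def)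
    ultimately have "\<lfloor>x i / R i\<rfloor> = \<lfloor>y i / R i\<rfloor>" using R[OF i] by (simp add: eq_nat_nat_iff)
    then have "\<bar>x i / R i - y i / R i\<bar> < 1" by linarith
    then have "\<bar>x i - y i\<bar> / R i < 1" using R[OF i]
      by (simp add: diff_divide_distrib[symmetric] abs_divide)
    then show ?thesis using R[OF i] by (simp add: pos_divide_less_eq)
  qed
  obtain i where "i \<in> {h..n}" "x i \<noteq> y i" using inj[OF xy(1,2)] xy(4) I by blast
  then show thesis using that[of "\<lambda>i. x i - y i" i] close diff xy A(1) by auto
qed

section \<open>Triangular bases of cocompact lattices\<close>

context witt_group
begin

text \<open>Outside a neighbourhood isolating \<open>\<one>\<close>, the sum of the coordinate sizes
  attains a positive minimum on the compact unit box.\<close>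

lemma discrete_imp_small_trivial:
  assumes "discrete \<Gamma>" "\<one> \<in> \<Gamma>"
  obtains \<epsilon> where "\<epsilon> > 0" "\<And>\<gamma>. \<gamma> \<in> \<Gamma> \<Longrightarrow> (\<And>m. m \<in> {1..n} \<Longrightarrow> \<bar>d m \<gamma>\<bar> < \<epsilon>) \<Longrightarrow> \<gamma> = \<one>"
proof -
  have "\<one> isolated_in \<Gamma>" using assms by (simp add: discrete_def)
  then obtain T where T: "open T" "T \<inter> \<Gamma> = {\<one>}" unfolding isolated_in_def by blast
  let ?Q = "cBox (\<lambda>_. 1) - T"
  have Q: "compact ?Q" by (rule compact_diff[OF compact_cBox T(1)])
  show thesis
  proof (cases "?Q = {}")
    case True
    have "\<gamma> = \<one>" if "\<gamma> \<in> \<Gamma>" "\<And>m. m \<in> {1..n} \<Longrightarrow> \<bar>d m \<gamma>\<bar> < 1" for \<gamma>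
    proof -
      have "\<gamma> \<in> cBox (\<lambda>_. 1)" using that(2) unfolding cBox_def by (simp add: less_imp_le)
      then show ?thesis using True T(2) that(1) by blast
    qed
    then show thesis using that[of 1] by simp
  next
    case False
    define f where "f x = (\<Sum>m\<in>{1..n}. \<bar>d m x\<bar>)" for x
    have "continuous_on ?Q f" unfolding f_def
      by (intro continuous_intros continuous_on_subset[OF continuous_d]) auto
    then obtain x0 where x0: "x0 \<in> ?Q" "\<And>x. x \<in> ?Q \<Longrightarrow> f x0 \<le> f x"
      using continuous_attains_inf[OF Q False] by blast
    have "f x0 > 0"
    proof (rule ccontr)
      assume "\<not> f x0 > 0"
      moreover have "f x0 \<ge> 0" unfolding f_def by (intro sum_nonneg) auto
      ultimately have "f x0 = 0" by simp
      then have "\<forall>m\<in>{1..n}. d m x0 = 0" unfolding f_def by (subst (asm) sum_nonneg_eq_0_iff) auto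
      then have "x0 = \<one>" by (intro d_inj) (simp add: d_one)
      then show False using x0(1) T(2) by blast
    qed
    define \<epsilon> where "\<epsilon> = min 1 (f x0 / real n)"
    have "\<epsilon> > 0" using \<open>f x0 > 0\<close> n3 by (simp add: \<epsilon>_def)
    moreover have "\<gamma> = \<one>" if g: "\<gamma> \<in> \<Gamma>" and small: "\<And>m. m \<in> {1..n} \<Longrightarrow> \<bar>d m \<gamma>\<bar> < \<epsilon>" for \<gamma>
    proof -
      have "\<gamma> \<in> cBox (\<lambda>_. 1)" using small unfolding cBox_def \<epsilon>_def by (simp add: less_imp_le)
      moreover have "f \<gamma> < f x0"
      proof -
        have "f \<gamma> < (\<Sum>m\<in>{1..n}. \<epsilon>)" unfolding f_def using small n3 by (intro sum_strict_mono) auto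
        also have "\<dots> = real n * \<epsilon>" by simp
        also have "\<dots> \<le> real n * (f x0 / real n)" by (intro mult_left_mono) (auto simp: \<epsilon>_def)
        also have "\<dots> = f x0" using n3 by simp
        finally show ?thesis .
      qed
      ultimately have "\<gamma> \<in> T" using x0(2)[of \<gamma>] by fastforce
      then show ?thesis using T(2) g by blast
    qed
    ultimately show thesis using that by blast
  qed
qed

lemma additive_int_pow:
  assumes hom: "\<And>x y. f (x \<otimes> y) = f x + (f y :: real)"
  shows "f (x [^] (k::int)) = real_of_int k * f x"
proof -
  have 1: "f \<one> = 0" using hom[of \<one> \<one>] by simp
  have inv: "f (inv x) = - f x" for x using hom[of x "inv x"] 1 by simp
  have nat: "f (x [^] (j::nat)) = real j * f x" for j
    by (induction j) (simp_all add: 1 hom distrib_right)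
  show ?thesis
    unfolding int_pow_def2[of G x k] Let_def
    by (cases "k < 0") (simp_all only: if_True if_False inv nat, simp_all)
qed

lemma d1_hom: "d 1 (x \<otimes> y) = d 1 x + d 1 y" using d_mult[of 1 x y] n3 by simp

lemma d2_hom: "d 2 (x \<otimes> y) = d 2 x + d 2 y"
proof -
  have "{1..<2::nat} = {1}" by auto
  moreover have "2 \<in> {1..n}" using n3 by simp
  ultimately show ?thesis using d_mult[of 2 x y] K_lev[of x 1 1] by (simp add: lev_1)
qed

definition lead :: "'g set \<Rightarrow> nat \<Rightarrow> real set" where "lead \<Gamma> i = d i ` (\<Gamma> \<inter> lev i)"

lemma lead_diff:
  assumes sub: "subgroup \<Gamma> G" and i: "i \<in> {1..n}" and xy: "x \<in> lead \<Gamma> i" "y \<in> lead \<Gamma> i"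
  shows "x - y \<in> lead \<Gamma> i"
proof -
  obtain g h where g: "g \<in> \<Gamma>" "g \<in> lev i" "x = d i g" and h: "h \<in> \<Gamma>" "h \<in> lev i" "y = d i h"
    using xy by (auto simp: lead_def)
  have ih: "inv h \<in> lev i" "d i (inv h) = - y" using inv_lev[OF h(2)] d_inv[OF h(2), of i] i h(3)
    by auto
  have "g \<otimes> inv h \<in> \<Gamma> \<inter> lev i" using sub g h ih i
    by (auto intro: subgroup.m_closed subgroup.m_inv_closed mult_lev)
  moreover have "d i (g \<otimes> inv h) = x - y" using d_mult_left[OF g(2), of i "inv h"] i ih(2) g(3) by simp
  ultimately show ?thesis unfolding lead_def by (metis image_eqI)
qed

lemma lead_comm:
  assumes sub: "subgroup \<Gamma> G" and x: "x \<in> lead \<Gamma> i" and y: "y \<in> lead \<Gamma> j"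
    and ij: "i > 0" "j > 0" "i + j \<le> n"
  shows "(real i - real j) * x * y \<in> lead \<Gamma> (i + j)"
proof -
  obtain g h where g: "g \<in> \<Gamma>" "g \<in> lev i" "x = d i g" and h: "h \<in> \<Gamma>" "h \<in> lev j" "y = d j h"
    using x y by (auto simp: lead_def)
  have "comm g h \<in> \<Gamma>" unfolding comm_def using sub g h
    by (auto intro: subgroup.m_closed subgroup.m_inv_closed)
  then show ?thesis unfolding lead_def using comm_lev[OF g(2) h(2) ij] g(3) h(3)
    by (metis IntI image_eqI)
qed

definition lead_discrete :: "'g set \<Rightarrow> nat \<Rightarrow> bool" where
  "lead_discrete \<Gamma> i \<longleftrightarrow> (\<exists>\<epsilon>>0. \<forall>x\<in>lead \<Gamma> i. \<bar>x\<bar> < \<epsilon> \<longrightarrow> x = 0)"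

text \<open>The commutator with a fixed element of level \<open>j\<close> multiplies leading
  coordinates by a nonzero constant, which carries discreteness from level \<open>i + j\<close> down
  to level \<open>i\<close>.\<close>

lemma lead_discrete_comm:
  assumes sub: "subgroup \<Gamma> G" and y: "y \<in> lead \<Gamma> j" "y \<noteq> 0" and ij: "i > 0" "j > 0" "i + j \<le> n" "i \<noteq> j"
    and disc: "lead_discrete \<Gamma> (i + j)"
  shows "lead_discrete \<Gamma> i"
proof -
  obtain \<epsilon> where \<epsilon>: "\<epsilon> > 0" "\<forall>x\<in>lead \<Gamma> (i + j). \<bar>x\<bar> < \<epsilon> \<longrightarrow> x = 0" using disc
    by (auto simp: lead_discrete_def)
  define c where "c = (real i - real j) * y"
  have c: "c \<noteq> 0" using y ij by (simp add: c_def)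
  have "x = 0" if x: "x \<in> lead \<Gamma> i" "\<bar>x\<bar> < \<epsilon> / \<bar>c\<bar>" for x
  proof -
    have "c * x \<in> lead \<Gamma> (i + j)" using lead_comm[OF sub x(1) y(1) ij(1-3)]
      by (simp add: c_def ac_simps)
    moreover have "\<bar>c * x\<bar> < \<epsilon>" using x(2) c by (simp add: abs_mult pos_less_divide_eq mult.commute)
    ultimately have "c * x = 0" using \<epsilon>(2) by blast
    then show ?thesis using c by simp
  qed
  then show ?thesis unfolding lead_discrete_def using \<epsilon>(1) c by (intro exI[of _ "\<epsilon> / \<bar>c\<bar>"]) auto
qed

lemma lead_cyclic:
  assumes sub: "subgroup \<Gamma> G" and i: "i \<in> {1..n}" and disc: "lead_discrete \<Gamma> i"
    and y: "y \<in> lead \<Gamma> i" "y \<noteq> 0"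
  obtains a where "a > 0" "a \<in> lead \<Gamma> i" "\<And>x. x \<in> lead \<Gamma> i \<Longrightarrow> \<exists>k::int. x = real_of_int k * a"
proof -
  obtain \<epsilon> where \<epsilon>: "\<epsilon> > 0" "\<And>x. x \<in> lead \<Gamma> i \<Longrightarrow> \<bar>x\<bar> < \<epsilon> \<Longrightarrow> x = 0" using disc
    by (auto simp: lead_discrete_def)
  show thesis
    by (rule real_subgroup_cyclic[OF lead_diff[OF sub i] \<epsilon> y]) (use that in blast)+
qed

text \<open>Each level needs a nonzero and a discrete set of leading coordinates. Nonzero elements
  at levels at least 3 come from commutators, discreteness is carried down from the top level, and
  level 2 follows from discreteness at level 1. The latter uses an element at level
  \<open>n - 1\<close>, already available because \<open>n - 1 \<ge> 3\<close>.\<close>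

lemma cocompact_imp_box_group:
  assumes n4: "n \<ge> 4" and sub: "subgroup \<Gamma> G" and disc: "discrete \<Gamma>"
    and comp: "compact_space (coset_topology G \<Gamma>)"
  obtains a where "box_group \<Gamma> a"
proof -
  obtain R0 :: real where R0: "\<And>g. \<exists>\<gamma>\<in>\<Gamma>. \<gamma> \<otimes> g \<in> oBox (\<lambda>_. R0)"
    using compact_quotient_imp_bounded[OF sub comp] by blast
  define R where "R = \<bar>R0\<bar> + 1"
  have R: "R > 0" and R_bound: "\<exists>\<gamma>\<in>\<Gamma>. \<bar>d 1 \<gamma> + d 1 g\<bar> < R \<and> \<bar>d 2 \<gamma> + d 2 g\<bar> < R" for g
  proof -
    show "R > 0" by (simp add: R_def)
    obtain \<gamma> where g: "\<gamma> \<in> \<Gamma>" "\<gamma> \<otimes> g \<in> oBox (\<lambda>_. R0)" using R0 by blast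
    have "1 \<in> {1..n}" "2 \<in> {1..n}" using n3 by auto
    then have "\<bar>d 1 (\<gamma> \<otimes> g)\<bar> < R0" "\<bar>d 2 (\<gamma> \<otimes> g)\<bar> < R0" using g(2) unfolding oBox_def by blast+
    then show "\<exists>\<gamma>\<in>\<Gamma>. \<bar>d 1 \<gamma> + d 1 g\<bar> < R \<and> \<bar>d 2 \<gamma> + d 2 g\<bar> < R"
      using g(1) unfolding d1_hom d2_hom R_def by (intro bexI[of _ \<gamma>]) auto
  qed
  have d12: "d 1 (mk c) = c 1" "d 2 (mk c) = c 2" for c using d_mk[of 1 c] d_mk[of 2 c] n3 by auto
  \<comment> \<open>The two elements lie within \<open>R\<close> of \<open>(4 R, 0)\<close> and
    \<open>(0, 4 R)\<close> in the coordinates \<open>d 1\<close> and \<open>d 2\<close>. Their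
    determinant cannot vanish, since \<open>(3 R)^2\<close> exceeds \<open>R^2\<close>.\<close>
  obtain \<gamma> where \<gamma>: "\<gamma> \<in> \<Gamma>" "\<bar>d 1 \<gamma> - 4 * R\<bar> < R" "\<bar>d 2 \<gamma>\<bar> < R"
    using R_bound[of "mk (\<lambda>i. if i = 1 then - 4 * R else 0)"] unfolding d12 by auto
  obtain \<delta> where \<delta>: "\<delta> \<in> \<Gamma>" "\<bar>d 1 \<delta>\<bar> < R" "\<bar>d 2 \<delta> - 4 * R\<bar> < R"
    using R_bound[of "mk (\<lambda>i. if i = 2 then - 4 * R else 0)"] unfolding d12 by auto
  have det: "d 2 \<gamma> * d 1 \<delta> - d 2 \<delta> * d 1 \<gamma> < 0"
  proof -
    have "\<bar>d 2 \<gamma> * d 1 \<delta>\<bar> \<le> R * R" unfolding abs_mult using \<gamma> \<delta> by (intro mult_mono) auto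
    moreover have "(3 * R) * (3 * R) \<le> d 2 \<delta> * d 1 \<gamma>" using \<gamma> \<delta> R by (intro mult_mono) auto
    moreover have "R * R > 0" using R by simp
    ultimately show ?thesis by linarith
  qed
  have \<gamma>1: "d 1 \<gamma> > 0" using \<gamma>(2) R by linarith
  have lead1: "d 1 \<gamma> \<in> lead \<Gamma> 1" "d 1 \<delta> \<in> lead \<Gamma> 1" using \<gamma>(1) \<delta>(1) by (auto simp: lead_def lev_1)
  have lead3: "\<exists>y\<in>lead \<Gamma> 3. y \<noteq> 0"
  proof -
    let ?c = "comm \<gamma> \<delta>"
    \<comment> \<open>The factor \<open>p - q\<close> is zero for \<open>p = q = 1\<close>, so the
      commutator falls into \<open>lev 3\<close>, where its coordinate is the determinant.\<close>
    have c: "?c \<in> lev 2" "d 2 ?c = 0" using comm_lev[of \<gamma> 1 \<delta> 1] n3 by (auto simp: lev_1 numeral_2_eq_2)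
    then have c3: "?c \<in> lev 3" using lev_Suc[of 2 ?c] by (simp add: numeral_3_eq_3 numeral_2_eq_2)
    have three: "3 \<in> {1..n}" using n3 by simp
    have I: "{1..<3::nat} = {1, 2}" by auto
    have m: "d 3 (x \<otimes> y) = d 3 x + d 3 y - d 2 y * d 1 x" for x y
      unfolding d_mult[OF three] I using K_lev[of x 1 2] K_1[of 2 x] by (simp add: lev_1)
    have "d 3 (?c \<otimes> (\<delta> \<otimes> \<gamma>)) = d 3 ?c + d 3 (\<delta> \<otimes> \<gamma>)" using d_mult_left[OF c3, of 3] three by simp
    then have "d 3 ?c = d 2 \<gamma> * d 1 \<delta> - d 2 \<delta> * d 1 \<gamma>" unfolding comm_mult by (simp add: m)
    moreover have "?c \<in> \<Gamma>" unfolding comm_def using sub \<gamma>(1) \<delta>(1)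
      by (auto intro: subgroup.m_closed subgroup.m_inv_closed)
    then have "d 3 ?c \<in> lead \<Gamma> 3" using c3 unfolding lead_def by blast
    ultimately show ?thesis using det by (intro bexI[of _ "d 3 ?c"]) simp_all
  qed
  have lead_ge3: "i \<ge> 3 \<Longrightarrow> i \<le> n \<Longrightarrow> \<exists>y\<in>lead \<Gamma> i. y \<noteq> 0" for i
  proof (induction i rule: nat_induct_at_least)
    case base
    then show ?case using lead3 by simp
  next
    case (Suc i)
    then obtain y where y: "y \<in> lead \<Gamma> i" "y \<noteq> 0" by auto
    have "(real 1 - real i) * d 1 \<gamma> * y \<in> lead \<Gamma> (1 + i)" using lead_comm[OF sub lead1(1) y(1)] Suc
      by simp
    moreover have "(real 1 - real i) * d 1 \<gamma> * y \<noteq> 0" using Suc.hyps \<gamma>1 y(2) by simp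
    ultimately show ?case by (simp only: plus_1_eq_Suc) blast
  qed
  obtain \<epsilon> where \<epsilon>: "\<epsilon> > 0" "\<And>\<gamma>. \<gamma> \<in> \<Gamma> \<Longrightarrow> (\<And>m. m \<in> {1..n} \<Longrightarrow> \<bar>d m \<gamma>\<bar> < \<epsilon>) \<Longrightarrow> \<gamma> = \<one>"
    using discrete_imp_small_trivial[OF disc subgroup.one_closed[OF sub]] by blast
  have disc_n: "lead_discrete \<Gamma> n"
  proof -
    have "x = 0" if x: "x \<in> lead \<Gamma> n" "\<bar>x\<bar> < \<epsilon>" for x
    proof -
      obtain g where g: "g \<in> \<Gamma>" "g \<in> lev n" "x = d n g" using x(1) by (auto simp: lead_def)
      have "\<bar>d m g\<bar> < \<epsilon>" if "m \<in> {1..n}" for m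
        using g x(2) \<epsilon>(1) that by (cases "m = n") (auto simp: lev_def)
      then have "g = \<one>" using \<epsilon>(2) g(1) by blast
      then show ?thesis using g(3) d_one[of n] n3 by simp
    qed
    then show ?thesis unfolding lead_discrete_def using \<epsilon>(1) by blast
  qed
  have disc_1: "lead_discrete \<Gamma> 1"
  proof -
    have n3: "3 \<le> n - 1" "n - 1 \<le> n" using n4 by linarith+
    obtain y where y: "y \<in> lead \<Gamma> (n - 1)" "y \<noteq> 0" using lead_ge3[OF n3] by blast
    have "1 + (n - 1) = n" using n4 by simp
    then show ?thesis using lead_discrete_comm[OF sub y, of 1] disc_n n4 by simp
  qed
  have lead2: "\<exists>y\<in>lead \<Gamma> 2. y \<noteq> 0"
  proof -
    have one: "1 \<in> {1..n}" using n3 by simp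
    have g1: "d 1 \<gamma> \<noteq> 0" using \<gamma>1 by simp
    obtain a where a: "a > 0" "\<And>x. x \<in> lead \<Gamma> 1 \<Longrightarrow> \<exists>k::int. x = real_of_int k * a"
      using lead_cyclic[OF sub one disc_1 lead1(1) g1] by blast
    obtain k l :: int where kl: "d 1 \<gamma> = real_of_int k * a" "d 1 \<delta> = real_of_int l * a" using a(2) lead1
      by metis
    \<comment> \<open>Both first coordinates are multiples of \<open>a\<close>, so this combination
      has \<open>d 1 z = 0\<close>, while \<open>a * d 2 z\<close> is the nonzero
      determinant.\<close>
    define z where "z = (\<gamma> [^] l) \<otimes> (\<delta> [^] (- k))"
    have zG: "z \<in> \<Gamma>" unfolding z_def using sub \<gamma>(1) \<delta>(1)
      by (auto intro: subgroup.m_closed subgroup_int_pow)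
    have "d 1 z = real_of_int l * d 1 \<gamma> - real_of_int k * d 1 \<delta>"
      unfolding z_def d1_hom additive_int_pow[of "d 1", OF d1_hom] by simp
    then have z1: "d 1 z = 0" using kl by simp
    have dz: "d 2 z = real_of_int l * d 2 \<gamma> - real_of_int k * d 2 \<delta>"
      unfolding z_def d2_hom additive_int_pow[of "d 2", OF d2_hom] by simp
    have "a * d 2 z = d 2 \<gamma> * d 1 \<delta> - d 2 \<delta> * d 1 \<gamma>" unfolding kl dz by (simp add: algebra_simps)
    then have "d 2 z \<noteq> 0" using det by auto
    moreover have "z \<in> lev 2" unfolding lev_def using z1 by (auto simp: numeral_2_eq_2 less_Suc_eq)
    ultimately show ?thesis using zG unfolding lead_def by blast
  qed
  have lead_nz: "\<exists>y\<in>lead \<Gamma> i. y \<noteq> 0" if i: "i \<in> {1..n}" for i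
  proof -
    consider "i = 1" | "i = 2" | "i \<ge> 3" using i by fastforce
    then show ?thesis
    proof cases
      case 1
      have "d 1 \<gamma> \<noteq> 0" using \<gamma>1 by simp
      then show ?thesis using lead1(1) unfolding 1 by blast
    qed (use lead2 lead_ge3 i in auto)
  qed
  have disc_ne: "lead_discrete \<Gamma> i" if i: "i \<in> {1..n}" "2 * i \<noteq> n" for i
  proof (cases "i = n")
    case False
    then have j: "n - i \<in> {1..n}" "i + (n - i) = n" "i \<noteq> n - i" using i by auto
    obtain y where y: "y \<in> lead \<Gamma> (n - i)" "y \<noteq> 0" using lead_nz[OF j(1)] by blast
    show ?thesis using lead_discrete_comm[OF sub y, of i] disc_n j i by simp
  qed (simp add: disc_n)
  have disc_all: "lead_discrete \<Gamma> i" if i: "i \<in> {1..n}" for i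
  \<comment> \<open>The middle level cannot be paired with itself; it is paired with level
    \<open>i - 1\<close>, and their sum \<open>n - 1\<close> is a level already known to be
    discrete.\<close>
  proof (cases "2 * i = n")
    case True
    then have j: "i - 1 \<in> {1..n}" "i + (i - 1) = n - 1" "i \<noteq> i - 1" "n - 1 \<in> {1..n}" "2 * (n - 1) \<noteq> n"
      using n4 by auto
    obtain y where y: "y \<in> lead \<Gamma> (i - 1)" "y \<noteq> 0" using lead_nz[OF j(1)] by blast
    show ?thesis using lead_discrete_comm[OF sub y, of i] disc_ne[OF j(4,5)] j i by simp
  qed (rule disc_ne[OF i])
  have "\<exists>a. a > 0 \<and> a \<in> lead \<Gamma> i \<and> (\<forall>x\<in>lead \<Gamma> i. \<exists>k::int. x = real_of_int k * a)" if i: "i \<in> {1..n}"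
    for i
    using lead_cyclic[OF sub i disc_all[OF i]] lead_nz[OF i] by metis
  then obtain a where a: "\<And>i. i \<in> {1..n} \<Longrightarrow> a i > 0 \<and> a i \<in> lead \<Gamma> i
    \<and> (\<forall>x\<in>lead \<Gamma> i. \<exists>k::int. x = real_of_int k * a i)"
    by metis
  have "box_group \<Gamma> a"
    unfolding box_group_def
  proof (intro conjI ballI)
    show "subgroup \<Gamma> G" by (rule sub)
    fix m assume m: "m \<in> {1..n}"
    show "0 < a m" using a[OF m] by blast
    have "a m \<in> d m ` (\<Gamma> \<inter> lev m)" using a[OF m] unfolding lead_def by blast
    then show "\<exists>\<gamma>\<in>\<Gamma> \<inter> lev m. d m \<gamma> = a m" by (auto simp: image_iff)
    fix x assume "x \<in> \<Gamma> \<inter> lev m"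
    then show "\<exists>k::int. d m x = real_of_int k * a m" using a[OF m] unfolding lead_def by blast
  qed
  then show thesis by (rule that)
qed

lemma box_group_lead: "box_group \<Gamma> a \<Longrightarrow> m \<in> {1..n} \<Longrightarrow> a m \<in> lead \<Gamma> m"
proof -
  assume "box_group \<Gamma> a" "m \<in> {1..n}"
  then obtain \<gamma> where "\<gamma> \<in> \<Gamma> \<inter> lev m" "d m \<gamma> = a m" using box_groupD(2) by blast
  then show ?thesis unfolding lead_def by (intro image_eqI[of _ _ \<gamma>]) auto
qed

text \<open>The number \<open>(i - j) * a i * a j\<close> is a nonzero leading coordinate at level
  \<open>i + j\<close>, hence a nonzero multiple of \<open>a (i + j)\<close>.\<close>

lemma box_group_comm_le:
  assumes box: "box_group \<Gamma> a" and ij: "i > 0" "j > 0" "i + j \<le> n" "i \<noteq> j"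
  shows "a (i + j) \<le> real n * a i * a j"
proof -
  have sub: "subgroup \<Gamma> G" using box by (simp add: box_group_def)
  have I: "i \<in> {1..n}" "j \<in> {1..n}" "i + j \<in> {1..n}" using ij by auto
  have "a i \<in> lead \<Gamma> i" "a j \<in> lead \<Gamma> j"
    using box_group_lead[OF box] I by blast+
  then have "(real i - real j) * a i * a j \<in> lead \<Gamma> (i + j)" using lead_comm[OF sub _ _ ij(1-3)]
    by blast
  then obtain k :: int where k: "(real i - real j) * a i * a j = real_of_int k * a (i + j)"
  proof -
    assume *: "\<And>k::int. (real i - real j) * a i * a j = real_of_int k * a (i + j) \<Longrightarrow> thesis"
    obtain x where x: "x \<in> \<Gamma>" "x \<in> lev (i + j)" "(real i - real j) * a i * a j = d (i + j) x"
      using \<open>(real i - real j) * a i * a j \<in> lead \<Gamma> (i + j)\<close> unfolding lead_def by blast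
    then show thesis using box_groupD(3)[OF box I(3) x(1,2)] * by auto
  qed
  have pos: "a i > 0" "a j > 0" "a (i + j) > 0" using box_groupD(1)[OF box] I by auto
  then have "real_of_int k * a (i + j) \<noteq> 0" using ij(4) k[symmetric] by simp
  then have "k \<noteq> 0" by auto
  then have "1 \<le> \<bar>real_of_int k\<bar>" by linarith
  then have "a (i + j) \<le> \<bar>real_of_int k\<bar> * a (i + j)" using pos by simp
  also have "\<dots> = \<bar>real i - real j\<bar> * (a i * a j)" using arg_cong[OF k, of abs] pos
    by (simp add: abs_mult)
  also have "\<dots> \<le> real n * (a i * a j)" using pos ij by (intro mult_right_mono) auto
  finally show ?thesis by (simp add: mult.assoc)
qed

text \<open>On \<open>lev h\<close> only the coordinate \<open>n = 2 * h\<close> fails to be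
  additive, by \<open>- (h - 1) * d h x * d h y\<close>; the quadratic term completes the
  square.\<close>

lemma theta_additive:
  assumes n: "2 * h = n" and x: "x \<in> lev h" and y: "y \<in> lev h"
  shows "\<theta> (real (h - 1) / 2) h (x \<otimes> y) = \<theta> (real (h - 1) / 2) h x + \<theta> (real (h - 1) / 2) h y"
proof -
  have h: "h > 0" "h \<in> {1..n}" "n \<in> {1..n}" "n \<le> h + h" "h \<le> h + h" "n = h + h" "h \<noteq> h + h" using n n3
    by auto
  have 1: "d n (x \<otimes> y) = d n x + d n y - real (h - 1) * d h x * d h y"
    using d_mult_leading[OF x y h(1,1,3,4)] h(6) by simp
  have 2: "d h (x \<otimes> y) = d h x + d h y"
    using d_mult_leading[OF x y h(1,1,2,5)] h(7) by simp
  show ?thesis unfolding \<theta>_def 1 2 by (simp add: power2_eq_square field_simps)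
qed

text \<open>The coordinates \<open>h, ..., n - 1\<close> together with \<open>\<theta>\<close> form
  a homomorphism from \<open>lev h\<close> to a vector space. It sends the triangular basis of the
  lattice to triangular vectors with the same diagonal \<open>a\<close>, so Minkowski's bound
  applies.\<close>

lemma box_group_short_vector:
  assumes box: "box_group \<Gamma> a" and n: "2 * h = n"
    and R: "\<And>i. i \<in> {h..n} \<Longrightarrow> R i > 0" and vol: "(\<Prod>i\<in>{h..n}. 2 * a i) < (\<Prod>i\<in>{h..n}. R i)"
  obtains \<gamma> where "\<gamma> \<in> \<Gamma>" "\<gamma> \<in> lev h" "\<gamma> \<noteq> \<one>" "\<And>i. i \<in> {h..<n} \<Longrightarrow> \<bar>d i \<gamma>\<bar> < R i"
    "\<bar>\<theta> (real (h - 1) / 2) h \<gamma>\<bar> < R n"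
proof -
  define c where "c = real (h - 1) / 2"
  have sub: "subgroup \<Gamma> G" using box by (simp add: box_group_def)
  have h: "h > 0" "h < n" "h \<le> n" "h \<le> Suc n" using n n3 by auto
  define f where "f x = (\<lambda>i. if i = n then \<theta> c h x else if i \<in> {h..<n} then d i x else 0)" for x
  have th: "\<theta> c h (x \<otimes> y) = \<theta> c h x + \<theta> c h y" if "x \<in> lev h" "y \<in> lev h" for x y
    unfolding c_def by (rule theta_additive[OF n that])
  have one: "\<theta> c h \<one> = 0" using d_one h n3 by (simp add: \<theta>_def)
  have di: "d i (x \<otimes> inv y) = d i x - d i y" if xy: "x \<in> lev h" "y \<in> lev h" and i: "i \<in> {h..<n}"
    for x y i
  proof -
    have hom: "d i (u \<otimes> w) = d i u + d i w" if "u \<in> lev h" "w \<in> lev h" for u w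
      using d_mult_leading[OF that h(1,1), of i] i n h by simp
    have "inv y \<in> lev h" using inv_lev[OF xy(2) h(4)] .
    moreover have "d i (y \<otimes> inv y) = 0" using d_one[of i] i h by simp
    ultimately have "d i (inv y) = - d i y" using hom[OF xy(2), of "inv y"] by simp
    then show ?thesis using hom[OF xy(1) \<open>inv y \<in> lev h\<close>] by simp
  qed
  have ti: "\<theta> c h (x \<otimes> inv y) = \<theta> c h x - \<theta> c h y" if xy: "x \<in> lev h" "y \<in> lev h" for x y
  proof -
    have iy: "inv y \<in> lev h" using inv_lev[OF xy(2) h(4)] .
    have "\<theta> c h (y \<otimes> inv y) = 0" using one by simp
    then have "\<theta> c h (inv y) = - \<theta> c h y" using th[OF xy(2) iy] by simp
    then show ?thesis using th[OF xy(1) iy] by simp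
  qed
  define g where "g i = (SOME \<gamma>. \<gamma> \<in> \<Gamma> \<inter> lev i \<and> d i \<gamma> = a i)" for i
  have g: "g i \<in> \<Gamma>" "g i \<in> lev i" "d i (g i) = a i" if "i \<in> {h..n}" for i
  proof -
    have "i \<in> {1..n}" using that h by auto
    then have "\<exists>\<gamma>. \<gamma> \<in> \<Gamma> \<inter> lev i \<and> d i \<gamma> = a i" using box_groupD(2)[OF box] by blast
    from someI_ex[OF this] show "g i \<in> \<Gamma>" "g i \<in> lev i" "d i (g i) = a i" unfolding g_def by auto
  qed
  obtain x i where x: "x \<in> f ` (\<Gamma> \<inter> lev h)" "i \<in> {h..n}" "x i \<noteq> 0" "\<And>i. i \<in> {h..n} \<Longrightarrow> \<bar>x i\<bar> < R i"
  proof (rule triangular_lattice_short_vector[where L = "f ` (\<Gamma> \<inter> lev h)" and v = "\<lambda>i. f (g i)" and a =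
    a and h = h and n = n and R = R])
    fix x y assume "x \<in> f ` (\<Gamma> \<inter> lev h)" "y \<in> f ` (\<Gamma> \<inter> lev h)"
    then obtain u w where u: "u \<in> \<Gamma>" "u \<in> lev h" "x = f u" and w: "w \<in> \<Gamma>" "w \<in> lev h" "y = f w" by auto
    have "(\<lambda>i. x i - y i) = f (u \<otimes> inv w)"
      unfolding u(3) w(3) f_def using di[OF u(2) w(2)] ti[OF u(2) w(2)] by (intro ext) simp
    moreover have "u \<otimes> inv w \<in> \<Gamma> \<inter> lev h"
      using sub u w inv_lev[OF w(2) h(4)] mult_lev[OF u(2)] h(4)
        by (auto intro: subgroup.m_closed subgroup.m_inv_closed)
    ultimately show "(\<lambda>i. x i - y i) \<in> f ` (\<Gamma> \<inter> lev h)" by blast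
  next
    fix i assume i: "i \<in> {h..n}"
    have "g i \<in> lev h" using lev_mono[of h i] g(2)[OF i] i by simp
    then show "f (g i) \<in> f ` (\<Gamma> \<inter> lev h)" using g(1)[OF i] by blast
    show "a i > 0" using box_groupD(1)[OF box, of i] i h by simp
    have dh: "d h (g i) = 0" if "i = n" using g(2)[OF i] h that by (auto simp: lev_def)
    show "f (g i) i = a i"
      using g(3)[OF i] dh i by (cases "i = n") (auto simp: f_def \<theta>_def)
    fix j assume j: "j \<in> {h..<i}"
    then have "j \<noteq> n" "j \<in> {h..<n}" "j \<in> {1..<i}" using i h by auto
    then show "f (g i) j = 0" using g(2)[OF i] by (simp add: f_def lev_def)
  qed (use h R vol in auto)
  obtain \<gamma> where \<gamma>: "\<gamma> \<in> \<Gamma>" "\<gamma> \<in> lev h" "x = f \<gamma>" using x(1) by auto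
  have "\<gamma> \<noteq> \<one>"
  proof
    assume "\<gamma> = \<one>"
    then have "x i = 0" unfolding \<gamma>(3) f_def using one d_one[of i] h by simp
    then show False using x(3) by simp
  qed
  moreover have "\<bar>d i \<gamma>\<bar> < R i" if "i \<in> {h..<n}" for i
    using x(4)[of i] that unfolding \<gamma>(3) f_def by simp
  moreover have "\<bar>\<theta> c h \<gamma>\<bar> < R n" using x(4)[of n] h unfolding \<gamma>(3) f_def by simp
  ultimately show thesis using that \<gamma> unfolding c_def by blast
qed

end

section \<open>The exponent\<close>

text \<open>In the variables \<open>A i = ln (a i)\<close> the commutator relations, the bound on the centre and
  Minkowski's bound for \<open>lev (n / 2)\<close> form a linear program; for even \<open>n = 2 h\<close> the dual solution
  combines two estimates with weights \<open>h\<close> and \<open>1\<close>.\<close>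

lemma commutator_linear_program:
  fixes A :: "nat \<Rightarrow> real"
  assumes n: "n \<ge> 3" and nonneg: "s \<ge> 0" "\<kappa> \<ge> 0" "l \<ge> 0"
    and comm: "\<And>i j. 0 < i \<Longrightarrow> 0 < j \<Longrightarrow> i + j \<le> n \<Longrightarrow> i \<noteq> j \<Longrightarrow> A (i + j) \<le> \<kappa> + A i + A j"
    and top: "real (n - 1) * s \<le> A n"
    and mink: "\<And>h. 2 * h = n \<Longrightarrow> (\<Sum>i\<in>{h..n}. real (i - 1) * s - l) \<le> (\<Sum>i\<in>{h..n}. A i)"
  shows "(real n * real (n - 1) / 2 + real ((n - 1) div 2)) * s - real n * (\<kappa> + l) \<le> (\<Sum>i\<in>{1..n}. A i)"
proof (cases "even n")
  case False
  then obtain p where p: "n = 2 * p + 1" by (rule oddE)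
  have split: "(\<Sum>i\<in>{1..n}. A i) = (\<Sum>i\<in>{1..p}. A i + A (n - i)) + A n"
  proof -
    have "{1..n} = {1..p} \<union> {p + 1..2 * p} \<union> {n}" using p by auto
    then have "(\<Sum>i\<in>{1..n}. A i) = (\<Sum>i\<in>{1..p} \<union> {p + 1..2 * p}. A i) + A n"
      using p by (simp add: sum.union_disjoint)
    also have "(\<Sum>i\<in>{1..p} \<union> {p + 1..2 * p}. A i) = (\<Sum>i\<in>{1..p}. A i) + (\<Sum>i\<in>{p + 1..2 * p}. A i)"
      by (rule sum.union_disjoint) auto
    also have "(\<Sum>i\<in>{p + 1..2 * p}. A i) = (\<Sum>i\<in>{1..p}. A (n - i))"
      by (rule sum.reindex_bij_witness[of _ "\<lambda>i. n - i" "\<lambda>i. n - i"]) (use p in auto)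
    finally show ?thesis by (simp add: sum.distrib)
  qed
  have "real p * (A n - \<kappa>) = (\<Sum>i\<in>{1..p}. A n - \<kappa>)" by simp
  also have "\<dots> \<le> (\<Sum>i\<in>{1..p}. A i + A (n - i))"
  proof (rule sum_mono)
    fix i assume i: "i \<in> {1..p}"
    have "A (i + (n - i)) \<le> \<kappa> + A i + A (n - i)" by (rule comm) (use i p in auto)
    moreover have "i + (n - i) = n" using i p by auto
    ultimately show "A n - \<kappa> \<le> A i + A (n - i)" by simp
  qed
  finally have "(real p + 1) * A n - real p * \<kappa> \<le> (\<Sum>i\<in>{1..n}. A i)" unfolding split
    by (simp add: algebra_simps)
  moreover have "(real p + 1) * (real (n - 1) * s) \<le> (real p + 1) * A n" using top
    by (intro mult_left_mono) auto
  moreover have "real p * \<kappa> \<le> real n * (\<kappa> + l)" using nonneg p by (intro mult_mono) auto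
  moreover have "(real n * real (n - 1) / 2 + real ((n - 1) div 2)) * s = (real p
    + 1) * (real (n - 1) * s)"
    using p by (simp add: field_simps)
  ultimately show ?thesis by linarith
next
  case True
  then obtain h where h: "n = 2 * h" by (rule evenE)
  have h2: "h \<ge> 2" using n h by linarith
  define X where "X = (\<Sum>i\<in>{1..<h}. A i)"
  define Y where "Y = (\<Sum>i\<in>{1..<h}. A (h + i))"
  have Y1: "Y = (\<Sum>i\<in>{h + 1..<n}. A i)" unfolding Y_def
    by (rule sum.reindex_bij_witness[of _ "\<lambda>i. i - h" "\<lambda>i. h + i"]) (use h in auto)
  have Y2: "Y = (\<Sum>i\<in>{1..<h}. A (n - i))" unfolding Y_def
    by (rule sum.reindex_bij_witness[of _ "\<lambda>i. h - i" "\<lambda>i. h - i"])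
      (use h in \<open>auto intro!: arg_cong[where f = A]\<close>)
  have Tl: "(\<Sum>i\<in>{h..n}. A i) = A h + Y + A n"
  proof -
    have "{h..n} = insert h (insert n {h + 1..<n})" using h h2 by auto
    then show ?thesis unfolding Y1 using h h2 by simp
  qed
  define T where "T = (\<Sum>i\<in>{1..n}. A i)"
  have T: "T = X + A h + Y + A n"
  proof -
    have "{1..n} = {1..<h} \<union> {h..n}" using h h2 by auto
    moreover have "sum A ({1..<h} \<union> {h..n}) = sum A {1..<h} + sum A {h..n}"
      by (rule sum.union_disjoint) auto
    ultimately have "T = X + (\<Sum>i\<in>{h..n}. A i)" unfolding T_def X_def by (simp only:)
    then show ?thesis using Tl by simp
  qed
  \<comment> \<open>This pairs each level \<open>i < h\<close> with \<open>n - i\<close> and leaves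
    out the middle level.\<close>
  have I: "real (h - 1) * (A n - \<kappa>) \<le> X + Y"
  proof -
    have "real (h - 1) * (A n - \<kappa>) = (\<Sum>i\<in>{1..<h}. A n - \<kappa>)" by simp
    also have "\<dots> \<le> (\<Sum>i\<in>{1..<h}. A i + A (n - i))"
    proof (rule sum_mono)
      fix i assume i: "i \<in> {1..<h}"
      have "A (i + (n - i)) \<le> \<kappa> + A i + A (n - i)" by (rule comm) (use i h in auto)
      moreover have "i + (n - i) = n" using i h by auto
      ultimately show "A n - \<kappa> \<le> A i + A (n - i)" by simp
    qed
    also have "\<dots> = X + Y" unfolding X_def Y2 by (rule sum.distrib)
    finally show ?thesis .
  qed
  \<comment> \<open>Commutators with level \<open>h\<close> itself bound the lower levels by the
    upper ones. This converts Minkowski's bound on the upper half into a bound on the whole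
    sum.\<close>
  have II: "Y - real (h - 1) * (\<kappa> + A h) \<le> X"
  proof -
    have "Y - real (h - 1) * (\<kappa> + A h) = (\<Sum>i\<in>{1..<h}. A (h + i) - (\<kappa> + A h))"
      unfolding Y_def by (simp add: sum_subtractf)
    also have "\<dots> \<le> X" unfolding X_def
    proof (rule sum_mono)
      fix i assume i: "i \<in> {1..<h}"
      have "A (h + i) \<le> \<kappa> + A h + A i" by (rule comm) (use i h in auto)
      then show "A (h + i) - (\<kappa> + A h) \<le> A i" by simp
    qed
    finally show ?thesis .
  qed
  define Q where "Q = (\<Sum>i\<in>{h..n}. real (i - 1) * s - l)"
  have III: "Q \<le> A h + Y + A n" using mink[of h] h unfolding Tl Q_def by simp
  have Q: "2 * Q = (real h + 1) * ((3 * real h - 2) * s - 2 * l)"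
  proof -
    have "2 * (\<Sum>i\<in>{h..h + k}. real (i - 1)) = (real k + 1) * (2 * real h + real k - 2)" for k
    proof (induction k)
      case 0
      then show ?case using h2 by (simp add: of_nat_diff)
    next
      case (Suc k)
      have "{h..h + Suc k} = insert (h + Suc k) {h..h + k}" by auto
      then have "2 * (\<Sum>i\<in>{h..h + Suc k}. real (i - 1)) = 2 * (real h + real k) + 2 * (\<Sum>i\<in>{h..h
        + k}. real (i - 1))"
        by simp
      then show ?case unfolding Suc by (simp add: algebra_simps)
    qed
    note kh = this[of h]
    have hh: "h + h = n" "2 * real h + real h = 3 * real h" using h by simp_all
    have *: "2 * (\<Sum>i\<in>{h..n}. real (i - 1)) = (real h + 1) * (3 * real h - 2)"
      using kh unfolding hh .
    have "card {h..n} = h + 1" using h by auto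
    then have c: "(\<Sum>i\<in>{h..n}. l) = real (h + 1) * l" by (simp only: sum_constant)
    have "Q = (\<Sum>i\<in>{h..n}. real (i - 1)) * s - real (h + 1) * l"
      unfolding Q_def sum_subtractf sum_distrib_right c ..
    then have "2 * Q = (2 * (\<Sum>i\<in>{h..n}. real (i - 1))) * s - 2 * (real (h + 1) * l)" by simp
    then show ?thesis unfolding * by (simp add: algebra_simps)
  qed
  have hr: "real (h - 1) = real h - 1" "real (n - 1) = 2 * real h - 1" using h2 h
    by (simp_all add: of_nat_diff)
  have a: "real h * A n + A h - (real h - 1) * \<kappa> \<le> T" using I unfolding T hr
    by (simp add: algebra_simps)
  have b: "2 * Q - real h * A h - A n - (real h - 1) * \<kappa> \<le> T"
    using II III unfolding T hr by (simp add: algebra_simps)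
  \<comment> \<open>With weights \<open>h\<close> and 1, the inequalities \<open>a\<close> and
    \<open>b\<close> eliminate \<open>A h\<close>. What remains is \<open>2 * Q\<close> and
    \<open>(h^2 - 1) * A n\<close>, the latter bounded by the centre; a common factor
    \<open>h + 1\<close> then cancels.\<close>
  have "real h * (real h * A n + A h - (real h - 1) * \<kappa>) \<le> real h * T" using a
    by (intro mult_left_mono) auto
  then have "(real h + 1) * T \<ge> ((real h)\<^sup>2 - 1) * A n + 2 * Q - (real h + 1) * ((real h - 1) * \<kappa>)"
    using b by (simp add: algebra_simps power2_eq_square)
  moreover have "((real h)\<^sup>2 - 1) * ((2 * real h - 1) * s) \<le> ((real h)\<^sup>2 - 1) * A n"
  proof (rule mult_left_mono)
    show "(2 * real h - 1) * s \<le> A n" using top unfolding hr .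
    show "0 \<le> (real h)\<^sup>2 - 1" using h2
      by (simp add: power2_eq_square)
      (metis mult_le_mono of_nat_1 of_nat_le_iff of_nat_mult mult_1 le_trans one_le_numeral)
  qed
  ultimately have "(real h + 1) * T \<ge> ((real h)\<^sup>2 - 1) * ((2 * real h - 1) * s)
     + (real h + 1) * ((3 * real h - 2) * s - 2 * l) - (real h + 1) * ((real h - 1) * \<kappa>)"
    unfolding Q by linarith
  also have "((real h)\<^sup>2 - 1) * ((2 * real h - 1) * s)
     + (real h + 1) * ((3 * real h - 2) * s - 2 * l) - (real h + 1) * ((real h - 1) * \<kappa>)
     = (real h + 1) * ((2 * (real h)\<^sup>2 - 1) * s - 2 * l - (real h - 1) * \<kappa>)"
    by (simp add: algebra_simps power2_eq_square)
  finally have "(2 * (real h)\<^sup>2 - 1) * s - 2 * l - (real h - 1) * \<kappa> \<le> T"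
    by (rule mult_left_le_imp_le) simp
  moreover have "2 * l + (real h - 1) * \<kappa> \<le> real n * (\<kappa> + l)"
  proof -
    have "2 \<le> real n" "real h - 1 \<le> real n" using n h by simp_all
    then have "2 * l \<le> real n * l" "(real h - 1) * \<kappa> \<le> real n * \<kappa>" using nonneg
      by (intro mult_right_mono; simp)+
    then show ?thesis by (simp add: distrib_left)
  qed
  moreover have "(real n * real (n - 1) / 2 + real ((n - 1) div 2)) * s = (2 * (real h)\<^sup>2 - 1) * s"
  proof -
    have "(n - 1) div 2 = h - 1" using h h2 by linarith
    then have p: "real ((n - 1) div 2) = real h - 1" using hr(1) by simp
    have rn: "real n = 2 * real h" using h by simp
    show ?thesis unfolding p hr rn by (simp add: field_simps power2_eq_square)
  qed
  ultimately show ?thesis unfolding T_def by linarith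
qed

context witt_group
begin

definition E :: nat where "E = (\<Sum>m\<in>{1..n}. expo m)"

lemma two_E: "2 * E = n * (n - 1) + 2 * ((n - 1) div 2)"
proof -
  have "E = (\<Sum>m\<in>{1..n}. (m - 1) + (if 2 * m < n then 1 else 0))"
    unfolding E_def by (rule sum.cong) (auto simp: expo_def)
  also have "\<dots> = (\<Sum>m\<in>{1..n}. m - 1) + (\<Sum>m\<in>{1..n}. if 2 * m < n then 1 else 0)" by (rule sum.distrib)
  also have "(\<Sum>m\<in>{1..n}. if 2 * m < n then 1 else 0) = card {m \<in> {1..n}. 2 * m < n}"
    by (simp add: sum.If_cases Int_def)
  also have "{m \<in> {1..n}. 2 * m < n} = {1..(n - 1) div 2}" using n3 by auto
  also have "card {1..(n - 1) div 2} = (n - 1) div 2" by simp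
  finally have e: "E = (\<Sum>m\<in>{1..n}. m - 1) + (n - 1) div 2" .
  have "2 * (\<Sum>m\<in>{1..k}. m - 1) = k * (k - 1)" for k :: nat
  proof (induction k)
    case (Suc k)
    have "{1..Suc k} = insert (Suc k) {1..k}" by auto
    then have "2 * (\<Sum>m\<in>{1..Suc k}. m - 1) = 2 * k + k * (k - 1)" using Suc by simp
    then show ?case by (cases k) simp_all
  qed simp
  then show ?thesis using e by simp
qed

lemma real_E: "real E = real n * real (n - 1) / 2 + real ((n - 1) div 2)"
proof -
  have "2 * real E = real n * real (n - 1) + 2 * real ((n - 1) div 2)"
    using arg_cong[OF two_E, of real] by simp
  then show ?thesis by simp
qed

text \<open>For odd \<open>n\<close> the exceptional pair of \<open>expo_mults\<close> does not
  exist and the plain coordinate lattice is a group. The base \<open>2 * s\<close> is even in view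
  of \<open>even_lat\<close>.\<close>

lemma fine_lattice:
  assumes s: "s > 0"
  obtains \<Gamma> where "box_group \<Gamma> (\<lambda>m. real (2 * s) ^ expo m)" "\<Gamma> \<subseteq> lat_low n (\<lambda>_. 1)"
proof (cases "even n")
  case True
  then obtain h where h: "2 * h = n" by (metis evenE)
  have "h \<ge> 2" using h n3 by linarith
  then show thesis
    using that box_group_even_lat[OF h _ refl s refl] even_lat_subset[OF h _ refl refl] by blast
next
  case False
  let ?b = "\<lambda>m. real (2 * s) ^ expo m"
  have "box_group (lat_low n ?b) ?b"
  proof (rule box_group_ilat)
    show "?b p * ?b q \<in> mults (?b (p + q))" if "0 < p" "0 < q" "p + q \<le> n" for p q
      by (rule expo_mults) (use that False in auto)
  qed (use s in auto)
  moreover have "?b m \<in> mults 1" for m using power_mults[of 0 "expo m" "2 * s"] by simp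
  then have "lat_low n ?b \<subseteq> lat_low n (\<lambda>_. 1)" unfolding lat_low_def using mults_trans by blast
  ultimately show thesis by (rule that)
qed

end

section \<open>The two growth estimates\<close>

locale witt_all = witt_haar G n d mk \<mu> + witt_gen G n d mk S
  for G :: "'g::euclidean_space monoid" (structure) and n d mk \<mu> S
begin

definition unit_vol :: real where "unit_vol = measure \<mu> (Box (\<lambda>_. 1))"

lemma emeasure_unit: "emeasure \<mu> (Box (\<lambda>_. 1)) = ennreal unit_vol"
  unfolding unit_vol_def using emeasure_Box_finite[of "\<lambda>_. 1"]
    by (intro emeasure_eq_ennreal_measure) simp

lemma unit_vol_pos: "unit_vol > 0"
  using emeasure_unit_Box_pos unfolding emeasure_unit by (simp add: ennreal_less_zero_iff)

lemma le_systole_iff: "ennreal r \<le> systole G S X \<longleftrightarrow> (\<forall>\<gamma>\<in>X. \<gamma> \<noteq> \<one> \<longrightarrow> r \<le> real (wl \<gamma>))"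
  unfolding systole_def le_INF_iff wl_def[symmetric] ennreal_of_nat_eq_real_of_nat
  by (auto simp: ennreal_le_iff)

text \<open>The first nonzero coordinate of \<open>\<gamma>\<close>, at level \<open>m\<close>, has
  size at least \<open>a m\<close>, while an element of length \<open>k\<close> has it at most
  \<open>C * k ^ wt m\<close>.\<close>

lemma box_group_systole:
  assumes C: "C \<ge> 1" "\<And>m x. m \<in> {1..n} \<Longrightarrow> \<bar>d m x\<bar> \<le> C * real (wl x) ^ wt m"
    and box: "box_group \<Gamma> a" and a: "\<And>m. m \<in> {1..n} \<Longrightarrow> \<rho> ^ wt m \<le> a m" and \<rho>: "\<rho> \<ge> 0"
    and \<gamma>: "\<gamma> \<in> \<Gamma>" "\<gamma> \<noteq> \<one>"
  shows "\<rho> \<le> C * real (wl \<gamma>)"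
proof -
  obtain m where m: "m \<in> {1..n}" "\<gamma> \<in> lev m" "a m \<le> \<bar>d m \<gamma>\<bar>"
    using box_group_trivial[OF box \<gamma>(1)] \<gamma>(2) by (meson not_le)
  have "\<rho> ^ wt m \<le> C * real (wl \<gamma>) ^ wt m" using a[OF m(1)] m(3) C(2)[OF m(1), of \<gamma>] by linarith
  also have "\<dots> \<le> C ^ wt m * real (wl \<gamma>) ^ wt m"
    using C(1) wt_pos[OF m(1)] by (intro mult_right_mono self_le_power) auto
  finally have "\<rho> ^ wt m \<le> (C * real (wl \<gamma>)) ^ wt m" by (simp add: power_mult_distrib)
  moreover have "0 \<le> C * real (wl \<gamma>)" using C(1) by simp
  ultimately show ?thesis using power_strict_mono[of "C * real (wl \<gamma>)" \<rho> "wt m"] wt_pos[OF m(1)]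
    by (meson not_le)
qed

lemma wt_le_expo: "m \<in> {1..n} \<Longrightarrow> wt m \<le> expo m" using n3 by (auto simp: wt_def expo_def)

lemma systolic_growth_upper: "growth_le (systolic_growth G S \<mu>) (\<lambda>r. ennreal (r ^ E))"
proof -
  obtain C where C: "C \<ge> 1" "\<And>m x. m \<in> {1..n} \<Longrightarrow> \<bar>d m x\<bar> \<le> C * real (wl x) ^ wt m"
    using coordinate_growth by blast
  have main: "systolic_growth G S \<mu> r \<le> ennreal unit_vol * ennreal ((4 * C * r) ^ E)
    + ennreal (unit_vol * 4 ^ E)"
    if r: "r > 0" for r
  proof -
    define s where "s = nat \<lceil>C * r\<rceil>"
    have Cr: "C * r > 0" using C(1) r by simp
    have s: "s > 0" "C * r \<le> real s" "real s \<le> C * r + 1" unfolding s_def using Cr by linarith+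
    let ?a = "\<lambda>m. real (2 * s) ^ expo m"
    obtain \<Gamma> where \<Gamma>: "box_group \<Gamma> ?a" "\<Gamma> \<subseteq> lat_low n (\<lambda>_. 1)" using fine_lattice[OF s(1)] by blast
    have "r \<le> real (wl \<gamma>)" if \<gamma>: "\<gamma> \<in> \<Gamma>" "\<gamma> \<noteq> \<one>" for \<gamma>
    proof -
      have "real (2 * s) \<le> C * real (wl \<gamma>)"
      proof (rule box_group_systole[OF C \<Gamma>(1) _ _ \<gamma>])
        fix m assume "m \<in> {1..n}"
        then show "real (2 * s) ^ wt m \<le> ?a m" using s(1) wt_le_expo by (intro power_increasing) auto
      qed auto
      then have "C * r \<le> C * real (wl \<gamma>)" using s by simp
      then show ?thesis using C(1) by simp
    qed
    then have "ennreal r \<le> systole G S \<Gamma>" unfolding le_systole_iff by blast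
    then have "systolic_growth G S \<mu> r \<le> covolume G \<mu> \<Gamma>"
      unfolding systolic_growth_def using box_group_cocompact_lattice[OF \<Gamma>(1)] by (intro INF_lower) simp
    also have "\<dots> \<le> emeasure \<mu> (Box ?a)" by (rule box_group_covolume_le[OF \<Gamma>(1)])
    also have "\<dots> \<le> of_nat (\<Prod>m\<in>{1..n}. (2 * s) ^ expo m) * emeasure \<mu> (Box (\<lambda>_. 1))"
      by (rule emeasure_Box_le_index[OF \<Gamma>(1) box_group_unit \<Gamma>(2)]) simp
    also have "(\<Prod>m\<in>{1..n}. (2 * s) ^ expo m) = (2 * s) ^ E" unfolding E_def
      by (rule power_sum[symmetric])
    also have "of_nat ((2 * s) ^ E) * emeasure \<mu> (Box (\<lambda>_. 1)) = ennreal (real (2 * s) ^ E * unit_vol)"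
      unfolding emeasure_unit ennreal_of_nat_eq_real_of_nat using unit_vol_pos
        by (simp add: ennreal_mult)
    also have "\<dots> \<le> ennreal (unit_vol * (4 * C * r) ^ E + unit_vol * 4 ^ E)"
    proof (rule ennreal_leI)
      \<comment> \<open>If \<open>C * r \<le> 1\<close>, then \<open>s \<le> 2\<close> and the
        constant \<open>4 ^ E\<close> suffices; otherwise \<open>s \<le> 2 * C * r\<close>.\<close>
      have "real (2 * s) ^ E \<le> (4 * C * r) ^ E + 4 ^ E"
      proof (cases "C * r \<le> 1")
        case True
        then have "real (2 * s) ^ E \<le> 4 ^ E" using s by (intro power_mono) auto
        then show ?thesis using Cr by (simp add: mult.assoc add_increasing)
      next
        case False
        then have "real (2 * s) ^ E \<le> (4 * C * r) ^ E" using s by (intro power_mono) auto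
        then show ?thesis by (simp add: add_increasing2)
      qed
      then have "unit_vol * real (2 * s) ^ E \<le> unit_vol * ((4 * C * r) ^ E + 4 ^ E)"
        using unit_vol_pos by (intro mult_left_mono) auto
      then show "real (2 * s) ^ E * unit_vol \<le> unit_vol * (4 * C * r) ^ E + unit_vol * 4 ^ E"
        by (simp only: distrib_left mult.commute)
    qed
    also have "\<dots> = ennreal unit_vol * ennreal ((4 * C * r) ^ E) + ennreal (unit_vol * 4 ^ E)"
      using unit_vol_pos Cr by (simp add: ennreal_plus ennreal_mult mult.assoc)
    finally show ?thesis .
  qed
  show ?thesis
    unfolding growth_le_def
  proof (intro exI conjI allI impI)
    show "systolic_growth G S \<mu> r \<le> ennreal unit_vol * ennreal (((4 * C) * r) ^ E)
      + ennreal (unit_vol * 4 ^ E)"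
      if "r > 0" for r using main[OF that] .
  qed (use unit_vol_pos C(1) in auto)
qed

text \<open>Were one of the bounds fed into the linear program violated, the lattice would contain a
  nontrivial element with small coordinates, hence of small length, against the systole. The program
  then bounds the product of the \<open>a m\<close>.\<close>

lemma covolume_lower_4:
  assumes n4: "n \<ge> 4"
  shows "\<exists>c0>0. \<exists>c1>0. \<forall>r\<ge>1. \<forall>\<Gamma>. cocompact_lattice G \<mu> \<Gamma> \<longrightarrow>
     (\<forall>\<gamma>\<in>\<Gamma>. \<gamma> \<noteq> \<one> \<longrightarrow> c1 * r \<le> real (wl \<gamma>)) \<longrightarrow> ennreal (c0 * r ^ E) \<le> covolume G \<mu> \<Gamma>"
proof -
  obtain C where C: "C \<ge> 1" "\<And>R x. R \<ge> 1 \<Longrightarrow> (\<And>m. m \<in> {1..n} \<Longrightarrow> \<bar>d m x\<bar> \<le> R ^ wt m) \<Longrightarrow> real (wl x) \<le> C * R"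
    using wl_upper by blast
  \<comment> \<open>Coordinates within \<open>(2 n r) ^ wt m\<close> give length at most
    \<open>2 n C r\<close>, which is below \<open>c1 * r\<close>.\<close>
  define c1 where "c1 = 2 * real n * C + 1"
  \<comment> \<open>The logarithmic losses: a factor \<open>n\<close> in each commutator inequality
    and a factor 2 per coordinate in Minkowski's bound. In \<open>c0\<close> the powers of 4 come
    from the volume of a box.\<close>
  define \<kappa> where "\<kappa> = ln (real n) + ln 2"
  define c0 where "c0 = exp (- (real n * \<kappa>)) * (1 / 4) ^ n * unit_vol"
  have "ennreal (c0 * r ^ E) \<le> covolume G \<mu> \<Gamma>"
    if r: "r \<ge> 1" and lat: "cocompact_lattice G \<mu> \<Gamma>"
      and sys: "\<forall>\<gamma>\<in>\<Gamma>. \<gamma> \<noteq> \<one> \<longrightarrow> c1 * r \<le> real (wl \<gamma>)" for r \<Gamma>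
  proof -
    have sub: "subgroup \<Gamma> G" and disc: "discrete \<Gamma>" and comp: "compact_space (coset_topology G \<Gamma>)"
      using lat unfolding cocompact_lattice_def lattice_subgroup_def by auto
    obtain a where box: "box_group \<Gamma> a" using cocompact_imp_box_group[OF n4 sub disc comp] by blast
    have a: "a m > 0" if "m \<in> {1..n}" for m using box_groupD(1)[OF box that] .
    have nr: "2 * real n * r \<ge> 1" using n3 r mult_mono[of 1 "2 * real n" 1 r] by simp
    have trivial: "\<gamma> = \<one>" if \<gamma>: "\<gamma> \<in> \<Gamma>" and small: "\<And>m. m \<in> {1..n} \<Longrightarrow> \<bar>d m \<gamma>\<bar> \<le> (2 * real n * r) ^ wt m"
      for \<gamma>
    proof (rule ccontr)
      assume "\<gamma> \<noteq> \<one>"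
      then have "c1 * r \<le> real (wl \<gamma>)" using sys \<gamma> by blast
      also have "real (wl \<gamma>) \<le> C * (2 * real n * r)" by (rule C(2)[OF nr small])
      finally show False using r unfolding c1_def by (simp add: algebra_simps)
    qed
    have r_le: "r ^ k \<le> (2 * real n * r) ^ k" for k
      using r n3 by (intro power_mono) auto
    have n1: "n \<in> {1..n}" using n3 by simp
    have wtn: "wt n = n - 1" using n3 by (simp add: wt_def)
    have top: "r ^ (n - 1) \<le> a n"
    proof (rule ccontr)
      assume "\<not> r ^ (n - 1) \<le> a n"
      then have an: "a n < r ^ (n - 1)" by simp
      obtain \<gamma> where \<gamma>: "\<gamma> \<in> \<Gamma>" "\<gamma> \<in> lev n" "d n \<gamma> = a n" using box_groupD(2)[OF box n1] by blast
      have "\<bar>d m \<gamma>\<bar> \<le> (2 * real n * r) ^ wt m" if m: "m \<in> {1..n}" for m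
      proof (cases "m = n")
        case True
        then show ?thesis using \<gamma>(3) an a[OF n1] r_le[of "n - 1"] wtn by simp
      next
        case False
        then have "d m \<gamma> = 0" using \<gamma>(2) m by (simp add: lev_def)
        then show ?thesis using r by simp
      qed
      then have "\<gamma> = \<one>" by (rule trivial[OF \<gamma>(1)])
      then show False using \<gamma>(3) d_one[OF n1] a[OF n1] by simp
    qed
    define s where "s = ln r"
    have s: "s \<ge> 0" using r by (simp add: s_def)
    have lnpow: "ln (r ^ k) = real k * s" for k using r by (simp add: s_def ln_realpow)
    have "(real n * real (n - 1) / 2 + real ((n - 1) div 2)) * s - real n * (ln (real n) + ln 2)
      \<le> (\<Sum>i\<in>{1..n}. ln (a i))"
    proof (rule commutator_linear_program)
      show "ln (a (i + j)) \<le> ln (real n) + ln (a i) + ln (a j)"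
        if ij: "0 < i" "0 < j" "i + j \<le> n" "i \<noteq> j" for i j
      proof -
        have pos: "a i > 0" "a j > 0" "a (i + j) > 0" using a ij by auto
        have "ln (a (i + j)) \<le> ln (real n * a i * a j)"
          using box_group_comm_le[OF box ij] pos n3 by (subst ln_le_cancel_iff) auto
        also have "\<dots> = ln (real n) + ln (a i) + ln (a j)" using pos n3 by (simp add: ln_mult)
        finally show ?thesis .
      qed
      have "ln (r ^ (n - 1)) \<le> ln (a n)" using top r a[OF n1] by (subst ln_le_cancel_iff) auto
      then show "real (n - 1) * s \<le> ln (a n)" unfolding lnpow .
      show "(\<Sum>i\<in>{h..n}. real (i - 1) * s - ln 2) \<le> (\<Sum>i\<in>{h..n}. ln (a i))" if h: "2 * h = n" for h
      proof (rule ccontr)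
        assume neg: "\<not> (\<Sum>i\<in>{h..n}. real (i - 1) * s - ln 2) \<le> (\<Sum>i\<in>{h..n}. ln (a i))"
        have hb: "2 \<le> h" "h < n" using h n4 by linarith+
        have ai: "a i > 0" if "i \<in> {h..n}" for i using a that hb by simp
        have "(\<Sum>i\<in>{h..n}. ln (2 * a i)) = (\<Sum>i\<in>{h..n}. ln 2 + ln (a i))"
        proof (rule sum.cong[OF refl])
          fix i assume "i \<in> {h..n}"
          then have "a i > 0" by (rule ai)
          then show "ln (2 * a i) = ln 2 + ln (a i)" by (simp add: ln_mult)
        qed
        also have "\<dots> < (\<Sum>i\<in>{h..n}. real (i - 1) * s)" using neg by (simp add: sum.distrib sum_subtractf)
        also have "\<dots> = (\<Sum>i\<in>{h..n}. ln (r ^ (i - 1)))" unfolding lnpow ..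
        finally have "exp (\<Sum>i\<in>{h..n}. ln (2 * a i)) < exp (\<Sum>i\<in>{h..n}. ln (r ^ (i - 1)))" by simp
        moreover have "exp (\<Sum>i\<in>{h..n}. ln (2 * a i)) = (\<Prod>i\<in>{h..n}. 2 * a i)"
          unfolding exp_sum[OF finite_atLeastAtMost] by (intro prod.cong refl) (simp add: ai)
        moreover have "exp (\<Sum>i\<in>{h..n}. ln (r ^ (i - 1))) = (\<Prod>i\<in>{h..n}. r ^ (i - 1))"
          unfolding exp_sum[OF finite_atLeastAtMost] using r by (intro prod.cong refl) simp
        ultimately have vol: "(\<Prod>i\<in>{h..n}. 2 * a i) < (\<Prod>i\<in>{h..n}. r ^ (i - 1))" by simp
        obtain \<gamma> where \<gamma>: "\<gamma> \<in> \<Gamma>" "\<gamma> \<in> lev h" "\<gamma> \<noteq> \<one>" "\<And>i. i \<in> {h..<n} \<Longrightarrow> \<bar>d i \<gamma>\<bar> < r ^ (i - 1)"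
          "\<bar>\<theta> (real (h - 1) / 2) h \<gamma>\<bar> < r ^ (n - 1)"
          using box_group_short_vector[OF box h _ vol] r by auto
        have "\<bar>d m \<gamma>\<bar> \<le> (2 * real n * r) ^ wt m" if m: "m \<in> {1..n}" for m
        proof -
          consider "m < h" | "m \<in> {h..<n}" | "m = n" using m by fastforce
          then show ?thesis
          proof cases
            case 1
            then have "d m \<gamma> = 0" using \<gamma>(2) m by (simp add: lev_def)
            then show ?thesis using r by simp
          next
            case 2
            then have "wt m = m - 1" using hb by (simp add: wt_def)
            then show ?thesis using \<gamma>(4)[OF 2] r_le[of "m - 1"] by simp
          next
            case 3
            \<comment> \<open>The top coordinate is recovered from \<open>\<theta>\<close>: the
              quadratic term has order \<open>r ^ (2 * (h - 1))\<close>, within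
              \<open>r ^ (n - 1)\<close>. Its factor \<open>(h - 1) / 2\<close> is the reason for
              the allowance \<open>2 n\<close> in the bounds.\<close>
            have "\<bar>d h \<gamma>\<bar> \<le> r ^ (h - 1)" using \<gamma>(4)[of h] hb by simp
            then have "(d h \<gamma>)\<^sup>2 \<le> (r ^ (h - 1))\<^sup>2"
              by (rule power2_le_iff_abs_le[THEN iffD2, rotated]) (use r in simp)
            also have "\<dots> = r ^ (2 * (h - 1))" by (simp add: power_mult[symmetric] mult.commute)
            also have "\<dots> \<le> r ^ (n - 1)" using r h by (intro power_increasing) auto
            finally have dh: "real (h - 1) / 2 * (d h \<gamma>)\<^sup>2 \<le> real (h - 1) / 2 * r ^ (n - 1)"
              by (intro mult_left_mono) auto
            have "\<bar>d n \<gamma>\<bar> \<le> r ^ (n - 1) + real (h - 1) / 2 * r ^ (n - 1)"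
            proof -
              have "0 \<le> real (h - 1) / 2 * (d h \<gamma>)\<^sup>2" by simp
              then show ?thesis using \<gamma>(5) dh unfolding \<theta>_def by linarith
            qed
            also have "\<dots> \<le> (2 * real n) * r ^ (n - 1)"
            proof -
              have "real (h - 1) \<le> real h" "real h < real n" "1 \<le> real n" using hb by auto
              then have "1 + real (h - 1) / 2 \<le> 2 * real n" by linarith
              then have "(1 + real (h - 1) / 2) * r ^ (n - 1) \<le> (2 * real n) * r ^ (n - 1)"
                using r by (intro mult_right_mono) auto
              then show ?thesis by (simp add: distrib_right)
            qed
            also have "\<dots> \<le> (2 * real n) ^ (n - 1) * r ^ (n - 1)"
              using n3 r by (intro mult_right_mono self_le_power) auto
            finally show ?thesis unfolding 3 wtn by (simp add: power_mult_distrib)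
          qed
        qed
        then have "\<gamma> = \<one>" by (rule trivial[OF \<gamma>(1)])
        then show False using \<gamma>(3) by simp
      qed
    qed (use n3 s in auto)
    then have le: "real E * s - real n * \<kappa> \<le> (\<Sum>i\<in>{1..n}. ln (a i))" unfolding real_E \<kappa>_def .
    have "exp (- (real n * \<kappa>)) * r ^ E = exp (real E * s - real n * \<kappa>)"
    proof -
      have "exp (real E * s) = r ^ E" unfolding lnpow[symmetric] using r by simp
      then show ?thesis by (simp add: exp_diff exp_minus field_simps)
    qed
    also have "\<dots> \<le> exp (\<Sum>i\<in>{1..n}. ln (a i))" using le by simp
    also have "\<dots> = (\<Prod>i\<in>{1..n}. a i)"
      unfolding exp_sum[OF finite_atLeastAtMost] by (intro prod.cong refl) (simp add: a)
    finally have prod: "exp (- (real n * \<kappa>)) * r ^ E \<le> (\<Prod>i\<in>{1..n}. a i)" .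
    have "c0 * r ^ E = (exp (- (real n * \<kappa>)) * r ^ E) * (1 / 4) ^ n * unit_vol" unfolding c0_def
      by (simp add: ac_simps)
    also have "\<dots> \<le> (\<Prod>i\<in>{1..n}. a i) * (1 / 4) ^ n * unit_vol"
      using prod unit_vol_pos by (intro mult_right_mono) auto
    also have "(\<Prod>i\<in>{1..n}. a i) * (1 / 4) ^ n = (\<Prod>m\<in>{1..n}. a m / 4)"
      by (simp add: prod_dividef power_one_over)
    finally have "ennreal (c0 * r ^ E) \<le> ennreal ((\<Prod>m\<in>{1..n}. a m / 4) * unit_vol)"
      by (rule ennreal_leI)
    also have "\<dots> = ennreal (\<Prod>m\<in>{1..n}. a m / 4) * emeasure \<mu> (Box (\<lambda>_. 1))"
      unfolding emeasure_unit using a unit_vol_pos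
        by (intro ennreal_mult prod_nonneg) (auto intro: less_imp_le)
    also have "\<dots> \<le> emeasure \<mu> (Box a)" by (rule emeasure_Box_ge[OF a])
    also have "\<dots> \<le> covolume G \<mu> \<Gamma>"
      by (rule covolume_ge_packing[OF sub disc borel_Box box_group_unique[OF box]])
    finally show ?thesis .
  qed
  moreover have "c0 > 0" unfolding c0_def using unit_vol_pos by simp
  moreover have "c1 > 0" unfolding c1_def using C(1) by (simp add: add_nonneg_pos)
  ultimately show ?thesis by blast
qed

text \<open>For \<open>n = 3\<close> the exponents \<open>expo\<close> and \<open>wt\<close>
  coincide, so \<open>E\<close> is the growth exponent of the volume of balls. It suffices that a
  set of elements of length of order \<open>r\<close> is packed by its translates; no basis of the
  lattice is used.\<close>

lemma covolume_lower_3: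
  assumes n: "n = 3"
  shows "\<exists>c0>0. \<exists>c1>0. \<forall>r\<ge>1. \<forall>\<Gamma>. cocompact_lattice G \<mu> \<Gamma> \<longrightarrow>
     (\<forall>\<gamma>\<in>\<Gamma>. \<gamma> \<noteq> \<one> \<longrightarrow> c1 * r \<le> real (wl \<gamma>)) \<longrightarrow> ennreal (c0 * r ^ E) \<le> covolume G \<mu> \<Gamma>"
proof -
  obtain C where C: "C \<ge> 1" "\<And>R x. R \<ge> 1 \<Longrightarrow> (\<And>m. m \<in> {1..n} \<Longrightarrow> \<bar>d m x\<bar> \<le> R ^ wt m) \<Longrightarrow> real (wl x) \<le> C * R"
    using wl_upper by blast
  obtain B :: nat where B: "\<And>x. x \<in> cBox (\<lambda>_. 1) \<Longrightarrow> wl x \<le> B"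
    using wl_bounded_on_compact[OF compact_cBox] by metis
  define c1 where "c1 = 2 * (C + real B) + 1"
  define c0 where "c0 = (1 / 2) ^ E * unit_vol"
  have E: "E = (\<Sum>m\<in>{1..n}. wt m)"
  proof -
    have "expo m = wt m" if "m \<in> {1..n}" for m using that n unfolding expo_def wt_def by auto
    then show ?thesis unfolding E_def by simp
  qed
  have "ennreal (c0 * r ^ E) \<le> covolume G \<mu> \<Gamma>"
    if r: "r \<ge> 1" and lat: "cocompact_lattice G \<mu> \<Gamma>"
      and sys: "\<forall>\<gamma>\<in>\<Gamma>. \<gamma> \<noteq> \<one> \<longrightarrow> c1 * r \<le> real (wl \<gamma>)" for r \<Gamma>
  proof -
    have sub: "subgroup \<Gamma> G" and disc: "discrete \<Gamma>"
      using lat unfolding cocompact_lattice_def lattice_subgroup_def by auto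
    define t where "t = nat \<lfloor>r\<rfloor>"
    have t: "t \<ge> 1" "real t \<le> r" "r / 2 \<le> real t"
    proof -
      have "1 \<le> \<lfloor>r\<rfloor>" using r by simp
      then show "t \<ge> 1" "real t \<le> r" "r / 2 \<le> real t" unfolding t_def by linarith+
    qed
    define f where "f j = mk (\<lambda>m. real (j m))" for j :: "nat \<Rightarrow> nat"
    have df: "d m (f j) = real (j m)" if "m \<in> {1..n}" for m j unfolding f_def by (rule d_mk[OF that])
    define J where "J = PiE {1..n} (\<lambda>m. {..<t ^ wt m})"
    have "inj_on f J"
    proof (rule inj_onI)
      fix i j assume ij: "i \<in> J" "j \<in> J" "f i = f j"
      show "i = j"
      proof (rule PiE_ext[OF ij(1,2)[unfolded J_def]])
        fix m assume "m \<in> {1..n}"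
        then show "i m = j m" using df[of m i] df[of m j] ij(3) by simp
      qed
    qed
    then have card: "card (f ` J) = t ^ E"
      unfolding E by (simp add: card_image J_def card_PiE power_sum)
    have finJ: "finite (f ` J)" unfolding J_def by (intro finite_imageI finite_PiE) auto
    have sub1: "f ` J \<subseteq> lat_low n (\<lambda>_. 1)"
      unfolding lat_low_def using df by (auto intro!: multsI[of _ "int _"])
    \<comment> \<open>Disjoint unit boxes at the integer points with coordinates below
      \<open>t ^ wt m\<close>: volume \<open>t ^ E\<close> units, and all lengths at most
      \<open>(C + B) * r\<close>. A translation taking one point of \<open>P\<close> to another has
      length below \<open>c1 * r\<close>.\<close>
    define P where "P = (\<Union>x\<in>f ` J. (\<lambda>y. x \<otimes> y) ` Box (\<lambda>_. 1))"
    have wlP: "real (wl p) \<le> (C + real B) * r" if p: "p \<in> P" for p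
    proof -
      obtain j y where j: "j \<in> J" "y \<in> Box (\<lambda>_. 1)" "p = f j \<otimes> y" using p unfolding P_def by blast
      have "real (wl (f j)) \<le> C * real t"
      proof (rule C(2))
        fix m assume m: "m \<in> {1..n}"
        then have "j m < t ^ wt m" using j(1) unfolding J_def by blast
        then have "real (j m) \<le> real (t ^ wt m)" by (simp only: of_nat_le_iff less_imp_le)
        then show "\<bar>d m (f j)\<bar> \<le> real t ^ wt m" using df[OF m, of j] by simp
      qed (use t in simp)
      moreover have "wl y \<le> B" using j(2) Box_subset_cBox by (intro B) blast
      moreover have "real (wl p) \<le> real (wl (f j)) + real (wl y)"
        unfolding j(3) of_nat_add[symmetric] of_nat_le_iff by (rule wl_mult)
      moreover have "C * real t \<le> C * r" using C(1) t by (intro mult_left_mono) auto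
      moreover have "real B * 1 \<le> real B * r" using r by (intro mult_left_mono) auto
      ultimately show ?thesis by (simp add: distrib_right)
    qed
    have "c0 * r ^ E \<le> real (t ^ E) * unit_vol"
    proof -
      have "(r / 2) ^ E \<le> real t ^ E" using t r by (intro power_mono) auto
      then have "(r / 2) ^ E * unit_vol \<le> real t ^ E * unit_vol" using unit_vol_pos
        by (intro mult_right_mono) auto
      then show ?thesis unfolding c0_def by (simp add: power_divide mult.commute)
    qed
    then have "ennreal (c0 * r ^ E) \<le> ennreal (real (t ^ E) * unit_vol)" by (rule ennreal_leI)
    also have "\<dots> = of_nat (card (f ` J)) * emeasure \<mu> (Box (\<lambda>_. 1))"
      unfolding card emeasure_unit ennreal_of_nat_eq_real_of_nat using unit_vol_pos
        by (intro ennreal_mult) auto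
    also have "\<dots> = emeasure \<mu> P"
      unfolding P_def by (rule emeasure_translates_disjoint[OF box_group_unit finJ sub1, symmetric])
    also have "\<dots> \<le> covolume G \<mu> \<Gamma>"
    proof (rule covolume_ge_packing[OF sub disc])
      show "P \<in> sets borel" unfolding P_def by (intro sets.finite_UN finJ borel_translate borel_Box)
      fix \<gamma> p assume \<gamma>: "\<gamma> \<in> \<Gamma>" "p \<in> P" "\<gamma> \<otimes> p \<in> P"
      have "\<gamma> = (\<gamma> \<otimes> p) \<otimes> inv p" by (simp add: m_assoc)
      then have "wl \<gamma> \<le> wl (\<gamma> \<otimes> p) + wl p" using wl_mult[of "\<gamma> \<otimes> p" "inv p"] wl_inv[of p] by simp
      then have "real (wl \<gamma>) \<le> real (wl (\<gamma> \<otimes> p)) + real (wl p)"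
        by (simp only: of_nat_add[symmetric] of_nat_le_iff)
      then have "real (wl \<gamma>) \<le> 2 * ((C + real B) * r)" using wlP[OF \<gamma>(2)] wlP[OF \<gamma>(3)] by linarith
      moreover have "2 * ((C + real B) * r) < c1 * r" unfolding c1_def using r
        by (simp add: algebra_simps)
      ultimately show "\<gamma> = \<one>" using sys \<gamma>(1) by fastforce
    qed
    finally show ?thesis .
  qed
  moreover have "c0 > 0" unfolding c0_def using unit_vol_pos by simp
  moreover have "c1 > 0" unfolding c1_def using C(1) by (simp add: add_nonneg_pos)
  ultimately show ?thesis by blast
qed

lemma systolic_growth_lower: "growth_le (\<lambda>r. ennreal (r ^ E)) (systolic_growth G S \<mu>)"
proof -
  have "\<exists>c0>0. \<exists>c1>0. \<forall>r\<ge>1. \<forall>\<Gamma>. cocompact_lattice G \<mu> \<Gamma> \<longrightarrow>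
     (\<forall>\<gamma>\<in>\<Gamma>. \<gamma> \<noteq> \<one> \<longrightarrow> c1 * r \<le> real (wl \<gamma>)) \<longrightarrow> ennreal (c0 * r ^ E) \<le> covolume G \<mu> \<Gamma>"
    using covolume_lower_3 covolume_lower_4 n3 by (cases "n = 3") auto
  then obtain c0 c1 where c: "c0 > 0" "c1 > 0" and lower: "\<And>r \<Gamma>. r \<ge> 1 \<Longrightarrow> cocompact_lattice G \<mu> \<Gamma> \<Longrightarrow>
     (\<forall>\<gamma>\<in>\<Gamma>. \<gamma> \<noteq> \<one> \<longrightarrow> c1 * r \<le> real (wl \<gamma>)) \<Longrightarrow> ennreal (c0 * r ^ E) \<le> covolume G \<mu> \<Gamma>" by blast
  have main: "ennreal (r ^ E) \<le> ennreal (1 / c0) * systolic_growth G S \<mu> (c1 * r) + ennreal 1"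
    if r: "r > 0" for r
  proof (cases "r \<ge> 1")
    case True
    have "ennreal (c0 * r ^ E) \<le> systolic_growth G S \<mu> (c1 * r)"
      unfolding systolic_growth_def
      by (rule INF_greatest) (use lower[OF True] in \<open>auto simp: le_systole_iff\<close>)
    then have "ennreal (1 / c0) * ennreal (c0 * r ^ E)
      \<le> ennreal (1 / c0) * systolic_growth G S \<mu> (c1 * r)"
      by (rule mult_left_mono) simp
    moreover have "ennreal (1 / c0) * ennreal (c0 * r ^ E) = ennreal (r ^ E)"
      using c r by (simp flip: ennreal_mult')
    ultimately show ?thesis by (simp add: add_increasing2)
  next
    case False
    \<comment> \<open>For \<open>r < 1\<close> the additive constant of \<open>growth_le\<close>
      covers the left side.\<close>
    then have "r ^ E \<le> 1" using r by (intro power_le_one) auto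
    then have "ennreal (r ^ E) \<le> ennreal 1" by (rule ennreal_leI)
    then show ?thesis by (simp add: add_increasing)
  qed
  show ?thesis
    unfolding growth_le_def
  proof (intro exI conjI allI impI)
    show "ennreal (r ^ E) \<le> ennreal (1 / c0) * systolic_growth G S \<mu> (c1 * r) + ennreal 1" if "r > 0"
      for r
      using main[OF that] .
  qed (use c in auto)
qed

end

theorem theorem1p6:
  fixes n :: nat
    and br :: "'g::euclidean_space \<Rightarrow> 'g \<Rightarrow> 'g"
    and e :: "nat \<Rightarrow> 'g"
    and S :: "'g set"
    and \<mu> :: "'g measure"
  assumes "n \<ge> 3"
    and "lie_bracket br"
    and "is_lie_basis_g n br e"
    and "compact_generating_set (nilpotent_lie_group br) S"
    and "left_haar_measure (nilpotent_lie_group br) \<mu>"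
  shows "real (homogeneous_dim br) = real n * (real n - 1) / 2 + 1 \<and>
    growth_equiv (systolic_growth (nilpotent_lie_group br) S \<mu>)
      (\<lambda>r. ennreal (r powi (int (homogeneous_dim br) + \<lceil>(real n - 4) / 2\<rceil>)))"
proof -
  interpret W: witt_algebra n br e by unfold_locales (rule assms)+
  have w: "witt_group (nilpotent_lie_group br) n W.d W.mk" by (rule W.witt_group)
  interpret A: witt_all "nilpotent_lie_group br" n W.d W.mk \<mu> S
    using w assms by (intro witt_all.intro witt_haar.intro witt_gen.intro witt_haar_axioms.intro
      witt_gen_axioms.intro)
  have dim: "real (homogeneous_dim br) = real n * (real n - 1) / 2 + 1" by (rule W.homogeneous_dim_eq)
  \<comment> \<open>For \<open>n = 2 q + 1\<close> the number \<open>(n - 4) / 2\<close> is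
    \<open>q - 3 / 2\<close>, for \<open>n = 2 q + 2\<close> it is \<open>q - 1\<close>; both round
    up to \<open>q - 1\<close>.\<close>
  have ceil: "\<lceil>(real n - 4) / 2\<rceil> = int ((n - 1) div 2) - 1"
  proof (rule ceiling_unique)
    define q where "q = (n - 1) div 2"
    have "n = 2 * q + 1 \<or> n = 2 * q + 2" unfolding q_def using assms(1) by presburger
    then show "real_of_int (int ((n - 1) div 2) - 1) - 1 < (real n - 4) / 2"
      "(real n - 4) / 2 \<le> real_of_int (int ((n - 1) div 2) - 1)" unfolding q_def[symmetric] by auto
  qed
  have "real (homogeneous_dim br) + real ((n - 1) div 2) - 1 = real A.E"
    unfolding dim A.real_E using assms(1) by (simp add: of_nat_diff)
  then have "int (homogeneous_dim br) + \<lceil>(real n - 4) / 2\<rceil> = int A.E" unfolding ceil by linarith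
  then show ?thesis
    using dim A.systolic_growth_upper A.systolic_growth_lower by (simp add: growth_equiv_def)
qed

end
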